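(* Let $M$ be a (countably infinite) stable homogeneous structure over a finite relational language $L$. Then there is an m.e.c. $\mathcal{C}$ with an infinite ultraproduct which is elementarily equivalent to $M$.
   Context: A countable structure over a relational language is homogeneous if every isomorphism between finite substructures extends to an automorphism. $M$ is stable if its first-order theory is stable. Definition of m.e.c. Let $\mathcal{C}$ be a class of finite $L$-structures. For a tuple $\bar y$ of variables, $(\mathcal{C},\bar y)$ denotes the set of pairs $(M,\bar a)$ with $M\in\mathcal{C}$, $\bar a\in M^{|\bar y|}$. A partition $\Pi$ of $(\mathcal{C},\bar y)$ is $\emptyset$-definable if for each $\pi\in\Pi$ there is a parameter-free $L$-formula $\phi_\pi(\bar y)$ with $\phi_\pi(M^{|\bar y|})=\{\bar b\in M^{|\bar{y}|}:(M,\bar b)\in\pi\}$ for all $M\in\mathcal{C}$. $\mathcal{C}$ is a multidimensional exact class (m.e.c.) if for every $L$-formula $\phi(\bar x;\bar y)$ there is a finite $\emptyset$-definable partition $\Pi$ of $(\mathcal{C},\bar y)$ and functions $h_\pi:\mathcal{C}\to\mathbb{R}^{\geq 0}$ ($\pi\in\Pi$) such that $|\phi(M^{|\bar x|};\bar b)|=h_\pi(M)$ for all $(M,\bar b)\in\pi$. *)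

theory Defs
  imports Complex_Main "HOL-Library.Countable_Set" "HOL-Library.Disjoint_Sets"
begin

section \<open>Relational languages, structures and first-order formulas\<close>

text \<open>0-ary relation symbols and the empty language are allowed.\<close>

record 'r language =
  symbols :: "'r set"
  arity :: "'r \<Rightarrow> nat"

text \<open>The value of \<open>interp\<close> at a symbol outside the language is never used.\<close>

record ('r, 'a) rel_structure =
  carrier :: "'a set"
  interp :: "'r \<Rightarrow> 'a list set"

definition tuples :: "('r, 'a) rel_structure \<Rightarrow> nat \<Rightarrow> 'a list set" where
  "tuples M n = {as. length as = n \<and> set as \<subseteq> carrier M}"

definition is_structure :: "'r language \<Rightarrow> ('r, 'a) rel_structure \<Rightarrow> bool" where
  "is_structure L M \<longleftrightarrow>
     carrier M \<noteq> {} \<and> (\<forall>R\<in>symbols L. interp M R \<subseteq> tuples M (arity L R))"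

datatype 'r fm =
    Eq nat nat
  | Rel 'r "nat list"
  | Neg "'r fm"
  | Conj "'r fm" "'r fm"
  | Exists nat "'r fm"

primrec wf_fm :: "'r language \<Rightarrow> 'r fm \<Rightarrow> bool" where
  "wf_fm L (Eq x y) \<longleftrightarrow> True"
| "wf_fm L (Rel R xs) \<longleftrightarrow> R \<in> symbols L \<and> length xs = arity L R"
| "wf_fm L (Neg \<phi>) \<longleftrightarrow> wf_fm L \<phi>"
| "wf_fm L (Conj \<phi> \<psi>) \<longleftrightarrow> wf_fm L \<phi> \<and> wf_fm L \<psi>"
| "wf_fm L (Exists x \<phi>) \<longleftrightarrow> wf_fm L \<phi>"

primrec free_vars :: "'r fm \<Rightarrow> nat set" where
  "free_vars (Eq x y) = {x, y}"
| "free_vars (Rel R xs) = set xs"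
| "free_vars (Neg \<phi>) = free_vars \<phi>"
| "free_vars (Conj \<phi> \<psi>) = free_vars \<phi> \<union> free_vars \<psi>"
| "free_vars (Exists x \<phi>) = free_vars \<phi> - {x}"

primrec sat :: "('r, 'a) rel_structure \<Rightarrow> (nat \<Rightarrow> 'a) \<Rightarrow> 'r fm \<Rightarrow> bool" where
  "sat M v (Eq x y) \<longleftrightarrow> v x = v y"
| "sat M v (Rel R xs) \<longleftrightarrow> map v xs \<in> interp M R"
| "sat M v (Neg \<phi>) \<longleftrightarrow> \<not> sat M v \<phi>"
| "sat M v (Conj \<phi> \<psi>) \<longleftrightarrow> sat M v \<phi> \<and> sat M v \<psi>"
| "sat M v (Exists x \<phi>) \<longleftrightarrow> (\<exists>a\<in>carrier M. sat M (v(x := a)) \<phi>)"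

text \<open>An \<open>L\<close>-formula \<open>\<phi>(xs)\<close>, where \<open>xs\<close> is a tuple of distinct variables.\<close>

definition formula_in :: "'r language \<Rightarrow> nat list \<Rightarrow> 'r fm \<Rightarrow> bool" where
  "formula_in L xs \<phi> \<longleftrightarrow> wf_fm L \<phi> \<and> distinct xs \<and> free_vars \<phi> \<subseteq> set xs"

text \<open>\<open>M \<Turnstile> \<phi>(as)\<close>, for a formula \<open>\<phi>(xs)\<close> and a tuple \<open>as\<close> of the same length as \<open>xs\<close>;
  the valuation is unspecified at variables not in \<open>xs\<close>, which are not free in \<open>\<phi>\<close>.\<close>

definition sat_at :: "('r, 'a) rel_structure \<Rightarrow> 'r fm \<Rightarrow> nat list \<Rightarrow> 'a list \<Rightarrow> bool" where
  "sat_at M \<phi> xs as \<longleftrightarrow> sat M (\<lambda>x. the (map_of (zip xs as) x)) \<phi>"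

text \<open>The set \<open>\<phi>(M\<^sup>n; bs)\<close> defined in \<open>M\<close> by \<open>\<phi>(xs; ys)\<close>, where \<open>n\<close> is the length of \<open>xs\<close>.\<close>

definition solutions ::
    "('r, 'a) rel_structure \<Rightarrow> 'r fm \<Rightarrow> nat list \<Rightarrow> nat list \<Rightarrow> 'a list \<Rightarrow> 'a list set" where
  "solutions M \<phi> xs ys bs = {as \<in> tuples M (length xs). sat_at M \<phi> (xs @ ys) (as @ bs)}"

definition theory_of :: "'r language \<Rightarrow> ('r, 'a) rel_structure \<Rightarrow> 'r fm set" where
  "theory_of L M = {\<phi>. formula_in L [] \<phi> \<and> sat_at M \<phi> [] []}"

definition elementarily_equivalent ::
    "'r language \<Rightarrow> ('r, 'a) rel_structure \<Rightarrow> ('r, 'b) rel_structure \<Rightarrow> bool" where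
  "elementarily_equivalent L M N \<longleftrightarrow> theory_of L M = theory_of L N"

definition is_model :: "'r language \<Rightarrow> ('r, 'a) rel_structure \<Rightarrow> 'r fm set \<Rightarrow> bool" where
  "is_model L N T \<longleftrightarrow> is_structure L N \<and> T \<subseteq> theory_of L N"


section \<open>Stability\<close>

text \<open>\<open>T\<close> is stable if no formula has the order property in a model of \<open>T\<close>. Models with universe
  contained in \<open>nat\<close> suffice for a countable language: by downward Loewenheim-Skolem, an instance
  of the order property in any model already occurs in a countable elementary substructure.\<close>

definition stable_theory :: "'r language \<Rightarrow> 'r fm set \<Rightarrow> bool" where
  "stable_theory L T \<longleftrightarrow>
     \<not> (\<exists>\<phi> xs ys (N :: ('r, nat) rel_structure) (a :: nat \<Rightarrow> nat list) (b :: nat \<Rightarrow> nat list).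
          formula_in L (xs @ ys) \<phi> \<and> is_model L N T \<and>
          (\<forall>i. a i \<in> tuples N (length xs)) \<and> (\<forall>j. b j \<in> tuples N (length ys)) \<and>
          (\<forall>i j. sat_at N \<phi> (xs @ ys) (a i @ b j) \<longleftrightarrow> i < j))"

definition stable_structure :: "'r language \<Rightarrow> ('r, 'a) rel_structure \<Rightarrow> bool" where
  "stable_structure L M \<longleftrightarrow> stable_theory L (theory_of L M)"


section \<open>Homogeneity\<close>

definition isomorphism ::
    "'r language \<Rightarrow> ('r, 'a) rel_structure \<Rightarrow> ('r, 'b) rel_structure \<Rightarrow> ('a \<Rightarrow> 'b) \<Rightarrow> bool" where
  "isomorphism L M N f \<longleftrightarrow>
     bij_betw f (carrier M) (carrier N) \<and>
     (\<forall>R\<in>symbols L. \<forall>as\<in>tuples M (arity L R). as \<in> interp M R \<longleftrightarrow> map f as \<in> interp N R)"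

definition substructure_on :: "('r, 'a) rel_structure \<Rightarrow> 'a set \<Rightarrow> ('r, 'a) rel_structure" where
  "substructure_on M A = \<lparr>carrier = A, interp = (\<lambda>R. interp M R \<inter> lists A)\<rparr>"

definition homogeneous :: "'r language \<Rightarrow> ('r, 'a) rel_structure \<Rightarrow> bool" where
  "homogeneous L M \<longleftrightarrow>
     (\<forall>A B f. finite A \<and> finite B \<and> A \<subseteq> carrier M \<and> B \<subseteq> carrier M \<and>
        isomorphism L (substructure_on M A) (substructure_on M B) f \<longrightarrow>
        (\<exists>g. isomorphism L M M g \<and> (\<forall>a\<in>A. g a = f a)))"


section \<open>Ultraproducts\<close>

definition is_ultrafilter :: "'i filter \<Rightarrow> bool" where
  "is_ultrafilter U \<longleftrightarrow>
     U \<noteq> bot \<and> (\<forall>P. eventually P U \<or> eventually (\<lambda>i. \<not> P i) U)"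

definition ultraproduct_rel ::
    "'i filter \<Rightarrow> ('i \<Rightarrow> ('r, 'a) rel_structure) \<Rightarrow> (('i \<Rightarrow> 'a) \<times> ('i \<Rightarrow> 'a)) set" where
  "ultraproduct_rel U N =
     {(f, g). (\<forall>i. f i \<in> carrier (N i)) \<and> (\<forall>i. g i \<in> carrier (N i)) \<and>
              eventually (\<lambda>i. f i = g i) U}"

definition ultraproduct ::
    "'i filter \<Rightarrow> ('i \<Rightarrow> ('r, 'a) rel_structure) \<Rightarrow> ('r, ('i \<Rightarrow> 'a) set) rel_structure" where
  "ultraproduct U N =
     \<lparr>carrier = {f. \<forall>i. f i \<in> carrier (N i)} // ultraproduct_rel U N,
      interp = (\<lambda>R. {map (\<lambda>f. ultraproduct_rel U N `` {f}) fs | fs.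
                       fs \<in> lists {f. \<forall>i. f i \<in> carrier (N i)} \<and>
                       eventually (\<lambda>i. map (\<lambda>f. f i) fs \<in> interp (N i) R) U})\<rparr>"


section \<open>Multidimensional exact classes\<close>

definition pointed ::
    "('r, 'a) rel_structure set \<Rightarrow> nat list \<Rightarrow> (('r, 'a) rel_structure \<times> 'a list) set" where
  "pointed C ys = {(M, bs). M \<in> C \<and> bs \<in> tuples M (length ys)}"

definition definable_partition ::
    "'r language \<Rightarrow> ('r, 'a) rel_structure set \<Rightarrow> nat list \<Rightarrow>
     (('r, 'a) rel_structure \<times> 'a list) set set \<Rightarrow> bool" where
  "definable_partition L C ys P \<longleftrightarrow>
     partition_on (pointed C ys) P \<and>
     (\<forall>\<pi>\<in>P. \<exists>\<psi>. formula_in L ys \<psi> \<and>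
        (\<forall>M\<in>C. {bs \<in> tuples M (length ys). sat_at M \<psi> ys bs} =
                {bs \<in> tuples M (length ys). (M, bs) \<in> \<pi>}))"

definition mec :: "'r language \<Rightarrow> ('r, 'a) rel_structure set \<Rightarrow> bool" where
  "mec L C \<longleftrightarrow>
     (\<forall>M\<in>C. is_structure L M \<and> finite (carrier M)) \<and>
     (\<forall>\<phi> xs ys. formula_in L (xs @ ys) \<phi> \<longrightarrow>
        (\<exists>P (h :: (('r, 'a) rel_structure \<times> 'a list) set \<Rightarrow> ('r, 'a) rel_structure \<Rightarrow> real).
           finite P \<and> definable_partition L C ys P \<and>
           (\<forall>\<pi>\<in>P. \<forall>M\<in>C. h \<pi> M \<ge> 0) \<and>
           (\<forall>\<pi>\<in>P. \<forall>(M, bs)\<in>\<pi>. real (card (solutions M \<phi> xs ys bs)) = h \<pi> M)))"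

end

theory Submission
  imports Defs "HOL-Library.Ramsey"
begin

text \<open>The proof rests on a fact about \<open>M\<close> alone, due to Lachlan: every finite subset of \<open>M\<close> lies in a finite
  \<open>A \<subseteq> M\<close> which is homogeneous with respect to the types of \<open>M\<close> (\<open>finite_extensible_superset\<close>).  Identify \<open>M\<close> with
  the natural numbers, and let \<open>A i\<close> be such a set containing \<open>{..i}\<close>.  In a finite homogeneous structure the number of
  solutions of a formula depends only on the quantifier-free type of the parameters, and a finite language has finitely many
  types of tuples of given length; therefore the substructures on the sets \<open>A i\<close> form an m.e.c.
  (\<open>mec_tuple_homogeneous\<close>).  As soon as \<open>A i\<close> realizes all types of \<open>m\<close>-tuples, homogeneity makes it satisfy the same
  formulas in \<open>m\<close> variables as \<open>M\<close> (\<open>sat_substructure_on\<close>), so that a nonprincipal ultraproduct is elementarily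
  equivalent to \<open>M\<close> by Los' theorem.

  The finite sets \<open>A\<close> are obtained by shrinking.  Let \<open>\<Omega> \<subseteq> M\<close> be homogeneous and infinite, and \<open>G\<close> its automorphism
  group.  Three properties of \<open>G\<close> are used, collected in the locale \<open>stable_action\<close>: it has finitely many orbits on
  tuples; the type of an element over a finite set is determined by its types over \<open>k\<close>-tuples of the set, because
  the relations have bounded arity; and invariant relations have no long ladders.  The last property is
  stability, made uniform by homogeneity (\<open>infinite_ladder\<close>).  Everything else is an argument about stabilizers and finite orbits.

  Stability bounds how often an infinite set can be halved by types.  This provides a minimal type: an infinite orbit of
  the stabilizer of a tuple \<open>b\<close> whose elements are conjugate over every finite set \<open>A \<supseteq> b\<close> over which they are not
  algebraic (\<open>exists_minimal\<close>).  Two facts make such types as simple as a set without structure.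
  Algebraic dependence among their elements reduces to dependence on a single element (\<open>trivial_pregeometry\<close>):
  conjugates of a longer minimal dependence could be combined into arbitrarily long ones, whereas no minimal dependence
  involves more than \<open>k\<close> elements.  And an element which is algebraic over \<open>b \<union> A \<union> B\<close> is algebraic over \<open>b \<union> A\<close> or
  \<open>b \<union> B\<close> (\<open>algebraic_over_union\<close>): the failures of this can be ranked, as chains of them are bounded by
  stability, and a failure of least rank would reproduce itself without bound.

  Consider the realizations of the conjugates of a minimal type up to interalgebraicity, here called coordinates.  A finite
  set \<open>A\<close> determines a set \<open>supp A\<close> of coordinates, with \<open>supp (A \<union> B) = supp A \<union> supp B\<close>.  The
  nonorthogonality relation partitions the coordinates into families.  By another application of stability, supports are
  finite and no coordinate depends on another one (\<open>finite_supp\<close>, \<open>no_dependence\<close>), which allows two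
  coordinates of a family to be exchanged without affecting finitely many others (\<open>swap\<close>).  Now choose
  finitely many coordinates in each family, equally many in all of them, and let \<open>\<Omega>'\<close> consist of the points supported by
  the chosen coordinates.  Exchanging coordinates shows that \<open>\<Omega>'\<close> is homogeneous (\<open>shrink\<close>), and the
  minimal type has become finite in it.  Since there are finitely many types of tuples of bounded length, repeating
  this leads to a finite set.\<close>

section \<open>Binary trees, ladders and shattered sets of a relation\<close>

text \<open>\<open>ladder \<phi> A B n\<close> is the order property of length \<open>n\<close>; \<open>splitting_tree \<phi> B n Z\<close> says that
  Shelah's local 2-rank of \<open>Z\<close> is at least \<open>n\<close>.\<close>

definition ladder :: "('z \<Rightarrow> 'y \<Rightarrow> bool) \<Rightarrow> 'z set \<Rightarrow> 'y set \<Rightarrow> nat \<Rightarrow> bool" where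
  "ladder \<phi> A B n \<longleftrightarrow> (\<exists>a b. (\<forall>i<n. a i \<in> A \<and> b i \<in> B) \<and> (\<forall>i<n. \<forall>j<n. \<phi> (a i) (b j) \<longleftrightarrow> i < j))"

primrec splitting_tree :: "('z \<Rightarrow> 'y \<Rightarrow> bool) \<Rightarrow> 'y set \<Rightarrow> nat \<Rightarrow> 'z set \<Rightarrow> bool" where
  "splitting_tree \<phi> B 0 Z \<longleftrightarrow> Z \<noteq> {}"
| "splitting_tree \<phi> B (Suc n) Z \<longleftrightarrow>
     (\<exists>y\<in>B. splitting_tree \<phi> B n {z\<in>Z. \<phi> z y} \<and> splitting_tree \<phi> B n {z\<in>Z. \<not> \<phi> z y})"

lemma splitting_tree_mono:
  "splitting_tree \<phi> B n Z \<Longrightarrow> Z \<subseteq> Z' \<Longrightarrow> B \<subseteq> B' \<Longrightarrow> splitting_tree \<phi> B' n Z'"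
proof (induction n arbitrary: Z Z')
  case (Suc n)
  then obtain y where y: "y \<in> B" "splitting_tree \<phi> B n {z\<in>Z. \<phi> z y}" "splitting_tree \<phi> B n {z\<in>Z. \<not> \<phi> z y}"
    by auto
  have "splitting_tree \<phi> B' n {z\<in>Z'. \<phi> z y}" by (rule Suc.IH[OF y(2)]) (use Suc.prems in auto)
  moreover have "splitting_tree \<phi> B' n {z\<in>Z'. \<not> \<phi> z y}" by (rule Suc.IH[OF y(3)]) (use Suc.prems in auto)
  ultimately show ?case using y(1) Suc.prems by auto
qed auto

text \<open>A splitting tree as an object, so that subtrees can be cut out of it.\<close>

datatype ('z, 'y) ptree = Leaf 'z | Node 'y "('z, 'y) ptree" "('z, 'y) ptree"

primrec full :: "nat \<Rightarrow> ('z, 'y) ptree \<Rightarrow> bool" where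
  "full n (Leaf z) \<longleftrightarrow> n = 0"
| "full n (Node y l r) \<longleftrightarrow> (\<exists>m. n = Suc m \<and> full m l \<and> full m r)"

primrec leaves :: "('z, 'y) ptree \<Rightarrow> 'z set" where
  "leaves (Leaf z) = {z}"
| "leaves (Node y l r) = leaves l \<union> leaves r"

primrec params :: "('z, 'y) ptree \<Rightarrow> 'y set" where
  "params (Leaf z) = {}"
| "params (Node y l r) = insert y (params l \<union> params r)"

primrec sorted_by :: "('z \<Rightarrow> 'y \<Rightarrow> bool) \<Rightarrow> ('z, 'y) ptree \<Rightarrow> bool" where
  "sorted_by \<phi> (Leaf z) \<longleftrightarrow> True"
| "sorted_by \<phi> (Node y l r) \<longleftrightarrow> sorted_by \<phi> l \<and> sorted_by \<phi> r \<and>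
     (\<forall>z\<in>leaves l. \<phi> z y) \<and> (\<forall>z\<in>leaves r. \<not> \<phi> z y)"

lemma leaves_nonempty: "leaves T \<noteq> {}"
  by (induction T) auto

lemma ptree_of_splitting_tree:
  "splitting_tree \<phi> B n Z \<Longrightarrow> \<exists>T. full n T \<and> sorted_by \<phi> T \<and> leaves T \<subseteq> Z \<and> params T \<subseteq> B"
proof (induction n arbitrary: Z)
  case 0
  then obtain z where "z \<in> Z" by auto
  then show ?case by (intro exI[of _ "Leaf z"]) auto
next
  case (Suc n)
  then obtain y where y: "y \<in> B" "splitting_tree \<phi> B n {z\<in>Z. \<phi> z y}" "splitting_tree \<phi> B n {z\<in>Z. \<not> \<phi> z y}"
    by auto
  from Suc.IH[OF y(2)] obtain l where l: "full n l" "sorted_by \<phi> l" "leaves l \<subseteq> {z\<in>Z. \<phi> z y}" "params l \<subseteq> B" by auto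
  from Suc.IH[OF y(3)] obtain r where r: "full n r" "sorted_by \<phi> r" "leaves r \<subseteq> {z\<in>Z. \<not> \<phi> z y}" "params r \<subseteq> B" by auto
  show ?case by (rule exI[of _ "Node y l r"]) (use l r y in auto)
qed

text \<open>A Ramsey property: if both branches of the root contain a large monochromatic subtree of the root's
  colour, the root joins them, and otherwise a branch alone contains one of the other colour.\<close>

lemma monochromatic_subtree:
  assumes "full (p + q) T" "sorted_by \<phi> T"
  shows "\<exists>T'. sorted_by \<phi> T' \<and> leaves T' \<subseteq> leaves T \<and> params T' \<subseteq> params T \<and>
     ((full p T' \<and> (\<forall>y\<in>params T'. c y)) \<or> (full q T' \<and> (\<forall>y\<in>params T'. \<not> c y)))"
  using assms
proof (induction T arbitrary: p q)
  case (Leaf z)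
  then show ?case by (intro exI[of _ "Leaf z"]) auto
next
  case (Node y l r)
  show ?case
  proof (cases "p = 0 \<or> q = 0")
    case True
    obtain z where "z \<in> leaves l" using leaves_nonempty by fastforce
    then show ?thesis using True by (intro exI[of _ "Leaf z"]) auto
  next
    case False
    then obtain p' q' where pq: "p = Suc p'" "q = Suc q'" by (metis not0_implies_Suc)
    note prems = Node.prems[unfolded pq]
    have fl: "full (p' + Suc q') l" "full (p' + Suc q') r" "full (Suc p' + q') l" "full (Suc p' + q') r"
      using prems by auto
    have sl: "sorted_by \<phi> l" "sorted_by \<phi> r" using prems by auto
    show ?thesis
    proof (cases "c y")
      case True
      obtain l' where l': "sorted_by \<phi> l'" "leaves l' \<subseteq> leaves l" "params l' \<subseteq> params l"
        "(full p' l' \<and> (\<forall>y\<in>params l'. c y)) \<or> (full q l' \<and> (\<forall>y\<in>params l'. \<not> c y))"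
        using Node.IH(1)[OF fl(1) sl(1)] pq by auto
      obtain r' where r': "sorted_by \<phi> r'" "leaves r' \<subseteq> leaves r" "params r' \<subseteq> params r"
        "(full p' r' \<and> (\<forall>y\<in>params r'. c y)) \<or> (full q r' \<and> (\<forall>y\<in>params r'. \<not> c y))"
        using Node.IH(2)[OF fl(2) sl(2)] pq by auto
      consider "full q l' \<and> (\<forall>y\<in>params l'. \<not> c y)" | "full q r' \<and> (\<forall>y\<in>params r'. \<not> c y)"
        | "full p' l' \<and> (\<forall>y\<in>params l'. c y)" "full p' r' \<and> (\<forall>y\<in>params r'. c y)" using l' r' by auto
      then show ?thesis
      proof cases
        case 1 then show ?thesis using l' by (intro exI[of _ l']) auto
      next
        case 2 then show ?thesis using r' by (intro exI[of _ r']) auto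
      next
        case 3 then show ?thesis using l' r' True prems pq
          by (intro exI[of _ "Node y l' r'"]) auto
      qed
    next
      case False
      obtain l' where l': "sorted_by \<phi> l'" "leaves l' \<subseteq> leaves l" "params l' \<subseteq> params l"
        "(full p l' \<and> (\<forall>y\<in>params l'. c y)) \<or> (full q' l' \<and> (\<forall>y\<in>params l'. \<not> c y))"
        using Node.IH(1)[OF fl(3) sl(1)] pq by auto
      obtain r' where r': "sorted_by \<phi> r'" "leaves r' \<subseteq> leaves r" "params r' \<subseteq> params r"
        "(full p r' \<and> (\<forall>y\<in>params r'. c y)) \<or> (full q' r' \<and> (\<forall>y\<in>params r'. \<not> c y))"
        using Node.IH(2)[OF fl(4) sl(2)] pq by auto
      consider "full p l' \<and> (\<forall>y\<in>params l'. c y)" | "full p r' \<and> (\<forall>y\<in>params r'. c y)"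
        | "full q' l' \<and> (\<forall>y\<in>params l'. \<not> c y)" "full q' r' \<and> (\<forall>y\<in>params r'. \<not> c y)" using l' r' by auto
      then show ?thesis
      proof cases
        case 1 then show ?thesis using l' by (intro exI[of _ l']) auto
      next
        case 2 then show ?thesis using r' by (intro exI[of _ r']) auto
      next
        case 3 then show ?thesis using l' r' False prems pq
          by (intro exI[of _ "Node y l' r'"]) auto
      qed
    qed
  qed
qed

text \<open>With \<open>\<le>\<close> in place of \<open><\<close> a ladder can be prolonged at the front by a single pair.\<close>

definition half_ladder :: "('z \<Rightarrow> 'y \<Rightarrow> bool) \<Rightarrow> ('z \<times> 'y) list \<Rightarrow> bool" where
  "half_ladder \<phi> ps \<longleftrightarrow> (\<forall>i<length ps. \<forall>j<length ps. \<phi> (fst (ps!i)) (snd (ps!j)) \<longleftrightarrow> i \<le> j)"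

lemma half_ladder_Cons:
  assumes "half_ladder \<phi> ps" "\<phi> a b" "\<forall>(a', b')\<in>set ps. \<phi> a b' \<and> \<not> \<phi> a' b"
  shows "half_ladder \<phi> ((a, b) # ps)"
  unfolding half_ladder_def
proof (intro allI impI)
  fix i j assume "i < length ((a, b) # ps)" "j < length ((a, b) # ps)"
  then show "\<phi> (fst (((a, b) # ps) ! i)) (snd (((a, b) # ps) ! j)) \<longleftrightarrow> i \<le> j"
    using assms nth_mem[of "i - 1" ps] nth_mem[of "j - 1" ps]
    by (cases i; cases j) (auto simp: half_ladder_def case_prod_unfold)
qed

primrec tree_bound :: "nat \<Rightarrow> nat" where
  "tree_bound 0 = 0"
| "tree_bound (Suc n) = 2 * Suc (tree_bound n)"

text \<open>Hodges' argument: pick a leaf \<open>a\<close>, pass to a subtree whose parameters all have the same relation to \<open>a\<close>, and let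
  \<open>b\<close> be its root.  A half-ladder found in the branch whose leaves have the opposite relation to \<open>b\<close> is
  prolonged by \<open>(a, b)\<close>.  Depending on the relation, this serves \<open>\<phi>\<close> or its negation, so both are pursued at once.\<close>

lemma half_ladder_of_ptree:
  assumes "full (tree_bound (m + n)) T" "sorted_by \<phi> T"
  shows "\<exists>ps. set ps \<subseteq> leaves T \<times> params T \<and>
    (half_ladder \<phi> ps \<and> length ps = m \<or> half_ladder (\<lambda>z y. \<not> \<phi> z y) ps \<and> length ps = n)"
  using assms
proof (induction "m + n" arbitrary: m n T)
  case 0
  then show ?case by (intro exI[of _ "[]"]) (auto simp: half_ladder_def)
next
  case (Suc k)
  show ?case
  proof (cases "m = 0 \<or> n = 0")
    case True
    then show ?thesis by (intro exI[of _ "[]"]) (auto simp: half_ladder_def)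
  next
    case False
    then obtain m' n' where mn: "m = Suc m'" "n = Suc n'" by (metis not0_implies_Suc)
    obtain a where a: "a \<in> leaves T" using leaves_nonempty by fastforce
    have "full (Suc (tree_bound k) + Suc (tree_bound k)) T"
      using Suc.prems(1) Suc.hyps(2)[symmetric] by (simp add: mult_2)
    from monochromatic_subtree[OF this Suc.prems(2), of "\<phi> a"]
    obtain T' where T': "sorted_by \<phi> T'" "leaves T' \<subseteq> leaves T" "params T' \<subseteq> params T"
      "full (Suc (tree_bound k)) T'" "(\<forall>y\<in>params T'. \<phi> a y) \<or> (\<forall>y\<in>params T'. \<not> \<phi> a y)"
      by auto
    then obtain b l r where T'_eq: "T' = Node b l r" by (cases T') auto
    have fl: "full (tree_bound k) l" "full (tree_bound k) r" using T' T'_eq by auto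
    show ?thesis
    proof (cases "\<forall>y\<in>params T'. \<phi> a y")
      case True
      have k: "k = m' + n" using Suc.hyps(2) mn by simp
      from Suc.hyps(1)[OF k, of r] fl T' T'_eq obtain ps where ps: "set ps \<subseteq> leaves r \<times> params r"
        "half_ladder \<phi> ps \<and> length ps = m' \<or> half_ladder (\<lambda>z y. \<not> \<phi> z y) ps \<and> length ps = n"
        using k by auto
      have sub: "set ps \<subseteq> leaves T \<times> params T" using ps(1) T' T'_eq by auto
      show ?thesis
      proof (cases "half_ladder \<phi> ps \<and> length ps = m'")
        case h: True
        have "half_ladder \<phi> ((a, b) # ps)"
          using h True ps(1) T'(1) by (intro half_ladder_Cons) (auto simp: T'_eq)
        then show ?thesis using h mn a sub T' T'_eq by (intro exI[of _ "(a, b) # ps"]) auto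
      next
        case False
        then show ?thesis using ps sub by (intro exI[of _ ps]) auto
      qed
    next
      case False
      then have neg: "\<forall>y\<in>params T'. \<not> \<phi> a y" using T' by auto
      have k: "k = m + n'" using Suc.hyps(2) mn by simp
      from Suc.hyps(1)[OF k, of l] fl T' T'_eq obtain ps where ps: "set ps \<subseteq> leaves l \<times> params l"
        "half_ladder \<phi> ps \<and> length ps = m \<or> half_ladder (\<lambda>z y. \<not> \<phi> z y) ps \<and> length ps = n'"
        using k by auto
      have sub: "set ps \<subseteq> leaves T \<times> params T" using ps(1) T' T'_eq by auto
      show ?thesis
      proof (cases "half_ladder (\<lambda>z y. \<not> \<phi> z y) ps \<and> length ps = n'")
        case h: True
        have "half_ladder (\<lambda>z y. \<not> \<phi> z y) ((a, b) # ps)"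
          using h neg ps(1) T'(1) by (intro half_ladder_Cons) (auto simp: T'_eq)
        then show ?thesis using h mn a sub T' T'_eq by (intro exI[of _ "(a, b) # ps"]) auto
      next
        case False
        then show ?thesis using ps sub by (intro exI[of _ ps]) auto
      qed
    qed
  qed
qed

lemma ladder_of_half_ladder:
  assumes "half_ladder \<phi> ps" "length ps = Suc n" "set ps \<subseteq> A \<times> B"
  shows "ladder \<phi> A B n"
  unfolding ladder_def
proof (intro exI conjI allI impI)
  \<comment> \<open>Shifting the elements by one place turns \<open>i \<le> j\<close> into \<open>i < j\<close>.\<close>
  fix i assume "i < n"
  then have "ps ! Suc i \<in> A \<times> B" "ps ! i \<in> A \<times> B" using assms by (auto simp: subset_code(1))
  then show "fst (ps ! Suc i) \<in> A" "snd (ps ! i) \<in> B" by auto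
next
  fix i j assume "i < n" "j < n"
  then show "\<phi> (fst (ps ! Suc i)) (snd (ps ! j)) \<longleftrightarrow> i < j" using assms by (auto simp: half_ladder_def)
qed

lemma ladder_of_neg_half_ladder:
  assumes "half_ladder (\<lambda>z y. \<not> \<phi> z y) ps" "length ps = n" "set ps \<subseteq> A \<times> B"
  shows "ladder \<phi> A B n"
  unfolding ladder_def
proof (intro exI conjI allI impI)
  \<comment> \<open>Reversing the list turns \<open>\<not> i \<le> j\<close> into \<open>i < j\<close>.\<close>
  fix i assume "i < n"
  then have "ps ! (n - 1 - i) \<in> A \<times> B" using assms by (auto simp: subset_code(1))
  then show "fst (ps ! (n - 1 - i)) \<in> A" "snd (ps ! (n - 1 - i)) \<in> B" by auto
next
  fix i j assume ij: "i < n" "j < n"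
  then have "n - 1 - i < length ps" "n - 1 - j < length ps" using assms by auto
  then have "\<not> \<phi> (fst (ps ! (n - 1 - i))) (snd (ps ! (n - 1 - j))) \<longleftrightarrow> n - 1 - i \<le> n - 1 - j"
    using assms(1) unfolding half_ladder_def by blast
  then show "\<phi> (fst (ps ! (n - 1 - i))) (snd (ps ! (n - 1 - j))) \<longleftrightarrow> i < j" using ij by auto
qed

lemma ladder_mono: "ladder \<phi> A B n \<Longrightarrow> A \<subseteq> A' \<Longrightarrow> B \<subseteq> B' \<Longrightarrow> m \<le> n \<Longrightarrow> ladder \<phi> A' B' m"
proof -
  assume *: "ladder \<phi> A B n" "A \<subseteq> A'" "B \<subseteq> B'" "m \<le> n"
  then obtain a b where "\<forall>i<n. a i \<in> A \<and> b i \<in> B" "\<forall>i<n. \<forall>j<n. \<phi> (a i) (b j) \<longleftrightarrow> i < j"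
    unfolding ladder_def by blast
  then show "ladder \<phi> A' B' m"
    unfolding ladder_def using * by (intro exI[of _ a] exI[of _ b]) (meson in_mono less_le_trans)
qed

lemma ladder_of_splitting_tree:
  assumes "splitting_tree \<phi> B (tree_bound (2 * Suc n)) Z"
  shows "ladder \<phi> Z B n"
proof -
  obtain T where T: "full (tree_bound (Suc n + Suc n)) T" "sorted_by \<phi> T" "leaves T \<subseteq> Z" "params T \<subseteq> B"
    using ptree_of_splitting_tree[OF assms] by (auto simp: mult_2)
  obtain ps where ps: "set ps \<subseteq> leaves T \<times> params T"
    "half_ladder \<phi> ps \<and> length ps = Suc n \<or> half_ladder (\<lambda>z y. \<not> \<phi> z y) ps \<and> length ps = Suc n"
    using half_ladder_of_ptree[OF T(1,2)] by auto
  have sub: "set ps \<subseteq> Z \<times> B" using ps T by auto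
  show ?thesis
  proof (cases "half_ladder \<phi> ps \<and> length ps = Suc n")
    case True
    then show ?thesis using ladder_of_half_ladder sub by blast
  next
    case False
    then have "ladder \<phi> Z B (Suc n)" using ps ladder_of_neg_half_ladder sub by blast
    then show ?thesis by (rule ladder_mono) auto
  qed
qed

lemma ladder_of_shattering:
  assumes a: "\<And>i. i < n \<Longrightarrow> a i \<in> A"
    and sh: "\<And>W. W \<subseteq> {..<n} \<Longrightarrow> \<exists>b\<in>B. \<forall>i<n. \<phi> (a i) b \<longleftrightarrow> i \<in> W"
  shows "ladder \<phi> A B n"
proof -
  have "\<forall>j. \<exists>b. j < n \<longrightarrow> b \<in> B \<and> (\<forall>i<n. \<phi> (a i) b \<longleftrightarrow> i < j)"
  proof
    fix j
    show "\<exists>b. j < n \<longrightarrow> b \<in> B \<and> (\<forall>i<n. \<phi> (a i) b \<longleftrightarrow> i < j)"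
    proof (cases "j < n")
      case True
      with sh[of "{..<j}"] show ?thesis by auto
    qed auto
  qed
  then obtain b where "\<forall>j. j < n \<longrightarrow> b j \<in> B \<and> (\<forall>i<n. \<phi> (a i) (b j) \<longleftrightarrow> i < j)" by metis
  then show ?thesis unfolding ladder_def by (intro exI[of _ a] exI[of _ b]) (use a in auto)
qed

section \<open>Oligomorphic groups with finitely determined types and no long ladders\<close>

definition tups :: "'a set \<Rightarrow> nat \<Rightarrow> 'a list set" where
  "tups \<Omega> n = {xs. set xs \<subseteq> \<Omega> \<and> length xs = n}"

definition invariant_rel ::
  "('a \<Rightarrow> 'a) set \<Rightarrow> 'a set \<Rightarrow> nat \<Rightarrow> nat \<Rightarrow> ('a list \<Rightarrow> 'a list \<Rightarrow> bool) \<Rightarrow> bool" where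
  "invariant_rel G \<Omega> p q R \<longleftrightarrow>
     (\<forall>g\<in>G. \<forall>xs\<in>tups \<Omega> p. \<forall>ys\<in>tups \<Omega> q. R (map g xs) (map g ys) \<longleftrightarrow> R xs ys)"

text \<open>The intended group consists of the automorphisms of a homogeneous structure on \<open>\<Omega>\<close>; all of them are
  permutations of the whole type, so that they compose as functions.  The assumption \<open>determined\<close> says that types over finite
  sets are determined by types over \<open>k\<close>-tuples, and \<open>no_long_ladder\<close> that \<open>\<Omega>\<close> is stable.\<close>

locale stable_action =
  fixes \<Omega> :: "'a set" and G :: "('a \<Rightarrow> 'a) set" and k :: nat
  assumes G_bij: "g \<in> G \<Longrightarrow> bij g"
    and G_image: "g \<in> G \<Longrightarrow> g ` \<Omega> = \<Omega>"
    and G_id: "id \<in> G"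
    and G_comp: "g \<in> G \<Longrightarrow> h \<in> G \<Longrightarrow> g \<circ> h \<in> G"
    and G_inv: "g \<in> G \<Longrightarrow> inv g \<in> G"
    and finitely_many_orbits:
      "\<exists>S. finite S \<and> (\<forall>xs\<in>tups \<Omega> n. \<exists>ys\<in>S. \<exists>g\<in>G. map g xs = ys)"
    and determined: "\<lbrakk>finite A; A \<noteq> {}; A \<subseteq> \<Omega>; x \<in> \<Omega>; y \<in> \<Omega>;
       \<And>es. es \<in> tups A k \<Longrightarrow> \<exists>g\<in>G. map g (es @ [x]) = es @ [y]\<rbrakk>
       \<Longrightarrow> \<exists>g\<in>G. (\<forall>a\<in>A. g a = a) \<and> g x = y"
    and no_long_ladder:
      "invariant_rel G \<Omega> p q R \<Longrightarrow> \<exists>n. \<not> ladder R (tups \<Omega> p) (tups \<Omega> q) n"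
begin

lemma G_inj: "g \<in> G \<Longrightarrow> inj g"
  using G_bij bij_is_inj by blast

lemma G_eq_iff [simp]: "g \<in> G \<Longrightarrow> g x = g y \<longleftrightarrow> x = y"
  using G_inj by (meson injD)

lemma G_inv_apply [simp]: "g \<in> G \<Longrightarrow> inv g (g x) = x" "g \<in> G \<Longrightarrow> g (inv g x) = x"
  using G_bij by (auto simp: bij_is_inj bij_is_surj surj_f_inv_f)

lemma G_mem [simp]: "g \<in> G \<Longrightarrow> g x \<in> \<Omega> \<longleftrightarrow> x \<in> \<Omega>"
  using G_image[of g] G_inj[of g] by (metis image_iff inj_image_mem_iff)

lemma G_image_iff: "g \<in> G \<Longrightarrow> y \<in> g ` A \<longleftrightarrow> inv g y \<in> A"
proof -
  assume g: "g \<in> G"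
  show ?thesis
  proof
    assume "inv g y \<in> A"
    then have "g (inv g y) \<in> g ` A" by (rule imageI)
    then show "y \<in> g ` A" using g by simp
  qed (use g in auto)
qed

definition stab :: "'a set \<Rightarrow> ('a \<Rightarrow> 'a) set" where
  "stab A = {g \<in> G. \<forall>a\<in>A. g a = a}"

lemma stabI: "g \<in> G \<Longrightarrow> (\<And>a. a \<in> A \<Longrightarrow> g a = a) \<Longrightarrow> g \<in> stab A"
  by (auto simp: stab_def)

lemma stabD: "g \<in> stab A \<Longrightarrow> g \<in> G" "g \<in> stab A \<Longrightarrow> a \<in> A \<Longrightarrow> g a = a"
  by (auto simp: stab_def)

lemma stab_mono: "A \<subseteq> B \<Longrightarrow> stab B \<subseteq> stab A"
  by (auto simp: stab_def)

lemma stab_id [simp]: "id \<in> stab A"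
  by (auto simp: stab_def G_id)

lemma stab_comp: "g \<in> stab A \<Longrightarrow> h \<in> stab A \<Longrightarrow> g \<circ> h \<in> stab A"
  by (auto simp: stab_def G_comp)

lemma stab_inv: "g \<in> stab A \<Longrightarrow> inv g \<in> stab A"
  unfolding stab_def by (simp add: G_inv) (metis G_inv_apply(1))

lemma stab_image: "g \<in> stab A \<Longrightarrow> B \<subseteq> A \<Longrightarrow> g ` B = B"
  by (auto simp: stab_def image_def) (metis subsetD)+

lemma stab_map: "g \<in> stab A \<Longrightarrow> set xs \<subseteq> A \<Longrightarrow> map g xs = xs"
  by (auto simp: stab_def intro!: map_idI)

lemma stab_conj:
  assumes "g \<in> G" shows "h \<in> stab (g ` A) \<longleftrightarrow> inv g \<circ> h \<circ> g \<in> stab A"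
proof
  assume h: "h \<in> stab (g ` A)"
  show "inv g \<circ> h \<circ> g \<in> stab A"
    using h assms by (intro stabI) (auto simp: G_comp G_inv stab_def)
next
  assume h: "inv g \<circ> h \<circ> g \<in> stab A"
  have "h = g \<circ> (inv g \<circ> h \<circ> g) \<circ> inv g" using assms by (auto simp: fun_eq_iff)
  then have "h \<in> G" using h assms by (metis G_comp G_inv stabD(1))
  moreover have "h (g a) = g a" if "a \<in> A" for a
    using stabD(2)[OF h that] assms by (metis G_inv_apply(2) comp_apply)
  ultimately show "h \<in> stab (g ` A)" by (auto intro: stabI)
qed

definition orb :: "'a set \<Rightarrow> 'a \<Rightarrow> 'a set" where
  "orb A x = (\<lambda>g. g x) ` stab A"

text \<open>Algebraic closure, in terms of orbits instead of formulas.\<close>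

definition cl :: "'a set \<Rightarrow> 'a set" where
  "cl A = {x \<in> \<Omega>. finite (orb A x)}"

lemma orb_self [simp]: "x \<in> orb A x"
  unfolding orb_def by (metis id_apply image_eqI stab_id)

lemma orb_mono: "A \<subseteq> B \<Longrightarrow> orb B x \<subseteq> orb A x"
  unfolding orb_def using stab_mono by blast

lemma orb_eq: assumes "g \<in> stab A" shows "orb A (g x) = orb A x"
proof -
  have "orb A (g x) \<subseteq> orb A x" if "g \<in> stab A" for g x
  proof
    fix y assume "y \<in> orb A (g x)"
    then obtain h where "h \<in> stab A" "y = (h \<circ> g) x" by (auto simp: orb_def)
    then show "y \<in> orb A x" using stab_comp[OF _ that, of h] unfolding orb_def by blast
  qed
  from this[OF assms] this[OF stab_inv[OF assms], of "g x"] show ?thesis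
    using assms stabD(1) by (metis G_inv_apply(1) subset_antisym)
qed

lemma cl_mono: "A \<subseteq> B \<Longrightarrow> cl A \<subseteq> cl B"
  by (auto simp: cl_def intro: finite_subset[OF orb_mono])

lemma cl_mono': "x \<in> cl A \<Longrightarrow> A \<subseteq> B \<Longrightarrow> x \<in> cl B"
  using cl_mono by blast

lemma cl_self: "a \<in> A \<Longrightarrow> a \<in> \<Omega> \<Longrightarrow> a \<in> cl A"
proof -
  assume a: "a \<in> A" "a \<in> \<Omega>"
  then have "orb A a = {a}" by (auto simp: orb_def stab_def intro!: image_eqI[of _ _ id] G_id)
  then show ?thesis using a by (simp add: cl_def)
qed

lemma orb_image: assumes "g \<in> G" shows "orb (g ` A) (g x) = g ` orb A x"
proof
  show "orb (g ` A) (g x) \<subseteq> g ` orb A x"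
  proof
    fix y assume "y \<in> orb (g ` A) (g x)"
    then obtain h where h: "h \<in> stab (g ` A)" "y = h (g x)" by (auto simp: orb_def)
    then have "inv g \<circ> h \<circ> g \<in> stab A" using stab_conj[OF assms] by blast
    then have "(inv g \<circ> h \<circ> g) x \<in> orb A x" unfolding orb_def by blast
    moreover have "y = g ((inv g \<circ> h \<circ> g) x)" using h assms by simp
    ultimately show "y \<in> g ` orb A x" by blast
  qed
  show "g ` orb A x \<subseteq> orb (g ` A) (g x)"
  proof
    fix y assume "y \<in> g ` orb A x"
    then obtain h where h: "h \<in> stab A" "y = g (h x)" by (auto simp: orb_def)
    have "inv g \<circ> (g \<circ> h \<circ> inv g) \<circ> g = h" using assms by (auto simp: fun_eq_iff)
    then have "g \<circ> h \<circ> inv g \<in> stab (g ` A)" using stab_conj[OF assms] h by metis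
    then have "(g \<circ> h \<circ> inv g) (g x) \<in> orb (g ` A) (g x)" unfolding orb_def by blast
    then show "y \<in> orb (g ` A) (g x)" using h assms by simp
  qed
qed

lemma cl_image_mem: "g \<in> G \<Longrightarrow> g x \<in> cl (g ` A) \<longleftrightarrow> x \<in> cl A"
  using G_inj[of g] by (auto simp: cl_def orb_image finite_image_iff inj_on_subset)

lemma cl_image: "g \<in> G \<Longrightarrow> cl (g ` A) = g ` cl A"
proof -
  assume g: "g \<in> G"
  have "y \<in> cl (g ` A) \<longleftrightarrow> y \<in> g ` cl A" for y
    using cl_image_mem[OF g, of "inv g y" A] g by (simp add: G_image_iff)
  then show ?thesis by blast
qed

lemma stab_cl_mem: "g \<in> stab A \<Longrightarrow> B \<subseteq> A \<Longrightarrow> g x \<in> cl B \<longleftrightarrow> x \<in> cl B"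
  using cl_image_mem[of g x B] stab_image[of g A B] stabD(1) by simp

lemma notin_cl_avoid:
  assumes "x \<in> \<Omega>" "x \<notin> cl A" "finite F"
  shows "\<exists>g\<in>stab A. g x \<notin> F"
proof -
  have "infinite (orb A x)" using assms by (auto simp: cl_def)
  then obtain y where "y \<in> orb A x" "y \<notin> F"
    using assms(3) by (meson finite_subset subsetI)
  then show ?thesis by (auto simp: orb_def)
qed

lemma conj_over_iff:
  "(\<exists>g\<in>stab (set as). g x = y) \<longleftrightarrow> (\<exists>g\<in>G. map g (as @ [x]) = as @ [y])"
proof
  assume "\<exists>g\<in>stab (set as). g x = y"
  then obtain g where "g \<in> stab (set as)" "g x = y" by blast
  then show "\<exists>g\<in>G. map g (as @ [x]) = as @ [y]"
    using stab_map[of g "set as" as] stabD(1) by (intro bexI[of _ g]) auto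
next
  assume "\<exists>g\<in>G. map g (as @ [x]) = as @ [y]"
  then obtain g where g: "g \<in> G" "map g as = as" "g x = y" by auto
  then have "g \<in> stab (set as)" by (intro stabI) (auto, metis in_set_conv_nth nth_map)
  then show "\<exists>g\<in>stab (set as). g x = y" using g by blast
qed

text \<open>The orbits of the stabilizer of \<open>A\<close> correspond to orbits of tuples which enumerate \<open>A\<close> and one further
  element; there are finitely many of them.\<close>

lemma finite_cl: assumes "finite A" "A \<subseteq> \<Omega>" shows "finite (cl A)"
proof -
  obtain as where as: "set as = A" using assms finite_list by blast
  obtain S where S: "finite S" "\<forall>xs\<in>tups \<Omega> (Suc (length as)). \<exists>ys\<in>S. \<exists>g\<in>G. map g xs = ys"
    using finitely_many_orbits by blast
  have "\<forall>x\<in>\<Omega>. \<exists>ys\<in>S. \<exists>g\<in>G. map g (as @ [x]) = ys"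
  proof
    fix x assume "x \<in> \<Omega>"
    then have "as @ [x] \<in> tups \<Omega> (Suc (length as))" using as assms by (auto simp: tups_def)
    then show "\<exists>ys\<in>S. \<exists>g\<in>G. map g (as @ [x]) = ys" using S(2) by blast
  qed
  then obtain r h where r: "\<And>x. x \<in> \<Omega> \<Longrightarrow> r x \<in> S" "\<And>x. x \<in> \<Omega> \<Longrightarrow> h x \<in> G"
    "\<And>x. x \<in> \<Omega> \<Longrightarrow> map (h x) (as @ [x]) = r x" by metis
  have orb: "orb A x = orb A y" if "x \<in> \<Omega>" "y \<in> \<Omega>" "r x = r y" for x y
  proof -
    have "map (h x) (as @ [x]) = map (h y) (as @ [y])" using r that by metis
    then have "map (inv (h x) \<circ> h y) (as @ [y]) = map (inv (h x) \<circ> h x) (as @ [x])"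
      by (metis map_map)
    moreover have "inv (h x) \<circ> h x = id" using r(2)[OF that(1)] by (auto simp: fun_eq_iff)
    ultimately have "\<exists>g\<in>G. map g (as @ [y]) = as @ [x]"
    proof -
      assume "map (inv (h x) \<circ> h y) (as @ [y]) = map (inv (h x) \<circ> h x) (as @ [x])" "inv (h x) \<circ> h x = id"
      then have "map (inv (h x) \<circ> h y) (as @ [y]) = as @ [x]" by simp
      moreover have "inv (h x) \<circ> h y \<in> G" using r(2) that by (intro G_comp G_inv) auto
      ultimately show ?thesis by blast
    qed
    then obtain g where "g \<in> stab A" "g y = x" using conj_over_iff as by blast
    then show ?thesis using orb_eq by blast
  qed
  define sel where "sel ys = (SOME z. z \<in> \<Omega> \<and> r z = ys)" for ys
  have sel: "sel (r x) \<in> \<Omega> \<and> r (sel (r x)) = r x" if "x \<in> \<Omega>" for x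
    unfolding sel_def by (rule someI[of _ x]) (use that in simp)
  have "orb A ` \<Omega> \<subseteq> (\<lambda>ys. orb A (sel ys)) ` S"
  proof
    fix o' assume "o' \<in> orb A ` \<Omega>"
    then obtain x where x: "x \<in> \<Omega>" "o' = orb A x" by blast
    have "o' = orb A (sel (r x))" unfolding x(2) using sel[OF x(1)] by (intro orb) (auto simp: x(1))
    then show "o' \<in> (\<lambda>ys. orb A (sel ys)) ` S" using r(1)[OF x(1)] by (rule image_eqI)
  qed
  then have "finite (orb A ` \<Omega>)" using finite_surj[OF S(1)] by simp
  then have "finite (\<Union>{o' \<in> orb A ` \<Omega>. finite o'})" by auto
  moreover have "cl A \<subseteq> \<Union>{o' \<in> orb A ` \<Omega>. finite o'}"
    by (auto simp: cl_def intro!: bexI exI[of _ "orb A _"])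
  ultimately show ?thesis by (rule finite_subset[rotated])
qed

lemma card_cl_bounded: "\<exists>N. \<forall>A. finite A \<longrightarrow> A \<subseteq> \<Omega> \<longrightarrow> card A \<le> n \<longrightarrow> card (cl A) \<le> N"
proof -
  have "\<exists>N. \<forall>as\<in>tups \<Omega> m. card (cl (set as)) \<le> N" for m
  proof -
    obtain S where S: "finite S" "\<forall>xs\<in>tups \<Omega> m. \<exists>ys\<in>S. \<exists>g\<in>G. map g xs = ys"
      using finitely_many_orbits by blast
    show ?thesis
    proof (intro exI ballI)
      fix as assume as: "as \<in> tups \<Omega> m"
      then obtain g ys where g: "ys \<in> S" "g \<in> G" "map g as = ys" using S by blast
      have "card (cl (set as)) = card (cl (set ys))"
        using cl_image[OF g(2), of "set as"] g G_inj[of g]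
        by (metis card_image inj_on_subset set_map subset_UNIV)
      also have "\<dots> \<le> Max (insert 0 ((\<lambda>ys. card (cl (set ys))) ` S))" using S g by (intro Max_ge) auto
      finally show "card (cl (set as)) \<le> Max (insert 0 ((\<lambda>ys. card (cl (set ys))) ` S))" .
    qed
  qed
  then obtain N where N: "\<And>m as. as \<in> tups \<Omega> m \<Longrightarrow> card (cl (set as)) \<le> N m" by metis
  show ?thesis
  proof (intro exI allI impI)
    fix A assume A: "finite A" "A \<subseteq> \<Omega>" "card A \<le> n"
    obtain as where as: "set as = A" "distinct as" using A finite_distinct_list by blast
    then have "as \<in> tups \<Omega> (card A)" using A by (auto simp: tups_def distinct_card)
    then have "card (cl A) \<le> N (card A)" using N as by blast
    also have "\<dots> \<le> Max (N ` {..n})" using A by (intro Max_ge) auto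
    finally show "card (cl A) \<le> Max (N ` {..n})" .
  qed
qed

lemma orb_finite_union:
  assumes "finite (orb A x)" "finite (orb (insert x A) y)"
  shows "finite (orb A y)"
proof -
  have "\<exists>h\<in>stab A. h x = z" if "z \<in> orb A x" for z using that by (auto simp: orb_def)
  then obtain h where h: "\<And>z. z \<in> orb A x \<Longrightarrow> h z \<in> stab A" "\<And>z. z \<in> orb A x \<Longrightarrow> h z x = z" by metis
  have "orb A y \<subseteq> (\<Union>z\<in>orb A x. h z ` orb (insert x A) y)"
  proof
    fix w assume "w \<in> orb A y"
    then obtain g where g: "g \<in> stab A" "w = g y" by (auto simp: orb_def)
    let ?z = "g x"
    have z: "?z \<in> orb A x" using g by (auto simp: orb_def)
    have hG: "h ?z \<in> G" using h z stabD by blast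
    have s: "inv (h ?z) \<circ> g \<in> stab (insert x A)"
      using stab_comp[OF stab_inv[OF h(1)[OF z]] g(1)] h(2)[OF z] hG
      by (auto simp: stab_def) (metis G_inv_apply(1))
    have "w = h ?z ((inv (h ?z) \<circ> g) y)" using g hG by simp
    moreover have "(inv (h ?z) \<circ> g) y \<in> orb (insert x A) y" using s unfolding orb_def by blast
    ultimately show "w \<in> (\<Union>z\<in>orb A x. h z ` orb (insert x A) y)" using z by blast
  qed
  then show ?thesis using assms by (meson finite_UN_I finite_imageI finite_subset)
qed

lemma cl_trans: assumes "finite B" "B \<subseteq> cl A" "x \<in> cl (A \<union> B)" shows "x \<in> cl A"
  using assms
proof (induction B arbitrary: x rule: finite_induct)
  case (insert b B)
  have "b \<in> cl (A \<union> B)" using insert.prems cl_mono[of A "A \<union> B"] by auto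
  then have "x \<in> cl (A \<union> B)"
    using insert.prems(2) orb_finite_union[of "A \<union> B" b x] by (auto simp: cl_def)
  then show ?case using insert by auto
qed auto

lemma cl_trans1: "y \<in> cl A \<Longrightarrow> x \<in> cl (insert y A) \<Longrightarrow> x \<in> cl A"
  using cl_trans[of "{y}" A x] by auto

text \<open>The two forms in which stability is applied: invariant relations do not shatter large families, and have bounded
  2-rank.\<close>

lemma no_shattering:
  assumes inv: "invariant_rel G \<Omega> p q R"
  shows "\<exists>n::nat. \<forall>a. (\<forall>i<n. a i \<in> tups \<Omega> p) \<longrightarrow>
     (\<exists>W\<subseteq>{..<n}. \<forall>b\<in>tups \<Omega> q. \<exists>i<n. R (a i) b \<longleftrightarrow> i \<notin> W)"
proof -
  obtain n where n: "\<not> ladder R (tups \<Omega> p) (tups \<Omega> q) n" using no_long_ladder[OF inv] by blast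
  show ?thesis
  proof (intro exI[of _ n] allI impI)
    fix a :: "nat \<Rightarrow> 'a list" assume a: "\<forall>i<n. a i \<in> tups \<Omega> p"
    show "\<exists>W\<subseteq>{..<n}. \<forall>b\<in>tups \<Omega> q. \<exists>i<n. R (a i) b \<longleftrightarrow> i \<notin> W"
    proof (rule ccontr)
      assume neg: "\<not> ?thesis"
      have "ladder R (tups \<Omega> p) (tups \<Omega> q) n"
      proof (rule ladder_of_shattering)
        fix W :: "nat set" assume "W \<subseteq> {..<n}"
        then have "\<not> (\<forall>b\<in>tups \<Omega> q. \<exists>i<n. R (a i) b \<longleftrightarrow> i \<notin> W)" using neg by simp
        then obtain b where "b \<in> tups \<Omega> q" "\<not> (\<exists>i<n. R (a i) b \<longleftrightarrow> i \<notin> W)" by auto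
        then show "\<exists>b\<in>tups \<Omega> q. \<forall>i<n. R (a i) b \<longleftrightarrow> i \<in> W" by auto
      qed (use a in auto)
      then show False using n by simp
    qed
  qed
qed

lemma no_tall_tree:
  assumes inv: "invariant_rel G \<Omega> p q R"
  shows "\<exists>n. \<not> splitting_tree R (tups \<Omega> q) n (tups \<Omega> p)"
proof -
  obtain n where n: "\<not> ladder R (tups \<Omega> p) (tups \<Omega> q) n" using no_long_ladder[OF inv] by blast
  then have "\<not> splitting_tree R (tups \<Omega> q) (tree_bound (2 * Suc n)) (tups \<Omega> p)"
    using ladder_of_splitting_tree by metis
  then show ?thesis by (rule exI)
qed

end

section \<open>Minimal types\<close>

context stable_action
begin

text \<open>\<open>same_type [z] (es @ [x])\<close> says that \<open>z\<close> and \<open>x\<close> have the same type over \<open>es\<close>.  In this form it is a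
  relation between tuples, to which the bound on trees applies.\<close>

definition same_type :: "'a list \<Rightarrow> 'a list \<Rightarrow> bool" where
  "same_type xs ys \<longleftrightarrow> (\<exists>g\<in>G. map g (butlast ys @ xs) = ys)"

lemma orb_iff: "x \<in> orb A z \<longleftrightarrow> (\<exists>g\<in>stab A. g z = x)"
  by (auto simp: orb_def)

lemma same_type_iff: "same_type [z] (es @ [x]) \<longleftrightarrow> x \<in> orb (set es) z"
  unfolding same_type_def orb_iff conj_over_iff by simp

lemma same_type_stab:
  assumes "ys \<in> tups \<Omega> (Suc n)" "g \<in> stab (set (butlast ys))"
  shows "same_type [g z] ys \<longleftrightarrow> same_type [z] ys"
proof -
  obtain es x where ys: "ys = es @ [x]" using assms(1) by (cases ys rule: rev_cases) (auto simp: tups_def)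
  have g: "g \<in> stab (set es)" using assms(2) ys by simp
  then show ?thesis unfolding ys same_type_iff by (simp add: orb_eq)
qed

text \<open>Halving a set repeatedly, and keeping an infinite half of smaller 2-rank, stops after boundedly many
  steps; each step costs \<open>k\<close> parameters.\<close>

lemma unsplittable_set:
  assumes "infinite D" "D \<subseteq> \<Omega>" "\<And>g. g \<in> stab (set b) \<Longrightarrow> g ` D \<subseteq> D" "set b \<subseteq> \<Omega>" "b \<noteq> []"
    and "\<not> splitting_tree same_type (tups \<Omega> (Suc k)) N ((\<lambda>z. [z]) ` D)"
  shows "\<exists>b' D'. infinite D' \<and> D' \<subseteq> \<Omega> \<and> (\<forall>g\<in>stab (set b'). g ` D' \<subseteq> D') \<and> set b' \<subseteq> \<Omega> \<and> b' \<noteq> [] \<and>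
     length b' \<le> length b + k * N \<and>
     (\<forall>ys\<in>tups \<Omega> (Suc k). finite {z\<in>D'. same_type [z] ys} \<or> finite {z\<in>D'. \<not> same_type [z] ys})"
  using assms
proof (induction N arbitrary: D b)
  case 0
  then show ?case by auto
next
  case (Suc N)
  show ?case
  proof (cases "\<forall>ys\<in>tups \<Omega> (Suc k). finite {z\<in>D. same_type [z] ys} \<or> finite {z\<in>D. \<not> same_type [z] ys}")
    case True
    then show ?thesis using Suc.prems by (intro exI[of _ b] exI[of _ D]) auto
  next
    case False
    then obtain ys where ys: "ys \<in> tups \<Omega> (Suc k)" "infinite {z\<in>D. same_type [z] ys}" "infinite {z\<in>D. \<not> same_type [z] ys}"
      by blast
    let ?b = "b @ butlast ys"
    have len: "length ?b = length b + k" using ys(1) by (auto simp: tups_def)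
    have sub: "set ?b \<subseteq> \<Omega>" using ys(1) Suc.prems(4) by (auto simp: tups_def dest: in_set_butlastD)
    have st: "g \<in> stab (set b)" "g \<in> stab (set (butlast ys))" if "g \<in> stab (set ?b)" for g
      using that stab_mono[of "set b" "set ?b"] stab_mono[of "set (butlast ys)" "set ?b"] by auto
    have "{v \<in> (\<lambda>z. [z]) ` D. same_type v ys} = (\<lambda>z. [z]) ` {z\<in>D. same_type [z] ys}"
      "{v \<in> (\<lambda>z. [z]) ` D. \<not> same_type v ys} = (\<lambda>z. [z]) ` {z\<in>D. \<not> same_type [z] ys}" by auto
    then consider "\<not> splitting_tree same_type (tups \<Omega> (Suc k)) N ((\<lambda>z. [z]) ` {z\<in>D. same_type [z] ys})"
      | "\<not> splitting_tree same_type (tups \<Omega> (Suc k)) N ((\<lambda>z. [z]) ` {z\<in>D. \<not> same_type [z] ys})"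
      using Suc.prems(6) ys(1) by auto
    then have "\<exists>b' D'. infinite D' \<and> D' \<subseteq> \<Omega> \<and> (\<forall>g\<in>stab (set b'). g ` D' \<subseteq> D') \<and> set b' \<subseteq> \<Omega> \<and> b' \<noteq> [] \<and>
     length b' \<le> length ?b + k * N \<and>
     (\<forall>ys\<in>tups \<Omega> (Suc k). finite {z\<in>D'. same_type [z] ys} \<or> finite {z\<in>D'. \<not> same_type [z] ys})"
    proof cases
      case 1
      show ?thesis
        by (rule Suc.IH[OF ys(2) _ _ sub _ 1])
          (use Suc.prems same_type_stab[OF ys(1)] st in \<open>fastforce+\<close>)
    next
      case 2
      show ?thesis
        by (rule Suc.IH[OF ys(3) _ _ sub _ 2])
          (use Suc.prems same_type_stab[OF ys(1)] st in \<open>fastforce+\<close>)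
    qed
    then show ?thesis unfolding len by (simp add: ac_simps)
  qed
qed

text \<open>Minimality of the orbit of \<open>d\<close> over \<open>b\<close>: over each finite \<open>A \<supseteq> b\<close> it has a single nonalgebraic type.\<close>

definition minimal_over :: "'a list \<Rightarrow> 'a \<Rightarrow> bool" where
  "minimal_over b d \<longleftrightarrow> set b \<subseteq> \<Omega> \<and> b \<noteq> [] \<and> d \<in> \<Omega> \<and> d \<notin> cl (set b) \<and>
     (\<forall>A x y. finite A \<longrightarrow> set b \<subseteq> A \<longrightarrow> A \<subseteq> \<Omega> \<longrightarrow> x \<in> orb (set b) d - cl A \<longrightarrow> y \<in> orb (set b) d - cl A
        \<longrightarrow> (\<exists>g\<in>stab A. g x = y))"

text \<open>In a set that cannot be split further, a nonalgebraic element has over each \<open>k\<close>-tuple the type which almost all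
  elements of the set have.  Any two of them therefore have the same type, by \<open>determined\<close>.\<close>

lemma exists_minimal:
  assumes inf: "infinite \<Omega>" and tree: "\<not> splitting_tree same_type (tups \<Omega> (Suc k)) N (tups \<Omega> 1)"
  shows "\<exists>b d. minimal_over b d \<and> length b \<le> Suc (k * N)"
proof -
  obtain w where w: "w \<in> \<Omega>" using inf by fastforce
  have "tups \<Omega> 1 = (\<lambda>z. [z]) ` \<Omega>" by (auto simp: tups_def length_Suc_conv)
  then have "\<exists>b' D'. infinite D' \<and> D' \<subseteq> \<Omega> \<and> (\<forall>g\<in>stab (set b'). g ` D' \<subseteq> D') \<and> set b' \<subseteq> \<Omega> \<and> b' \<noteq> [] \<and>
     length b' \<le> length [w] + k * N \<and>
     (\<forall>ys\<in>tups \<Omega> (Suc k). finite {z\<in>D'. same_type [z] ys} \<or> finite {z\<in>D'. \<not> same_type [z] ys})"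
    using assms w G_image by (intro unsplittable_set) (auto simp: stab_def)
  then obtain b D where D0: "infinite D" "D \<subseteq> \<Omega>" "\<forall>g\<in>stab (set b). g ` D \<subseteq> D" "set b \<subseteq> \<Omega>" "b \<noteq> []"
    "length b \<le> length [w] + k * N"
    "\<forall>ys\<in>tups \<Omega> (Suc k). finite {z\<in>D. same_type [z] ys} \<or> finite {z\<in>D. \<not> same_type [z] ys}"
    by (elim exE conjE) blast
  note D = D0(1,2) bspec[OF D0(3)] D0(4,5) D0(6)[simplified] bspec[OF D0(7)]
  have "finite (cl (set b))" using D(4) by (intro finite_cl) auto
  then obtain d where d: "d \<in> D" "d \<notin> cl (set b)" using D(1) by (meson finite_subset subsetI)
  have "\<exists>g\<in>stab A. g x = y"
    if A: "finite A" "set b \<subseteq> A" "A \<subseteq> \<Omega>" and x: "x \<in> orb (set b) d - cl A" and y: "y \<in> orb (set b) d - cl A" for A x y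
  proof -
    have cofin: "finite {z\<in>D. \<not> same_type [z] (es @ [u])}"
      if "es \<in> tups A k" "u \<in> orb (set b) d - cl A" for es u
    proof -
      have uD: "u \<in> D" using that(2) D(3) d(1) by (auto simp: orb_def)
      have es: "set es \<subseteq> A" "length es = k" using that(1) by (auto simp: tups_def)
      have u: "u \<in> \<Omega>" using uD D(2) by auto
      have "orb A u \<subseteq> {z\<in>D. same_type [z] (es @ [u])}"
      proof
        fix z assume "z \<in> orb A u"
        then obtain g where g: "g \<in> stab A" "z = g u" by (auto simp: orb_def)
        have "z \<in> D" using g uD D(3) stab_mono[OF A(2)] by blast
        moreover have "inv g \<in> stab (set es)" using stab_inv[OF g(1)] stab_mono[OF es(1)] by blast
        then have "same_type [z] (es @ [u])" unfolding same_type_iff g(2) orb_iff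
          using g(1) stabD(1) by (intro bexI[of _ "inv g"]) auto
        ultimately show "z \<in> {z\<in>D. same_type [z] (es @ [u])}" by blast
      qed
      moreover have "infinite (orb A u)" using that(2) u by (auto simp: cl_def)
      ultimately have "infinite {z\<in>D. same_type [z] (es @ [u])}" using finite_subset by metis
      moreover have "es @ [u] \<in> tups \<Omega> (Suc k)" using es A(3) u by (auto simp: tups_def)
      ultimately show ?thesis using D(7) by blast
    qed
    have xy: "x \<in> \<Omega>" "y \<in> \<Omega>" using x y D(2,3) d(1) by (auto simp: orb_def)
    have "\<exists>g\<in>G. (\<forall>a\<in>A. g a = a) \<and> g x = y"
    proof (rule determined[OF A(1) _ A(3) xy])
      show "A \<noteq> {}" using A(2) D(5) by auto
      fix es assume es: "es \<in> tups A k"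
      have "finite ({z\<in>D. \<not> same_type [z] (es @ [x])} \<union> {z\<in>D. \<not> same_type [z] (es @ [y])})"
        using cofin[OF es x] cofin[OF es y] by blast
      then have "\<not> D \<subseteq> {z\<in>D. \<not> same_type [z] (es @ [x])} \<union> {z\<in>D. \<not> same_type [z] (es @ [y])}"
        using D(1) finite_subset[of D] by auto
      then obtain z where "same_type [z] (es @ [x])" "same_type [z] (es @ [y])" by blast
      then have "x \<in> orb (set es) z" "y \<in> orb (set es) z" unfolding same_type_iff by auto
      then have "y \<in> orb (set es) x" using orb_eq unfolding orb_iff by (metis orb_iff)
      then show "\<exists>g\<in>G. map g (es @ [x]) = es @ [y]" unfolding conj_over_iff[symmetric] orb_iff .
    qed
    then show ?thesis by (auto simp: stab_def)
  qed
  then have "minimal_over b d" unfolding minimal_over_def using D(2,4,5) d by (intro conjI allI impI) auto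
  then show ?thesis using D(6) by blast
qed

end

locale minimal_type = stable_action +
  fixes b0 :: "'a list" and d0 :: 'a
  assumes min0: "minimal_over b0 d0"
begin

text \<open>\<open>Par\<close> consists of the conjugates of the parameter tuple, and \<open>X b\<close> of the realizations of the conjugate minimal type
  over \<open>b\<close>.  All conjugates have to be treated together, since the interaction between different
  conjugates is what matters later.\<close>

definition Pts :: "('a list \<times> 'a) set" where
  "Pts = (\<lambda>g. (map g b0, g d0)) ` G"

definition X :: "'a list \<Rightarrow> 'a set" where
  "X b = {x. (b, x) \<in> Pts}"

definition Par :: "'a list set" where
  "Par = (\<lambda>g. map g b0) ` G"

lemma b0_simps: "set b0 \<subseteq> \<Omega>" "b0 \<noteq> []" "d0 \<in> \<Omega>" "d0 \<notin> cl (set b0)"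
  using min0 unfolding minimal_over_def by - (elim conjE, assumption)+

lemma min0_conj: "\<lbrakk>finite A; set b0 \<subseteq> A; A \<subseteq> \<Omega>; x \<in> orb (set b0) d0; x \<notin> cl A; y \<in> orb (set b0) d0; y \<notin> cl A\<rbrakk>
    \<Longrightarrow> \<exists>g\<in>stab A. g x = y"
  using min0 unfolding minimal_over_def by (elim conjE) blast

lemma Pts_iff: "(b, x) \<in> Pts \<longleftrightarrow> x \<in> X b"
  by (simp add: X_def)

lemma Par_subset: "b \<in> Par \<Longrightarrow> set b \<subseteq> \<Omega>"
  using b0_simps by (fastforce simp: Par_def)

lemma Par_nonempty: "b \<in> Par \<Longrightarrow> b \<noteq> []"
  using b0_simps by (fastforce simp: Par_def)

lemma Par_length: "b \<in> Par \<Longrightarrow> length b = length b0"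
  by (auto simp: Par_def)

lemma X_Par: "x \<in> X b \<Longrightarrow> b \<in> Par"
  by (auto simp: X_def Pts_def Par_def)

lemma X_subset: "X b \<subseteq> \<Omega>"
  using b0_simps by (auto simp: X_def Pts_def)

lemma X_in: "x \<in> X b \<Longrightarrow> x \<in> \<Omega>"
  using X_subset by blast

lemma Par_map: assumes "g \<in> G" shows "map g b \<in> Par \<longleftrightarrow> b \<in> Par"
proof -
  have *: "map g b \<in> Par" if a: "b \<in> Par" "g \<in> G" for g b
  proof -
    obtain h where "h \<in> G" "b = map h b0" using a by (auto simp: Par_def)
    then show ?thesis unfolding Par_def using a G_comp by (intro image_eqI[of _ _ "g \<circ> h"]) auto
  qed
  have "map (inv g) (map g b) = b" using assms by (auto intro!: map_idI)
  then show ?thesis using *[of b g] *[of "map g b" "inv g"] assms G_inv by metis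
qed

lemma X_map: assumes "g \<in> G" shows "g x \<in> X (map g b) \<longleftrightarrow> x \<in> X b"
proof -
  have *: "g x \<in> X (map g b)" if a: "x \<in> X b" "g \<in> G" for g b x
  proof -
    obtain h where "h \<in> G" "b = map h b0" "x = h d0" using a by (auto simp: X_def Pts_def)
    then show ?thesis unfolding X_def Pts_def using a G_comp by (auto intro!: image_eqI[of _ _ "g \<circ> h"])
  qed
  have "map (inv g) (map g b) = b" "inv g (g x) = x" using assms by (auto intro!: map_idI)
  then show ?thesis using *[of x b g] *[of "g x" "map g b" "inv g"] assms G_inv by metis
qed

lemma X_stab: "g \<in> stab A \<Longrightarrow> set b \<subseteq> A \<Longrightarrow> g x \<in> X b \<longleftrightarrow> x \<in> X b"
  using X_map[of g x b] stab_map[of g A b] stabD(1)[of g A] by simp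

lemma X_conj: assumes "x \<in> X b" "y \<in> X c" shows "\<exists>g\<in>G. map g b = c \<and> g x = y"
proof -
  obtain g h where gh: "g \<in> G" "b = map g b0" "x = g d0" "h \<in> G" "c = map h b0" "y = h d0"
    using assms by (auto simp: X_def Pts_def)
  then have "map (h \<circ> inv g) b = c" "(h \<circ> inv g) x = y" by auto
  then show ?thesis using gh G_comp G_inv by blast
qed

lemma X_orb: "b \<in> Par \<Longrightarrow> \<exists>x. x \<in> X b"
  by (auto simp: X_def Par_def Pts_def)

lemma X_eq_orb: assumes "x \<in> X b" shows "X b = orb (set b) x"
proof
  show "X b \<subseteq> orb (set b) x"
  proof
    fix y assume "y \<in> X b"
    then obtain g where g: "g \<in> G" "map g b = b" "g x = y" using X_conj[OF assms] by blast
    then have "g \<in> stab (set b)" by (intro stabI) (auto, metis in_set_conv_nth nth_map)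
    then show "y \<in> orb (set b) x" using g by (auto simp: orb_def)
  qed
  show "orb (set b) x \<subseteq> X b" using X_stab assms by (auto simp: orb_def)
qed

lemma X_nonalg: "x \<in> X b \<Longrightarrow> x \<notin> cl (set b)"
proof -
  assume "x \<in> X b"
  then obtain g where g: "g \<in> G" "b = map g b0" "x = g d0" by (auto simp: X_def Pts_def)
  then show ?thesis using b0_simps cl_image_mem[OF g(1), of d0 "set b0"] by auto
qed

lemma X_infinite: "b \<in> Par \<Longrightarrow> infinite (X b)"
  using X_orb X_nonalg X_eq_orb X_in by (metis (mono_tags, lifting) cl_def mem_Collect_eq)

lemma minimality:
  assumes "finite A" "A \<subseteq> \<Omega>" "set b \<subseteq> A" "x \<in> X b" "x \<notin> cl A" "y \<in> X b" "y \<notin> cl A"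
  shows "\<exists>g\<in>stab A. g x = y"
proof -
  obtain g where g: "g \<in> G" "b = map g b0" using X_Par[OF assms(4)] by (auto simp: Par_def)
  let ?h = "inv g"
  have h: "?h \<in> G" using g G_inv by blast
  have b0: "map ?h b = b0" using g by (auto intro!: map_idI)
  have X0: "X b0 = orb (set b0) d0"
    by (rule X_eq_orb) (use G_id in \<open>auto simp: X_def Pts_def intro!: image_eqI[of _ _ id]\<close>)
  have "?h x \<in> X b0" "?h y \<in> X b0" using X_map[OF h, of x b] X_map[OF h, of y b] b0 assms by auto
  moreover have "?h x \<notin> cl (?h ` A)" "?h y \<notin> cl (?h ` A)" using assms cl_image_mem[OF h] by auto
  moreover have "set b0 \<subseteq> ?h ` A" using b0 assms(3) by (metis image_mono set_map)
  ultimately have "\<exists>f\<in>stab (?h ` A). f (?h x) = ?h y"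
    using assms(1,2) h unfolding X0 by (intro min0_conj) auto
  then obtain f where f: "f \<in> stab (?h ` A)" "f (?h x) = ?h y" by blast
  have "inv ?h \<circ> f \<circ> ?h \<in> stab A" using f stab_conj[OF h] by blast
  moreover have "(inv ?h \<circ> f \<circ> ?h) x = y" using f(2) h by simp
  ultimately show ?thesis by blast
qed

lemma exists_generic: assumes "b \<in> Par" "finite A" "A \<subseteq> \<Omega>" shows "\<exists>x. x \<in> X b \<and> x \<notin> cl A"
  using X_infinite[OF assms(1)] finite_cl[OF assms(2,3)] by (meson finite_subset subsetI)

lemma move_generic:
  assumes "finite A" "A \<subseteq> \<Omega>" "set b \<subseteq> A" "x \<in> X b" "x \<notin> cl A" "finite U" "U \<subseteq> \<Omega>"
  shows "\<exists>g\<in>stab A. g x \<in> X b \<and> g x \<notin> cl U"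
proof -
  obtain y where y: "y \<in> X b" "y \<notin> cl (A \<union> U)"
    using exists_generic[OF X_Par[OF assms(4)], of "A \<union> U"] assms by auto
  then have "y \<notin> cl A" "y \<notin> cl U" using cl_mono'[of y A "A \<union> U"] cl_mono'[of y U "A \<union> U"] by auto
  then show ?thesis using minimality[OF assms(1-5), of y] y by auto
qed

text \<open>If \<open>x\<close> were nonalgebraic over \<open>b\<close> and every \<open>k\<close>-tuple, it would have over each of them the type of a generic element,
  and thus would be generic itself by \<open>determined\<close>.\<close>

lemma locality:
  assumes "finite A" "A \<subseteq> \<Omega>" "x \<in> X b" "x \<in> cl (set b \<union> A)"
  shows "\<exists>es\<in>tups (set b \<union> A) k. x \<in> cl (set b \<union> set es)"
proof (rule ccontr)
  assume neg: "\<not> ?thesis"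
  let ?A = "set b \<union> A"
  have b: "b \<in> Par" using assms X_Par by blast
  have A: "finite ?A" "?A \<subseteq> \<Omega>" using assms Par_subset[OF b] by auto
  obtain y where y: "y \<in> X b" "y \<notin> cl ?A" using exists_generic[OF b A] by blast
  have "\<exists>g\<in>G. (\<forall>a\<in>?A. g a = a) \<and> g x = y"
  proof (rule determined[OF A(1) _ A(2)])
    show "?A \<noteq> {}" using Par_nonempty[OF b] by auto
    show "x \<in> \<Omega>" "y \<in> \<Omega>" using X_in assms y by auto
    fix es assume es: "es \<in> tups ?A k"
    let ?E = "set b \<union> set es"
    have E: "finite ?E" "?E \<subseteq> ?A" using es by (auto simp: tups_def)
    have "x \<notin> cl ?E" using neg es by blast
    moreover have "y \<notin> cl ?E" using y(2) cl_mono'[OF _ E(2)] by blast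
    ultimately obtain g where g: "g \<in> stab ?E" "g x = y"
      using minimality[of ?E b x y] E A assms(3) y(1) by auto
    then have "g \<in> stab (set es)" using stab_mono[of "set es" ?E] by blast
    then show "\<exists>g\<in>G. map g (es @ [x]) = es @ [y]" unfolding conj_over_iff[symmetric] using g by blast
  qed
  then obtain g where "g \<in> stab ?A" "g x = y" by (auto simp: stab_def)
  then have "y \<in> cl ?A" using stab_cl_mem[of g ?A ?A x] assms(4) by auto
  then show False using y by blast
qed

text \<open>If \<open>x\<close> were generic over \<open>A\<close> and \<open>y\<close>, the infinitely many conjugates of \<open>y\<close> over \<open>A\<close> would be algebraic over \<open>A\<close> and one
  generic element, contradicting that closures are finite.\<close>

lemma exchange:
  assumes A: "finite A" "A \<subseteq> \<Omega>" "set b \<subseteq> A" "set c \<subseteq> A" and x: "x \<in> X b" and y: "y \<in> X c"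
    and yx: "y \<in> cl (insert x A)" "y \<notin> cl A"
  shows "x \<in> cl (insert y A)"
proof (rule ccontr)
  assume nx: "x \<notin> cl (insert y A)"
  have xA: "x \<notin> cl A" using nx cl_mono'[of x A "insert y A"] by blast
  have \<Omega>: "x \<in> \<Omega>" "y \<in> \<Omega>" using x y X_in by auto
  text \<open>Every generic element over \<open>A\<close> and \<open>y\<close> has \<open>y\<close> in its closure, and the same holds for each conjugate of \<open>y\<close>.\<close>
  have all: "z \<in> cl (insert x' A)" if z: "z \<in> orb A y" and x': "x' \<in> X b" "x' \<notin> cl (insert z A)" for z x'
  proof -
    obtain g where g: "g \<in> stab A" "z = g y" using z by (auto simp: orb_def)
    have gG: "g \<in> G" and gA: "g ` A = A" using g stabD(1) stab_image by auto
    have "g x \<in> X b" using X_stab[OF g(1) A(3)] x by blast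
    moreover have "g x \<notin> cl (insert z A)" using cl_image_mem[OF gG, of x "insert y A"] nx gA g by simp
    ultimately obtain h where h: "h \<in> stab (insert z A)" "h (g x) = x'"
      using minimality[of "insert z A" b "g x" x'] x' A \<Omega> gG g by auto
    have "z \<in> cl (insert (g x) A)" using cl_image_mem[OF gG, of y "insert x A"] yx gA g by simp
    then have "h z \<in> cl (h ` insert (g x) A)" using cl_image_mem stabD(1)[OF h(1)] by blast
    moreover have "h z = z" "h ` A = A" using stabD(2)[OF h(1)] stab_image[OF h(1)] by auto
    ultimately show ?thesis using h(2) by simp
  qed
  have inf: "infinite (orb A y)" using yx(2) \<Omega> by (auto simp: cl_def)
  let ?N = "card (cl (insert x A))"
  obtain Z where Z: "Z \<subseteq> orb A y" "finite Z" "card Z = Suc ?N" using infinite_arbitrarily_large[OF inf] by blast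
  have orb\<Omega>: "orb A y \<subseteq> \<Omega>" using \<Omega> stabD(1) by (auto simp: orb_def)
  obtain x' where x': "x' \<in> X b" "x' \<notin> cl (Z \<union> A)"
    using exists_generic[OF X_Par[OF x], of "Z \<union> A"] Z A orb\<Omega> by (meson finite_UnI le_sup_iff subset_trans)
  have "Z \<subseteq> cl (insert x' A)"
  proof
    fix z assume z: "z \<in> Z"
    then have "x' \<notin> cl (insert z A)" using x' cl_mono'[of x' "insert z A" "Z \<union> A"] by auto
    then show "z \<in> cl (insert x' A)" using all z Z x' by blast
  qed
  moreover have fin: "finite (cl (insert x' A))" using A X_in x' by (intro finite_cl) auto
  ultimately have "Suc ?N \<le> card (cl (insert x' A))" using card_mono Z by metis
  moreover have "card (cl (insert x' A)) = ?N"
  proof -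
    have "x' \<notin> cl A" using x' cl_mono'[of x' A "Z \<union> A"] by auto
    then obtain g where g: "g \<in> stab A" "g x = x'" using minimality[of A b x x'] A x xA x' by auto
    then have gG: "g \<in> G" and "g ` insert x A = insert x' A" using stabD(1) stab_image[of g A A] by auto
    then have "cl (insert x' A) = g ` cl (insert x A)" using cl_image[OF gG] by metis
    then show ?thesis using G_inj[OF gG] by (metis card_image inj_on_subset subset_UNIV)
  qed
  ultimately show False by simp
qed

end

section \<open>Triviality of minimal types\<close>

context stable_action
begin

lemma cl_stab_image: "g \<in> stab A \<Longrightarrow> g y \<in> cl (A \<union> g ` S) \<longleftrightarrow> y \<in> cl (A \<union> S)"
  using cl_image_mem[of g y "A \<union> S"] stab_image[of g A A] stabD(1)[of g A] by (simp add: image_Un)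

lemma stab_mem: "g \<in> stab A \<Longrightarrow> g x \<in> \<Omega> \<longleftrightarrow> x \<in> \<Omega>"
  using stabD(1) by simp

lemma cl_stab_insert: "g \<in> stab A \<Longrightarrow> g y \<in> cl (insert (g x) A) \<longleftrightarrow> y \<in> cl (insert x A)"
  using cl_stab_image[of g A y "{x}"] by simp

end

context minimal_type
begin

text \<open>The elements on which closure over \<open>A\<close> satisfies the exchange law.  They may belong to different conjugates of the
  minimal type.\<close>

definition pt :: "'a set \<Rightarrow> 'a set" where
  "pt A = {x. \<exists>b. set b \<subseteq> A \<and> x \<in> X b}"

lemma pt_subset: "pt A \<subseteq> \<Omega>"
  using X_in by (auto simp: pt_def)

lemma pt_mono: "A \<subseteq> B \<Longrightarrow> pt A \<subseteq> pt B"
  by (auto simp: pt_def)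

lemma ptI: "x \<in> X b \<Longrightarrow> set b \<subseteq> A \<Longrightarrow> x \<in> pt A"
  by (auto simp: pt_def)

lemma pt_stab: "g \<in> stab A \<Longrightarrow> g x \<in> pt A \<longleftrightarrow> x \<in> pt A"
  unfolding pt_def using X_stab by blast

lemma pt_exchange:
  "\<lbrakk>finite A; A \<subseteq> \<Omega>; x \<in> pt A; y \<in> pt A; y \<in> cl (insert x A); y \<notin> cl A\<rbrakk> \<Longrightarrow> x \<in> cl (insert y A)"
  unfolding pt_def using exchange by blast

lemma independent_add:
  assumes "finite D" "D \<subseteq> \<Omega>" "u \<in> pt D" "u \<notin> cl D" "finite Z" "Z \<subseteq> pt D"
    and "\<And>z. z \<in> Z \<Longrightarrow> z \<notin> cl (insert u D \<union> (Z - {z}))"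
  shows "u \<notin> cl (D \<union> Z)"
  using assms(5,6,7)
proof (induction Z rule: finite_induct)
  case empty
  then show ?case using assms by simp
next
  case (insert z Z)
  have sub: "insert u D \<union> (Z - {w}) \<subseteq> insert u D \<union> (insert z Z - {w})" for w by auto
  have "u \<notin> cl (D \<union> Z)"
    using insert.prems cl_mono'[OF _ sub] by (intro insert.IH) auto
  show ?case
  proof
    assume "u \<in> cl (D \<union> insert z Z)"
    then have "u \<in> cl (insert z (D \<union> Z))" by simp
    then have "z \<in> cl (insert u (D \<union> Z))"
      using insert.prems insert.hyps assms(1-3) \<open>u \<notin> cl (D \<union> Z)\<close> pt_mono[of D "D \<union> Z"] pt_subset[of D]
      by - (rule pt_exchange; auto)
    then show False using insert.prems(2)[of z] insert.hyps by simp
  qed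
qed

text \<open>An independent set \<open>R\<close> can be moved away from any finite set while the action on \<open>Y\<close> is prescribed.  Its elements are moved
  one after the other; each is generic over the images of the earlier ones.\<close>

lemma fresh_set:
  assumes A: "finite A" "A \<subseteq> \<Omega>" and g: "g \<in> stab A" and Y: "finite Y" "Y \<subseteq> \<Omega>"
    and R: "finite R" "R \<subseteq> pt A" and ind: "\<And>r. r \<in> R \<Longrightarrow> r \<notin> cl (A \<union> Y \<union> (R - {r}))"
    and U: "finite U" "U \<subseteq> \<Omega>" "A \<subseteq> U"
  shows "\<exists>h\<in>stab A. (\<forall>y\<in>Y. h y = g y) \<and> (\<forall>r\<in>R. h r \<notin> cl (U \<union> h ` (R - {r})))"
  using R ind
proof (induction R rule: finite_induct)
  case empty
  then show ?case using g by blast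
next
  case (insert r R)
  have sub: "A \<union> Y \<union> (R - {w}) \<subseteq> A \<union> Y \<union> (insert r R - {w})" for w by auto
  have "\<exists>h\<in>stab A. (\<forall>y\<in>Y. h y = g y) \<and> (\<forall>r\<in>R. h r \<notin> cl (U \<union> h ` (R - {r})))"
    using insert.prems cl_mono'[OF _ sub] by (intro insert.IH) auto
  then obtain h where h: "h \<in> stab A" "\<And>y. y \<in> Y \<Longrightarrow> h y = g y" "\<And>r. r \<in> R \<Longrightarrow> h r \<notin> cl (U \<union> h ` (R - {r}))"
    by blast
  have hG: "h \<in> G" using h stabD by blast
  have R\<Omega>: "R \<subseteq> \<Omega>" "r \<in> \<Omega>" using insert.prems pt_subset by auto
  have h\<Omega>: "h ` R \<subseteq> \<Omega>" "h ` Y \<subseteq> \<Omega>" using R\<Omega> Y hG by auto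
  obtain b where b: "set b \<subseteq> A" "r \<in> X b" using insert.prems by (auto simp: pt_def)
  let ?B = "A \<union> h ` (Y \<union> R)"
  have "r \<notin> cl (A \<union> (Y \<union> R))" using insert.prems(2)[of r] insert.hyps by (simp add: Un_assoc)
  then have "h r \<notin> cl ?B" using cl_stab_image[OF h(1), of r "Y \<union> R"] by simp
  moreover have "h r \<in> X b" using X_stab[OF h(1) b(1)] b(2) by simp
  moreover have "finite ?B" "?B \<subseteq> \<Omega>" "set b \<subseteq> ?B" "finite (U \<union> h ` R)" "U \<union> h ` R \<subseteq> \<Omega>"
    using A Y U insert.hyps h\<Omega> b by auto
  ultimately obtain f where f: "f \<in> stab ?B" "f (h r) \<notin> cl (U \<union> h ` R)"
    using move_generic[of ?B b "h r" "U \<union> h ` R"] by blast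
  have fG: "f \<in> G" using f stabD by blast
  let ?h = "f \<circ> h"
  have "f \<in> stab A" using f stab_mono[of A ?B] by auto
  then have hs: "?h \<in> stab A" using stab_comp h by blast
  have fix_R: "?h w = h w" if "w \<in> R \<union> Y" for w using that stabD(2)[OF f(1)] by auto
  have img: "?h ` S = h ` S" if "S \<subseteq> R" for S using fix_R that by (intro image_cong) auto
  have "?h w \<notin> cl (U \<union> ?h ` (insert r R - {w}))" if w: "w \<in> insert r R" for w
  proof (cases "w = r")
    case True
    then have "insert r R - {w} = R" using insert.hyps by auto
    then show ?thesis using f(2) img[of R] True by simp
  next
    case False
    then have wR: "w \<in> R" using w by auto
    then have "insert r R - {w} = insert r (R - {w})" using False by auto
    then have eq: "U \<union> ?h ` (insert r R - {w}) = insert (?h r) (U \<union> h ` (R - {w}))" using img[of "R - {w}"] by auto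
    show ?thesis
    proof
      assume "?h w \<in> cl (U \<union> ?h ` (insert r R - {w}))"
      then have "h w \<in> cl (insert (?h r) (U \<union> h ` (R - {w})))" using fix_R[of w] wR eq by simp
      moreover have "h w \<notin> cl (U \<union> h ` (R - {w}))" using h(3) wR by blast
      moreover have "pt A \<subseteq> pt (U \<union> h ` (R - {w}))" using U by (intro pt_mono) auto
      then have "h w \<in> pt (U \<union> h ` (R - {w}))" "?h r \<in> pt (U \<union> h ` (R - {w}))"
        using pt_stab[OF h(1)] pt_stab[OF hs] insert.prems(1) wR by auto
      ultimately have "?h r \<in> cl (insert (h w) (U \<union> h ` (R - {w})))"
        using U insert.hyps h\<Omega> by - (rule pt_exchange; auto)
      moreover have "insert (h w) (U \<union> h ` (R - {w})) = U \<union> h ` R" using wR by auto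
      ultimately show False using f(2) by simp
    qed
  qed
  moreover have "?h y = g y" if "y \<in> Y" for y using fix_R[of y] h(2)[OF that] that by simp
  ultimately show ?case using hs by blast
qed

definition min_support :: "'a set \<Rightarrow> 'a set \<Rightarrow> 'a \<Rightarrow> bool" where
  "min_support A S z \<longleftrightarrow> finite S \<and> z \<notin> S \<and> z \<in> cl (A \<union> S) \<and> (\<forall>s\<in>S. z \<notin> cl (A \<union> (S - {s})))"

lemma min_support_not_in:
  assumes m: "min_support A S z" and s: "s \<in> S"
  shows "s \<notin> cl (A \<union> (S - {s}))"
proof
  assume "s \<in> cl (A \<union> (S - {s}))"
  moreover have "insert s (A \<union> (S - {s})) = A \<union> S" using s by auto
  ultimately have "z \<in> cl (A \<union> (S - {s}))" using cl_trans1 m by (metis min_support_def)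
  then show False using m s by (auto simp: min_support_def)
qed

lemma min_support_swap:
  assumes A: "finite A" "A \<subseteq> \<Omega>" and m: "min_support A S z" and pts: "insert z S \<subseteq> pt A" and s: "s \<in> S"
  shows "min_support A (insert z (S - {s})) s"
proof -
  have fin: "finite S" and z: "z \<notin> S" using m by (auto simp: min_support_def)
  have pts': "insert z S \<subseteq> pt (A \<union> T)" for T using pts pt_mono[of A "A \<union> T"] by auto
  have sub\<Omega>: "S \<subseteq> \<Omega>" using pts pt_subset by blast
  have "A \<union> S = insert s (A \<union> (S - {s}))" using s by auto
  then have "s \<in> cl (insert z (A \<union> (S - {s})))"
    using m s A fin sub\<Omega> pts'[of "S - {s}"] by - (rule pt_exchange; auto simp: min_support_def)
  moreover have "s \<notin> cl (A \<union> (insert z (S - {s}) - {t}))" if t: "t \<in> insert z (S - {s})" for t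
  proof (cases "t = z")
    case True
    then have "insert z (S - {s}) - {t} = S - {s}" using z by auto
    then show ?thesis using min_support_not_in[OF m s] by simp
  next
    case False
    then have t: "t \<in> S" "t \<noteq> s" using t by auto
    let ?D = "A \<union> (S - {s} - {t})"
    have eq: "A \<union> (insert z (S - {s}) - {t}) = insert z ?D" using False by auto
    show ?thesis
    proof
      assume "s \<in> cl (A \<union> (insert z (S - {s}) - {t}))"
      then have "s \<in> cl (insert z ?D)" by (simp only: eq)
      moreover have "s \<notin> cl ?D" using min_support_not_in[OF m s] cl_mono'[of s ?D "A \<union> (S - {s})"] by auto
      ultimately have "z \<in> cl (insert s ?D)"
        using A fin sub\<Omega> pts'[of "S - {s} - {t}"] s by - (rule pt_exchange; auto)
      moreover have "insert s ?D = A \<union> (S - {t})" using s t by auto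
      ultimately show False using m t by (auto simp: min_support_def)
    qed
  qed
  ultimately show ?thesis using fin z s by (auto simp: min_support_def)
qed

text \<open>By locality \<open>z\<close> is algebraic over \<open>b\<close> and \<open>k\<close> elements of \<open>A \<union> S\<close>, which include all of \<open>S\<close> by minimality.\<close>

lemma min_support_bound:
  assumes "finite A" "A \<subseteq> \<Omega>" "min_support A S z" "insert z S \<subseteq> pt A"
  shows "card S \<le> k"
proof -
  obtain b where b: "set b \<subseteq> A" "z \<in> X b" using assms by (auto simp: pt_def)
  have S: "finite S" "S \<subseteq> \<Omega>" using assms pt_subset[of A] by (auto simp: min_support_def)
  have "set b \<union> (A \<union> S) = A \<union> S" using b by auto
  then have "\<exists>es\<in>tups (set b \<union> (A \<union> S)) k. z \<in> cl (set b \<union> set es)"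
    using assms S b by (intro locality) (auto simp: min_support_def)
  then obtain es where es: "set es \<subseteq> A \<union> S" "length es = k" "z \<in> cl (set b \<union> set es)"
    using b by (auto simp: tups_def)
  have "S \<subseteq> set es"
  proof
    fix s assume s: "s \<in> S"
    show "s \<in> set es"
    proof (rule ccontr)
      assume "s \<notin> set es"
      then have "set b \<union> set es \<subseteq> A \<union> (S - {s})" using es b by auto
      then have "z \<in> cl (A \<union> (S - {s}))" using es(3) cl_mono' by blast
      then show False using assms(3) s by (auto simp: min_support_def)
    qed
  qed
  then have "card S \<le> card (set es)" by (intro card_mono) auto
  also have "\<dots> \<le> k" using card_length[of es] es by simp
  finally show ?thesis .
qed

text \<open>Substituting a conjugate of a dependence for one of its own arguments produces a longer dependence.  Among three
  elements two realize the same type, and a conjugate can be chosen that maps one of these to the other.\<close>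

lemma min_support_grow:
  assumes A: "finite A" "A \<subseteq> \<Omega>" "set b \<subseteq> A" "set c \<subseteq> A"
    and m: "min_support A S z" and XS: "insert z S \<subseteq> X b \<union> X c" and card: "2 \<le> card S"
  shows "\<exists>S' z'. min_support A S' z' \<and> insert z' S' \<subseteq> X b \<union> X c \<and> card S < card S'"
proof -
  have finS: "finite S" and zS: "z \<notin> S" using m by (auto simp: min_support_def)
  have Xpt: "X b \<union> X c \<subseteq> pt A" using A by (auto simp: pt_def)
  have "\<exists>x x1. x \<in> insert z S \<and> x1 \<in> insert z S \<and> x \<noteq> x1 \<and> ({x, x1} \<subseteq> X b \<or> {x, x1} \<subseteq> X c)"
  proof -
    obtain T where T: "T \<subseteq> S" "card T = 2" using card obtain_subset_with_card_n[of 2 S] by blast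
    then obtain s t where st: "s \<in> S" "t \<in> S" "s \<noteq> t" by (metis card_2_iff' subsetD)
    have "s \<noteq> z" "t \<noteq> z" "s \<in> X b \<union> X c" "t \<in> X b \<union> X c" "z \<in> X b \<union> X c" using st zS XS by auto
    then show ?thesis using st by (cases "s \<in> X b"; cases "t \<in> X b"; cases "z \<in> X b") blast+
  qed
  then obtain x x1 \<beta> where x: "x \<in> insert z S" "x1 \<in> insert z S" "x \<noteq> x1" "x \<in> X \<beta>" "x1 \<in> X \<beta>" "\<beta> = b \<or> \<beta> = c"
    by blast
  define S0 where "S0 = insert z S - {x}"
  have m0: "min_support A S0 x"
  proof (cases "x = z")
    case True
    then show ?thesis using m zS by (simp add: S0_def)
  next
    case False
    then have "S0 = insert z (S - {x})" by (auto simp: S0_def)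
    then show ?thesis using min_support_swap[OF A(1,2) m, of x] XS Xpt False x(1) by auto
  qed
  have ins: "insert x S0 = insert z S" using x by (auto simp: S0_def)
  have pts: "insert x S0 \<subseteq> pt A" using ins XS Xpt by auto
  have finS0: "finite S0" using finS by (simp add: S0_def)
  have cardS0: "card S0 = card S" using x zS finS by (simp add: S0_def)
  have x1: "x1 \<in> S0" using x by (auto simp: S0_def)
  have sub\<Omega>: "insert x S0 \<subseteq> \<Omega>" using pts pt_subset by blast
  define R where "R = S0 - {x1}"
  have S0_eq: "S0 = insert x1 R" using x1 by (auto simp: R_def)
  have x1R: "x1 \<notin> R" by (simp add: R_def)
  have beta: "set \<beta> \<subseteq> A" using x A by auto
  have "x \<notin> cl A"
    using m0 x1 cl_mono'[of x A "A \<union> (S0 - {x1})"] by (auto simp: min_support_def)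
  moreover have "x1 \<notin> cl A"
    using min_support_not_in[OF m0 x1] cl_mono'[of x1 A "A \<union> (S0 - {x1})"] by auto
  ultimately obtain g where g: "g \<in> stab A" "g x1 = x"
    using minimality[OF A(1,2) beta x(5) _ x(4)] by blast
  let ?U = "A \<union> insert x S0"
  have "\<exists>h\<in>stab A. (\<forall>y\<in>{x1}. h y = g y) \<and> (\<forall>r\<in>R. h r \<notin> cl (?U \<union> h ` (R - {r})))"
  proof (rule fresh_set[OF A(1,2) g(1)])
    fix r assume r: "r \<in> R"
    then have "A \<union> {x1} \<union> (R - {r}) = A \<union> (S0 - {r})" using S0_eq x1R by auto
    then show "r \<notin> cl (A \<union> {x1} \<union> (R - {r}))" using min_support_not_in[OF m0, of r] r by (simp add: R_def)
  qed (use A finS0 pts sub\<Omega> x1 in \<open>auto simp: R_def\<close>)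
  then obtain h where h: "h \<in> stab A" "h x1 = x" "\<And>r. r \<in> R \<Longrightarrow> h r \<notin> cl (?U \<union> h ` (R - {r}))"
    using g by auto
  have hG: "h \<in> G" using h stabD by blast
  define Z where "Z = h ` R"
  have hS0: "h ` S0 = insert x Z" using S0_eq h(2) by (auto simp: Z_def)
  have finR: "finite R" using finS0 by (simp add: R_def)
  have R\<Omega>: "R \<subseteq> \<Omega>" using sub\<Omega> by (auto simp: R_def)
  have Z\<Omega>: "Z \<subseteq> \<Omega>" using R\<Omega> hG by (auto simp: Z_def)
  have Zptc: "Z \<subseteq> X b \<union> X c"
  proof -
    have "R \<subseteq> X b \<union> X c" using ins XS by (auto simp: R_def)
    then show ?thesis using X_stab[OF h(1) A(3)] X_stab[OF h(1) A(4)] by (auto simp: Z_def)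
  qed
  have Zpt: "Z \<subseteq> pt A" using Zptc Xpt by blast
  have finZ: "finite Z" using finR by (simp add: Z_def)
  have hdiff: "h ` (R - {r}) = Z - {h r}" for r using G_inj[OF hG] by (auto simp: Z_def inj_eq)
  have Zfresh: "w \<notin> cl (?U \<union> (Z - {w}))" if "w \<in> Z" for w
    using that h(3) hdiff by (auto simp: Z_def)
  have Zdisj: "Z \<inter> insert x S0 = {}"
  proof -
    have "w \<in> cl (?U \<union> (Z - {w}))" if "w \<in> insert x S0" for w
      using that sub\<Omega> by (intro cl_self) auto
    then show ?thesis using Zfresh by blast
  qed
  let ?y = "h x"
  let ?S' = "S0 \<union> Z"
  have xcl: "x \<in> cl (A \<union> S0)" using m0 by (auto simp: min_support_def)
  have y1: "?y \<in> cl (insert x (A \<union> Z))"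
  proof -
    have "?y \<in> cl (A \<union> h ` S0)" using cl_stab_image[OF h(1), of x S0] xcl by simp
    then show ?thesis by (simp add: hS0)
  qed
  have ycl: "?y \<in> cl (A \<union> ?S')"
  proof -
    have "x \<in> cl (A \<union> ?S')" using xcl cl_mono'[of x "A \<union> S0" "A \<union> ?S'"] by auto
    moreover have "?y \<in> cl (insert x (A \<union> ?S'))" using y1 cl_mono'[of ?y "insert x (A \<union> Z)" "insert x (A \<union> ?S')"] by auto
    ultimately show ?thesis using cl_trans1 by blast
  qed
  have y2: "?y \<notin> cl (A \<union> Z)"
    using cl_stab_image[OF h(1), of x R] m0 x1 by (auto simp: min_support_def R_def Z_def)
  have yX: "?y \<in> X \<beta>" using X_stab[OF h(1) beta] x by simp
  have ypt: "?y \<in> pt A" using ptI[OF yX beta] .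
  have removal: "?y \<notin> cl (A \<union> (?S' - {u}))" if u: "u \<in> ?S'" for u
  proof
    assume yu: "?y \<in> cl (A \<union> (?S' - {u}))"
    show False
    proof (cases "u \<in> S0")
      case True
      then have uZ: "u \<notin> Z" using Zdisj by auto
      let ?D = "A \<union> (S0 - {u})"
      have eq: "A \<union> (?S' - {u}) = ?D \<union> Z" using uZ by auto
      have "x \<in> cl (insert ?y (A \<union> Z))"
        using y1 y2 A finR Z\<Omega> ypt pts pt_mono[of A "A \<union> Z"]
        by - (rule pt_exchange; auto simp: Z_def)
      then have "x \<in> cl (insert ?y (?D \<union> Z))" using cl_mono'[of x "insert ?y (A \<union> Z)" "insert ?y (?D \<union> Z)"] by auto
      moreover have "?y \<in> cl (?D \<union> Z)" using yu by (simp only: eq)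
      ultimately have xD: "x \<in> cl (?D \<union> Z)" using cl_trans1 by blast
      have "u \<in> cl (A \<union> insert x (S0 - {u}))"
        using min_support_swap[OF A(1,2) m0 pts True] by (auto simp: min_support_def)
      then have "u \<in> cl (insert x (?D \<union> Z))"
        using cl_mono'[of u "A \<union> insert x (S0 - {u})" "insert x (?D \<union> Z)"] by auto
      then have "u \<in> cl (?D \<union> Z)" using xD cl_trans1 by blast
      moreover have "u \<notin> cl (?D \<union> Z)"
      proof (rule independent_add)
        show "u \<notin> cl ?D" using min_support_not_in[OF m0 True] .
        fix w assume w: "w \<in> Z"
        have "insert u ?D \<union> (Z - {w}) \<subseteq> ?U \<union> (Z - {w})" using True by auto
        then show "w \<notin> cl (insert u ?D \<union> (Z - {w}))" using Zfresh[OF w] cl_mono' by blast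
      qed (use A finS0 sub\<Omega> pts True finZ Zpt pt_mono[of A ?D] in auto)
      ultimately show False by blast
    next
      case False
      then obtain r where r: "r \<in> R" "u = h r" using u by (auto simp: Z_def)
      have rS0: "r \<in> S0" using r by (simp add: R_def)
      have "r \<in> cl (A \<union> insert x (S0 - {r}))"
        using min_support_swap[OF A(1,2) m0 pts rS0] by (auto simp: min_support_def)
      then have "u \<in> cl (A \<union> h ` insert x (S0 - {r}))" using cl_stab_image[OF h(1)] r by blast
      moreover have "h ` (S0 - {r}) = insert x (Z - {u})"
        using S0_eq x1R r h(2) hdiff[of r] by (auto simp: insert_Diff_if)
      ultimately have "u \<in> cl (insert ?y (A \<union> insert x (Z - {u})))" by simp
      then have "u \<in> cl (insert ?y (?U \<union> (Z - {u})))"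
        using cl_mono'[of u "insert ?y (A \<union> insert x (Z - {u}))" "insert ?y (?U \<union> (Z - {u}))"] by auto
      moreover have "?y \<in> cl (?U \<union> (Z - {u}))"
        using yu cl_mono'[of ?y "A \<union> (?S' - {u})" "?U \<union> (Z - {u})"] by auto
      ultimately have "u \<in> cl (?U \<union> (Z - {u}))" using cl_trans1 by blast
      then show False using Zfresh[of u] r by (auto simp: Z_def)
    qed
  qed
  have disj: "S0 \<inter> Z = {}" using Zdisj by auto
  have cardR: "card R = card S - 1" using x1 cardS0 finS0 by (simp add: R_def)
  have "card Z = card R" unfolding Z_def using G_inj[OF hG] by (meson card_image inj_on_subset subset_UNIV)
  then have cardS': "card ?S' = card S + (card S - 1)"
    using disj finS0 finR cardS0 cardR by (simp add: card_Un_disjoint Z_def)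
  have "?y \<notin> ?S'"
  proof
    assume y: "?y \<in> ?S'"
    have "?S' \<noteq> {?y}" using cardS' card by auto
    then obtain u where u: "u \<in> ?S'" "u \<noteq> ?y" using y by blast
    have "?y \<in> cl (A \<union> (?S' - {u}))" using y u sub\<Omega> Z\<Omega> by (intro cl_self) auto
    then show False using removal[OF u(1)] by blast
  qed
  then have "min_support A ?S' ?y" using ycl removal finS0 finR by (auto simp: min_support_def Z_def)
  moreover have "insert ?y ?S' \<subseteq> X b \<union> X c" using yX x(6) Zptc XS by (auto simp: S0_def)
  moreover have "card S < card ?S'" using cardS' card by simp
  ultimately show ?thesis by blast
qed

lemma no_large_min_support:
  assumes A: "finite A" "A \<subseteq> \<Omega>" "set b \<subseteq> A" "set c \<subseteq> A"
    and m: "min_support A S z" and XS: "insert z S \<subseteq> X b \<union> X c"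
  shows "card S < 2"
proof (rule ccontr)
  assume "\<not> card S < 2"
  then have "2 \<le> card S" by simp
  have "\<exists>S' z'. min_support A S' z' \<and> insert z' S' \<subseteq> X b \<union> X c \<and> 2 + n \<le> card S'" for n
  proof (induction n)
    case 0
    then show ?case using m XS \<open>2 \<le> card S\<close> by auto
  next
    case (Suc n)
    then obtain S' z' where S': "min_support A S' z'" "insert z' S' \<subseteq> X b \<union> X c" "2 + n \<le> card S'" by blast
    then show ?case using min_support_grow[OF A S'(1,2)] by fastforce
  qed
  then obtain S' z' where "min_support A S' z'" "insert z' S' \<subseteq> X b \<union> X c" "2 + k \<le> card S'" by blast
  moreover have "X b \<union> X c \<subseteq> pt A" using A by (auto simp: pt_def)
  ultimately show False using min_support_bound[OF A(1,2), of S' z'] by auto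
qed

text \<open>A minimal support with two elements would grow beyond \<open>k\<close>.\<close>

theorem trivial_pregeometry:
  assumes A: "finite A" "A \<subseteq> \<Omega>" "set b \<subseteq> A" "set c \<subseteq> A"
    and S: "finite S" "S \<subseteq> X b \<union> X c" and z: "z \<in> X b \<union> X c" "z \<notin> cl A" "z \<in> cl (A \<union> S)"
  shows "\<exists>s\<in>S. z \<in> cl (insert s A)"
proof -
  let ?P = "\<lambda>T. T \<subseteq> S \<and> z \<in> cl (A \<union> T)"
  have "\<exists>T. ?P T \<and> (\<forall>T'. ?P T' \<longrightarrow> card T \<le> card T')"
    using ex_has_least_nat[of ?P S card] z by blast
  then obtain T where T: "?P T" "\<And>T'. ?P T' \<Longrightarrow> card T \<le> card T'" by blast
  have finT: "finite T" using T S finite_subset by auto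
  have min: "z \<notin> cl (A \<union> (T - {s}))" if "s \<in> T" for s
  proof
    assume "z \<in> cl (A \<union> (T - {s}))"
    then have "card T \<le> card (T - {s})" using T(1) by (intro T(2)) auto
    then show False using that finT by (metis card_Diff1_less not_less)
  qed
  show ?thesis
  proof (cases "z \<in> T")
    case True
    then show ?thesis using T z X_in by (intro bexI[of _ z] cl_self) auto
  next
    case False
    then have "min_support A T z" using T finT min by (auto simp: min_support_def)
    then have "card T < 2" using no_large_min_support[OF A, of T z] T S z by blast
    moreover have "T \<noteq> {}" using T z by auto
    ultimately obtain t where "T = {t}" using finT
      by (metis One_nat_def card_1_singletonE card_gt_0_iff less_2_cases_iff less_irrefl)
    then show ?thesis using T by auto
  qed
qed

lemma independent_conjugates:
  assumes A: "finite A" "A \<subseteq> \<Omega>" "set b \<subseteq> A" "x \<in> X b" "x \<notin> cl A"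
  shows "\<exists>g. \<forall>j<n::nat. g j \<in> stab A \<and> g j x \<notin> cl (A \<union> (\<lambda>i. g i x) ` {..<j})"
proof (induction n)
  case (Suc n)
  then obtain g where g: "\<And>j. j < n \<Longrightarrow> g j \<in> stab A \<and> g j x \<notin> cl (A \<union> (\<lambda>i. g i x) ` {..<j})" by blast
  let ?U = "A \<union> (\<lambda>i. g i x) ` {..<n}"
  have "(\<lambda>i. g i x) ` {..<n} \<subseteq> \<Omega>" using g X_in[OF A(4)] stab_mem by blast
  then obtain h where h: "h \<in> stab A" "h x \<notin> cl ?U" using move_generic[OF A, of ?U] A by auto
  have "\<forall>j<Suc n. (g(n := h)) j \<in> stab A \<and> (g(n := h)) j x \<notin> cl (A \<union> (\<lambda>i. (g(n := h)) i x) ` {..<j})"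
  proof (intro allI impI)
    fix j assume "j < Suc n"
    moreover have "(\<lambda>i. (g(n := h)) i x) ` {..<j} = (\<lambda>i. g i x) ` {..<j}" if "j \<le> n"
      using that by (intro image_cong) auto
    ultimately show "(g(n := h)) j \<in> stab A \<and> (g(n := h)) j x \<notin> cl (A \<union> (\<lambda>i. (g(n := h)) i x) ` {..<j})"
      using g h by (cases "j = n") auto
  qed
  then show ?case by blast
qed auto

text \<open>Two minimal types that interact over some parameters already interact over their own parameters:
  otherwise independent conjugates \<open>(p j, q j)\<close> of \<open>(x, y)\<close> would be shattered by conjugates of \<open>A\<close>, since arbitrary
  elements \<open>q j\<close> could be moved away from \<open>A\<close> while the others and all \<open>p j\<close> are fixed.\<close>

theorem interaction_over_base:
  assumes A: "finite A" "A \<subseteq> \<Omega>" "set b \<subseteq> A" "set c \<subseteq> A"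
    and x: "x \<in> X b" and y: "y \<in> X c" and yx: "y \<in> cl (insert x A)" "y \<notin> cl A"
  shows "y \<in> cl (insert x (set b \<union> set c))"
proof (rule ccontr)
  assume neg: "y \<notin> cl (insert x (set b \<union> set c))"
  let ?B = "set b \<union> set c"
  have B: "finite ?B" "?B \<subseteq> \<Omega>" "?B \<subseteq> A" using A by auto
  have \<Omega>: "x \<in> \<Omega>" "y \<in> \<Omega>" using x y X_in by auto
  have xA: "x \<notin> cl A" using yx cl_trans1 by blast
  obtain as where as: "set as = A" using A finite_list by blast
  define R where "R xs ys \<longleftrightarrow> xs ! 1 \<in> cl (insert (xs ! 0) (set ys))" for xs ys
  have inv: "invariant_rel G \<Omega> 2 (length as) R"
    unfolding invariant_rel_def
  proof (intro ballI)
    fix g xs ys assume g: "g \<in> G" and xs: "xs \<in> tups \<Omega> 2"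
    have "map g xs ! 1 = g (xs ! 1)" "map g xs ! 0 = g (xs ! 0)" using xs by (auto simp: tups_def)
    then show "R (map g xs) (map g ys) \<longleftrightarrow> R xs ys"
      using cl_image_mem[OF g, of "xs ! 1" "insert (xs ! 0) (set ys)"] by (simp add: R_def)
  qed
  obtain n :: nat where n: "\<forall>a. (\<forall>i<n. a i \<in> tups \<Omega> 2) \<longrightarrow>
     (\<exists>W\<subseteq>{..<n}. \<forall>b\<in>tups \<Omega> (length as). \<exists>i<n. R (a i) b \<longleftrightarrow> i \<notin> W)"
    using no_shattering[OF inv] by (elim exE)
  obtain g where g: "\<And>j. j < n \<Longrightarrow> g j \<in> stab A" "\<And>j. j < n \<Longrightarrow> g j x \<notin> cl (A \<union> (\<lambda>i. g i x) ` {..<j})"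
    using independent_conjugates[OF A(1-3) x xA, of n] by blast
  define p q where "p j = g j x" and "q j = g j y" for j
  have p: "p j \<in> X b" "p j \<in> \<Omega>" and q: "q j \<in> X c" "q j \<in> \<Omega>" if "j < n" for j
    using X_stab[OF g(1)[OF that]] A x y \<Omega> stab_mem[OF g(1)[OF that]] by (auto simp: p_def q_def)
  have qA: "q j \<notin> cl A" if "j < n" for j using stab_cl_mem[OF g(1)[OF that] subset_refl] yx(2) by (simp add: q_def)
  have pA: "p j \<notin> cl A" if "j < n" for j using stab_cl_mem[OF g(1)[OF that] subset_refl] xA by (simp add: p_def)
  have qp: "q j \<in> cl (insert (p j) A)" if "j < n" for j
    using cl_stab_insert[OF g(1)[OF that]] yx(1) by (simp add: p_def q_def)
  have pq: "p j \<in> cl (insert (q j) A)" if "j < n" for j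
    using exchange[OF A p(1)[OF that] q(1)[OF that] qp[OF that] qA[OF that]] .
  have qpB: "q j \<notin> cl (insert (p j) ?B)" if "j < n" for j
  proof -
    have "g j \<in> stab ?B" using g(1)[OF that] stab_mono[OF B(3)] by blast
    then show ?thesis using cl_stab_insert neg by (simp add: p_def q_def)
  qed
  have pp_less: "p j \<notin> cl (insert (p i) A)" if "i < j" "j < n" for i j
    using g(2)[OF that(2)] cl_mono'[of "p j" "insert (p i) A" "A \<union> (\<lambda>i. g i x) ` {..<j}"] that
    by (auto simp: p_def)
  have pp: "p j \<notin> cl (insert (p i) A)" if "i \<noteq> j" "i < n" "j < n" for i j
  proof (cases "i < j")
    case True then show ?thesis using pp_less that by blast
  next
    case False
    then have "j < i" using that by auto
    then show ?thesis
      using exchange[OF A(1-3,3) p(1)[OF that(2)] p(1)[OF that(3)]] pp_less[of j i] pA that by blast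
  qed
  have qpi: "q j \<notin> cl (insert (p i) A)" if "i \<noteq> j" "i < n" "j < n" for i j
  proof
    assume "q j \<in> cl (insert (p i) A)"
    moreover have "p j \<in> cl (insert (q j) (insert (p i) A))"
      using pq[OF that(3)] cl_mono'[of "p j" "insert (q j) A" "insert (q j) (insert (p i) A)"] by auto
    ultimately show False using pp[OF that] cl_trans1 by blast
  qed
  have qqi: "q j \<notin> cl (insert (q i) A)" if "i \<noteq> j" "i < n" "j < n" for i j
  proof
    assume "q j \<in> cl (insert (q i) A)"
    then have "q j \<in> cl (insert (q i) (insert (p i) A))"
      using cl_mono'[of "q j" "insert (q i) A" "insert (q i) (insert (p i) A)"] by auto
    then show False using qpi[OF that] qp[OF that(2)] cl_trans1 by blast
  qed
  have free: "q j \<notin> cl (?B \<union> (p ` {..<n} \<union> (q ` {..<n} - {q j})))" if j: "j < n" for j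
  proof
    assume in_cl: "q j \<in> cl (?B \<union> (p ` {..<n} \<union> (q ` {..<n} - {q j})))"
    have "\<exists>s\<in>p ` {..<n} \<union> (q ` {..<n} - {q j}). q j \<in> cl (insert s ?B)"
      using p q qA[OF j] cl_mono'[OF _ B(3)] in_cl j by (intro trivial_pregeometry[OF B(1,2), where b = b and c = c]) auto
    then obtain s where s: "s \<in> p ` {..<n} \<union> (q ` {..<n} - {q j})" "q j \<in> cl (insert s ?B)" by blast
    have sA: "q j \<in> cl (insert s A)" using s(2) cl_mono'[of "q j" "insert s ?B" "insert s A"] B(3) by auto
    from s(1) consider i where "i < n" "s = p i" | i where "i < n" "s = q i" "q i \<noteq> q j" by auto
    then show False
    proof cases
      case 1
      then show ?thesis using qpB[OF j] qpi[of i j] s(2) sA j by (cases "i = j") auto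
    next
      case 2
      then show ?thesis using qqi[of i j] sA j by auto
    qed
  qed
  have "\<forall>i<n. [p i, q i] \<in> tups \<Omega> 2" using p q by (auto simp: tups_def)
  then obtain W where W: "W \<subseteq> {..<n}" "\<forall>b\<in>tups \<Omega> (length as). \<exists>i<n. R [p i, q i] b \<longleftrightarrow> i \<notin> W"
    using n[rule_format, of "\<lambda>i. [p i, q i]"] by blast
  let ?F = "p ` {..<n} \<union> q ` W" and ?M = "q ` ({..<n} - W)"
  let ?U = "A \<union> (p ` {..<n} \<union> q ` {..<n})"
  have "\<exists>h\<in>stab ?B. (\<forall>y\<in>?F. h y = id y) \<and> (\<forall>r\<in>?M. h r \<notin> cl (?U \<union> h ` (?M - {r})))"
  proof (rule fresh_set[OF B(1,2) stab_id])
    fix r assume "r \<in> ?M"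
    then obtain j where j: "j < n" "j \<notin> W" "r = q j" by auto
    have "q i \<noteq> q j" if "i \<in> W" for i
    proof
      assume "q i = q j"
      moreover have "i < n" "i \<noteq> j" using that W j by auto
      moreover have "q i \<in> cl (insert (q i) A)" using q(2)[OF \<open>i < n\<close>] by (intro cl_self) auto
      ultimately show False using qqi[of i j] j by simp
    qed
    then have "?B \<union> ?F \<union> (?M - {r}) \<subseteq> ?B \<union> (p ` {..<n} \<union> (q ` {..<n} - {q j}))" using W j by auto
    then show "r \<notin> cl (?B \<union> ?F \<union> (?M - {r}))" using free[OF j(1)] cl_mono' j(3) by blast
  next
    show "?M \<subseteq> pt ?B" using q by (auto simp: pt_def)
    show "finite ?F" "finite ?U" using W A finite_subset[OF W(1)] by auto
    show "?F \<subseteq> \<Omega>" "?U \<subseteq> \<Omega>" using W p q A by auto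
  qed (use B in auto)
  then obtain h where h: "h \<in> stab ?B" "\<And>y. y \<in> ?F \<Longrightarrow> h y = y" "\<And>r. r \<in> ?M \<Longrightarrow> h r \<notin> cl (?U \<union> h ` (?M - {r}))"
    by auto
  have hG: "h \<in> G" using h stabD by blast
  have "map (inv h) as \<in> tups \<Omega> (length as)" using as A G_inv[OF hG] by (auto simp: tups_def)
  then obtain i where i: "i < n" "R [p i, q i] (map (inv h) as) \<longleftrightarrow> i \<notin> W" using W(2) by blast
  have "h ` inv h ` A = A" using hG by (force simp: image_image)
  then have "R [p i, q i] (map (inv h) as) \<longleftrightarrow> h (q i) \<in> cl (insert (h (p i)) A)"
    using cl_image_mem[OF hG, of "q i" "insert (p i) (inv h ` A)"] as by (simp add: R_def)
  also have "h (p i) = p i" using h(2) i by simp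
  also have "h (q i) \<in> cl (insert (p i) A) \<longleftrightarrow> i \<in> W"
  proof (cases "i \<in> W")
    case True
    then show ?thesis using h(2)[of "q i"] qp[OF i(1)] by simp
  next
    case False
    then have "h (q i) \<notin> cl (?U \<union> h ` (?M - {q i}))" using h(3) i by blast
    then have "h (q i) \<notin> cl (insert (p i) A)"
      using cl_mono'[of "h (q i)" "insert (p i) A" "?U \<union> h ` (?M - {q i})"] i by auto
    then show ?thesis using False by simp
  qed
  finally show False using i(2) by blast
qed

end

section \<open>Algebraicity over a union\<close>

context minimal_type
begin

lemma pt_interaction:
  assumes "finite A" "A \<subseteq> \<Omega>" "set b \<subseteq> A" "x \<in> X b" "y \<in> X b" "y \<in> cl (insert x A)" "y \<notin> cl A"
  shows "y \<in> cl (insert x (set b))"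
  using interaction_over_base[OF assms(1,2,3,3,4-7)] by simp

text \<open>Consider a \<open>g\<close> leaving as few elements as possible in the closure of \<open>U\<close>.  By triviality, an element left there could
  be moved while the elements which are not interalgebraic with it are fixed.\<close>

lemma move_set:
  assumes A: "finite A" "A \<subseteq> \<Omega>" "set b \<subseteq> A" and F: "finite F" "F \<subseteq> X b" "F \<inter> cl A = {}"
    and U: "finite U" "U \<subseteq> \<Omega>" "A \<subseteq> U"
  shows "\<exists>g\<in>stab A. \<forall>f\<in>F. g f \<notin> cl U"
proof -
  let ?n = "\<lambda>g. card {f\<in>F. g f \<in> cl U}"
  have "\<exists>g. g \<in> stab A \<and> (\<forall>h. h \<in> stab A \<longrightarrow> ?n g \<le> ?n h)"
    using ex_has_least_nat[of "\<lambda>g. g \<in> stab A" id ?n] stab_id by blast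
  then obtain g where g: "g \<in> stab A" "\<And>h. h \<in> stab A \<Longrightarrow> ?n g \<le> ?n h" by blast
  show ?thesis
  proof (rule ccontr)
    assume "\<not> ?thesis"
    then obtain f where f: "f \<in> F" "g f \<in> cl U" using g(1) by blast
    have gX: "g w \<in> X b" and gA: "g w \<notin> cl A" if "w \<in> F" for w
      using X_stab[OF g(1) A(3), of w] stab_cl_mem[OF g(1) subset_refl, of w] F that by auto
    let ?e = "g f"
    let ?R = "g ` F - cl (insert ?e A)"
    have R: "finite ?R" "?R \<subseteq> X b" using F gX by auto
    have R\<Omega>: "?R \<subseteq> \<Omega>" using R(2) X_subset by blast
    have "?e \<notin> cl (A \<union> ?R)"
    proof
      assume "?e \<in> cl (A \<union> ?R)"
      then have "\<exists>s\<in>?R. ?e \<in> cl (insert s A)"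
        using R gX[OF f(1)] gA[OF f(1)] by (intro trivial_pregeometry[OF A A(3)]) auto
      then obtain s where s: "s \<in> ?R" "?e \<in> cl (insert s A)" by blast
      then have "s \<in> cl (insert ?e A)" using exchange[OF A A(3) _ gX[OF f(1)] s(2) gA[OF f(1)]] R(2) by blast
      then show False using s(1) by blast
    qed
    then obtain h where h: "h \<in> stab (A \<union> ?R)" "h ?e \<notin> cl U"
      using move_generic[of "A \<union> ?R" b ?e U] A R R\<Omega> U gX[OF f(1)] by (metis Un_subset_iff finite_Un le_supI1)
    have hA: "h \<in> stab A" using h stab_mono[of A "A \<union> ?R"] by auto
    have hg: "h \<circ> g \<in> stab A" using stab_comp[OF hA g(1)] .
    have "{w\<in>F. (h \<circ> g) w \<in> cl U} \<subseteq> {w\<in>F. g w \<in> cl U} - {f}"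
    proof
      fix w assume w: "w \<in> {w\<in>F. (h \<circ> g) w \<in> cl U}"
      show "w \<in> {w\<in>F. g w \<in> cl U} - {f}"
      proof (cases "g w \<in> cl (insert ?e A)")
        case True
        then have 1: "h (g w) \<in> cl (insert (h ?e) A)" using cl_stab_insert[OF hA] by blast
        have 2: "h (g w) \<notin> cl A" using stab_cl_mem[OF hA subset_refl] gA w by blast
        have "h ?e \<in> cl (insert (h (g w)) A)"
          using exchange[OF A A(3) _ _ 1 2] X_stab[OF hA A(3)] gX w f(1) by blast
        then have "h ?e \<in> cl (insert (h (g w)) U)" using cl_mono'[of "h ?e"] U(3) by blast
        then have "h ?e \<in> cl U" using w cl_trans1 by auto
        then show ?thesis using h(2) by blast
      next
        case False
        then have "g w \<in> ?R" using w by blast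
        then have "h (g w) = g w" using stabD(2)[OF h(1)] by blast
        then show ?thesis using w h(2) by auto
      qed
    qed
    then have "?n (h \<circ> g) < ?n g" using f F(1) by (intro psubset_card_mono) auto
    then show False using g(2)[OF hg] by simp
  qed
qed

definition known :: "'a list \<Rightarrow> 'a set \<Rightarrow> 'a set" where
  "known b A = X b \<inter> cl (set b \<union> A)"

lemma known_mono: "A \<subseteq> B \<Longrightarrow> known b A \<subseteq> known b B"
  unfolding known_def using cl_mono[of "set b \<union> A" "set b \<union> B"] by blast

lemma known_finite: "b \<in> Par \<Longrightarrow> finite A \<Longrightarrow> A \<subseteq> \<Omega> \<Longrightarrow> finite (known b A)"
  unfolding known_def using Par_subset by (intro finite_Int disjI2 finite_cl) auto

lemma known_image: "g \<in> G \<Longrightarrow> g x \<in> known (map g b) (g ` A) \<longleftrightarrow> x \<in> known b A"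
  unfolding known_def using X_map cl_image_mem[of g x "set b \<union> A"] by (simp add: image_Un)

lemma known_stab: "g \<in> stab (set b) \<Longrightarrow> g x \<in> known b (g ` A) \<longleftrightarrow> x \<in> known b A"
  using known_image[of g x b A] stab_map[of g "set b" b] stabD(1)[of g "set b"] by simp

text \<open>A violation at \<open>a\<close> over \<open>C\<close>: some \<open>i\<close> is known over \<open>C'\<close> and \<open>a\<close> together, but over neither of \<open>C'\<close> and
  \<open>C \<union> {a}\<close>.  The set \<open>J\<close> collects elements which are to be held fixed.\<close>

primrec violations :: "'a list \<Rightarrow> 'a set \<Rightarrow> nat \<Rightarrow> 'a \<Rightarrow> 'a set \<Rightarrow> bool" where
  "violations b J 0 a C \<longleftrightarrow> True"
| "violations b J (Suc n) a C \<longleftrightarrow> (\<exists>C' i. finite C' \<and> C' \<subseteq> \<Omega> \<and> C \<subseteq> C' \<and> i \<in> known b (insert a C') \<and>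
     i \<notin> known b (insert a C) \<and> i \<notin> known b C' \<and> i \<notin> cl (set b \<union> J) \<and> violations b J n a C')"

lemma violations_image:
  assumes g: "g \<in> G"
  shows "violations b J n a C \<Longrightarrow> violations (map g b) (g ` J) n (g a) (g ` C)"
proof (induction n arbitrary: C)
  case (Suc n)
  then obtain C' i where C': "finite C'" "C' \<subseteq> \<Omega>" "C \<subseteq> C'" "i \<in> known b (insert a C')"
     "i \<notin> known b (insert a C)" "i \<notin> known b C'" "i \<notin> cl (set b \<union> J)" "violations b J n a C'" by auto
  have "g i \<in> known (map g b) (insert (g a) (g ` C'))" "g i \<notin> known (map g b) (insert (g a) (g ` C))"
    "g i \<notin> known (map g b) (g ` C')" "g i \<notin> cl (set (map g b) \<union> g ` J)"
    using C' known_image[OF g, of i b "insert a C'"] known_image[OF g, of i b "insert a C"]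
      known_image[OF g, of i b C'] cl_image_mem[OF g, of i "set b \<union> J"] by (simp_all add: image_Un)
  moreover have "finite (g ` C')" "g ` C' \<subseteq> \<Omega>" "g ` C \<subseteq> g ` C'" using C' g by auto
  ultimately show ?case using Suc.IH[OF C'(8)] by (auto simp del: set_map)
qed simp

lemma violations_mono: "violations b J n a D \<Longrightarrow> C \<subseteq> D \<Longrightarrow> violations b J n a C"
proof (cases n)
  case (Suc m)
  assume "violations b J n a D" "C \<subseteq> D"
  then obtain C' i where C': "finite C'" "C' \<subseteq> \<Omega>" "D \<subseteq> C'" "i \<in> known b (insert a C')"
     "i \<notin> known b (insert a D)" "i \<notin> known b C'" "i \<notin> cl (set b \<union> J)" "violations b J m a C'"
    using Suc by auto
  moreover have "C \<subseteq> C'" "i \<notin> known b (insert a C)"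
    using \<open>C \<subseteq> D\<close> C' known_mono[of "insert a C" "insert a D" b] by auto
  ultimately show ?thesis unfolding Suc violations.simps by blast
qed simp

text \<open>The set \<open>J\<close> grows along the tree to be constructed: on one branch by the element witnessing a violation, which is
  known from then on, and on the other branch by a generic conjugate of it.\<close>

lemma violations_fix_known:
  assumes b: "b \<in> Par" and J: "finite J" "J \<subseteq> X b" and y: "y \<in> known b (insert a C)" and aC: "finite C" "insert a C \<subseteq> \<Omega>"
  shows "violations b J n a C \<Longrightarrow> violations b (insert y J) n a C"
  using y aC
proof (induction n arbitrary: C)
  case (Suc n)
  obtain C' i where C': "finite C'" "C' \<subseteq> \<Omega>" "C \<subseteq> C'" "i \<in> known b (insert a C')"
     "i \<notin> known b (insert a C)" "i \<notin> known b C'" "i \<notin> cl (set b \<union> J)" "violations b J n a C'"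
    using Suc.prems(1) by auto
  have iX: "i \<in> X b" using C' by (auto simp: known_def)
  have yX: "y \<in> X b" using Suc.prems by (auto simp: known_def)
  have "i \<notin> cl (set b \<union> insert y J)"
  proof
    assume "i \<in> cl (set b \<union> insert y J)"
    then have "\<exists>s\<in>insert y J. i \<in> cl (insert s (set b))"
      using J iX yX X_nonalg[OF iX] Par_subset[OF b]
      by (intro trivial_pregeometry[where b = b and c = b]) auto
    then obtain s where s: "s \<in> insert y J" "i \<in> cl (insert s (set b))" by blast
    show False
    proof (cases "s \<in> J")
      case True
      then show ?thesis using C'(7) cl_mono'[OF s(2), of "set b \<union> J"] by auto
    next
      case False
      then have "i \<in> cl (insert y (set b))" using s by auto
      then have "i \<in> cl (insert y (set b \<union> insert a C))"
        using cl_mono'[of i "insert y (set b)" "insert y (set b \<union> insert a C)"] by auto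
      moreover have "y \<in> cl (set b \<union> insert a C)" using Suc.prems by (auto simp: known_def)
      ultimately have "i \<in> cl (set b \<union> insert a C)" using cl_trans1 by blast
      then show ?thesis using C'(5) iX by (auto simp: known_def)
    qed
  qed
  moreover have "violations b (insert y J) n a C'"
    using Suc.prems C' known_mono[of "insert a C" "insert a C'" b] by (intro Suc.IH) auto
  ultimately show ?case using C' by auto
qed simp

lemma violations_fix_generic:
  assumes b: "b \<in> Par" and J: "finite J" "J \<subseteq> X b"
  shows "violations b J n a C \<Longrightarrow>
    \<exists>T. finite T \<and> T \<subseteq> \<Omega> \<and> (\<forall>y\<in>X b. y \<notin> cl T \<longrightarrow> violations b (insert y J) n a C)"
proof (induction n arbitrary: C)
  case 0
  show ?case by (intro exI[of _ "{}"]) simp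
next
  case (Suc n)
  obtain C' i where C': "finite C'" "C' \<subseteq> \<Omega>" "C \<subseteq> C'" "i \<in> known b (insert a C')"
     "i \<notin> known b (insert a C)" "i \<notin> known b C'" "i \<notin> cl (set b \<union> J)" "violations b J n a C'"
    using Suc.prems(1) by auto
  obtain T where T: "finite T" "T \<subseteq> \<Omega>" "\<And>y. y \<in> X b \<Longrightarrow> y \<notin> cl T \<Longrightarrow> violations b (insert y J) n a C'"
    using Suc.IH[OF C'(8)] by blast
  have iX: "i \<in> X b" using C' by (auto simp: known_def)
  have bs: "finite (set b)" "set b \<subseteq> \<Omega>" using Par_subset[OF b] by auto
  let ?T = "T \<union> insert i (set b)"
  have "violations b (insert y J) (Suc n) a C" if y: "y \<in> X b" "y \<notin> cl ?T" for y
  proof -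
    have "y \<notin> cl T" using y(2) cl_mono'[of y T ?T] by auto
    moreover have "i \<notin> cl (set b \<union> insert y J)"
    proof
      assume "i \<in> cl (set b \<union> insert y J)"
      then have "\<exists>s\<in>insert y J. i \<in> cl (insert s (set b))"
        using J iX y(1) X_nonalg[OF iX] bs
        by (intro trivial_pregeometry[where b = b and c = b]) auto
      then obtain s where s: "s \<in> insert y J" "i \<in> cl (insert s (set b))" by blast
      show False
      proof (cases "s \<in> J")
        case True
        then show ?thesis using C'(7) cl_mono'[OF s(2), of "set b \<union> J"] by auto
      next
        case False
        then have "i \<in> cl (insert y (set b))" using s by auto
        then have "y \<in> cl (insert i (set b))" using exchange[OF bs subset_refl subset_refl y(1) iX _ X_nonalg[OF iX]] by blast
        then show ?thesis using y(2) cl_mono'[of y "insert i (set b)" ?T] by auto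
      qed
    qed
    ultimately show ?thesis using T(3)[OF y(1)] C' by auto
  qed
  then show ?case using T(1,2) iX X_in bs by (intro exI[of _ ?T]) auto
qed

text \<open>A long chain of violations at \<open>a\<close> yields a tall binary tree of conjugates of \<open>a\<close>, for the formula saying that
  \<open>i\<close> is algebraic over \<open>b\<close>, the given element and \<open>k\<close> further parameters.\<close>

lemma tree_of_violations:
  fixes R
  defines "R \<equiv> \<lambda>xs ys. ys ! 0 \<in> cl (set (tl ys) \<union> set xs)"
  assumes b: "b \<in> Par" and aC: "finite C" "insert a C \<subseteq> \<Omega>" and J: "finite J" "J \<subseteq> X b"
    and v: "violations b J n a C"
  shows "splitting_tree R (tups \<Omega> (Suc (length b + k))) n ((\<lambda>z. [z]) ` orb (set b \<union> C \<union> J) a)"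
  using aC J v
proof (induction n arbitrary: a C J)
  case 0
  show ?case unfolding splitting_tree.simps using orb_self[of a] by blast
next
  case (Suc n)
  obtain C' i where C': "finite C'" "C' \<subseteq> \<Omega>" "C \<subseteq> C'" "i \<in> known b (insert a C')"
     "i \<notin> known b (insert a C)" "i \<notin> known b C'" "i \<notin> cl (set b \<union> J)" "violations b J n a C'"
    using Suc.prems(5) by auto
  have bs: "finite (set b)" "set b \<subseteq> \<Omega>" using Par_subset[OF b] by auto
  have J\<Omega>: "J \<subseteq> \<Omega>" and a\<Omega>: "a \<in> \<Omega>" using Suc.prems X_in by auto
  have iX: "i \<in> X b" and icl: "i \<in> cl (set b \<union> insert a C')" and inc: "i \<notin> cl (set b \<union> C')"
    using C' by (auto simp: known_def)
  have i\<Omega>: "i \<in> \<Omega>" using iX X_in by blast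
  obtain es where es: "es \<in> tups (set b \<union> insert a C') k" "i \<in> cl (set b \<union> set es)"
    using locality[OF _ _ iX icl] C' a\<Omega> by auto
  define E where "E = map (\<lambda>e. if e = a then hd b else e) es"
  have hdb: "hd b \<in> set b" using Par_nonempty[OF b] by simp
  have E: "set E \<subseteq> set b \<union> C'" "length E = k" "set es \<subseteq> insert a (set E)"
    using es(1) hdb by (auto simp: E_def tups_def)
  have iE: "i \<in> cl (insert a (set b \<union> set E))"
    using es(2) E(3) cl_mono'[of i "set b \<union> set es" "insert a (set b \<union> set E)"] by auto
  define ys where "ys = i # b @ E"
  have ys: "ys \<in> tups \<Omega> (Suc (length b + k))" using E C' bs i\<Omega> by (auto simp: tups_def ys_def)
  have R: "R [z] ys \<longleftrightarrow> i \<in> cl (insert z (set b \<union> set E))" for z by (simp add: R_def ys_def)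
  let ?Z = "orb (set b \<union> C \<union> J) a"
  let ?B = "set b \<union> C' \<union> J"
  let ?B' = "set b \<union> C' \<union> insert i J"
  have bE: "set b \<union> set E \<subseteq> ?B'" "set b \<union> set E \<subseteq> ?B" using E by auto
  have Jiy: "finite (insert i J)" "insert i J \<subseteq> X b" using Suc.prems iX by auto
  have aC': "insert a C' \<subseteq> \<Omega>" using a\<Omega> C' by auto
  have R_orb: "R [z] ys \<longleftrightarrow> R [a'] ys" if z: "z \<in> orb ?B' a'" for z a'
  proof -
    obtain g where g: "g \<in> stab ?B'" "z = g a'" using z by (auto simp: orb_def)
    have "g \<in> stab (set b \<union> set E)" "g i = i" using g(1) stab_mono[OF bE(1)] stabD(2)[OF g(1)] by auto
    then show ?thesis unfolding R g(2) using cl_stab_insert[of g "set b \<union> set E" i a'] by simp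
  qed
  have left: "splitting_tree R (tups \<Omega> (Suc (length b + k))) n {v \<in> (\<lambda>z. [z]) ` ?Z. R v ys}"
  proof (rule splitting_tree_mono[OF _ _ subset_refl])
    show "splitting_tree R (tups \<Omega> (Suc (length b + k))) n ((\<lambda>z. [z]) ` orb ?B' a)"
      using violations_fix_known[OF b Suc.prems(3,4) C'(4,1) aC' C'(8)] Suc.IH[OF C'(1) aC' Jiy] by blast
    have "orb ?B' a \<subseteq> ?Z" using C'(3) by (intro orb_mono) auto
    then show "(\<lambda>z. [z]) ` orb ?B' a \<subseteq> {v \<in> (\<lambda>z. [z]) ` ?Z. R v ys}" using R_orb[of _ a] iE R[of a] by auto
  qed
  have Bfin: "finite ?B" "?B \<subseteq> \<Omega>" "set b \<subseteq> ?B" using bs C' Suc.prems J\<Omega> by auto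
  have iB: "i \<notin> cl ?B"
  proof
    assume "i \<in> cl ?B"
    moreover have BC: "finite (set b \<union> C')" "set b \<union> C' \<subseteq> \<Omega>" "set b \<subseteq> set b \<union> C'" using bs C' by auto
    ultimately have "\<exists>s\<in>J. i \<in> cl (insert s (set b \<union> C'))"
      using iX inc Suc.prems(3,4) by (intro trivial_pregeometry[where b = b and c = b]) auto
    then obtain s where s: "s \<in> J" "i \<in> cl (insert s (set b \<union> C'))" by blast
    then have "i \<in> cl (insert s (set b))" using pt_interaction[OF BC _ iX s(2) inc] Suc.prems(4) by blast
    then show False using C'(7) s(1) cl_mono'[of i "insert s (set b)" "set b \<union> J"] by auto
  qed
  obtain T where T: "finite T" "T \<subseteq> \<Omega>" "\<And>y. y \<in> X b \<Longrightarrow> y \<notin> cl T \<Longrightarrow> violations b (insert y J) n a C'"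
    using violations_fix_generic[OF b Suc.prems(3,4) C'(8)] by blast
  have "finite (T \<union> insert a ?B)" "T \<union> insert a ?B \<subseteq> \<Omega>" using T Bfin a\<Omega> by auto
  then obtain f where f: "f \<in> stab ?B" "f i \<in> X b" "f i \<notin> cl (T \<union> insert a ?B)"
    using move_generic[OF Bfin iX iB] by blast
  define h where "h = inv f"
  have fG: "f \<in> G" and hB: "h \<in> stab ?B" using f stabD(1) stab_inv by (auto simp: h_def)
  have hG: "h \<in> G" using hB stabD by blast
  have hf: "h (f w) = w" "f (h w) = w" for w using fG by (auto simp: h_def)
  have "violations b (insert (f i) J) n a C'" using T(3)[OF f(2)] f(3) cl_mono'[of "f i" T "T \<union> insert a ?B"] by auto
  then have "violations (map h b) (h ` insert (f i) J) n (h a) (h ` C')" by (rule violations_image[OF hG])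
  moreover have "map h b = b" "h ` J = J" "h ` C' = C'"
    using stab_map[OF hB, of b] stab_image[OF hB, of J] stab_image[OF hB, of C'] by auto
  ultimately have viol: "violations b (insert i J) n (h a) C'" using hf by simp
  have right: "splitting_tree R (tups \<Omega> (Suc (length b + k))) n {v \<in> (\<lambda>z. [z]) ` ?Z. \<not> R v ys}"
  proof (rule splitting_tree_mono[OF _ _ subset_refl])
    have "insert (h a) C' \<subseteq> \<Omega>" using hG a\<Omega> C' by simp
    then show "splitting_tree R (tups \<Omega> (Suc (length b + k))) n ((\<lambda>z. [z]) ` orb ?B' (h a))"
      using Suc.IH[OF C'(1) _ Jiy viol] by blast
    have "orb ?B' (h a) \<subseteq> orb ?B (h a)" by (intro orb_mono) auto
    also have "\<dots> = orb ?B a" using orb_eq[OF hB] .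
    also have "\<dots> \<subseteq> ?Z" using C'(3) by (intro orb_mono) auto
    finally have sub: "orb ?B' (h a) \<subseteq> ?Z" .
    have "\<not> R [h a] ys"
    proof
      assume "R [h a] ys"
      then have "f i \<in> cl (insert (f (h a)) (set b \<union> set E))"
        using cl_stab_insert[of f "set b \<union> set E" i "h a"] f(1) stab_mono[OF bE(2)] R by blast
      then have "f i \<in> cl (insert a (set b \<union> set E))" by (simp only: hf)
      then show False using f(3) E(1) cl_mono'[of "f i" "insert a (set b \<union> set E)" "T \<union> insert a ?B"] by auto
    qed
    then have "\<not> R [z] ys" if "z \<in> orb ?B' (h a)" for z using R_orb[OF that] by simp
    then show "(\<lambda>z. [z]) ` orb ?B' (h a) \<subseteq> {v \<in> (\<lambda>z. [z]) ` ?Z. \<not> R v ys}" using sub by auto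
  qed
  show ?case using left right ys by auto
qed

lemma violations_bounded:
  "\<exists>N. \<forall>b a C. b \<in> Par \<longrightarrow> finite C \<longrightarrow> insert a C \<subseteq> \<Omega> \<longrightarrow> \<not> violations b {} N a C"
proof -
  define R :: "'a list \<Rightarrow> 'a list \<Rightarrow> bool" where "R = (\<lambda>xs ys. ys ! 0 \<in> cl (set (tl ys) \<union> set xs))"
  let ?q = "Suc (length b0 + k)"
  have "invariant_rel G \<Omega> 1 ?q R"
    unfolding invariant_rel_def
  proof (intro ballI)
    fix g xs ys assume g: "g \<in> G" and ys: "ys \<in> tups \<Omega> ?q"
    obtain y ys' where "ys = y # ys'" using ys by (cases ys) (auto simp: tups_def)
    then show "R (map g xs) (map g ys) \<longleftrightarrow> R xs ys"
      using cl_image_mem[OF g, of y "set ys' \<union> set xs"] by (simp add: R_def image_Un)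
  qed
  from no_tall_tree[OF this] obtain N where N: "\<not> splitting_tree R (tups \<Omega> ?q) N (tups \<Omega> 1)" by (elim exE)
  show ?thesis
  proof (intro exI[of _ N] allI impI notI)
    fix b a C assume *: "b \<in> Par" "finite C" "insert a C \<subseteq> \<Omega>" "violations b {} N a C"
    have "splitting_tree R (tups \<Omega> (Suc (length b + k))) N ((\<lambda>z. [z]) ` orb (set b \<union> C \<union> {}) a)"
      unfolding R_def using * by (intro tree_of_violations) auto
    then have "splitting_tree R (tups \<Omega> ?q) N (tups \<Omega> 1)"
    proof (rule splitting_tree_mono)
      show "(\<lambda>z. [z]) ` orb (set b \<union> C \<union> {}) a \<subseteq> tups \<Omega> 1" using * stab_mem by (auto simp: tups_def orb_def)
    qed (use Par_length[OF *(1)] in simp)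
    then show False using N by blast
  qed
qed

definition violation :: "'a list \<Rightarrow> 'a set \<Rightarrow> 'a \<Rightarrow> 'a set \<Rightarrow> bool" where
  "violation b C a C' \<longleftrightarrow> (\<exists>i. i \<in> known b (insert a C') \<and> i \<notin> known b (insert a C) \<and> i \<notin> known b C')"

text \<open>The rank of \<open>a\<close> over \<open>C\<close> is the greatest length of a chain of violations; \<open>least_rank b r\<close> says that no
  positive rank is smaller than \<open>r\<close>.\<close>

definition rank_le :: "'a list \<Rightarrow> nat \<Rightarrow> 'a \<Rightarrow> 'a set \<Rightarrow> bool" where
  "rank_le b r a C \<longleftrightarrow> finite C \<and> insert a C \<subseteq> \<Omega> \<and> \<not> violations b {} (Suc r) a C"

definition least_rank :: "'a list \<Rightarrow> nat \<Rightarrow> bool" where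
  "least_rank b r \<longleftrightarrow> 0 < r \<and>
     (\<forall>a C. finite C \<longrightarrow> insert a C \<subseteq> \<Omega> \<longrightarrow> violations b {} 1 a C \<longrightarrow> violations b {} r a C)"

lemma rank_le_mono:
  assumes "rank_le b r a C" "C \<subseteq> D" "finite D" "D \<subseteq> \<Omega>" shows "rank_le b r a D"
  using assms violations_mono[of b "{}" "Suc r" a D C] by (auto simp: rank_le_def simp del: violations.simps)

lemma rank_le_image:
  assumes "g \<in> stab (set b \<union> C)" "rank_le b r a C" shows "rank_le b r (g a) C"
proof -
  have g: "g \<in> G" "inv g \<in> G" and inv: "inv g \<in> stab (set b \<union> C)" using assms stabD(1) stab_inv by auto
  have "map (inv g) b = b" "inv g ` C = C" using stab_map[OF inv] stab_image[OF inv] by auto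
  then have "\<not> violations b {} (Suc r) (g a) C"
    using violations_image[OF g(2), of b "{}" "Suc r" "g a" C] assms(2) g
    by (auto simp: rank_le_def simp del: violations.simps)
  then show ?thesis using assms(2) g by (simp add: rank_le_def del: violations.simps)
qed

text \<open>Over the set that witnesses a violation the rank has dropped below \<open>r\<close>, so no violations are left.\<close>

lemma no_second_violation:
  assumes b: "b \<in> Par" and least: "least_rank b r" and low: "rank_le b r x C" and v: "violation b C x C'"
    and sub: "C \<subseteq> C'" "C' \<subseteq> D" "D \<subseteq> D'" "finite D'" "D' \<subseteq> \<Omega>"
  shows "known b (insert x D') = known b (insert x D) \<union> known b D'"
proof -
  have x\<Omega>: "x \<in> \<Omega>" using low by (simp add: rank_le_def)
  have finD: "finite D" by (rule finite_subset[OF sub(3,4)])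
  have fin: "finite C'" "finite D" using finite_subset[OF sub(2) finD] finD by auto
  have "i \<in> known b (insert x D) \<union> known b D'" if i: "i \<in> known b (insert x D')" for i
  proof (rule ccontr)
    assume neg: "i \<notin> known b (insert x D) \<union> known b D'"
    have "i \<notin> cl (set b \<union> {})" using i X_nonalg by (auto simp: known_def)
    then have "violations b {} 1 x D" using i neg sub by auto
    then have "violations b {} r x D" using least fin sub x\<Omega> by (auto simp: least_rank_def)
    then have r: "violations b {} r x C'" using violations_mono sub by blast
    obtain j where j: "j \<in> known b (insert x C')" "j \<notin> known b (insert x C)" "j \<notin> known b C'"
      using v by (auto simp: violation_def)
    have "j \<notin> cl (set b \<union> {})" using j X_nonalg by (auto simp: known_def)
    moreover have "C' \<subseteq> \<Omega>" using sub by auto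
    ultimately have "violations b {} (Suc r) x C" unfolding violations.simps using j r sub(1) fin(1) by blast
    then show False using low by (simp add: rank_le_def del: violations.simps)
  qed
  moreover have "known b (insert x D) \<union> known b D' \<subseteq> known b (insert x D')"
    by (intro Un_least known_mono) (use sub in auto)
  ultimately show ?thesis by blast
qed

text \<open>Each element of a difference set witnesses violations at both members of the pair.\<close>

definition diff :: "'a list \<Rightarrow> 'a set \<Rightarrow> 'a \<Rightarrow> 'a \<Rightarrow> 'a set" where
  "diff b C x y = known b (insert x (insert y C)) - known b (insert x C) - known b (insert y C)"

lemma diff_violation:
  assumes "i \<in> diff b C x y"
  shows "violation b C x (insert y C)" "violation b C y (insert x C)"
proof -
  have "insert x (insert y C) = insert y (insert x C)" by auto
  then show "violation b C x (insert y C)" "violation b C y (insert x C)"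
    using assms by (auto simp: diff_def violation_def)
qed

text \<open>A pair with a difference set can be doubled: moving \<open>x\<close> generically over \<open>y\<close>, the difference set of \<open>x\<close> and its
  image contains two disjoint copies.  Boundedness of algebraic closures therefore excludes such pairs.\<close>

lemma no_diff_pair:
  assumes b: "b \<in> Par" and least: "least_rank b r" and low: "rank_le b r x C" "rank_le b r y C"
  shows "diff b C x y = {}"
proof (rule ccontr)
  assume ne: "diff b C x y \<noteq> {}"
  have C: "finite C" "C \<subseteq> \<Omega>" using low by (auto simp: rank_le_def)
  have bs: "finite (set b)" "set b \<subseteq> \<Omega>" using Par_subset[OF b] by auto
  obtain N where N: "\<And>A. finite A \<Longrightarrow> A \<subseteq> \<Omega> \<Longrightarrow> card A \<le> card (set b) + card C + 2 \<Longrightarrow> card (cl A) \<le> N"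
    using card_cl_bounded by blast
  let ?P = "\<lambda>(x, y). rank_le b r x C \<and> rank_le b r y C"
  let ?f = "\<lambda>(x, y). card (diff b C x y)"
  have fin: "finite (known b (insert x (insert y C)))" if "?P (x, y)" for x y
    using that b by (intro known_finite) (auto simp: rank_le_def)
  have bound: "\<forall>p. ?P p \<longrightarrow> ?f p < Suc N"
  proof (clarify)
    fix x y assume xy: "rank_le b r x C" "rank_le b r y C"
    let ?A = "set b \<union> insert x (insert y C)"
    have A: "finite ?A" "?A \<subseteq> \<Omega>" using xy bs by (auto simp: rank_le_def)
    have "card ?A \<le> card (set b) + card (insert x (insert y C))" by (rule card_Un_le)
    also have "card (insert x (insert y C)) \<le> Suc (Suc (card C))"
      by (simp add: card_insert_if C(1))
    finally have "card (cl ?A) \<le> N" using N A by simp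
    moreover have "diff b C x y \<subseteq> cl ?A" by (auto simp: diff_def known_def)
    ultimately show "card (diff b C x y) < Suc N" using card_mono[OF finite_cl[OF A]] by (meson le_imp_less_Suc le_trans)
  qed
  obtain p where p: "?P p" "\<And>q. ?P q \<Longrightarrow> ?f q \<le> ?f p"
    using ex_has_greatest_nat[of ?P "(x, y)" ?f "Suc N"] low bound by blast
  obtain x0 x1 where x01: "p = (x0, x1)" by (cases p)
  have low0: "rank_le b r x0 C" and low1: "rank_le b r x1 C" using p(1) x01 by auto
  have x\<Omega>: "x0 \<in> \<Omega>" "x1 \<in> \<Omega>" using low0 low1 by (auto simp: rank_le_def)
  let ?s = "\<lambda>A. known b (A \<union> C)"
  have "?f (x, y) \<le> ?f p" using p(2) low by blast
  moreover have "?f (x, y) > 0" using ne fin[of x y] low by (auto simp: card_gt_0_iff diff_def)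
  ultimately have ne0: "diff b C x0 x1 \<noteq> {}" using x01 by auto
  let ?A = "set b \<union> insert x1 C"
  let ?S = "known b (insert x0 (insert x1 C))"
  let ?F = "?S - known b (insert x1 C)"
  have A: "finite ?A" "?A \<subseteq> \<Omega>" "set b \<subseteq> ?A" using bs C x\<Omega> by auto
  have finS: "finite ?S" using fin p(1) x01 by blast
  have "\<exists>g\<in>stab ?A. \<forall>f\<in>?F. g f \<notin> cl (insert x0 ?A)"
    using A x\<Omega> finS by (intro move_set) (auto simp: known_def)
  then obtain g where g: "g \<in> stab ?A" "\<And>f. f \<in> ?F \<Longrightarrow> g f \<notin> cl (insert x0 ?A)" by blast
  have gb: "g \<in> stab (set b)" "g \<in> stab (set b \<union> C)" using g(1) stab_mono[of "set b" ?A] stab_mono[of "set b \<union> C" ?A] by auto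
  have gG: "g \<in> G" using g stabD by blast
  have gC: "g ` C = C" "g x1 = x1" using stab_image[OF g(1)] stabD(2)[OF g(1)] by auto
  define x2 where "x2 = g x0"
  have low2: "rank_le b r x2 C" using rank_le_image[OF gb(2) low0] by (simp add: x2_def)
  have x2\<Omega>: "x2 \<in> \<Omega>" using low2 by (auto simp: rank_le_def)
  have gk: "known b (insert x2 (insert x1 C)) = g ` ?S" "known b (insert x1 C) = g ` known b (insert x1 C)"
    "known b (insert x2 C) = g ` known b (insert x0 C)"
  proof -
    have *: "known b (g ` A) = g ` known b A" for A
    proof -
      have "w \<in> known b (g ` A) \<longleftrightarrow> w \<in> g ` known b A" for w
        using known_stab[OF gb(1), of "inv g w" A] gG by (simp add: G_image_iff)
      then show ?thesis by blast
    qed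
    show "known b (insert x2 (insert x1 C)) = g ` ?S" "known b (insert x1 C) = g ` known b (insert x1 C)"
      "known b (insert x2 C) = g ` known b (insert x0 C)"
      using *[of "insert x0 (insert x1 C)"] *[of "insert x1 C"] *[of "insert x0 C"] gC by (simp_all add: x2_def)
  qed
  let ?D = "insert x0 (insert x1 (insert x2 C))"
  let ?k01 = "?S" and ?k12 = "known b (insert x2 (insert x1 C))" and ?k02 = "known b (insert x0 (insert x2 C))"
  have gF: "g f \<notin> ?k01" if "f \<in> ?F" for f
    using g(2)[OF that] by (auto simp: known_def insert_commute)
  have k12: "?k12 \<inter> ?k01 = known b (insert x1 C)"
  proof
    show "?k12 \<inter> ?k01 \<subseteq> known b (insert x1 C)"
    proof
      fix w assume w: "w \<in> ?k12 \<inter> ?k01"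
      then obtain f where f: "f \<in> ?S" "w = g f" using gk(1) by auto
      then have "f \<in> known b (insert x1 C)" using gF w by blast
      then show "w \<in> known b (insert x1 C)" using gk(2) f(2) by blast
    qed
    show "known b (insert x1 C) \<subseteq> ?k12 \<inter> ?k01" by (intro Int_greatest known_mono) auto
  qed
  obtain i where i: "i \<in> diff b C x0 x1" using ne0 by blast
  have "g i \<in> g ` ?S - g ` known b (insert x0 C) - g ` known b (insert x1 C)"
    using i gG by (auto simp: diff_def)
  then have "g i \<in> diff b C x2 x1" unfolding diff_def gk(1,3) gk(2)[symmetric] .
  note v01 = diff_violation[OF i] and v21 = diff_violation[OF this]
  have finD: "finite ?D" "?D \<subseteq> \<Omega>" using C x\<Omega> x2\<Omega> by auto
  have t1: "known b ?D = ?k01 \<union> ?k12"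
    using no_second_violation[OF b least low0 v01(1), of "insert x1 C" "insert x1 (insert x2 C)"] C x\<Omega> x2\<Omega>
    by (auto simp: insert_commute)
  have t2: "known b ?D = ?k01 \<union> ?k02"
    using no_second_violation[OF b least low1 v01(2), of "insert x0 C" "insert x0 (insert x2 C)"] C x\<Omega> x2\<Omega>
    by (auto simp: insert_commute)
  have t3: "known b ?D = ?k12 \<union> ?k02"
    using no_second_violation[OF b least low1 v21(2), of "insert x2 C" "insert x0 (insert x2 C)"] C x\<Omega> x2\<Omega>
    by (auto simp: insert_commute)
  have mono: "known b (insert x0 C) \<subseteq> ?k01" "known b (insert x2 C) \<subseteq> ?k12"
    "known b (insert x0 C) \<subseteq> ?k02" "known b (insert x2 C) \<subseteq> ?k02"
    by (intro known_mono; auto)+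
  let ?d0 = "diff b C x0 x1"
  have d0: "?d0 \<subseteq> ?k01" "?d0 \<inter> ?k12 = {}" "?d0 \<inter> known b (insert x0 C) = {}"
    using k12 by (auto simp: diff_def)
  have d1: "g ` ?d0 \<subseteq> ?k12" "g ` ?d0 \<inter> ?k01 = {}" "g ` ?d0 \<inter> known b (insert x2 C) = {}"
    using gk gF gG by (auto simp: diff_def)
  have "?d0 \<subseteq> ?k02" using d0(1,2) t1 t3 by blast
  moreover have "g ` ?d0 \<subseteq> ?k02" using d1(1,2) t1 t2 by blast
  moreover have "?d0 \<inter> known b (insert x2 C) = {}" using d0(2) mono(2) by blast
  moreover have "g ` ?d0 \<inter> known b (insert x0 C) = {}" using d1(2) mono(1) by blast
  ultimately have "?d0 \<union> g ` ?d0 \<subseteq> diff b C x0 x2"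
    using d0(3) d1(3) unfolding diff_def[of b C x0 x2] by blast
  moreover have fin02: "finite (diff b C x0 x2)" using fin[of x0 x2] low0 low2 by (simp add: diff_def)
  moreover have "?d0 \<inter> g ` ?d0 = {}" using d0 d1 by blast
  moreover have fd: "finite ?d0" using finS by (simp add: diff_def)
  moreover have "card (g ` ?d0) = card ?d0" using G_inj[OF gG] by (meson card_image inj_on_subset subset_UNIV)
  ultimately have "card ?d0 + card ?d0 \<le> card (diff b C x0 x2)"
    using card_mono[of "diff b C x0 x2" "?d0 \<union> g ` ?d0"] by (simp add: card_Un_disjoint)
  moreover have "card (diff b C x0 x2) \<le> card ?d0" using p(2)[of "(x0, x2)"] low0 low2 x01 by simp
  moreover have "card ?d0 > 0" using ne0 fd by (simp add: card_gt_0_iff)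
  ultimately show False by simp
qed

text \<open>Conjugates of \<open>F\<close> over \<open>A\<close>, each of them independent of the earlier conjugates of \<open>a\<close> and \<open>i\<close>.\<close>

lemma spread_conjugates:
  assumes A: "finite A" "A \<subseteq> \<Omega>" "set b \<subseteq> A" and F: "finite F" "F \<subseteq> X b" "F \<inter> cl A = {}"
    and a: "a \<in> \<Omega>" and i: "i \<in> \<Omega>"
  shows "\<exists>g. \<forall>j<n::nat. g j \<in> stab A \<and>
    (\<forall>f\<in>F. g j f \<notin> cl (A \<union> ((\<lambda>m. g m a) ` {..<j} \<union> (\<lambda>m. g m i) ` {..<j})))"
proof (induction n)
  case (Suc n)
  then obtain g where g: "\<And>j. j < n \<Longrightarrow> g j \<in> stab A"
    "\<And>j f. j < n \<Longrightarrow> f \<in> F \<Longrightarrow> g j f \<notin> cl (A \<union> ((\<lambda>m. g m a) ` {..<j} \<union> (\<lambda>m. g m i) ` {..<j}))" by blast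
  let ?U = "\<lambda>g j. A \<union> ((\<lambda>m. g m a) ` {..<j} \<union> (\<lambda>m. g m i) ` {..<j})"
  have "(\<lambda>m. g m a) ` {..<n} \<subseteq> \<Omega>" "(\<lambda>m. g m i) ` {..<n} \<subseteq> \<Omega>" using g(1) stab_mem a i by blast+
  then have "finite (?U g n)" "?U g n \<subseteq> \<Omega>" "A \<subseteq> ?U g n" using A by auto
  from move_set[OF A F this] obtain h where h: "h \<in> stab A" "\<And>f. f \<in> F \<Longrightarrow> h f \<notin> cl (?U g n)" by blast
  have "(g(n := h)) j \<in> stab A \<and> (\<forall>f\<in>F. (g(n := h)) j f \<notin> cl (?U (g(n := h)) j))" if j: "j < Suc n" for j
  proof -
    have "?U (g(n := h)) j = ?U g j" using j by (intro arg_cong2[where f = "(\<union>)"] image_cong refl) auto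
    moreover have "g j \<in> stab A \<and> (\<forall>f\<in>F. g j f \<notin> cl (?U g j))" if "j \<noteq> n" using g j that by auto
    ultimately show ?thesis using h by (cases "j = n") auto
  qed
  then show ?case by blast
qed simp

lemma exists_least_rank:
  assumes b: "b \<in> Par" and v: "finite C0" "insert a0 C0 \<subseteq> \<Omega>" "violations b {} 1 a0 C0"
  shows "\<exists>r a C. least_rank b r \<and> rank_le b r a C \<and> violations b {} 1 a C"
proof -
  obtain N where N: "\<And>a C. finite C \<Longrightarrow> insert a C \<subseteq> \<Omega> \<Longrightarrow> \<not> violations b {} N a C"
    using violations_bounded b by blast
  have step: "\<exists>r'. 0 < r' \<and> r' < r \<and> violations b {} r' a C \<and> \<not> violations b {} (Suc r') a C"
    if "violations b {} 1 a C" "\<not> violations b {} r a C" for r a C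
  proof (rule ccontr)
    assume neg: "\<not> ?thesis"
    have "n < r \<longrightarrow> violations b {} (Suc n) a C" for n
    proof (induction n)
      case 0
      then show ?case using that(1) by simp
    next
      case (Suc n)
      then show ?case using neg by (metis Suc_lessD zero_less_Suc)
    qed
    moreover have "r \<noteq> 0" using that(2) by (cases r) auto
    ultimately show False using that(2) by (metis Suc_pred lessI neq0_conv)
  qed
  let ?Q = "\<lambda>r. 0 < r \<and> (\<exists>a C. finite C \<and> insert a C \<subseteq> \<Omega> \<and> violations b {} 1 a C \<and> \<not> violations b {} (Suc r) a C)"
  have "\<exists>r. ?Q r" using step[OF v(3) N[OF v(1,2)]] v by blast
  then have Q: "?Q (LEAST r. ?Q r)" by (rule LeastI_ex)
  define r where "r = (LEAST r. ?Q r)"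
  obtain a C where aC: "0 < r" "finite C" "insert a C \<subseteq> \<Omega>" "violations b {} 1 a C" "\<not> violations b {} (Suc r) a C"
    using Q unfolding r_def by blast
  have "violations b {} r a' C'" if a': "finite C'" "insert a' C' \<subseteq> \<Omega>" "violations b {} 1 a' C'" for a' C'
  proof (rule ccontr)
    assume "\<not> violations b {} r a' C'"
    then obtain r' where r': "0 < r'" "r' < r" "\<not> violations b {} (Suc r') a' C'" using step[OF a'(3)] by blast
    have "?Q r'"
    proof (intro conjI exI)
      show "0 < r'" "finite C'" "insert a' C' \<subseteq> \<Omega>" "violations b {} 1 a' C'" "\<not> violations b {} (Suc r') a' C'"
        using r' a' by blast+
    qed
    then have "r \<le> r'" unfolding r_def by (rule Least_le)
    then show False using r' by simp
  qed
  then have "least_rank b r" using aC(1) unfolding least_rank_def by blast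
  moreover have "rank_le b r a C" using aC unfolding rank_le_def by blast
  ultimately show ?thesis using aC(4) by blast
qed

text \<open>A violation leads to a pair with a difference set: among many conjugates of \<open>a\<close> over \<open>C'\<close>, some element known
  over \<open>C'\<close> and one of them has to be known over \<open>C\<close> and the conjugates alone, since otherwise conjugates of \<open>C'\<close>
  would shatter the pairs \<open>(g j a, g j i)\<close>.\<close>

theorem no_violation:
  assumes b: "b \<in> Par" and C0: "finite C0'" "C0' \<subseteq> \<Omega>" "C0 \<subseteq> C0'" "a0 \<in> \<Omega>"
  shows "\<not> violation b C0 a0 C0'"
proof
  assume v0: "violation b C0 a0 C0'"
  obtain i0 where i0: "i0 \<in> known b (insert a0 C0')" "i0 \<notin> known b (insert a0 C0)" "i0 \<notin> known b C0'"
    using v0 by (auto simp: violation_def)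
  have "i0 \<notin> cl (set b \<union> {})" using i0(1) X_nonalg by (auto simp: known_def)
  then have "violations b {} 1 a0 C0"
    unfolding One_nat_def violations.simps using i0 C0 by blast
  moreover have "finite C0" using C0 finite_subset by blast
  moreover have "insert a0 C0 \<subseteq> \<Omega>" using C0 by auto
  ultimately obtain r a C where least: "least_rank b r" and low: "rank_le b r a C" and v: "violations b {} 1 a C"
    using exists_least_rank[OF b, of C0 a0] by blast
  obtain C' i where C': "finite C'" "C' \<subseteq> \<Omega>" "C \<subseteq> C'" "i \<in> known b (insert a C')"
     "i \<notin> known b (insert a C)" "i \<notin> known b C'"
    using v by auto
  have viol: "violation b C a C'" using C' by (auto simp: violation_def)
  have bs: "finite (set b)" "set b \<subseteq> \<Omega>" using Par_subset[OF b] by auto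
  have a\<Omega>: "a \<in> \<Omega>" and CF: "finite C" "C \<subseteq> \<Omega>" using low by (auto simp: rank_le_def)
  have iX: "i \<in> X b" and i\<Omega>: "i \<in> \<Omega>" using C' X_in by (auto simp: known_def)
  let ?A = "set b \<union> C'"
  let ?F = "known b (insert a C') - known b C'"
  have A: "finite ?A" "?A \<subseteq> \<Omega>" "set b \<subseteq> ?A" using bs C' by auto
  have F: "finite ?F" "?F \<subseteq> X b" "?F \<inter> cl ?A = {}" "i \<in> ?F"
    using C' a\<Omega> known_finite[OF b, of "insert a C'"] by (auto simp: known_def)
  obtain as where as: "set as = ?A" using finite_list[OF A(1)] by (elim exE)
  define R :: "'a list \<Rightarrow> 'a list \<Rightarrow> bool" where "R xs ys \<longleftrightarrow> xs ! 1 \<in> cl (insert (xs ! 0) (set ys))" for xs ys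
  have inv: "invariant_rel G \<Omega> 2 (length as) R"
    unfolding invariant_rel_def
  proof (intro ballI)
    fix g xs ys assume g: "g \<in> G" and xs: "xs \<in> tups \<Omega> 2"
    have "map g xs ! 1 = g (xs ! 1)" "map g xs ! 0 = g (xs ! 0)" using xs by (auto simp: tups_def)
    then show "R (map g xs) (map g ys) \<longleftrightarrow> R xs ys"
      using cl_image_mem[OF g, of "xs ! 1" "insert (xs ! 0) (set ys)"] by (simp add: R_def)
  qed
  obtain n :: nat where n: "\<forall>a. (\<forall>i<n. a i \<in> tups \<Omega> 2) \<longrightarrow>
     (\<exists>W\<subseteq>{..<n}. \<forall>b\<in>tups \<Omega> (length as). \<exists>i<n. R (a i) b \<longleftrightarrow> i \<notin> W)"
    using no_shattering[OF inv] by (elim exE)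
  obtain g where g: "\<And>j. j < n \<Longrightarrow> g j \<in> stab ?A"
    "\<And>j f. j < n \<Longrightarrow> f \<in> ?F \<Longrightarrow> g j f \<notin> cl (?A \<union> ((\<lambda>m. g m a) ` {..<j} \<union> (\<lambda>m. g m i) ` {..<j}))"
    using spread_conjugates[OF A F(1-3) a\<Omega> i\<Omega>, of n] by blast
  define p q where "p j = g j a" and "q j = g j i" for j
  have gb: "g j \<in> stab (set b)" "g j \<in> stab (set b \<union> C)" "g j ` C' = C'" "g j ` C = C" if "j < n" for j
    using g(1)[OF that] stab_mono[of "set b" ?A] stab_mono[of "set b \<union> C" ?A] C'(3)
      stab_image[OF g(1)[OF that], of C'] stab_image[OF g(1)[OF that], of C] by auto
  have p\<Omega>: "p j \<in> \<Omega>" and qX: "q j \<in> X b" "q j \<in> \<Omega>" if "j < n" for j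
    using stab_mem[OF g(1)[OF that]] a\<Omega> i\<Omega> X_stab[OF gb(1)[OF that] subset_refl] iX by (auto simp: p_def q_def)
  have qk: "q j \<in> known b (insert (p j) C')" "q j \<notin> known b (insert (p j) C)" "q j \<notin> known b C'" if "j < n" for j
    using known_stab[OF gb(1)[OF that], of i "insert a C'"] known_stab[OF gb(1)[OF that], of i "insert a C"]
      known_stab[OF gb(1)[OF that], of i "C'"] C'(4-6) gb(3,4)[OF that] by (simp_all add: p_def q_def)
  have qq: "q j \<notin> cl (insert (q l) (set b))" if "l \<noteq> j" "l < n" "j < n" for l j
  proof -
    have less: "q j \<notin> cl (insert (q l) (set b))" if "l < j" "j < n" for l j
      using g(2)[OF that(2) F(4)] cl_mono'[of "q j" "insert (q l) (set b)" "?A \<union> ((\<lambda>m. g m a) ` {..<j} \<union> (\<lambda>m. g m i) ` {..<j})"] that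
      by (auto simp: q_def)
    show ?thesis
    proof (cases "l < j")
      case False
      then have "j < l" using that by auto
      then show ?thesis
        using less[of j l] exchange[OF bs subset_refl subset_refl qX(1)[OF that(2)] qX(1)[OF that(3)] _ X_nonalg[OF qX(1)[OF that(3)]]] that by blast
    qed (use less that in blast)
  qed
  have "\<exists>l<n. q l \<in> known b (C \<union> p ` {..<n})"
  proof (rule ccontr)
    assume neg: "\<not> ?thesis"
    let ?B = "set b \<union> (C \<union> p ` {..<n})"
    have B: "finite ?B" "?B \<subseteq> \<Omega>" "set b \<subseteq> ?B" using bs CF p\<Omega> by auto
    have qB: "q l \<notin> cl ?B" if "l < n" for l using neg qX[OF that] that by (auto simp: known_def)
    have free: "q j \<notin> cl (?B \<union> (q ` {..<n} - {q j}))" if j: "j < n" for j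
    proof
      assume "q j \<in> cl (?B \<union> (q ` {..<n} - {q j}))"
      then have "\<exists>s\<in>q ` {..<n} - {q j}. q j \<in> cl (insert s ?B)"
        using qX qB[OF j] j by (intro trivial_pregeometry[OF B B(3)]) auto
      then obtain l where l: "l < n" "q l \<noteq> q j" "q j \<in> cl (insert (q l) ?B)" by auto
      then have "q j \<in> cl (insert (q l) (set b))" using pt_interaction[OF B qX(1) qX(1) _ qB] j by blast
      then show False using qq[of l j] l j by auto
    qed
    have "\<forall>j<n. [p j, q j] \<in> tups \<Omega> 2" using p\<Omega> qX by (auto simp: tups_def)
    then obtain W where W: "W \<subseteq> {..<n}" "\<forall>b\<in>tups \<Omega> (length as). \<exists>j<n. R [p j, q j] b \<longleftrightarrow> j \<notin> W"
      using n[rule_format, of "\<lambda>j. [p j, q j]"] by blast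
    let ?Y = "p ` {..<n} \<union> q ` W" and ?M = "q ` ({..<n} - W)"
    let ?U = "?B \<union> C'"
    have "\<exists>h\<in>stab ?B. (\<forall>y\<in>?Y. h y = id y) \<and> (\<forall>r\<in>?M. h r \<notin> cl (?U \<union> h ` (?M - {r})))"
    proof (rule fresh_set[OF B(1,2) stab_id])
      fix s assume "s \<in> ?M"
      then obtain j where j: "j < n" "j \<notin> W" "s = q j" by auto
      have "q l \<noteq> q j" if "l \<in> W" for l
      proof
        assume "q l = q j"
        moreover have "l < n" "l \<noteq> j" using that W j by auto
        moreover have "q l \<in> cl (insert (q l) (set b))" using qX(2)[OF \<open>l < n\<close>] by (intro cl_self) auto
        ultimately show False using qq[of l j] j by simp
      qed
      then have "?B \<union> ?Y \<union> (?M - {s}) \<subseteq> ?B \<union> (q ` {..<n} - {q j})" using W j by auto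
      then have "cl (?B \<union> ?Y \<union> (?M - {s})) \<subseteq> cl (?B \<union> (q ` {..<n} - {q j}))" by (rule cl_mono)
      then show "s \<notin> cl (?B \<union> ?Y \<union> (?M - {s}))" using free[OF j(1)] j(3) by auto
    next
      have "?M \<subseteq> X b" using qX by auto
      then show "?M \<subseteq> pt ?B" using B(3) by (auto simp: pt_def)
      show "finite ?Y" "finite ?U" using finite_subset[OF W(1)] B(1) C'(1) by auto
      show "?Y \<subseteq> \<Omega>" "?U \<subseteq> \<Omega>" using W p\<Omega> qX B(2) C'(2) by auto
    qed auto
    then obtain h where h: "h \<in> stab ?B" "\<And>y. y \<in> ?Y \<Longrightarrow> h y = y" "\<And>r. r \<in> ?M \<Longrightarrow> h r \<notin> cl (?U \<union> h ` (?M - {r}))"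
      by auto
    have hG: "h \<in> G" using h stabD by blast
    have "map (inv h) as \<in> tups \<Omega> (length as)" using as A G_inv[OF hG] by (auto simp: tups_def)
    then obtain j where j: "j < n" "R [p j, q j] (map (inv h) as) \<longleftrightarrow> j \<notin> W" using W(2) by blast
    have "h ` inv h ` ?A = ?A" using hG by (force simp: image_image)
    then have "R [p j, q j] (map (inv h) as) \<longleftrightarrow> h (q j) \<in> cl (insert (h (p j)) ?A)"
      using cl_image_mem[OF hG, of "q j" "insert (p j) (inv h ` ?A)"] as by (simp add: R_def)
    also have "h (p j) = p j" using h(2) j by simp
    also have "h (q j) \<in> cl (insert (p j) ?A) \<longleftrightarrow> j \<in> W"
    proof (cases "j \<in> W")
      case True
      then show ?thesis using h(2)[of "q j"] qk(1)[OF j(1)] by (simp add: known_def)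
    next
      case False
      then have "h (q j) \<notin> cl (?U \<union> h ` (?M - {q j}))" using h(3) j by blast
      then have "h (q j) \<notin> cl (insert (p j) ?A)"
        using cl_mono'[of "h (q j)" "insert (p j) ?A" "?U \<union> h ` (?M - {q j})"] j by auto
      then show ?thesis using False by simp
    qed
    finally show False using j(2) by blast
  qed
  then obtain l where l: "l < n" "q l \<in> known b (C \<union> p ` {..<n})" by blast
  have lowp: "rank_le b r (p j) C" if "j < n" for j
    using rank_le_image[OF gb(2)[OF that] low] by (simp add: p_def)
  have violp: "violation b C (p j) C'" if "j < n" for j
    using qk[OF that] by (auto simp: violation_def)
  have tame: "known b (p ` S \<union> C') = known b C' \<union> (\<Union>j\<in>S. known b (insert (p j) C'))" if S: "S \<subseteq> {..<n}" for S
  proof -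
    have "finite S" using S finite_subset by blast
    then show ?thesis using S
    proof (induction S rule: finite_induct)
      case (insert j S)
      have "known b (insert (p j) (p ` S \<union> C')) = known b (insert (p j) C') \<union> known b (p ` S \<union> C')"
        using insert.prems insert.hyps p\<Omega> C'
        by (intro no_second_violation[OF b least lowp violp]) auto
      then show ?case using insert by auto
    qed simp
  qed
  have l_out: "q l \<notin> known b (p ` ({..<n} - {l}) \<union> C')"
  proof
    assume "q l \<in> known b (p ` ({..<n} - {l}) \<union> C')"
    then obtain j where j: "j < n" "j \<noteq> l" "q l \<in> known b (insert (p j) C')"
      using tame[of "{..<n} - {l}"] qk(3)[OF l(1)] by auto
    show False
    proof (cases "j < l")
      case True
      then show False
        using g(2)[OF l(1) F(4)] j(3) cl_mono'[of "q l" "set b \<union> insert (p j) C'" "?A \<union> ((\<lambda>m. g m a) ` {..<l} \<union> (\<lambda>m. g m i) ` {..<l})"]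
        by (auto simp: known_def q_def p_def)
    next
      case False
      then have lj: "l < j" using j by auto
      have gj: "g j \<in> G" using g(1)[OF j(1)] stabD by blast
      let ?w = "inv (g j) (q l)"
      have w: "g j ?w = q l" using gj by simp
      have "?w \<in> known b (insert a C')" "?w \<notin> known b C'"
        using known_stab[OF gb(1)[OF j(1)], of ?w "insert a C'"] known_stab[OF gb(1)[OF j(1)], of ?w C'] j(3) qk(3)[OF l(1)]
          gb(3)[OF j(1)] w by (simp_all add: p_def)
      then have "g j ?w \<notin> cl (?A \<union> ((\<lambda>m. g m a) ` {..<j} \<union> (\<lambda>m. g m i) ` {..<j}))" using g(2)[OF j(1)] by blast
      moreover have "q l \<in> cl (?A \<union> ((\<lambda>m. g m a) ` {..<j} \<union> (\<lambda>m. g m i) ` {..<j}))"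
        using lj qX(2)[OF l(1)] by (intro cl_self) (auto simp: q_def)
      ultimately show False using w by simp
    qed
  qed
  let ?P = "\<lambda>T. T \<subseteq> {..<n} \<and> q l \<in> known b (C \<union> p ` T)"
  have "\<exists>T. ?P T \<and> (\<forall>T'. ?P T' \<longrightarrow> card T \<le> card T')"
    using ex_has_least_nat[of ?P "{..<n}" card] l by blast
  then obtain T where T: "?P T" "\<And>T'. ?P T' \<Longrightarrow> card T \<le> card T'" by blast
  have finT: "finite T" using T finite_subset by blast
  have min: "q l \<notin> known b (C \<union> p ` (T - {s}))" if "s \<in> T" for s
  proof
    assume "q l \<in> known b (C \<union> p ` (T - {s}))"
    then have "card T \<le> card (T - {s})" using T(1) by (intro T(2)) auto
    then show False using that finT by (metis card_Diff1_less not_less)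
  qed
  have lT: "l \<in> T"
  proof (rule ccontr)
    assume "l \<notin> T"
    then have "C \<union> p ` T \<subseteq> p ` ({..<n} - {l}) \<union> C'" using T(1) C'(3) by auto
    then show False using known_mono T(1) l_out by blast
  qed
  have "T \<noteq> {l}" using T(1) qk(2)[OF l(1)] by auto
  then obtain m where m: "m \<in> T" "m \<noteq> l" using lT by blast
  let ?C1 = "C \<union> p ` (T - {l} - {m})"
  have mn: "m < n" using m T by auto
  have C1: "finite ?C1" "?C1 \<subseteq> \<Omega>" "C \<subseteq> ?C1" using CF finT T(1) p\<Omega> by auto
  have eqs: "insert (p l) (C \<union> p ` (T - {l})) = C \<union> p ` T" using lT by auto
  have sub: "insert (p l) ?C1 = C \<union> p ` (T - {m})" "insert (p m) ?C1 = C \<union> p ` (T - {l})" using lT m by auto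
  have "q l \<in> diff b ?C1 (p l) (p m)"
    unfolding diff_def sub eqs using T(1) min[OF lT] min[OF m(1)] by blast
  moreover have "diff b ?C1 (p l) (p m) = {}"
    using rank_le_mono[OF lowp C1(3,1,2)] l(1) mn by (intro no_diff_pair[OF b least]) auto
  ultimately show False by blast
qed

text \<open>A minimal set \<open>T\<close> over which \<open>x\<close> is algebraic and which is contained in neither \<open>A\<close> nor \<open>B\<close> has two elements, and \<open>x\<close>
  witnesses a violation at one of them, with respect to the remaining ones.\<close>

theorem algebraic_over_union:
  assumes A: "finite A" "A \<subseteq> \<Omega>" "finite B" "B \<subseteq> \<Omega>" and x: "x \<in> X b" "x \<in> cl (set b \<union> (A \<union> B))"
  shows "x \<in> cl (set b \<union> A) \<or> x \<in> cl (set b \<union> B)"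
proof (rule ccontr)
  assume neg: "\<not> ?thesis"
  have b: "b \<in> Par" using X_Par[OF x(1)] .
  let ?P = "\<lambda>T. T \<subseteq> A \<union> B \<and> x \<in> cl (set b \<union> T)"
  have "\<exists>T. ?P T \<and> (\<forall>T'. ?P T' \<longrightarrow> card T \<le> card T')"
    using ex_has_least_nat[of ?P "A \<union> B" card] x by blast
  then obtain T where T: "?P T" "\<And>T'. ?P T' \<Longrightarrow> card T \<le> card T'" by blast
  have finT: "finite T" using T(1) A finite_subset[of T "A \<union> B"] by blast
  have min: "x \<notin> cl (set b \<union> (T - {s}))" if "s \<in> T" for s
  proof
    assume "x \<in> cl (set b \<union> (T - {s}))"
    then have "card T \<le> card (T - {s})" using T(1) by (intro T(2)) auto
    then show False using that finT by (metis card_Diff1_less not_less)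
  qed
  have nsub: "\<not> T \<subseteq> A" "\<not> T \<subseteq> B" using neg T(1) cl_mono'[of x "set b \<union> T" "set b \<union> A"] cl_mono'[of x "set b \<union> T" "set b \<union> B"] by auto
  then obtain s t where st: "s \<in> T" "s \<notin> A" "t \<in> T" "t \<notin> B" by blast
  then have ne: "s \<noteq> t" using T(1) by auto
  let ?C = "T - {s} - {t}"
  have ins: "insert s (insert t ?C) = T" "insert s ?C = T - {t}" "insert t ?C = T - {s}" using st ne by auto
  have "violation b ?C s (insert t ?C)"
    unfolding violation_def ins(2,3) insert_Diff[OF st(1)]
    using T(1) min[OF st(1)] min[OF st(3)] x(1) by (intro exI[of _ x]) (auto simp: known_def)
  moreover have "\<not> violation b ?C s (insert t ?C)"
    using finT T(1) A st by (intro no_violation[OF b]) auto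
  ultimately show False by blast
qed

end

section \<open>Coordinates\<close>

context minimal_type
begin

text \<open>An equivalence relation on the realizations of conjugates of the minimal type; its classes are called coordinates.  Both
  elements have to be generic over both parameter tuples, since algebraic elements would be interalgebraic with everything.\<close>

definition interalg :: "'a list \<times> 'a \<Rightarrow> 'a list \<times> 'a \<Rightarrow> bool" where
  "interalg p q \<longleftrightarrow> p \<in> Pts \<and> q \<in> Pts \<and> snd p \<notin> cl (set (fst p) \<union> set (fst q)) \<and>
     snd q \<notin> cl (set (fst p) \<union> set (fst q)) \<and> snd q \<in> cl (insert (snd p) (set (fst p) \<union> set (fst q)))"

lemma interalg_iff:
  "interalg (b, x) (c, y) \<longleftrightarrow> x \<in> X b \<and> y \<in> X c \<and> x \<notin> cl (set b \<union> set c) \<and> y \<notin> cl (set b \<union> set c) \<and>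
     y \<in> cl (insert x (set b \<union> set c))"
  by (simp add: interalg_def Pts_iff)

lemma X_params: "x \<in> X b \<Longrightarrow> finite (set b) \<and> set b \<subseteq> \<Omega>"
  using X_Par Par_subset by blast

lemma interalg_refl: "x \<in> X b \<Longrightarrow> interalg (b, x) (b, x)"
  using X_nonalg[of x b] X_in[of x b] cl_self[of x "insert x (set b)"] by (simp add: interalg_iff)

lemma interalg_sym: "interalg (b, x) (c, y) \<Longrightarrow> interalg (c, y) (b, x)"
  using exchange[of "set b \<union> set c" b c x y] X_params[of x b] X_params[of y c]
  by (auto simp: interalg_iff Un_commute)

text \<open>The element \<open>y\<close> in the middle is generic over all three parameter tuples by \<open>algebraic_over_union\<close>.  Over these tuples
  \<open>x\<close> and \<open>z\<close> are then interalgebraic, and the parameters of \<open>y\<close> can be dropped by \<open>interaction_over_base\<close>.\<close>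

lemma interalg_trans:
  assumes xy: "interalg (b, x) (c, y)" and yz: "interalg (c, y) (e, z)"
  shows "interalg (b, x) (e, z)"
proof -
  have X: "x \<in> X b" "y \<in> X c" "z \<in> X e" using xy yz by (auto simp: interalg_iff)
  have fin: "finite (set b)" "set b \<subseteq> \<Omega>" "finite (set c)" "set c \<subseteq> \<Omega>" "finite (set e)" "set e \<subseteq> \<Omega>"
    using X X_params by auto
  have yn: "y \<notin> cl (set c \<union> set b)" "y \<notin> cl (set c \<union> set e)" using xy yz by (auto simp: interalg_iff Un_commute)
  have yA: "y \<notin> cl (set c \<union> (set b \<union> set e))"
    using algebraic_over_union[OF fin(1,2,5,6) X(2)] yn by blast
  have *: "w \<notin> cl (set b \<union> set e)" if "y \<in> cl (insert w (set c \<union> (set b \<union> set e)))" for w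
  proof
    assume "w \<in> cl (set b \<union> set e)"
    then have "w \<in> cl (set c \<union> (set b \<union> set e))" using cl_mono'[of w "set b \<union> set e" "set c \<union> (set b \<union> set e)"] by auto
    then show False using that yA cl_trans1 by blast
  qed
  have y1: "y \<in> cl (insert x (set c \<union> (set b \<union> set e)))"
    using xy cl_mono'[of y "insert x (set b \<union> set c)" "insert x (set c \<union> (set b \<union> set e))"] by (auto simp: interalg_iff)
  have y2: "y \<in> cl (insert z (set c \<union> (set b \<union> set e)))"
    using interalg_sym[OF yz] cl_mono'[of y "insert z (set e \<union> set c)" "insert z (set c \<union> (set b \<union> set e))"]
    by (auto simp: interalg_iff)
  let ?A = "set c \<union> (set b \<union> set e)"
  have "z \<in> cl (insert y (insert x ?A))"
    using yz cl_mono'[of z "insert y (set c \<union> set e)" "insert y (insert x ?A)"] by (auto simp: interalg_iff)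
  then have zx: "z \<in> cl (insert x ?A)" using y1 cl_trans1 by blast
  have "z \<notin> cl ?A" using y2 yA cl_trans1 by blast
  then have "z \<in> cl (insert x (set b \<union> set e))"
    using zx X fin by (intro interaction_over_base[of ?A]) auto
  then show ?thesis using *[OF y1] *[OF y2] X by (simp add: interalg_iff)
qed

lemma interalg_image: "g \<in> G \<Longrightarrow> interalg (map g b, g x) (map g c, g y) \<longleftrightarrow> interalg (b, x) (c, y)"
  using X_map[of g x b] X_map[of g y c] cl_image_mem[of g x "set b \<union> set c"] cl_image_mem[of g y "set b \<union> set c"]
    cl_image_mem[of g y "insert x (set b \<union> set c)"] by (simp add: interalg_iff image_Un)

definition coord :: "'a list \<Rightarrow> 'a \<Rightarrow> ('a list \<times> 'a) set" where
  "coord b x = {q. interalg (b, x) q}"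

definition coords :: "'a list \<Rightarrow> ('a list \<times> 'a) set set" where
  "coords b = coord b ` X b"

text \<open>The support of \<open>A\<close>: the coordinates which \<open>A\<close> determines, given their parameters.\<close>

definition supp :: "'a set \<Rightarrow> ('a list \<times> 'a) set set" where
  "supp A = {coord b x | b x. x \<in> X b \<and> x \<in> cl (set b \<union> A)}"

definition act :: "('a \<Rightarrow> 'a) \<Rightarrow> ('a list \<times> 'a) set \<Rightarrow> ('a list \<times> 'a) set" where
  "act g \<iota> = (\<lambda>(b, x). (map g b, g x)) ` \<iota>"

lemma coord_eq_iff: "x \<in> X b \<Longrightarrow> y \<in> X c \<Longrightarrow> coord b x = coord c y \<longleftrightarrow> interalg (b, x) (c, y)"
proof
  assume X: "x \<in> X b" "y \<in> X c" and "coord b x = coord c y"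
  then have "(c, y) \<in> coord b x" using interalg_refl by (simp add: coord_def)
  then show "interalg (b, x) (c, y)" by (simp add: coord_def)
next
  assume a: "interalg (b, x) (c, y)"
  have "interalg (b, x) q \<longleftrightarrow> interalg (c, y) q" for q
    using interalg_trans[OF a] interalg_trans[OF interalg_sym[OF a]] by (cases q) blast
  then show "coord b x = coord c y" by (simp add: coord_def)
qed

text \<open>This makes the support independent of the representatives of coordinates.\<close>

lemma known_interalg:
  assumes xy: "interalg (b, x) (c, y)" and A: "finite A" "A \<subseteq> \<Omega>" and x: "x \<in> cl (set b \<union> A)"
  shows "y \<in> cl (set c \<union> A)"
proof -
  have X: "x \<in> X b" "y \<in> X c" using xy by (auto simp: interalg_iff)
  have fin: "finite (set b)" "set b \<subseteq> \<Omega>" using X X_params by auto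
  have "y \<in> cl (insert x (set c \<union> (set b \<union> A)))"
    using xy cl_mono'[of y "insert x (set b \<union> set c)" "insert x (set c \<union> (set b \<union> A))"] by (auto simp: interalg_iff)
  moreover have "x \<in> cl (set c \<union> (set b \<union> A))" using x cl_mono'[of x "set b \<union> A" "set c \<union> (set b \<union> A)"] by auto
  ultimately have "y \<in> cl (set c \<union> (set b \<union> A))" using cl_trans1 by blast
  moreover have "y \<notin> cl (set c \<union> set b)" using xy by (simp add: interalg_iff Un_commute)
  ultimately show ?thesis using algebraic_over_union[OF fin A X(2)] by blast
qed

lemma supp_iff:
  assumes "finite A" "A \<subseteq> \<Omega>" "x \<in> X b"
  shows "coord b x \<in> supp A \<longleftrightarrow> x \<in> cl (set b \<union> A)"
proof
  assume "coord b x \<in> supp A"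
  then obtain c y where c: "coord b x = coord c y" "y \<in> X c" "y \<in> cl (set c \<union> A)" by (auto simp: supp_def)
  then have "interalg (c, y) (b, x)" using coord_eq_iff[OF c(2) assms(3)] by simp
  then show "x \<in> cl (set b \<union> A)" using known_interalg assms c by blast
qed (use assms in \<open>auto simp: supp_def\<close>)

lemma supp_coord: "\<iota> \<in> supp A \<Longrightarrow> \<exists>b x. x \<in> X b \<and> \<iota> = coord b x"
  by (auto simp: supp_def)

lemma coords_Par: "\<iota> \<in> coords b \<Longrightarrow> b \<in> Par"
  using X_Par by (auto simp: coords_def)

lemma supp_coords: "\<iota> \<in> supp A \<Longrightarrow> \<exists>b. \<iota> \<in> coords b"
  by (auto simp: supp_def coords_def)

lemma supp_mono: "A \<subseteq> B \<Longrightarrow> supp A \<subseteq> supp B"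
proof
  fix \<iota> assume "A \<subseteq> B" "\<iota> \<in> supp A"
  then obtain b x where "x \<in> X b" "x \<in> cl (set b \<union> A)" "\<iota> = coord b x" by (auto simp: supp_def)
  moreover have "x \<in> cl (set b \<union> B)" using calculation(2) cl_mono'[of x "set b \<union> A" "set b \<union> B"] \<open>A \<subseteq> B\<close> by auto
  ultimately show "\<iota> \<in> supp B" by (auto simp: supp_def)
qed

lemma supp_Un:
  assumes "finite A" "A \<subseteq> \<Omega>" "finite B" "B \<subseteq> \<Omega>"
  shows "supp (A \<union> B) = supp A \<union> supp B"
proof
  show "supp (A \<union> B) \<subseteq> supp A \<union> supp B"
  proof
    fix \<iota> assume "\<iota> \<in> supp (A \<union> B)"
    then obtain b x where x: "x \<in> X b" "x \<in> cl (set b \<union> (A \<union> B))" "\<iota> = coord b x" by (auto simp: supp_def)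
    then show "\<iota> \<in> supp A \<union> supp B" using algebraic_over_union[OF assms x(1,2)] by (auto simp: supp_def)
  qed
  show "supp A \<union> supp B \<subseteq> supp (A \<union> B)" using supp_mono[of A "A \<union> B"] supp_mono[of B "A \<union> B"] by auto
qed

lemma supp_empty: "supp {} = {}"
  using X_nonalg by (auto simp: supp_def)

lemma supp_UN:
  assumes "finite K" "\<And>i. i \<in> K \<Longrightarrow> finite (A i) \<and> A i \<subseteq> \<Omega>"
  shows "supp (\<Union>i\<in>K. A i) = (\<Union>i\<in>K. supp (A i))"
  using assms
proof (induction K rule: finite_induct)
  case (insert i K)
  then have "supp (A i \<union> (\<Union>i\<in>K. A i)) = supp (A i) \<union> supp (\<Union>i\<in>K. A i)" by (intro supp_Un) auto
  then show ?case using insert by auto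
qed (simp add: supp_empty)

lemma coords_supp_self: "coords b \<inter> supp (set b) = {}"
  using supp_iff[of "set b"] X_nonalg X_params by (auto simp: coords_def)

lemma finite_coords_supp:
  assumes "finite A" "A \<subseteq> \<Omega>" shows "finite (coords b \<inter> supp A)"
proof (cases "b \<in> Par")
  case True
  have "coords b \<inter> supp A \<subseteq> coord b ` known b A"
    using supp_iff[OF assms] by (auto simp: coords_def known_def)
  then show ?thesis using known_finite[OF True assms] by (rule finite_surj[rotated])
next
  case False
  then have "coords b = {}" using coords_Par by blast
  then show ?thesis by simp
qed

lemma card_coords_supp: "\<exists>N. \<forall>A b. finite A \<longrightarrow> A \<subseteq> \<Omega> \<longrightarrow> card A \<le> n \<longrightarrow> card (coords b \<inter> supp A) \<le> N"
proof -
  obtain N where N: "\<And>A. finite A \<Longrightarrow> A \<subseteq> \<Omega> \<Longrightarrow> card A \<le> length b0 + n \<Longrightarrow> card (cl A) \<le> N"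
    using card_cl_bounded by blast
  show ?thesis
  proof (intro exI[of _ N] allI impI)
    fix A b assume A: "finite A" "A \<subseteq> \<Omega>" "card A \<le> n"
    show "card (coords b \<inter> supp A) \<le> N"
    proof (cases "b \<in> Par")
      case True
      have fin: "finite (set b \<union> A)" "set b \<union> A \<subseteq> \<Omega>" using A Par_subset[OF True] by auto
      have "coords b \<inter> supp A \<subseteq> coord b ` known b A"
        using supp_iff[OF A(1,2)] by (auto simp: coords_def known_def)
      then have "card (coords b \<inter> supp A) \<le> card (known b A)"
        using known_finite[OF True A(1,2)] by (rule surj_card_le[rotated])
      also have "\<dots> \<le> card (cl (set b \<union> A))" using finite_cl[OF fin] by (intro card_mono) (auto simp: known_def)
      also have "\<dots> \<le> N"
        using N[OF fin] card_Un_le[of "set b" A] card_length[of b] Par_length[OF True] A(3) by linarith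
      finally show ?thesis .
    next
      case False
      then have "coords b = {}" using coords_Par by blast
      then show ?thesis by simp
    qed
  qed
qed

lemma act_coord: assumes "g \<in> G" shows "act g (coord b x) = coord (map g b) (g x)"
proof
  show "act g (coord b x) \<subseteq> coord (map g b) (g x)"
    using interalg_image[OF assms] by (auto simp: act_def coord_def)
  show "coord (map g b) (g x) \<subseteq> act g (coord b x)"
  proof
    fix q assume "q \<in> coord (map g b) (g x)"
    moreover obtain c y where q: "q = (c, y)" by (cases q)
    moreover have cy: "c = map g (map (inv g) c)" "y = g (inv g y)" using assms by (auto intro!: map_idI[symmetric])
    ultimately have "interalg (b, x) (map (inv g) c, inv g y)"
      using interalg_image[OF assms, of b x "map (inv g) c" "inv g y"] by (simp add: coord_def)
    then show "q \<in> act g (coord b x)" unfolding act_def coord_def q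
      using cy by (intro image_eqI[of _ _ "(map (inv g) c, inv g y)"]) auto
  qed
qed

lemma act_comp: "act (g \<circ> h) \<iota> = act g (act h \<iota>)"
  by (force simp: act_def image_image)

lemma act_inv: "g \<in> G \<Longrightarrow> act (inv g) (act g \<iota>) = \<iota>" "g \<in> G \<Longrightarrow> act g (act (inv g) \<iota>) = \<iota>"
proof -
  assume g: "g \<in> G"
  have "inv g \<circ> g = id" "g \<circ> inv g = id" using g by (auto simp: fun_eq_iff)
  moreover have "act id \<iota> = \<iota>" by (auto simp: act_def)
  ultimately show "act (inv g) (act g \<iota>) = \<iota>" "act g (act (inv g) \<iota>) = \<iota>" by (metis act_comp)+
qed

lemma act_eq_iff: "g \<in> G \<Longrightarrow> act g \<iota> = act g \<kappa> \<longleftrightarrow> \<iota> = \<kappa>"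
  by (metis act_inv(1))

lemma act_inj: "g \<in> G \<Longrightarrow> inj (act g)"
  by (simp add: act_eq_iff inj_def)

lemma act_coords: "g \<in> G \<Longrightarrow> act g \<iota> \<in> coords (map g b) \<longleftrightarrow> \<iota> \<in> coords b"
proof -
  assume g: "g \<in> G"
  have *: "act g \<iota> \<in> coords (map g b)" if "\<iota> \<in> coords b" "g \<in> G" for g \<iota> b
    using that act_coord X_map by (auto simp: coords_def)
  have "map (inv g) (map g b) = b" using g by (auto intro!: map_idI)
  then show ?thesis using *[of \<iota> b g] *[of "act g \<iota>" "map g b" "inv g"] g G_inv act_inv by metis
qed

lemma act_supp: "g \<in> G \<Longrightarrow> act g \<iota> \<in> supp (g ` A) \<longleftrightarrow> \<iota> \<in> supp A"
proof -
  assume g: "g \<in> G"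
  have *: "act g \<iota> \<in> supp (g ` A)" if a: "\<iota> \<in> supp A" "g \<in> G" for g \<iota> A
  proof -
    obtain b x where b: "x \<in> X b" "x \<in> cl (set b \<union> A)" "\<iota> = coord b x" using a(1) by (auto simp: supp_def)
    then have "g x \<in> X (map g b)" "g x \<in> cl (set (map g b) \<union> g ` A)"
      using X_map[OF a(2)] cl_image_mem[OF a(2), of x "set b \<union> A"] by (simp_all add: image_Un)
    then show ?thesis unfolding b(3) act_coord[OF a(2)] supp_def by blast
  qed
  have "inv g ` g ` A = A" using g by (force simp: image_image)
  then show ?thesis using *[of \<iota> A g] *[of "act g \<iota>" "g ` A" "inv g"] g G_inv act_inv by metis
qed

lemma act_stab_coords: "g \<in> stab A \<Longrightarrow> set b \<subseteq> A \<Longrightarrow> act g \<iota> \<in> coords b \<longleftrightarrow> \<iota> \<in> coords b"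
  using act_coords[of g \<iota> b] stab_map[of g A b] stabD(1)[of g A] by simp

lemma act_stab_supp: "g \<in> stab A \<Longrightarrow> B \<subseteq> A \<Longrightarrow> act g \<iota> \<in> supp B \<longleftrightarrow> \<iota> \<in> supp B"
  using act_supp[of g \<iota> B] stab_image[of g A B] stabD(1)[of g A] by simp

lemma act_stab_fix: "g \<in> stab A \<Longrightarrow> set b \<subseteq> A \<Longrightarrow> x \<in> A \<Longrightarrow> act g (coord b x) = coord b x"
  using act_coord[of g b x] stab_map[of g A b] stabD[of g A] by simp

text \<open>A realization \<open>x\<close> over parameters in \<open>A\<close> contributes nothing but its own coordinate, because interaction with it
  takes place over the parameters alone.\<close>

lemma supp_insert:
  assumes A: "finite A" "A \<subseteq> \<Omega>" "set b \<subseteq> A" and x: "x \<in> X b"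
  shows "supp (insert x A) \<subseteq> insert (coord b x) (supp A)"
proof
  fix \<iota> assume "\<iota> \<in> supp (insert x A)"
  then obtain c y where c: "y \<in> X c" "y \<in> cl (set c \<union> insert x A)" "\<iota> = coord c y" by (auto simp: supp_def)
  have fin: "finite (set c \<union> A)" "set c \<union> A \<subseteq> \<Omega>" using X_params[OF c(1)] A by auto
  show "\<iota> \<in> insert (coord b x) (supp A)"
  proof (cases "y \<in> cl (set c \<union> A)")
    case True
    then show ?thesis using c by (auto simp: supp_def)
  next
    case False
    have y: "y \<in> cl (insert x (set c \<union> A))" using c(2) by simp
    have "y \<in> cl (insert x (set b \<union> set c))"
      using interaction_over_base[OF fin _ _ x c(1) y False] A by auto
    moreover have "y \<notin> cl (set b \<union> set c)" using False A(3) cl_mono'[of y "set b \<union> set c" "set c \<union> A"] by auto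
    moreover have "x \<notin> cl (set b \<union> set c)" using calculation cl_trans1 by blast
    ultimately have "interalg (b, x) (c, y)" using x c(1) by (simp add: interalg_iff)
    then show ?thesis using c(3) coord_eq_iff[OF x c(1)] by simp
  qed
qed

text \<open>Coordinates with parameters in \<open>A\<close> can be held fixed at no cost.\<close>

lemma fix_coords:
  assumes A: "finite A" "A \<subseteq> \<Omega>" and Q: "finite Q" "\<And>\<iota>. \<iota> \<in> Q \<Longrightarrow> \<exists>b. set b \<subseteq> A \<and> \<iota> \<in> coords b"
  shows "\<exists>E. finite E \<and> E \<subseteq> \<Omega> \<and> supp (A \<union> E) \<subseteq> supp A \<union> Q \<and> (\<forall>g\<in>stab (A \<union> E). \<forall>\<iota>\<in>Q. act g \<iota> = \<iota>)"
  using Q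
proof (induction Q rule: finite_induct)
  case empty
  show ?case by (rule exI[of _ "{}"]) simp
next
  case (insert \<iota> Q)
  obtain E where E: "finite E" "E \<subseteq> \<Omega>" "supp (A \<union> E) \<subseteq> supp A \<union> Q"
    "\<And>g \<kappa>. g \<in> stab (A \<union> E) \<Longrightarrow> \<kappa> \<in> Q \<Longrightarrow> act g \<kappa> = \<kappa>"
    using insert.IH[OF insert.prems] by auto
  obtain b x where b: "set b \<subseteq> A" "x \<in> X b" "\<iota> = coord b x" using insert.prems[of \<iota>] by (auto simp: coords_def)
  have x: "x \<in> \<Omega>" using b X_in by blast
  have "supp (insert x (A \<union> E)) \<subseteq> insert \<iota> (supp (A \<union> E))"
    unfolding b(3) using A E(1,2) b(1) by (intro supp_insert[OF _ _ _ b(2)]) auto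
  then have "supp (A \<union> insert x E) \<subseteq> supp A \<union> insert \<iota> Q" using E(3) by simp blast
  moreover have "act g \<kappa> = \<kappa>" if "g \<in> stab (A \<union> insert x E)" "\<kappa> \<in> insert \<iota> Q" for g \<kappa>
  proof (cases "\<kappa> = \<iota>")
    case True
    then show ?thesis using act_stab_fix[OF that(1), of b x] b by auto
  next
    case False
    then show ?thesis using E(4)[of g \<kappa>] that stab_mono[of "A \<union> E" "A \<union> insert x E"] by auto
  qed
  ultimately show ?case using E x by (intro exI[of _ "insert x E"]) auto
qed

lemma coord_fibre_finite:
  assumes "x \<in> X b" shows "finite {y \<in> X b. coord b y = coord b x}"
proof -
  have "{y \<in> X b. coord b y = coord b x} \<subseteq> cl (insert x (set b))"
  proof clarify
    fix y assume "y \<in> X b" "coord b y = coord b x"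
    then have "interalg (b, x) (b, y)" using coord_eq_iff[OF assms, of y b] by simp
    then show "y \<in> cl (insert x (set b))" by (simp add: interalg_iff)
  qed
  moreover have "finite (cl (insert x (set b)))" using X_params[OF assms] X_in[OF assms] by (intro finite_cl) auto
  ultimately show ?thesis by (rule finite_subset)
qed

lemma move_coord:
  assumes A: "finite A" "A \<subseteq> \<Omega>" "set b \<subseteq> A" and \<iota>: "\<iota> \<in> coords b" "\<iota> \<notin> supp A" and \<Phi>: "finite \<Phi>"
  shows "\<exists>g\<in>stab A. act g \<iota> \<notin> \<Phi>"
proof -
  obtain x where x: "x \<in> X b" "\<iota> = coord b x" using \<iota> by (auto simp: coords_def)
  have "x \<notin> cl A" using \<iota> x supp_iff[OF A(1,2) x(1)] A(3) by (simp add: sup.absorb2)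
  have fib: "{y \<in> X b. coord b y \<in> \<Phi>} = (\<Union>\<kappa>\<in>\<Phi> \<inter> coords b. {y \<in> X b. coord b y = \<kappa>})"
    by (auto simp: coords_def)
  have "finite {y \<in> X b. coord b y \<in> \<Phi>}"
    unfolding fib using \<Phi> coord_fibre_finite by (intro finite_UN_I) (auto simp: coords_def)
  with \<open>x \<notin> cl A\<close> obtain g where g: "g \<in> stab A" "g x \<notin> {y \<in> X b. coord b y \<in> \<Phi>}"
    using notin_cl_avoid[OF X_in[OF x(1)], of A] by blast
  then have "act g \<iota> \<notin> \<Phi>"
    using act_coord[of g b x] stab_map[OF g(1) A(3)] stabD(1)[OF g(1)] X_stab[OF g(1) A(3)] x by simp
  then show ?thesis using g by blast
qed

lemma coords_conj:
  assumes A: "finite A" "A \<subseteq> \<Omega>" "set b \<subseteq> A" and \<iota>: "\<iota> \<in> coords b" "\<iota> \<notin> supp A" "\<kappa> \<in> coords b" "\<kappa> \<notin> supp A"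
  shows "\<exists>g\<in>stab A. act g \<iota> = \<kappa>"
proof -
  obtain x y where xy: "x \<in> X b" "\<iota> = coord b x" "y \<in> X b" "\<kappa> = coord b y" using \<iota> by (auto simp: coords_def)
  have "x \<notin> cl A" "y \<notin> cl A"
    using \<iota> xy supp_iff[OF A(1,2) xy(1)] supp_iff[OF A(1,2) xy(3)] A(3) by (simp_all add: sup.absorb2)
  then obtain g where g: "g \<in> stab A" "g x = y" using minimality[OF A xy(1) _ xy(3)] by blast
  then have "act g \<iota> = \<kappa>" using act_coord[of g b x] stab_map[OF g(1) A(3)] stabD(1)[OF g(1)] xy by simp
  then show ?thesis using g by blast
qed

text \<open>The coordinates in \<open>W\<close> are moved one at a time, holding all others fixed by \<open>fix_coords\<close>.\<close>

lemma move_coords: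
  assumes A: "finite A" "A \<subseteq> \<Omega>" and Q: "finite Q" "\<And>\<iota>. \<iota> \<in> Q \<Longrightarrow> \<exists>b. set b \<subseteq> A \<and> \<iota> \<in> coords b"
    and W: "W \<subseteq> Q" "W \<inter> supp A = {}" and \<Phi>: "finite \<Phi>"
  shows "\<exists>g\<in>stab A. (\<forall>\<iota>\<in>Q - W. act g \<iota> = \<iota>) \<and> (\<forall>\<iota>\<in>W. act g \<iota> \<notin> \<Phi>)"
proof -
  have "finite W" using W Q finite_subset by blast
  then show ?thesis using W
  proof (induction W rule: finite_induct)
    case empty
    have "act (\<lambda>a. a) \<iota> = \<iota>" for \<iota> by (auto simp: act_def)
    then show ?case by (intro bexI[OF _ stab_id]) simp
  next
    case (insert \<iota> W)
    have "\<exists>g\<in>stab A. (\<forall>\<iota>\<in>Q - W. act g \<iota> = \<iota>) \<and> (\<forall>\<iota>\<in>W. act g \<iota> \<notin> \<Phi>)" using insert.prems by (intro insert.IH) auto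
    then obtain g where g: "g \<in> stab A" "\<And>\<kappa>. \<kappa> \<in> Q - W \<Longrightarrow> act g \<kappa> = \<kappa>" "\<And>\<kappa>. \<kappa> \<in> W \<Longrightarrow> act g \<kappa> \<notin> \<Phi>" by auto
    have gG: "g \<in> G" using g stabD by blast
    have \<iota>: "\<iota> \<in> Q" "act g \<iota> = \<iota>" "\<iota> \<notin> supp A" using insert g by auto
    let ?Q = "act g ` (Q - {\<iota>})"
    have Q': "\<exists>b. set b \<subseteq> A \<and> \<kappa> \<in> coords b" if \<kappa>: "\<kappa> \<in> ?Q" for \<kappa>
    proof -
      obtain \<kappa>' where k: "\<kappa>' \<in> Q" "\<kappa> = act g \<kappa>'" using \<kappa> by auto
      obtain b where "set b \<subseteq> A" "\<kappa>' \<in> coords b" using Q(2)[OF k(1)] by auto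
      then show ?thesis using act_stab_coords[OF g(1), of b \<kappa>'] k(2) by auto
    qed
    have "finite ?Q" using Q(1) by simp
    then have "\<exists>E. finite E \<and> E \<subseteq> \<Omega> \<and> supp (A \<union> E) \<subseteq> supp A \<union> ?Q \<and> (\<forall>h\<in>stab (A \<union> E). \<forall>\<kappa>\<in>?Q. act h \<kappa> = \<kappa>)"
      by (rule fix_coords[OF A]) (rule Q')
    then obtain E where E: "finite E" "E \<subseteq> \<Omega>" "supp (A \<union> E) \<subseteq> supp A \<union> ?Q"
      "\<forall>h\<in>stab (A \<union> E). \<forall>\<kappa>\<in>?Q. act h \<kappa> = \<kappa>" by (elim exE conjE) (rule that; assumption)
    obtain b where b: "set b \<subseteq> A" "\<iota> \<in> coords b" using Q(2) \<iota> by blast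
    have "\<iota> \<notin> ?Q"
    proof
      assume "\<iota> \<in> ?Q"
      then obtain \<kappa> where "\<kappa> \<noteq> \<iota>" "act g \<kappa> = act g \<iota>" using \<iota>(2) by auto
      then show False using act_eq_iff[OF gG] by blast
    qed
    then have "\<iota> \<notin> supp (A \<union> E)" using E(3) \<iota>(3) by blast
    then obtain h where h: "h \<in> stab (A \<union> E)" "act h \<iota> \<notin> \<Phi>"
      using move_coord[of "A \<union> E" b \<iota> \<Phi>] A E(1,2) b \<Phi> by auto
    have "h \<in> stab A" using h stab_mono[of A "A \<union> E"] by auto
    then have hg: "h \<circ> g \<in> stab A" using stab_comp g by blast
    have fixed: "act (h \<circ> g) \<kappa> = act g \<kappa>" if "\<kappa> \<in> Q - {\<iota>}" for \<kappa>
      using that bspec[OF bspec[OF E(4) h(1)], of "act g \<kappa>"] by (simp add: act_comp)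
    have \<iota>_moved: "act (h \<circ> g) \<iota> = act h \<iota>" by (simp add: act_comp \<iota>)
    show ?case
    proof (intro bexI[OF _ hg] conjI ballI)
      fix \<kappa> assume "\<kappa> \<in> Q - insert \<iota> W"
      then show "act (h \<circ> g) \<kappa> = \<kappa>" using fixed[of \<kappa>] g(2)[of \<kappa>] by simp
    next
      fix \<kappa> assume \<kappa>: "\<kappa> \<in> insert \<iota> W"
      show "act (h \<circ> g) \<kappa> \<notin> \<Phi>"
      proof (cases "\<kappa> = \<iota>")
        case False
        then have "\<kappa> \<in> W" "\<kappa> \<in> Q - {\<iota>}" using \<kappa> insert.prems by auto
        then show ?thesis using fixed[of \<kappa>] g(3)[of \<kappa>] by simp
      qed (simp add: \<iota>_moved h(2))
    qed
  qed
qed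

text \<open>In model-theoretic terms, linked parameter tuples are those whose minimal types are nonorthogonal.\<close>

definition linked :: "'a list \<Rightarrow> 'a list \<Rightarrow> bool" where
  "linked b c \<longleftrightarrow> coords b \<inter> coords c \<noteq> {}"

lemma linkedI: "\<iota> \<in> coords b \<Longrightarrow> \<iota> \<in> coords c \<Longrightarrow> linked b c"
  by (auto simp: linked_def)

lemma linked_sym: "linked b c \<Longrightarrow> linked c b"
  by (auto simp: linked_def)

lemma linked_Par: "linked b c \<Longrightarrow> b \<in> Par \<and> c \<in> Par"
  using coords_Par by (auto simp: linked_def)

lemma linked_refl: "b \<in> Par \<Longrightarrow> linked b b"
  using X_orb by (auto simp: linked_def coords_def)

lemma linked_image: "g \<in> G \<Longrightarrow> linked (map g b) (map g c) \<longleftrightarrow> linked b c"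
proof -
  assume g: "g \<in> G"
  have *: "linked (map g b) (map g c)" if "linked b c" "g \<in> G" for g b c
  proof -
    obtain \<iota> where "\<iota> \<in> coords b" "\<iota> \<in> coords c" using \<open>linked b c\<close> by (auto simp: linked_def)
    then show ?thesis using linkedI[of "act g \<iota>" "map g b" "map g c"] act_coords[OF \<open>g \<in> G\<close>] by simp
  qed
  have "map (inv g) (map g b) = b" "map (inv g) (map g c) = c" using g by (auto intro!: map_idI)
  then show ?thesis using *[of b c g] *[of "map g b" "map g c" "inv g"] g G_inv by metis
qed

text \<open>One shared coordinate suffices: all elements of \<open>X b\<close> which are generic over \<open>b\<close> and \<open>c\<close> are conjugate over \<open>b\<close> and \<open>c\<close>.\<close>

lemma linked_partner:
  assumes "linked b c" "\<iota> \<in> coords b" "\<iota> \<notin> supp (set c)"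
  shows "\<iota> \<in> coords c"
proof -
  have P: "b \<in> Par" "c \<in> Par" using linked_Par assms by auto
  have fin: "finite (set b)" "set b \<subseteq> \<Omega>" "finite (set c)" "set c \<subseteq> \<Omega>" using P Par_subset by auto
  obtain x where x: "x \<in> X b" "\<iota> = coord b x" using assms by (auto simp: coords_def)
  then have xn: "x \<notin> cl (set b \<union> set c)" using supp_iff fin assms(3) by blast
  obtain x0 y0 where 0: "x0 \<in> X b" "y0 \<in> X c" "coord b x0 = coord c y0" using assms by (auto simp: linked_def coords_def)
  then have i0: "interalg (b, x0) (c, y0)" using coord_eq_iff by blast
  then have "x0 \<notin> cl (set b \<union> set c)" by (simp add: interalg_iff)
  then obtain g where g: "g \<in> stab (set b \<union> set c)" "g x0 = x"
    using minimality[of "set b \<union> set c" b x0 x] fin x xn 0 by auto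
  have "map g b = b" "map g c = c" using stab_map[OF g(1)] by auto
  then have "interalg (b, x) (c, g y0)" using interalg_image[OF stabD(1)[OF g(1)], of b x0 c y0] i0 g by simp
  then show ?thesis using coord_eq_iff[OF x(1), of "g y0" c] x by (auto simp: coords_def interalg_iff)
qed

lemma coords_infinite: assumes "b \<in> Par" "finite \<Phi>" shows "\<exists>\<iota>\<in>coords b. \<iota> \<notin> \<Phi>"
proof -
  obtain \<iota> where \<iota>: "\<iota> \<in> coords b" using X_orb[OF assms(1)] by (auto simp: coords_def)
  have fin: "finite (set b)" "set b \<subseteq> \<Omega>" using Par_subset[OF assms(1)] by auto
  have "\<iota> \<notin> supp (set b)" using \<iota> coords_supp_self by blast
  then obtain g where g: "g \<in> stab (set b)" "act g \<iota> \<notin> \<Phi>"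
    using move_coord[OF fin subset_refl \<iota> _ assms(2)] by blast
  then have "act g \<iota> \<in> coords b" using act_stab_coords[OF g(1) subset_refl] \<iota> by simp
  then show ?thesis using g(2) by blast
qed

lemma linked_trans: assumes "linked b c" "linked c e" shows "linked b e"
proof -
  have P: "b \<in> Par" "c \<in> Par" "e \<in> Par" using linked_Par assms by auto
  have fin: "finite (set c \<union> set e)" "set c \<union> set e \<subseteq> \<Omega>" using P Par_subset by auto
  obtain \<iota> where \<iota>: "\<iota> \<in> coords b" "\<iota> \<notin> coords b \<inter> supp (set c \<union> set e)"
    using coords_infinite[OF P(1) finite_coords_supp[OF fin]] by blast
  then have "\<iota> \<notin> supp (set c)" "\<iota> \<notin> supp (set e)"
    using supp_mono[of "set c" "set c \<union> set e"] supp_mono[of "set e" "set c \<union> set e"] by auto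
  then have "\<iota> \<in> coords e" using linked_partner[OF assms(1) \<iota>(1)] linked_partner[OF assms(2)] by simp
  then show ?thesis by (rule linkedI[OF \<iota>(1)])
qed

lemma linked_stab: "g \<in> stab (set c) \<Longrightarrow> linked c b \<Longrightarrow> linked c (map g b)"
  using linked_image[of g c b] stab_map[of g "set c" c] stabD(1)[of g "set c"] by simp

text \<open>Finitely many coordinates from linked tuples are coordinates for a single linked tuple.  The tuple \<open>c\<close> is
  chosen so that as many coordinates of \<open>b\<close> as possible are missing from it, and then moved over \<open>b\<close>.\<close>

lemma common_params:
  assumes b: "b \<in> Par" and D: "finite D" "\<And>\<iota>. \<iota> \<in> D \<Longrightarrow> \<exists>e. linked b e \<and> \<iota> \<in> coords e"
  shows "\<exists>c. linked b c \<and> D \<subseteq> coords c"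
proof -
  let ?f = "\<lambda>(b, c). card (coords b \<inter> supp (set c))"
  let ?P = "\<lambda>(b, c). linked b c"
  obtain N where N: "\<And>A b. finite A \<Longrightarrow> A \<subseteq> \<Omega> \<Longrightarrow> card A \<le> length b0 \<Longrightarrow> card (coords b \<inter> supp A) \<le> N"
    using card_coords_supp by blast
  have bound: "\<forall>p. ?P p \<longrightarrow> ?f p < Suc N"
  proof (clarify)
    fix b c assume "linked b c"
    then have c: "c \<in> Par" using linked_Par by blast
    then show "card (coords b \<inter> supp (set c)) < Suc N"
      using N[of "set c" b] Par_subset[OF c] Par_length[OF c] card_length[of c] by auto
  qed
  obtain p where p: "?P p" "\<And>q. ?P q \<Longrightarrow> ?f q \<le> ?f p"
    using ex_has_greatest_nat[of ?P "(b, b)" ?f "Suc N"] linked_refl[OF b] bound by blast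
  obtain b1 c1 where bc1: "p = (b1, c1)" by (cases p)
  have l1: "linked b1 c1" using p(1) bc1 by simp
  have max: "card (coords e \<inter> supp (set c)) \<le> card (coords b1 \<inter> supp (set c1))" if "linked e c" for e c
    using p(2)[of "(e, c)"] that bc1 by simp
  obtain f1 where f1: "f1 \<in> G" "map f1 b1 = b"
  proof -
    have "b1 \<in> Par" using l1 linked_Par by blast
    then obtain u v where "u \<in> G" "b1 = map u b0" "v \<in> G" "b = map v b0" using b by (auto simp: Par_def)
    then have "map (v \<circ> inv u) b1 = b" "v \<circ> inv u \<in> G" using G_comp G_inv by auto
    then show thesis using that by blast
  qed
  define c2 where "c2 = map f1 c1"
  have l2: "linked b c2" using linked_image[OF f1(1), of b1 c1] l1 f1(2) by (simp add: c2_def)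
  have fin: "finite (set b)" "set b \<subseteq> \<Omega>" and finc2: "finite (set c2)" "set c2 \<subseteq> \<Omega>"
    using b l2 linked_Par Par_subset by auto
  have card_image: "card (coords (map g b') \<inter> supp (set (map g c'))) = card (coords b' \<inter> supp (set c'))" if "g \<in> G" for g b' c'
  proof -
    have "coords (map g b') \<inter> supp (set (map g c')) = act g ` (coords b' \<inter> supp (set c'))"
    proof -
      have "\<iota> \<in> coords (map g b') \<inter> supp (set (map g c')) \<longleftrightarrow> act (inv g) \<iota> \<in> coords b' \<inter> supp (set c')" for \<iota>
        using act_coords[OF that, of "act (inv g) \<iota>" b'] act_supp[OF that, of "act (inv g) \<iota>" "set c'"] act_inv[OF that] by simp
      moreover have "act g (act (inv g) \<iota>) = \<iota>" "act (inv g) (act g \<iota>) = \<iota>" for \<iota> using act_inv[OF that] by auto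
      ultimately show ?thesis by (smt (verit, ccfv_threshold) image_iff set_eq_iff)
    qed
    then show ?thesis using act_inj[OF that] by (metis card_image inj_on_subset subset_UNIV)
  qed
  have max2: "card (coords e \<inter> supp (set c)) \<le> card (coords b \<inter> supp (set c2))" if "linked e c" for e c
    using max[OF that] card_image[OF f1(1), of b1 c1] f1(2) by (simp add: c2_def)
  obtain e where e: "\<And>\<iota>. \<iota> \<in> D \<Longrightarrow> linked b (e \<iota>) \<and> \<iota> \<in> coords (e \<iota>)" using D(2) by metis
  let ?\<Phi> = "D \<union> (\<Union>\<iota>\<in>D. coords b \<inter> supp (set (e \<iota>)))"
  have "finite (coords b \<inter> supp (set (e \<iota>)))" if "\<iota> \<in> D" for \<iota>
    using e[OF that] linked_Par Par_subset by (intro finite_coords_supp) auto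
  then have fin\<Phi>: "finite ?\<Phi>" using D(1) by (intro finite_UnI finite_UN_I) auto
  let ?Q = "coords b \<inter> supp (set c2)"
  have "?Q \<inter> supp (set b) = {}" using coords_supp_self by auto
  then have "\<exists>g\<in>stab (set b). (\<forall>\<iota>\<in>?Q - ?Q. act g \<iota> = \<iota>) \<and> (\<forall>\<iota>\<in>?Q. act g \<iota> \<notin> ?\<Phi>)"
    using fin finite_coords_supp[OF finc2, of b] fin\<Phi> by (intro move_coords) auto
  then obtain g where g: "g \<in> stab (set b)" "\<And>\<iota>. \<iota> \<in> ?Q \<Longrightarrow> act g \<iota> \<notin> ?\<Phi>" by auto
  have gG: "g \<in> G" using g stabD by blast
  define c where "c = map g c2"
  have l: "linked b c" using linked_stab[OF g(1) l2] by (simp add: c_def)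
  have bc: "\<iota> \<notin> ?\<Phi>" if i: "\<iota> \<in> coords b \<inter> supp (set c)" for \<iota>
  proof -
    have "act (inv g) \<iota> \<in> ?Q"
      using i act_supp[OF gG, of "act (inv g) \<iota>" "set c2"] act_stab_coords[OF g(1) subset_refl, of "act (inv g) \<iota>"] act_inv[OF gG]
      by (simp add: c_def)
    then show ?thesis using g(2) act_inv[OF gG] by metis
  qed
  have cardc: "card (coords b \<inter> supp (set c)) = card ?Q"
    using card_image[OF gG, of b c2] stab_map[OF g(1) subset_refl] by (simp add: c_def)
  have finc: "finite (set c)" "set c \<subseteq> \<Omega>" using l linked_Par Par_subset by auto
  have "\<iota> \<in> coords c" if \<iota>: "\<iota> \<in> D" for \<iota>
  proof -
    let ?e = "e \<iota>"
    have be: "linked b ?e" and ie: "\<iota> \<in> coords ?e" using e[OF \<iota>] by auto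
    have lec: "linked ?e c" using linked_trans[OF linked_sym[OF be] l] .
    have "coords b \<inter> supp (set c) \<subseteq> coords ?e \<inter> supp (set c)"
      using bc linked_partner[OF be] \<iota> by blast
    moreover have "card (coords ?e \<inter> supp (set c)) \<le> card (coords b \<inter> supp (set c))" using max2[OF lec] cardc by simp
    ultimately have eq: "coords b \<inter> supp (set c) = coords ?e \<inter> supp (set c)"
      using finite_coords_supp[OF finc] by (intro card_seteq) auto
    have "\<iota> \<notin> supp (set c)" using eq bc[of \<iota>] ie \<iota> by blast
    then show ?thesis using linked_partner[OF lec ie] by blast
  qed
  then show ?thesis using l by blast
qed

end

section \<open>Supports are finite and coordinates are independent\<close>

context minimal_type
begin

text \<open>\<open>depends \<iota> \<theta>\<close>: every parameter tuple of \<open>\<theta>\<close> determines \<open>\<iota>\<close>, so that \<open>\<iota>\<close> cannot be moved while \<open>\<theta>\<close> is held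
  fixed.  The aim is to show that this never happens.\<close>

definition depends :: "('a list \<times> 'a) set \<Rightarrow> ('a list \<times> 'a) set \<Rightarrow> bool" where
  "depends \<iota> \<theta> \<longleftrightarrow> (\<forall>c. \<theta> \<in> coords c \<longrightarrow> \<iota> \<in> supp (set c))"

text \<open>The coordinate \<open>\<iota>\<close> can be moved while \<open>\<theta>\<close> is held fixed.\<close>

definition free_from :: "('a list \<times> 'a) set \<Rightarrow> ('a list \<times> 'a) set \<Rightarrow> bool" where
  "free_from \<theta> \<iota> \<longleftrightarrow> \<theta> \<noteq> \<iota> \<and> \<not> depends \<iota> \<theta>"

lemma dependsD: "depends \<iota> \<theta> \<Longrightarrow> \<theta> \<in> coords c \<Longrightarrow> \<iota> \<in> supp (set c)"
  by (simp add: depends_def)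

lemma depends_act: assumes "g \<in> G" shows "depends (act g \<iota>) (act g \<theta>) \<longleftrightarrow> depends \<iota> \<theta>"
proof -
  have *: "depends (act g \<iota>) (act g \<theta>)" if d: "depends \<iota> \<theta>" and g: "g \<in> G" for g \<iota> \<theta>
    unfolding depends_def
  proof (intro allI impI)
    fix c assume "act g \<theta> \<in> coords c"
    moreover have c: "c = map g (map (inv g) c)" using g by (auto intro!: map_idI[symmetric])
    ultimately have "\<theta> \<in> coords (map (inv g) c)" using act_coords[OF g] by metis
    then have "\<iota> \<in> supp (set (map (inv g) c))" using d dependsD by blast
    then have "act g \<iota> \<in> supp (g ` set (map (inv g) c))" using act_supp[OF g] by blast
    then show "act g \<iota> \<in> supp (set c)" using c by (metis set_map)
  qed
  show ?thesis using *[of \<iota> \<theta> g] *[of "act g \<iota>" "act g \<theta>" "inv g"] assms G_inv act_inv by auto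
qed

lemma free_from_act: "g \<in> G \<Longrightarrow> free_from (act g \<theta>) (act g \<iota>) \<longleftrightarrow> free_from \<theta> \<iota>"
  by (simp add: free_from_def depends_act act_eq_iff)

lemma depends_irrefl: "\<theta> \<in> coords c \<Longrightarrow> \<not> depends \<theta> \<theta>"
  using dependsD[of \<theta> \<theta> c] coords_supp_self by blast

lemma supp_params_finite: "b \<in> Par \<Longrightarrow> finite (set b) \<and> set b \<subseteq> \<Omega>"
  using Par_subset by simp

lemma fix_coords_avoiding:
  assumes C: "finite C" "C \<subseteq> \<Omega>" and D: "finite D" "\<And>\<theta>. \<theta> \<in> D \<Longrightarrow> \<exists>b. \<theta> \<in> coords b \<and> I \<inter> supp (set b) = {}"
    and I: "I \<inter> supp C = {}" "I \<inter> D = {}"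
  shows "\<exists>B. finite B \<and> C \<subseteq> B \<and> B \<subseteq> \<Omega> \<and> I \<inter> supp B = {} \<and> (\<forall>g\<in>stab B. \<forall>\<theta>\<in>D. act g \<theta> = \<theta>)"
proof -
  obtain e where e: "\<And>\<theta>. \<theta> \<in> D \<Longrightarrow> \<theta> \<in> coords (e \<theta>) \<and> I \<inter> supp (set (e \<theta>)) = {}" using D(2) by metis
  have e\<Omega>: "finite (set (e \<theta>)) \<and> set (e \<theta>) \<subseteq> \<Omega>" if "\<theta> \<in> D" for \<theta>
    using e[OF that] coords_Par supp_params_finite by blast
  let ?E = "\<Union>\<theta>\<in>D. set (e \<theta>)"
  have fin: "finite ?E" "?E \<subseteq> \<Omega>" using D(1) e\<Omega> by auto
  have CE: "finite (C \<union> ?E)" "C \<union> ?E \<subseteq> \<Omega>" using C fin by auto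
  have "supp (C \<union> ?E) = supp C \<union> (\<Union>\<theta>\<in>D. supp (set (e \<theta>)))"
    using supp_Un[OF C fin] supp_UN[OF D(1) e\<Omega>] by simp
  then have \<iota>CE: "I \<inter> supp (C \<union> ?E) = {}" using e I(1) by blast
  have "\<exists>E. finite E \<and> E \<subseteq> \<Omega> \<and> supp ((C \<union> ?E) \<union> E) \<subseteq> supp (C \<union> ?E) \<union> D \<and>
      (\<forall>g\<in>stab ((C \<union> ?E) \<union> E). \<forall>\<theta>\<in>D. act g \<theta> = \<theta>)"
  proof (rule fix_coords[OF CE D(1)])
    fix \<theta> assume "\<theta> \<in> D"
    then show "\<exists>b. set b \<subseteq> C \<union> ?E \<and> \<theta> \<in> coords b" using e by (intro exI[of _ "e \<theta>"]) auto
  qed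
  then obtain E where E: "finite E" "E \<subseteq> \<Omega>" "supp ((C \<union> ?E) \<union> E) \<subseteq> supp (C \<union> ?E) \<union> D"
    "\<forall>g\<in>stab ((C \<union> ?E) \<union> E). \<forall>\<theta>\<in>D. act g \<theta> = \<theta>" by (elim exE conjE) (rule that; assumption)
  have "I \<inter> supp ((C \<union> ?E) \<union> E) = {}" using E(3) \<iota>CE I(2) by blast
  then show ?thesis using E CE by (intro exI[of _ "(C \<union> ?E) \<union> E"]) (simp add: le_supI1)
qed

lemma move_one:
  assumes C: "finite C" "C \<subseteq> \<Omega>" and D: "finite D" "\<And>\<theta>. \<theta> \<in> D \<Longrightarrow> free_from \<theta> \<iota>"
    and \<iota>: "\<iota> \<in> coords a" "\<iota> \<notin> supp C" and Y: "finite Y" "Y \<subseteq> \<Omega>"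
  shows "\<exists>g\<in>stab C. (\<forall>\<theta>\<in>D. act g \<theta> = \<theta>) \<and> act g \<iota> \<notin> supp Y"
proof -
  have "\<exists>B. finite B \<and> C \<subseteq> B \<and> B \<subseteq> \<Omega> \<and> {\<iota>} \<inter> supp B = {} \<and> (\<forall>g\<in>stab B. \<forall>\<theta>\<in>D. act g \<theta> = \<theta>)"
  proof (rule fix_coords_avoiding[OF C D(1)])
    fix \<theta> assume "\<theta> \<in> D"
    then show "\<exists>b. \<theta> \<in> coords b \<and> {\<iota>} \<inter> supp (set b) = {}" using D(2) by (auto simp: free_from_def depends_def)
  qed (use D(2)[of \<iota>] \<iota>(2) in \<open>auto simp: free_from_def\<close>)
  then obtain B where B: "finite B" "C \<subseteq> B" "B \<subseteq> \<Omega>" "\<iota> \<notin> supp B" "\<forall>g\<in>stab B. \<forall>\<theta>\<in>D. act g \<theta> = \<theta>"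
    by auto
  have a: "finite (set a)" "set a \<subseteq> \<Omega>" using coords_Par[OF \<iota>(1)] supp_params_finite by blast+
  have "supp (B \<union> set a) = supp B \<union> supp (set a)" using supp_Un B(1,3) a by blast
  then have "\<iota> \<notin> supp (B \<union> set a)" using B(4) \<iota>(1) coords_supp_self[of a] by blast
  then obtain g where g: "g \<in> stab (B \<union> set a)" "act g \<iota> \<notin> coords a \<inter> supp Y"
    using move_coord[of "B \<union> set a" a \<iota>, OF _ _ _ \<iota>(1) _ finite_coords_supp[OF Y, of a]] B(1,3) a by auto
  have "act g \<iota> \<in> coords a" using act_stab_coords[OF g(1), of a \<iota>] \<iota>(1) by simp
  moreover have "g \<in> stab B" "g \<in> stab C" using g(1) B(2) stab_mono[of B "B \<union> set a"] stab_mono[of C "B \<union> set a"] by auto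
  ultimately show ?thesis using B(5) g(2) by blast
qed

text \<open>In a list in which no entry depends on an earlier one, the entries can be moved from the left to the right:
  the earlier entries are held fixed while the next one is moved.\<close>

lemma move_list:
  assumes C: "finite C" "C \<subseteq> \<Omega>" and D: "finite D" and Y: "finite Y" "Y \<subseteq> \<Omega>"
    and F: "sorted_wrt free_from F" "\<And>\<iota>. \<iota> \<in> set F \<Longrightarrow> (\<exists>a. \<iota> \<in> coords a) \<and> \<iota> \<notin> supp C \<and> (\<forall>\<theta>\<in>D. free_from \<theta> \<iota>)"
  shows "\<exists>g\<in>stab C. (\<forall>\<theta>\<in>D. act g \<theta> = \<theta>) \<and> (\<forall>\<iota>\<in>set F. act g \<iota> \<notin> supp Y)"
  using F
proof (induction F rule: rev_induct)
  case Nil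
  have "act (\<lambda>a. a) \<iota> = \<iota>" for \<iota> by (auto simp: act_def)
  then show ?case by (intro bexI[OF _ stab_id]) (simp add: id_def)
next
  case (snoc \<iota> F)
  have "\<exists>g\<in>stab C. (\<forall>\<theta>\<in>D. act g \<theta> = \<theta>) \<and> (\<forall>\<iota>\<in>set F. act g \<iota> \<notin> supp Y)"
    using snoc.prems by (intro snoc.IH) (auto simp: sorted_wrt_append)
  then obtain g where g: "g \<in> stab C" "\<forall>\<theta>\<in>D. act g \<theta> = \<theta>" "\<forall>\<iota>\<in>set F. act g \<iota> \<notin> supp Y" by auto
  have gG: "g \<in> G" using stabD(1)[OF g(1)] .
  obtain a where a: "\<iota> \<in> coords a" using snoc.prems by auto
  have free: "free_from \<theta> \<iota>" if "\<theta> \<in> set F \<union> D" for \<theta>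
    using snoc.prems that by (auto simp: sorted_wrt_append)
  have "\<exists>h\<in>stab C. (\<forall>\<theta>\<in>act g ` set F \<union> D. act h \<theta> = \<theta>) \<and> act h (act g \<iota>) \<notin> supp Y"
  proof (rule move_one[OF C _ _ _ _ Y])
    show "act g \<iota> \<in> coords (map g a)" using act_coords[OF gG] a by blast
    show "act g \<iota> \<notin> supp C" using act_stab_supp[OF g(1) subset_refl] snoc.prems by simp
    show "finite (act g ` set F \<union> D)" using D by simp
    fix \<theta> assume "\<theta> \<in> act g ` set F \<union> D"
    then obtain \<theta>' where "\<theta>' \<in> set F \<union> D" "\<theta> = act g \<theta>'" using g(2) by force
    then show "free_from \<theta> (act g \<iota>)" using free free_from_act[OF gG] by simp
  qed
  then obtain h where h: "h \<in> stab C" "\<forall>\<theta>\<in>act g ` set F \<union> D. act h \<theta> = \<theta>" "act h (act g \<iota>) \<notin> supp Y" by auto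
  have "act (h \<circ> g) \<theta> = \<theta>" if "\<theta> \<in> D" for \<theta> using that g(2) h(2) by (simp add: act_comp)
  moreover have "act (h \<circ> g) \<kappa> \<notin> supp Y" if "\<kappa> \<in> set (F @ [\<iota>])" for \<kappa>
    using that g(3) h(2,3) by (auto simp: act_comp)
  ultimately show ?case using stab_comp[OF h(1) g(1)] by blast
qed

lemma avoiding_params:
  assumes \<theta>: "\<theta> \<in> coords c0" and F: "sorted_wrt free_from F" "\<And>\<iota>. \<iota> \<in> set F \<Longrightarrow> (\<exists>a. \<iota> \<in> coords a) \<and> free_from \<theta> \<iota>"
  shows "\<exists>c. \<theta> \<in> coords c \<and> set F \<inter> supp (set c) = {}"
proof -
  have "finite (set c0)" "set c0 \<subseteq> \<Omega>" using coords_Par[OF \<theta>] supp_params_finite by blast+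
  then have "\<exists>g\<in>stab {}. (\<forall>\<theta>'\<in>{\<theta>}. act g \<theta>' = \<theta>') \<and> (\<forall>\<iota>\<in>set F. act g \<iota> \<notin> supp (set c0))"
    using F(2) by (intro move_list[OF _ _ _ _ _ F(1)]) (auto simp: supp_empty)
  then obtain g where g: "g \<in> stab {}" "act g \<theta> = \<theta>" "\<forall>\<iota>\<in>set F. act g \<iota> \<notin> supp (set c0)" by auto
  have gG: "g \<in> G" using stabD(1)[OF g(1)] .
  have c: "c0 = map g (map (inv g) c0)" using gG by (auto intro!: map_idI[symmetric])
  have "\<theta> \<in> coords (map (inv g) c0)" using act_coords[OF gG, of \<theta> "map (inv g) c0"] g(2) \<theta> c by simp
  moreover have "\<iota> \<notin> supp (set (map (inv g) c0))" if "\<iota> \<in> set F" for \<iota>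
    using act_supp[OF gG, of \<iota> "set (map (inv g) c0)"] g(3) that c by (metis set_map)
  ultimately show ?thesis by blast
qed

text \<open>A long such list inside one support would give a long ladder: for each \<open>t\<close>, all entries but the first \<open>t\<close> can be
  moved off the support.\<close>

lemma free_lists_bounded:
  "\<exists>N. \<forall>xs F. xs \<in> tups \<Omega> p \<longrightarrow> sorted_wrt free_from F \<longrightarrow> set F \<subseteq> supp (set xs) \<longrightarrow> length F < N"
proof -
  let ?R = "\<lambda>zs xs. last zs \<in> cl (set (butlast zs) \<union> set xs)"
  let ?q = "Suc (length b0)"
  have "invariant_rel G \<Omega> ?q p ?R"
    unfolding invariant_rel_def
  proof (intro ballI)
    fix g zs xs assume g: "g \<in> G" and zs: "zs \<in> tups \<Omega> ?q"
    then have "zs \<noteq> []" by (auto simp: tups_def)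
    then show "?R (map g zs) (map g xs) \<longleftrightarrow> ?R zs xs"
      using cl_image_mem[OF g, of "last zs" "set (butlast zs) \<union> set xs"]
      by (simp add: last_map map_butlast[symmetric] image_Un)
  qed
  then obtain n where n: "\<not> ladder ?R (tups \<Omega> ?q) (tups \<Omega> p) n" using no_long_ladder by blast
  show ?thesis
  proof (intro exI[of _ n] allI impI)
    fix xs F assume xs: "xs \<in> tups \<Omega> p" and F: "sorted_wrt free_from F" "set F \<subseteq> supp (set xs)"
    have fin: "finite (set xs)" "set xs \<subseteq> \<Omega>" using xs by (auto simp: tups_def)
    show "length F < n"
    proof (rule ccontr)
      assume "\<not> length F < n"
      then have len: "n \<le> length F" by simp
      have "\<exists>c x. x \<in> X c \<and> F ! i = coord c x" if "i < n" for i
        using F(2) nth_mem[of i F] that len supp_coord[of "F ! i" "set xs"] by fastforce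
      then obtain c x where cx: "\<And>i. i < n \<Longrightarrow> x i \<in> X (c i) \<and> F ! i = coord (c i) (x i)" by metis
      have "\<exists>ys\<in>tups \<Omega> p. \<forall>i<n. F ! i \<in> supp (set ys) \<longleftrightarrow> i < t" for t
      proof -
        have sp: "sorted_wrt free_from (take t F @ drop t F)" using F(1) by simp
        have "\<exists>g\<in>stab {}. (\<forall>\<theta>\<in>set (take t F). act g \<theta> = \<theta>) \<and> (\<forall>\<iota>\<in>set (drop t F). act g \<iota> \<notin> supp (set xs))"
        proof (rule move_list)
          show "sorted_wrt free_from (drop t F)" using sp by (simp only: sorted_wrt_append)
          fix \<iota> assume \<iota>: "\<iota> \<in> set (drop t F)"
          then have "\<iota> \<in> supp (set xs)" using F(2) in_set_dropD[of \<iota> t F] by auto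
          moreover have "\<forall>\<theta>\<in>set (take t F). free_from \<theta> \<iota>" using sp \<iota> by (simp only: sorted_wrt_append) blast
          ultimately show "(\<exists>a. \<iota> \<in> coords a) \<and> \<iota> \<notin> supp {} \<and> (\<forall>\<theta>\<in>set (take t F). free_from \<theta> \<iota>)"
            using supp_coords by (auto simp: supp_empty)
        qed (use fin in auto)
        then obtain g where g: "g \<in> stab {}" "\<forall>\<theta>\<in>set (take t F). act g \<theta> = \<theta>"
          "\<forall>\<iota>\<in>set (drop t F). act g \<iota> \<notin> supp (set xs)" by auto
        have gG: "g \<in> G" using stabD(1)[OF g(1)] .
        have xsg: "set xs = g ` set (map (inv g) xs)" using gG by (simp add: image_image)
        have mem: "\<iota> \<in> supp (set (map (inv g) xs)) \<longleftrightarrow> act g \<iota> \<in> supp (set xs)" for \<iota>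
          using act_supp[OF gG, of \<iota> "set (map (inv g) xs)"] unfolding xsg[symmetric] by simp
        have "F ! i \<in> supp (set (map (inv g) xs)) \<longleftrightarrow> i < t" if "i < n" for i
        proof (cases "i < t")
          case True
          then have "F ! i \<in> set (take t F)" using that len by (auto simp: in_set_conv_nth intro!: exI[of _ i])
          then have "act g (F ! i) = F ! i" using g(2) by blast
          moreover have "F ! i \<in> supp (set xs)" using F(2) nth_mem[of i F] that len by auto
          ultimately show ?thesis using True mem by simp
        next
          case False
          then have "F ! i \<in> set (drop t F)" using that len by (auto simp: in_set_conv_nth intro!: exI[of _ "i - t"])
          then show ?thesis using g(3) mem False by simp
        qed
        moreover have "map (inv g) xs \<in> tups \<Omega> p" using xs G_inv[OF gG] by (auto simp: tups_def)
        ultimately show ?thesis by blast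
      qed
      then obtain ys where ys: "\<And>t. ys t \<in> tups \<Omega> p" "\<And>t i. i < n \<Longrightarrow> F ! i \<in> supp (set (ys t)) \<longleftrightarrow> i < t" by metis
      have "ladder ?R (tups \<Omega> ?q) (tups \<Omega> p) n"
        unfolding ladder_def
      proof (rule exI[of _ "\<lambda>i. c i @ [x i]"], rule exI[of _ ys], intro conjI allI impI)
        fix i assume "i < n"
        then have "x i \<in> X (c i)" using cx by blast
        then show "c i @ [x i] \<in> tups \<Omega> ?q"
          using X_in Par_subset[OF X_Par] Par_length[OF X_Par] by (auto simp: tups_def)
      next
        fix i j :: nat assume "i < n" "j < n"
        moreover have "finite (set (ys j))" "set (ys j) \<subseteq> \<Omega>" using ys(1)[of j] by (auto simp: tups_def)
        ultimately show "?R (c i @ [x i]) (ys j) \<longleftrightarrow> i < j"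
          using ys(2)[of i j] cx[of i] supp_iff[of "set (ys j)" "x i" "c i"] by simp
      qed (use ys in auto)
      then show False using n by simp
    qed
  qed
qed

text \<open>By Ramsey's theorem an infinite set of coordinates without mutual dependence contains arbitrarily long lists in which
  no entry depends on an earlier one, or no entry on a later one.\<close>

lemma mutual_dependence:
  assumes A: "finite A" "A \<subseteq> \<Omega>" and \<theta>: "inj \<theta>" "\<And>i::nat. \<theta> i \<in> supp A"
  shows "\<exists>i j. i < j \<and> depends (\<theta> i) (\<theta> j) \<and> depends (\<theta> j) (\<theta> i)"
proof (rule ccontr)
  assume neg: "\<not> ?thesis"
  obtain xs where xs: "set xs = A" using A finite_list by blast
  then have "xs \<in> tups \<Omega> (length xs)" using A by (simp add: tups_def)
  then obtain N where N: "\<And>F. sorted_wrt free_from F \<Longrightarrow> set F \<subseteq> supp A \<Longrightarrow> length F < N"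
    using free_lists_bounded[of "length xs"] xs by metis
  define f where "f S = (if depends (\<theta> (Max S)) (\<theta> (Min S)) then 1 else 0 :: nat)" for S
  have "\<exists>Y t. Y \<subseteq> (UNIV :: nat set) \<and> infinite Y \<and> t < 2 \<and> (\<forall>x\<in>Y. \<forall>y\<in>Y. x \<noteq> y \<longrightarrow> f {x, y} = t)"
    by (rule Ramsey2) (auto simp: f_def)
  then obtain Y t where Y: "infinite Y" "t < 2" "\<And>x y. x \<in> Y \<Longrightarrow> y \<in> Y \<Longrightarrow> x \<noteq> y \<Longrightarrow> f {x, y} = t" by blast
  define ns where "ns = map (enumerate Y) [0..<N]"
  have ns_Y: "set ns \<subseteq> Y" using enumerate_in_set[OF Y(1)] by (auto simp: ns_def)
  have sorted_ns: "sorted_wrt (<) ns"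
    unfolding ns_def sorted_wrt_map
    by (rule sorted_wrt_mono_rel[OF _ sorted_wrt_upt]) (simp add: enumerate_mono Y(1))
  have f_ns: "f {x, y} = (if depends (\<theta> y) (\<theta> x) then 1 else 0)" if "x < y" for x y
    using that by (simp add: f_def max_def min_def)
  have ne: "\<theta> x \<noteq> \<theta> y" if "x < y" for x y using that \<theta>(1) by (auto dest: injD)
  define F where "F = (if t = 0 then map \<theta> ns else rev (map \<theta> ns))"
  have "sorted_wrt free_from F"
  proof (cases "t = 0")
    case True
    have "free_from (\<theta> x) (\<theta> y)" if "x \<in> set ns" "y \<in> set ns" "x < y" for x y
      using Y(3)[of x y] ns_Y that f_ns[of x y] True ne by (auto simp: free_from_def split: if_splits)
    then show ?thesis using True sorted_wrt_mono_rel[OF _ sorted_ns, of "\<lambda>x y. free_from (\<theta> x) (\<theta> y)"]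
      by (simp add: F_def sorted_wrt_map)
  next
    case False
    have "free_from (\<theta> y) (\<theta> x)" if "x \<in> set ns" "y \<in> set ns" "x < y" for x y
    proof -
      have "f {x, y} \<noteq> 0" using Y(3)[of x y] ns_Y that False by auto
      then have "depends (\<theta> y) (\<theta> x)" using f_ns[OF that(3)] by (auto split: if_splits)
      then show ?thesis using neg ne that(3) by (metis free_from_def)
    qed
    then show ?thesis using False sorted_wrt_mono_rel[OF _ sorted_ns, of "\<lambda>x y. free_from (\<theta> y) (\<theta> x)"]
      by (simp add: F_def sorted_wrt_map sorted_wrt_rev rev_map[symmetric])
  qed
  moreover have "set F \<subseteq> supp A" using \<theta>(2) by (auto simp: F_def)
  ultimately have "length F < N" using N by blast
  then show False by (simp add: F_def ns_def split: if_splits)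
qed

text \<open>Consider a longest list \<open>F\<close> of coordinates which depend mutually on some \<open>\<phi>\<close> but not on earlier entries.  Its length is
  bounded, as \<open>F\<close> is contained in the support of any parameter tuple of \<open>\<phi>\<close>.\<close>

lemma no_mutual_dependence:
  assumes \<theta>: "\<theta> \<in> coords c" and d: "depends \<iota> \<theta>" "depends \<theta> \<iota>"
  shows False
proof -
  define Q where "Q = (\<lambda>(\<theta>, F). F \<noteq> [] \<and> (\<exists>c. \<theta> \<in> coords c) \<and> sorted_wrt free_from F \<and>
    (\<forall>\<iota>\<in>set F. depends \<iota> \<theta> \<and> depends \<theta> \<iota>))"
  obtain N where N: "\<And>xs F. xs \<in> tups \<Omega> (length b0) \<Longrightarrow> sorted_wrt free_from F \<Longrightarrow> set F \<subseteq> supp (set xs) \<Longrightarrow> length F < N"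
    using free_lists_bounded[of "length b0"] by blast
  have bound: "\<forall>p. Q p \<longrightarrow> length (snd p) < N"
  proof (intro allI impI)
    fix p assume "Q p"
    moreover obtain \<theta> F where p: "p = (\<theta>, F)" by (cases p)
    ultimately obtain c where c: "\<theta> \<in> coords c" "sorted_wrt free_from F" "\<forall>\<iota>\<in>set F. depends \<iota> \<theta>" by (auto simp: Q_def)
    have "c \<in> tups \<Omega> (length b0)" using coords_Par[OF c(1)] Par_subset Par_length by (simp add: tups_def)
    moreover have "set F \<subseteq> supp (set c)" using c dependsD by blast
    ultimately show "length (snd p) < N" using N c(2) p by simp
  qed
  have "Q (\<theta>, [\<iota>])" using \<theta> d by (auto simp: Q_def)
  then obtain p where p: "Q p" "\<And>q. Q q \<Longrightarrow> length (snd q) \<le> length (snd p)"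
    using ex_has_greatest_nat[of Q _ "\<lambda>q. length (snd q)" N] bound by blast
  obtain \<phi> F where pF: "p = (\<phi>, F)" by (cases p)
  then have F: "F \<noteq> []" "sorted_wrt free_from F" "\<And>\<iota>. \<iota> \<in> set F \<Longrightarrow> depends \<iota> \<phi> \<and> depends \<phi> \<iota>"
    and "\<exists>b. \<phi> \<in> coords b" using p(1) by (auto simp: Q_def)
  then obtain b where b: "\<phi> \<in> coords b" by blast
  have b\<Omega>: "finite (set b)" "set b \<subseteq> \<Omega>" using coords_Par[OF b] supp_params_finite by blast+
  have F_coord: "\<exists>a. \<iota> \<in> coords a" if "\<iota> \<in> set F" for \<iota>
    using F(3)[OF that] dependsD[OF _ b] supp_coords by blast
  obtain \<kappa> F' where \<kappa>: "F = \<kappa> # F'" using F(1) by (cases F) auto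
  obtain a0 where "\<kappa> \<in> coords a0" using F_coord \<kappa> by auto
  then have "\<exists>a. \<kappa> \<in> coords a \<and> set F' \<inter> supp (set a) = {}"
    using F(2) F_coord \<kappa> by (intro avoiding_params) auto
  then obtain a where a: "\<kappa> \<in> coords a" "set F' \<inter> supp (set a) = {}" by blast
  then have Fa: "set F \<inter> supp (set a) = {}" using coords_supp_self \<kappa> by auto
  have a\<Omega>: "finite (set a)" "set a \<subseteq> \<Omega>" using coords_Par[OF a(1)] supp_params_finite by blast+
  have "depends \<phi> \<kappa>" using F(3) \<kappa> by simp
  then have \<phi>a: "\<phi> \<in> supp (set a)" using a(1) dependsD by blast
  \<comment> \<open>Infinitely many copies of \<open>(\<phi>, F)\<close> over \<open>a\<close>, each copy of \<open>F\<close> avoiding the parameters of all earlier copies of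
    \<open>\<phi>\<close>.  Two of the copies of \<open>\<phi>\<close> depend on each other, which allows \<open>F\<close> to be prolonged.\<close>
  have "\<exists>g::nat \<Rightarrow> 'a \<Rightarrow> 'a. \<forall>j. g j \<in> stab (set a) \<and> (\<forall>t<j. \<forall>\<iota>\<in>set F. act (g j) \<iota> \<notin> supp (g t ` set b))"
  proof (rule dependent_wellorder_choice)
    fix j :: nat and f :: "nat \<Rightarrow> 'a \<Rightarrow> 'a"
    assume f: "\<And>t. t < j \<Longrightarrow> f t \<in> stab (set a) \<and> (\<forall>s<t. \<forall>\<iota>\<in>set F. act (f t) \<iota> \<notin> supp (f s ` set b))"
    let ?Y = "\<Union>t<j. f t ` set b"
    have "f t ` set b \<subseteq> \<Omega>" if "t < j" for t using f[OF that] stabD(1) b\<Omega> G_image by blast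
    then have Y: "finite ?Y" "?Y \<subseteq> \<Omega>" by auto
    have "\<exists>g\<in>stab (set a). (\<forall>\<theta>\<in>{}. act g \<theta> = \<theta>) \<and> (\<forall>\<iota>\<in>set F. act g \<iota> \<notin> supp ?Y)"
      using Fa F_coord by (intro move_list[OF a\<Omega> _ Y F(2)]) auto
    moreover have "supp (f t ` set b) \<subseteq> supp ?Y" if "t < j" for t using that by (intro supp_mono) auto
    ultimately show "\<exists>r. r \<in> stab (set a) \<and> (\<forall>t<j. \<forall>\<iota>\<in>set F. act r \<iota> \<notin> supp (f t ` set b))"
      by (elim bexE conjE) (intro exI conjI allI impI ballI; blast)
  qed auto
  then obtain g where g: "\<And>j::nat. g j \<in> stab (set a)"
    "\<And>j t \<iota>. t < j \<Longrightarrow> \<iota> \<in> set F \<Longrightarrow> act (g j) \<iota> \<notin> supp (set (map (g t) b))" by auto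
  have gG: "g j \<in> G" for j using stabD(1)[OF g(1)] .
  have gb: "act (g j) \<phi> \<in> coords (map (g j) b)" for j using act_coords[OF gG] b by blast
  have apart: "\<not> depends (act (g j) \<iota>) (act (g t) \<phi>)" if "t < j" "\<iota> \<in> set F" for t j \<iota>
    using dependsD[OF _ gb[of t]] g(2)[OF that] by blast
  have "inj (\<lambda>j. act (g j) \<phi>)"
  proof (rule linorder_injI)
    fix t j :: nat assume "t < j"
    moreover have "depends (act (g j) \<kappa>) (act (g j) \<phi>)" using depends_act[OF gG] F(3) \<kappa> by simp
    ultimately show "act (g t) \<phi> \<noteq> act (g j) \<phi>" using apart[of t j \<kappa>] \<kappa> by auto
  qed
  moreover have "act (g j) \<phi> \<in> supp (set a)" for j using act_stab_supp[OF g(1) subset_refl] \<phi>a by blast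
  ultimately obtain t j where tj: "t < j" "depends (act (g t) \<phi>) (act (g j) \<phi>)" "depends (act (g j) \<phi>) (act (g t) \<phi>)"
    using mutual_dependence[OF a\<Omega>, of "\<lambda>j. act (g j) \<phi>"] by blast
  let ?F = "act (g t) \<phi> # map (act (g j)) F"
  have "sorted_wrt free_from (map (act (g j)) F)"
    using F(2) by (simp add: sorted_wrt_map free_from_act[OF gG])
  moreover have "free_from (act (g t) \<phi>) (act (g j) \<iota>)" if "\<iota> \<in> set F" for \<iota>
  proof -
    have "act (g t) \<phi> \<in> supp (set a)" using act_stab_supp[OF g(1) subset_refl] \<phi>a by blast
    moreover have "act (g j) \<iota> \<notin> supp (set a)" using act_stab_supp[OF g(1) subset_refl] Fa that by blast
    ultimately show ?thesis using apart[OF tj(1) that] by (auto simp: free_from_def)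
  qed
  ultimately have "sorted_wrt free_from ?F" by simp
  moreover have "\<forall>\<iota>\<in>set ?F. depends \<iota> (act (g j) \<phi>) \<and> depends (act (g j) \<phi>) \<iota>"
    using tj F(3) depends_act[OF gG] by simp
  ultimately have "Q (act (g j) \<phi>, ?F)" using gb unfolding Q_def by blast
  then show False using p(2)[of "(act (g j) \<phi>, ?F)"] pF by simp
qed

lemma finite_supp: assumes "finite A" "A \<subseteq> \<Omega>" shows "finite (supp A)"
proof (rule ccontr)
  assume "infinite (supp A)"
  then obtain \<theta> :: "nat \<Rightarrow> _" where \<theta>: "inj \<theta>" "range \<theta> \<subseteq> supp A" using infinite_countable_subset by blast
  then obtain i j where ij: "depends (\<theta> i) (\<theta> j)" "depends (\<theta> j) (\<theta> i)" using mutual_dependence[OF assms, of \<theta>] by blast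
  obtain c where "\<theta> j \<in> coords c" using \<theta>(2) supp_coords[of "\<theta> j" A] by blast
  then show False using no_mutual_dependence ij by blast
qed

text \<open>Dependence is irreflexive and, as supports are closed under it, transitive.  If \<open>\<iota>\<close> depends on \<open>\<theta>\<close>, then fewer
  coordinates depend on \<open>\<iota>\<close> than on \<open>\<theta>\<close>; but all coordinates are conjugate.\<close>

lemma no_dependence: assumes \<theta>: "\<theta> \<in> coords b" shows "\<not> depends \<iota> \<theta>"
proof
  assume \<iota>: "depends \<iota> \<theta>"
  let ?K = "\<lambda>\<theta>. {\<iota>. depends \<iota> \<theta>}"
  have finK: "finite (?K \<theta>)" if "\<theta> \<in> coords c" for \<theta> c
  proof (rule finite_subset)
    show "?K \<theta> \<subseteq> supp (set c)" using dependsD that by blast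
    show "finite (supp (set c))" using finite_supp coords_Par[OF that] supp_params_finite by blast
  qed
  \<comment> \<open>A support is closed under dependence, since otherwise some \<open>\<kappa>\<close> could be moved to infinitely many places, all of them
    depending on the finitely many elements of the support.\<close>
  have closed: "\<kappa> \<in> supp A" if A: "finite A" "A \<subseteq> \<Omega>" and \<rho>: "\<rho> \<in> supp A" "depends \<kappa> \<rho>" for A \<kappa> \<rho>
  proof (rule ccontr)
    assume \<kappa>: "\<kappa> \<notin> supp A"
    obtain c where c: "\<rho> \<in> coords c" using supp_coords \<rho> by blast
    obtain e where e: "\<kappa> \<in> coords e" using supp_coords dependsD[OF \<rho>(2) c] by blast
    have e\<Omega>: "finite (set e)" "set e \<subseteq> \<Omega>" using coords_Par[OF e] supp_params_finite by blast+
    have "\<kappa> \<notin> supp (A \<union> set e)" using supp_Un[OF A e\<Omega>] \<kappa> e coords_supp_self[of e] by blast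
    moreover have "finite (\<Union>\<mu>\<in>supp A. ?K \<mu>)"
    proof (intro finite_UN_I finite_supp A)
      fix \<mu> assume "\<mu> \<in> supp A"
      then obtain c where "\<mu> \<in> coords c" using supp_coords by blast
      then show "finite (?K \<mu>)" by (rule finK)
    qed
    ultimately have "\<exists>g\<in>stab (A \<union> set e). act g \<kappa> \<notin> (\<Union>\<mu>\<in>supp A. ?K \<mu>)"
      using A e\<Omega> e by (intro move_coord[of _ e]) auto
    then obtain g where g: "g \<in> stab (A \<union> set e)" "act g \<kappa> \<notin> (\<Union>\<mu>\<in>supp A. ?K \<mu>)" by blast
    have "act g \<rho> \<in> supp A" using act_stab_supp[OF g(1), of A] \<rho> by simp
    moreover have "depends (act g \<kappa>) (act g \<rho>)" using depends_act[OF stabD(1)[OF g(1)]] \<rho> by simp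
    ultimately show False using g(2) by blast
  qed
  have "?K \<iota> \<subseteq> ?K \<theta>"
  proof clarify
    fix \<kappa> assume "depends \<kappa> \<iota>"
    then show "depends \<kappa> \<theta>" unfolding depends_def[of \<kappa> \<theta>]
      using closed dependsD[OF \<iota>] coords_Par supp_params_finite by metis
  qed
  obtain c where c: "\<iota> \<in> coords c" using supp_coords dependsD[OF \<iota> \<theta>] by blast
  then have "\<iota> \<notin> ?K \<iota>" using depends_irrefl by blast
  then have "?K \<iota> \<subset> ?K \<theta>" using \<open>?K \<iota> \<subseteq> ?K \<theta>\<close> \<iota> by blast
  then have less: "card (?K \<iota>) < card (?K \<theta>)" using finK[OF \<theta>] by (rule psubset_card_mono[rotated])
  obtain x y where x: "x \<in> X b" "\<theta> = coord b x" and y: "y \<in> X c" "\<iota> = coord c y"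
    using \<theta> c by (auto simp: coords_def)
  obtain g where g: "g \<in> G" "map g b = c" "g x = y" using X_conj[OF x(1) y(1)] by blast
  then have "act g \<theta> = \<iota>" using act_coord x y by blast
  then have "act g ` ?K \<theta> \<subseteq> ?K \<iota>" using depends_act[OF g(1)] by blast
  then have "card (?K \<theta>) \<le> card (?K \<iota>)"
    using finK[OF c] act_inj[OF g(1)] by (meson card_inj_on_le inj_on_subset subset_UNIV)
  then show False using less by simp
qed

end

section \<open>Shrinking a minimal type\<close>

context minimal_type
begin

text \<open>The coordinates of all tuples linked to \<open>b\<close>.  Unlike \<open>coords b\<close>, families partition the set of coordinates.\<close>

definition family :: "'a list \<Rightarrow> ('a list \<times> 'a) set set" where
  "family b = {\<iota>. \<exists>c. linked b c \<and> \<iota> \<in> coords c}"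

lemma family_linked: "linked b c \<Longrightarrow> family b = family c"
  using linked_trans linked_sym unfolding family_def by blast

lemma family_cases: "family b \<inter> family c = {} \<or> family b = family c"
proof (rule disjCI)
  assume "family b \<noteq> family c"
  show "family b \<inter> family c = {}"
  proof (rule ccontr)
    assume "family b \<inter> family c \<noteq> {}"
    then obtain \<iota> b' c' where "linked b b'" "\<iota> \<in> coords b'" "linked c c'" "\<iota> \<in> coords c'" by (auto simp: family_def)
    then have "family b = family b'" "family b' = family c'" "family c = family c'"
      using family_linked linkedI by blast+
    then show False using \<open>family b \<noteq> family c\<close> by simp
  qed
qed

lemma coords_family: "coords b \<subseteq> family b"
  using linked_refl coords_Par unfolding family_def by blast

lemma family_common_params:
  assumes "b \<in> Par" "finite D" "D \<subseteq> family b"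
  shows "\<exists>c. linked b c \<and> D \<subseteq> coords c"
proof (rule common_params[OF assms(1,2)])
  fix \<iota> assume "\<iota> \<in> D"
  then show "\<exists>e. linked b e \<and> \<iota> \<in> coords e" using assms(3) by (auto simp: family_def)
qed

lemma act_family: assumes g: "g \<in> G" shows "act g \<iota> \<in> family (map g b) \<longleftrightarrow> \<iota> \<in> family b"
proof -
  have *: "act g \<iota> \<in> family (map g b)" if \<iota>: "\<iota> \<in> family b" and g: "g \<in> G" for g \<iota> b
  proof -
    obtain c where "linked b c" "\<iota> \<in> coords c" using \<iota> by (auto simp: family_def)
    then have "linked (map g b) (map g c)" "act g \<iota> \<in> coords (map g c)" using linked_image[OF g] act_coords[OF g] by auto
    then show ?thesis by (auto simp: family_def)
  qed
  have "map (inv g) (map g b) = b" using g by (auto intro!: map_idI)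
  then show ?thesis using *[of \<iota> b g] *[of "act g \<iota>" "map g b" "inv g"] g G_inv act_inv by metis
qed

lemma supp_image: assumes "g \<in> G" shows "supp (g ` A) = act g ` supp A"
proof
  show "act g ` supp A \<subseteq> supp (g ` A)" using act_supp[OF assms] by blast
  show "supp (g ` A) \<subseteq> act g ` supp A"
  proof
    fix \<iota> assume "\<iota> \<in> supp (g ` A)"
    then have "act (inv g) \<iota> \<in> supp A" using act_supp[OF assms, of "act (inv g) \<iota>" A] act_inv[OF assms] by simp
    then show "\<iota> \<in> act g ` supp A" using act_inv(2)[OF assms] by (metis image_eqI)
  qed
qed

text \<open>Finitely many coordinates of a family belong to a single parameter tuple, which reduces the bound to \<open>card_coords_supp\<close>.\<close>

lemma card_family_supp:
  "\<exists>N. \<forall>A b. finite A \<longrightarrow> A \<subseteq> \<Omega> \<longrightarrow> card A \<le> n \<longrightarrow> b \<in> Par \<longrightarrow> card (family b \<inter> supp A) \<le> N"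
proof -
  obtain N where N: "\<And>A b. finite A \<Longrightarrow> A \<subseteq> \<Omega> \<Longrightarrow> card A \<le> n \<Longrightarrow> card (coords b \<inter> supp A) \<le> N"
    using card_coords_supp by blast
  show ?thesis
  proof (intro exI[of _ N] allI impI)
    fix A b assume A: "finite A" "A \<subseteq> \<Omega>" "card A \<le> n" and b: "b \<in> Par"
    have fin: "finite (supp A)" using finite_supp A by blast
    obtain c where c: "family b \<inter> supp A \<subseteq> coords c"
      using family_common_params[OF b, of "family b \<inter> supp A"] fin by auto
    have "card (family b \<inter> supp A) \<le> card (coords c \<inter> supp A)" using c fin by (intro card_mono) auto
    then show "card (family b \<inter> supp A) \<le> N" using N[OF A, of c] by simp
  qed
qed

text \<open>Since the coordinates are independent, any two coordinates of a family can be exchanged over a set which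
  determines neither of them, and without affecting finitely many others.\<close>

lemma swap:
  assumes A: "finite A" "A \<subseteq> \<Omega>" and b: "\<iota> \<in> family b" "\<kappa> \<in> family b" "\<iota> \<notin> supp A" "\<kappa> \<notin> supp A"
    and D: "finite D" "\<And>\<theta>. \<theta> \<in> D \<Longrightarrow> \<exists>c. \<theta> \<in> coords c" "\<iota> \<notin> D" "\<kappa> \<notin> D"
  shows "\<exists>g\<in>stab A. act g \<iota> = \<kappa> \<and> (\<forall>\<theta>\<in>D. act g \<theta> = \<theta>)"
proof (cases "\<iota> = \<kappa>")
  case True
  have "act (\<lambda>a. a) \<theta> = \<theta>" for \<theta> by (auto simp: act_def)
  then show ?thesis using True by (intro bexI[OF _ stab_id]) (simp add: id_def)
next
  case False
  have "b \<in> Par" using b(1) linked_Par by (auto simp: family_def)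
  then obtain c where c: "\<iota> \<in> coords c" "\<kappa> \<in> coords c"
    using family_common_params[of b "{\<iota>, \<kappa>}"] b by auto
  have c\<Omega>: "finite (set c)" "set c \<subseteq> \<Omega>" using coords_Par[OF c(1)] supp_params_finite by blast+
  have "\<exists>B. finite B \<and> A \<subseteq> B \<and> B \<subseteq> \<Omega> \<and> {\<iota>, \<kappa>} \<inter> supp B = {} \<and> (\<forall>g\<in>stab B. \<forall>\<theta>\<in>D. act g \<theta> = \<theta>)"
  proof (rule fix_coords_avoiding[OF A D(1)])
    fix \<theta> assume \<theta>: "\<theta> \<in> D"
    then obtain d where "\<theta> \<in> coords d" using D(2) by blast
    moreover have "free_from \<theta> \<iota>" "free_from \<theta> \<kappa>" "free_from \<iota> \<kappa>"
      using no_dependence calculation c \<theta> D(3,4) False by (auto simp: free_from_def)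
    ultimately show "\<exists>b. \<theta> \<in> coords b \<and> {\<iota>, \<kappa>} \<inter> supp (set b) = {}"
      using avoiding_params[of \<theta> d "[\<iota>, \<kappa>]"] c by auto
  qed (use b D in auto)
  then obtain B where B: "finite B" "A \<subseteq> B" "B \<subseteq> \<Omega>" "{\<iota>, \<kappa>} \<inter> supp B = {}"
    "\<forall>g\<in>stab B. \<forall>\<theta>\<in>D. act g \<theta> = \<theta>" by (elim exE conjE) (rule that; assumption)
  have "supp (B \<union> set c) = supp B \<union> supp (set c)" using supp_Un B(1,3) c\<Omega> by blast
  then have "\<iota> \<notin> supp (B \<union> set c)" "\<kappa> \<notin> supp (B \<union> set c)" using B(4) coords_supp_self[of c] c by blast+
  then obtain g where g: "g \<in> stab (B \<union> set c)" "act g \<iota> = \<kappa>"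
    using coords_conj[of "B \<union> set c" c \<iota> \<kappa>] B(1,3) c\<Omega> c by auto
  have "g \<in> stab A" "g \<in> stab B" using g(1) B(2) stab_mono[of A "B \<union> set c"] stab_mono[of B "B \<union> set c"] by auto
  then show ?thesis using B(5) g(2) by blast
qed

text \<open>Choosing \<open>n\<close> coordinates in every family and keeping the points supported by them preserves
  homogeneity: a coordinate outside the chosen set is exchanged for a chosen one of the same family, and there
  is one available because conjugate sets have equally many coordinates in corresponding families.\<close>

lemma shrink:
  assumes B: "finite B" "B \<subseteq> \<Omega>"
  shows "\<exists>\<Omega>'\<subseteq>\<Omega>. B \<subseteq> \<Omega>' \<and> (\<forall>b. finite (X b \<inter> \<Omega>')) \<and>
    (\<forall>g\<in>G. \<forall>xs c. set xs \<subseteq> \<Omega>' \<longrightarrow> g ` set xs \<subseteq> \<Omega>' \<longrightarrow> c \<in> \<Omega>' \<longrightarrow> (\<exists>h\<in>G. map h xs = map g xs \<and> h c \<in> \<Omega>'))"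
proof -
  obtain n where n: "\<And>b. b \<in> Par \<Longrightarrow> card (family b \<inter> supp B) \<le> n"
    using card_family_supp[of "card B"] B by blast
  have "\<exists>I. supp B \<inter> Y \<subseteq> I \<and> I \<subseteq> Y \<and> finite I \<and> card I = n" if Y: "Y \<in> family ` Par" for Y
  proof -
    obtain b where b: "b \<in> Par" "Y = family b" using Y by blast
    have "infinite Y"
    proof
      assume "finite Y"
      then show False using coords_infinite[OF b(1), of Y] coords_family[of b] b(2) by blast
    qed
    moreover have "finite (supp B \<inter> Y)" using finite_supp[OF B] by simp
    ultimately obtain E where E: "finite E" "E \<subseteq> Y - (supp B \<inter> Y)" "card E = n - card (supp B \<inter> Y)"
      using infinite_arbitrarily_large[of "Y - (supp B \<inter> Y)"] by (metis Diff_infinite_finite)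
    moreover have "card (supp B \<inter> Y) \<le> n" using n[OF b(1)] b(2) by (simp add: Int_commute)
    moreover have "card ((supp B \<inter> Y) \<union> E) = card (supp B \<inter> Y) + card E"
      using E \<open>finite (supp B \<inter> Y)\<close> by (intro card_Un_disjoint) auto
    ultimately show ?thesis using \<open>finite (supp B \<inter> Y)\<close>
      by (intro exI[of _ "(supp B \<inter> Y) \<union> E"]) auto
  qed
  then obtain I where I: "\<And>Y. Y \<in> family ` Par \<Longrightarrow> supp B \<inter> Y \<subseteq> I Y \<and> I Y \<subseteq> Y \<and> finite (I Y) \<and> card (I Y) = n"
    by metis
  define J where "J = (\<Union>Y\<in>family ` Par. I Y)"
  have J_family: "J \<inter> family b = I (family b)" if "b \<in> Par" for b
  proof
    show "I (family b) \<subseteq> J \<inter> family b" using I that unfolding J_def by blast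
    show "J \<inter> family b \<subseteq> I (family b)"
    proof
      fix \<iota> assume "\<iota> \<in> J \<inter> family b"
      then obtain c where c: "c \<in> Par" "\<iota> \<in> I (family c)" "\<iota> \<in> family b" by (auto simp: J_def)
      then have "\<iota> \<in> family c" using I by blast
      then have "family b = family c" using family_cases c(3) by blast
      then show "\<iota> \<in> I (family b)" using c by simp
    qed
  qed
  have J_card: "finite (J \<inter> family b) \<and> card (J \<inter> family b) = n" if "b \<in> Par" for b
    using I J_family that by simp
  have "supp B \<subseteq> J"
  proof
    fix \<iota> assume \<iota>: "\<iota> \<in> supp B"
    then obtain b where b: "\<iota> \<in> coords b" using supp_coords by blast
    then have "family b \<in> family ` Par" "\<iota> \<in> family b" using coords_Par coords_family by blast+
    then show "\<iota> \<in> J" using I \<iota> unfolding J_def by blast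
  qed
  define \<Omega>' where "\<Omega>' = {a \<in> \<Omega>. supp {a} \<subseteq> J}"
  have \<Omega>'_supp: "supp A \<subseteq> J" if A: "finite A" "A \<subseteq> \<Omega>'" for A
  proof -
    have "supp (\<Union>a\<in>A. {a}) = (\<Union>a\<in>A. supp {a})" using A by (intro supp_UN) (auto simp: \<Omega>'_def)
    then show ?thesis using A by (auto simp: \<Omega>'_def)
  qed
  have ext: "\<exists>h\<in>G. map h xs = map g xs \<and> h c \<in> \<Omega>'"
    if "g \<in> G" "set xs \<subseteq> \<Omega>'" "g ` set xs \<subseteq> \<Omega>'" "c \<in> \<Omega>'" for g xs c
    using that(1,3)
  proof (induction "card (supp (g ` insert c (set xs)) - J)" arbitrary: g rule: less_induct)
    case less
    have g: "g \<in> G" using less.prems by blast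
    have cx: "finite (insert c (set xs))" "insert c (set xs) \<subseteq> \<Omega>" using that by (auto simp: \<Omega>'_def)
    let ?S = "supp (g ` insert c (set xs))"
    have gcx: "finite (g ` insert c (set xs))" "g ` insert c (set xs) \<subseteq> \<Omega>"
      using cx G_image[OF g] by auto
    have finS: "finite ?S" using finite_supp[OF gcx] .
    show ?case
    proof (cases "?S \<subseteq> J")
      case True
      have "supp {g c} \<subseteq> ?S" by (rule supp_mono) auto
      then have "g c \<in> \<Omega>'" using True gcx by (auto simp: \<Omega>'_def)
      then show ?thesis using g by blast
    next
      case False
      then obtain \<iota> where \<iota>: "\<iota> \<in> ?S" "\<iota> \<notin> J" by blast
      then obtain b where b: "\<iota> \<in> coords b" using supp_coords by blast
      have bP: "b \<in> Par" "\<iota> \<in> family b" using coords_Par coords_family b by blast+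
      define b' where "b' = map (inv g) b"
      have b': "map g b' = b" "b' \<in> Par" using g bP Par_map[OF G_inv[OF g], of b] by (auto simp: b'_def intro!: map_idI)
      have "?S \<inter> family b = act g ` (supp (insert c (set xs)) \<inter> family b')"
        unfolding supp_image[OF g] using act_family[OF g, of _ b'] b'(1) by auto
      also have "card \<dots> \<le> card (supp (insert c (set xs)) \<inter> family b')"
        using finite_supp[OF cx] by (intro card_image_le) simp
      also have "\<dots> \<le> card (J \<inter> family b')"
        using \<Omega>'_supp[OF cx(1)] that J_card[OF b'(2)] by (intro card_mono) auto
      finally have le: "card (?S \<inter> family b) \<le> n" using J_card[OF b'(2)] by simp
      have "\<exists>\<kappa>. \<kappa> \<in> J \<inter> family b \<and> \<kappa> \<notin> ?S"
      proof (rule ccontr)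
        assume "\<not> ?thesis"
        then have "J \<inter> family b \<subset> ?S \<inter> family b" using \<iota> bP by blast
        then have "card (J \<inter> family b) < card (?S \<inter> family b)" using finS by (intro psubset_card_mono) auto
        then show False using le J_card[OF bP(1)] by simp
      qed
      then obtain \<kappa> where \<kappa>: "\<kappa> \<in> J" "\<kappa> \<in> family b" "\<kappa> \<notin> ?S" by blast
      let ?A = "g ` set xs"
      have A: "finite ?A" "?A \<subseteq> \<Omega>" using gcx by auto
      have "supp ?A \<subseteq> J" using \<Omega>'_supp[OF A(1) less.prems(2)] .
      moreover have "supp ?A \<subseteq> ?S" by (rule supp_mono) auto
      ultimately have "\<exists>h\<in>stab ?A. act h \<iota> = \<kappa> \<and> (\<forall>\<theta>\<in>?S - {\<iota>}. act h \<theta> = \<theta>)"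
        using A \<iota> \<kappa> bP finS supp_coords by (intro swap[of _ _ b]) auto
      then obtain h where h: "h \<in> stab ?A" "act h \<iota> = \<kappa>" "\<And>\<theta>. \<theta> \<in> ?S - {\<iota>} \<Longrightarrow> act h \<theta> = \<theta>" by auto
      have hG: "h \<in> G" using stabD(1)[OF h(1)] .
      have "supp ((h \<circ> g) ` insert c (set xs)) = act h ` ?S"
        unfolding image_comp[symmetric] by (rule supp_image[OF hG])
      also have "\<dots> - J = ?S - {\<iota>} - J" using h(2,3) \<iota>(1) \<kappa>(1) by (auto simp: image_iff) (metis)+
      finally have "supp ((h \<circ> g) ` insert c (set xs)) - J = ?S - J - {\<iota>}" by blast
      moreover have "card (?S - J - {\<iota>}) < card (?S - J)" using finS \<iota> by (intro psubset_card_mono) auto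
      moreover have same: "map (h \<circ> g) xs = map g xs" using stabD(2)[OF h(1)] by simp
      moreover have "(h \<circ> g) ` set xs \<subseteq> \<Omega>'" using less.prems(2) same by (metis set_map)
      ultimately have "\<exists>h'\<in>G. map h' xs = map (h \<circ> g) xs \<and> h' c \<in> \<Omega>'"
        using less.hyps[of "h \<circ> g"] G_comp[OF hG g] by simp
      then show ?thesis using same by simp
    qed
  qed
  have "finite (X b \<inter> \<Omega>')" for b
  proof (cases "b \<in> Par")
    case True
    have "X b \<inter> \<Omega>' \<subseteq> (\<Union>\<kappa>\<in>J \<inter> family b. {y \<in> X b. coord b y = \<kappa>})"
    proof
      fix y assume y: "y \<in> X b \<inter> \<Omega>'"
      then have "y \<in> \<Omega>" "supp {y} \<subseteq> J" by (auto simp: \<Omega>'_def)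
      moreover have "coord b y \<in> supp {y}"
        using y supp_iff[of "{y}" y b] cl_self[of y "set b \<union> {y}"] X_in by auto
      moreover have "coord b y \<in> family b" using y coords_family[of b] by (auto simp: coords_def)
      ultimately show "y \<in> (\<Union>\<kappa>\<in>J \<inter> family b. {y \<in> X b. coord b y = \<kappa>})" using y by blast
    qed
    moreover have "finite {y \<in> X b. coord b y = \<kappa>}" for \<kappa>
    proof (cases "\<kappa> \<in> coords b")
      case True
      then show ?thesis using coord_fibre_finite by (auto simp: coords_def)
    next
      case False
      then have "{y \<in> X b. coord b y = \<kappa>} = {}" by (auto simp: coords_def)
      then show ?thesis by (simp only: finite.emptyI)
    qed
    ultimately show ?thesis using J_card[OF True] finite_subset by blast
  next
    case False
    then have "X b = {}" using X_Par by blast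
    then show ?thesis by simp
  qed
  moreover have "B \<subseteq> \<Omega>'"
  proof
    fix a assume a: "a \<in> B"
    then have "supp {a} \<subseteq> supp B" by (intro supp_mono) auto
    then show "a \<in> \<Omega>'" using a B \<open>supp B \<subseteq> J\<close> by (auto simp: \<Omega>'_def)
  qed
  moreover have "\<Omega>' \<subseteq> \<Omega>" by (auto simp: \<Omega>'_def)
  ultimately show ?thesis using ext by (intro exI[of _ \<Omega>']) simp
qed

end

section \<open>Finite homogeneous subsets\<close>

text \<open>A countable set with a notion of type of finite tuples.  In the application \<open>tp xs\<close> is the quantifier-free type
  of \<open>xs\<close>, and \<open>k\<close> bounds the arities of the relation symbols.\<close>

locale type_space =
  fixes M :: "'a set" and tp :: "'a list \<Rightarrow> 't" and k :: nat
  assumes countable_M: "countable M"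
    and tp_length: "tp xs = tp ys \<Longrightarrow> length xs = length ys"
    and tp_nth_eq: "tp xs = tp ys \<Longrightarrow> i < length xs \<Longrightarrow> j < length xs \<Longrightarrow> xs ! i = xs ! j \<longleftrightarrow> ys ! i = ys ! j"
    and tp_select: "tp xs = tp ys \<Longrightarrow> set ns \<subseteq> {..<length xs} \<Longrightarrow> tp (map ((!) xs) ns) = tp (map ((!) ys) ns)"
    and finite_types: "finite (tp ` tups M n)"
    and tp_determined: "\<lbrakk>xs \<noteq> []; \<And>es. es \<in> tups (set xs) k \<Longrightarrow> tp (es @ [x]) = tp (es @ [y])\<rbrakk> \<Longrightarrow>
       tp (xs @ [x]) = tp (xs @ [y])"
    and no_ladder: "(\<And>xs ys xs' ys'. \<lbrakk>xs \<in> tups M p; ys \<in> tups M q; xs' \<in> tups M p; ys' \<in> tups M q;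
       tp (xs @ ys) = tp (xs' @ ys'); R xs ys\<rbrakk> \<Longrightarrow> R xs' ys') \<Longrightarrow> \<exists>n. \<not> ladder R (tups M p) (tups M q) n"
begin

text \<open>The one-point extension property, relative to the types of \<open>M\<close>; for countable sets it amounts to homogeneity, by
  \<open>back_and_forth\<close>.\<close>

definition extensible :: "'a set \<Rightarrow> bool" where
  "extensible \<Omega> \<longleftrightarrow> \<Omega> \<subseteq> M \<and> (\<forall>xs ys c. set xs \<subseteq> \<Omega> \<longrightarrow> set ys \<subseteq> \<Omega> \<longrightarrow> tp xs = tp ys \<longrightarrow> c \<in> \<Omega> \<longrightarrow>
     (\<exists>d\<in>\<Omega>. tp (xs @ [c]) = tp (ys @ [d])))"

lemma extensibleD:
  "extensible \<Omega> \<Longrightarrow> set xs \<subseteq> \<Omega> \<Longrightarrow> set ys \<subseteq> \<Omega> \<Longrightarrow> tp xs = tp ys \<Longrightarrow> c \<in> \<Omega> \<Longrightarrow> \<exists>d\<in>\<Omega>. tp (xs @ [c]) = tp (ys @ [d])"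
  unfolding extensible_def by blast

text \<open>The type-preserving permutations of \<open>\<Omega>\<close>, extended by the identity to permutations of the whole type.\<close>

definition perms :: "'a set \<Rightarrow> ('a \<Rightarrow> 'a) set" where
  "perms \<Omega> = {g. bij g \<and> g ` \<Omega> = \<Omega> \<and> (\<forall>x. x \<notin> \<Omega> \<longrightarrow> g x = x) \<and> (\<forall>zs. set zs \<subseteq> \<Omega> \<longrightarrow> tp (map g zs) = tp zs)}"

lemma perms_tp: "g \<in> perms \<Omega> \<Longrightarrow> set zs \<subseteq> \<Omega> \<Longrightarrow> tp (map g zs) = tp zs"
  unfolding perms_def by blast

lemma tp_select_eq:
  assumes "tp xs = tp ys" "set ns \<subseteq> {..<length xs}" "us = map ((!) xs) ns" "vs = map ((!) ys) ns"
  shows "tp us = tp vs"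
  using tp_select assms by simp

lemma back_and_forth_step:
  assumes \<Omega>: "extensible \<Omega>" and xs: "set xs \<subseteq> \<Omega>" "set ys \<subseteq> \<Omega>" "tp xs = tp ys" and e: "e \<in> \<Omega>"
  shows "\<exists>us vs. set us \<subseteq> \<Omega> \<and> set vs \<subseteq> \<Omega> \<and> tp (xs @ us) = tp (ys @ vs) \<and> e \<in> set us \<and> e \<in> set vs"
proof -
  obtain d where d: "d \<in> \<Omega>" "tp (xs @ [e]) = tp (ys @ [d])" using extensibleD[OF \<Omega> xs e] by blast
  have "\<exists>c\<in>\<Omega>. tp ((ys @ [d]) @ [e]) = tp ((xs @ [e]) @ [c])"
    using d xs e by (intro extensibleD[OF \<Omega>]) auto
  then obtain c where "c \<in> \<Omega>" "tp ((ys @ [d]) @ [e]) = tp ((xs @ [e]) @ [c])" by blast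
  then show ?thesis using d e by (intro exI[of _ "[e, c]"] exI[of _ "[d, e]"]) auto
qed

lemma back_and_forth:
  assumes \<Omega>: "extensible \<Omega>" and xs: "set xs \<subseteq> \<Omega>" "set ys \<subseteq> \<Omega>" "tp xs = tp ys"
  shows "\<exists>g\<in>perms \<Omega>. map g xs = ys"
proof (cases "\<Omega> = {}")
  case True
  then have "xs = []" "ys = []" using xs by auto
  then show ?thesis using True by (intro bexI[of _ id]) (auto simp: perms_def)
next
  case False
  have "countable \<Omega>" using \<Omega> countable_M countable_subset by (auto simp: extensible_def)
  then obtain e :: "nat \<Rightarrow> 'a" where e: "range e = \<Omega>" using False by (metis range_from_nat_into)
  define good where "good = (\<lambda>(us, vs). set us \<subseteq> \<Omega> \<and> set vs \<subseteq> \<Omega> \<and> tp us = tp vs)"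
  have "\<exists>S :: nat \<Rightarrow> 'a list \<times> 'a list. \<forall>n. (good (S n) \<and> (n = 0 \<longrightarrow> S n = (xs, ys))) \<and>
      (\<exists>us vs. S (Suc n) = (fst (S n) @ us, snd (S n) @ vs) \<and> e n \<in> set us \<and> e n \<in> set vs)"
  proof (rule dependent_nat_choice)
    show "\<exists>p. good p \<and> ((0::nat) = 0 \<longrightarrow> p = (xs, ys))" using xs by (auto simp: good_def)
    fix p and n :: nat assume p: "good p \<and> (n = 0 \<longrightarrow> p = (xs, ys))"
    have "e n \<in> \<Omega>" using e by blast
    then obtain us vs where "set us \<subseteq> \<Omega>" "set vs \<subseteq> \<Omega>" "tp (fst p @ us) = tp (snd p @ vs)" "e n \<in> set us" "e n \<in> set vs"
      using back_and_forth_step[OF \<Omega>, of "fst p" "snd p" "e n"] p by (auto simp: good_def)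
    then show "\<exists>q. (good q \<and> (Suc n = 0 \<longrightarrow> q = (xs, ys))) \<and>
        (\<exists>us vs. q = (fst p @ us, snd p @ vs) \<and> e n \<in> set us \<and> e n \<in> set vs)"
      using p by (intro exI[of _ "(fst p @ us, snd p @ vs)"]) (auto simp: good_def)
  qed
  then obtain S where S: "\<And>n. good (S n)" "S 0 = (xs, ys)"
    "\<And>n. \<exists>us vs. S (Suc n) = (fst (S n) @ us, snd (S n) @ vs) \<and> e n \<in> set us \<and> e n \<in> set vs" by blast
  define A where "A n = fst (S n)" for n
  define B where "B n = snd (S n)" for n
  have tpAB: "tp (A n) = tp (B n)" and A\<Omega>: "set (A n) \<subseteq> \<Omega>" and B\<Omega>: "set (B n) \<subseteq> \<Omega>" for n
    using S(1)[of n] by (auto simp: A_def B_def good_def split: prod.splits)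
  have len: "length (A n) = length (B n)" for n using tp_length[OF tpAB] .
  have step: "\<exists>us vs. A (Suc n) = A n @ us \<and> B (Suc n) = B n @ vs" for n using S(3)[of n] by (auto simp: A_def B_def)
  have enA: "e n \<in> set (A (Suc n))" and enB: "e n \<in> set (B (Suc n))" for n using S(3)[of n] by (auto simp: A_def B_def)
  have mono: "\<exists>us vs. A (n + m) = A n @ us \<and> B (n + m) = B n @ vs" for n m
  proof (induction m)
    case (Suc m)
    then show ?case using step[of "n + m"] by auto
  qed simp
  have nth_mono: "i < length (A m)" "A m ! i = A n ! i" "B m ! i = B n ! i" if "n \<le> m" "i < length (A n)" for n m i
  proof -
    have "n + (m - n) = m" using that by simp
    then obtain us vs where "A m = A n @ us" "B m = B n @ vs" using mono[of n "m - n"] by auto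
    then show "i < length (A m)" "A m ! i = A n ! i" "B m ! i = B n ! i" using that len[of n] by (auto simp: nth_append)
  qed
  define r where "r x y \<longleftrightarrow> (\<exists>n i. i < length (A n) \<and> A n ! i = x \<and> B n ! i = y)" for x y
  have r_iff: "x = x' \<longleftrightarrow> y = y'" if r: "r x y" "r x' y'" for x x' y y'
  proof -
    obtain n i n' i' where "i < length (A n)" "A n ! i = x" "B n ! i = y" "i' < length (A n')" "A n' ! i' = x'" "B n' ! i' = y'"
      using r by (auto simp: r_def)
    then have "i < length (A (max n n'))" "A (max n n') ! i = x" "B (max n n') ! i = y"
      "i' < length (A (max n n'))" "A (max n n') ! i' = x'" "B (max n n') ! i' = y'"
      using nth_mono[of n "max n n'" i] nth_mono[of n' "max n n'" i'] by auto
    then show ?thesis using tp_nth_eq[OF tpAB, of i "max n n'" i'] by simp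
  qed
  have r_left: "\<exists>y\<in>\<Omega>. r x y" and r_right: "\<exists>y\<in>\<Omega>. r y x" if x: "x \<in> \<Omega>" for x
  proof -
    obtain n where n: "x = e n" using x e by auto
    obtain i where "i < length (A (Suc n))" "A (Suc n) ! i = x" using enA n by (metis in_set_conv_nth)
    moreover have "B (Suc n) ! i \<in> \<Omega>" using calculation len[of "Suc n"] B\<Omega>[of "Suc n"] by (auto intro: nth_mem)
    ultimately show "\<exists>y\<in>\<Omega>. r x y" unfolding r_def by blast
    obtain i where "i < length (B (Suc n))" "B (Suc n) ! i = x" using enB n by (metis in_set_conv_nth)
    moreover have "A (Suc n) ! i \<in> \<Omega>" using calculation len[of "Suc n"] A\<Omega>[of "Suc n"] by (auto intro: nth_mem)
    ultimately show "\<exists>y\<in>\<Omega>. r y x" unfolding r_def using len by metis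
  qed
  define g where "g x = (if x \<in> \<Omega> then SOME y. y \<in> \<Omega> \<and> r x y else x)" for x
  have g: "g x \<in> \<Omega> \<and> r x (g x)" if "x \<in> \<Omega>" for x
    using someI_ex[of "\<lambda>y. y \<in> \<Omega> \<and> r x y"] r_left[OF that] that by (auto simp: g_def)
  have g_eq: "g x = y" if "r x y" "x \<in> \<Omega>" for x y using g[OF that(2)] r_iff[OF that(1)] by blast
  have gA: "map g (A n) = B n" for n
  proof (rule nth_equalityI)
    fix i assume i: "i < length (map g (A n))"
    then have "r (A n ! i) (B n ! i)" "A n ! i \<in> \<Omega>" using A\<Omega>[of n] by (auto simp: r_def)
    then show "map g (A n) ! i = B n ! i" using g_eq i by simp
  qed (simp add: len)
  have img: "g ` \<Omega> = \<Omega>"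
  proof
    show "g ` \<Omega> \<subseteq> \<Omega>" using g by blast
    show "\<Omega> \<subseteq> g ` \<Omega>" using r_right g_eq by (metis image_eqI subsetI)
  qed
  have g_out: "g x = x" if "x \<notin> \<Omega>" for x using that by (simp add: g_def)
  have inj: "x = y" if "g x = g y" for x y
  proof (cases "x \<in> \<Omega>")
    case True
    then have "y \<in> \<Omega>" using that g[of x] g_out[of y] by (cases "y \<in> \<Omega>") auto
    then show ?thesis using True that g[of x] g[of y] r_iff[of x "g x" y "g y"] by simp
  next
    case False
    then have "y \<notin> \<Omega>" using that g[of y] g_out[of x] by (cases "y \<in> \<Omega>") auto
    then show ?thesis using that g_out[OF False] g_out[of y] by simp
  qed
  have "\<exists>x. y = g x" for y
  proof (cases "y \<in> \<Omega>")
    case True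
    then show ?thesis using img by blast
  next
    case False
    then show ?thesis using g_out[of y] by (intro exI[of _ y]) simp
  qed
  then have "surj g" by (simp add: surj_def)
  then have "bij g" using inj by (auto simp: bij_def intro: injI)
  have tpg: "tp (map g zs) = tp zs" if zs: "set zs \<subseteq> \<Omega>" for zs
  proof -
    have "\<exists>n. \<forall>z\<in>set zs. z \<in> set (A n)"
      using zs
    proof (induction zs)
      case (Cons z zs)
      then obtain n where n: "\<forall>z\<in>set zs. z \<in> set (A n)" by auto
      obtain m where "z = e m" using Cons.prems e by auto
      then have "z \<in> set (A (Suc m))" using enA by simp
      moreover have "set (A n) \<subseteq> set (A (n + Suc m))" using mono[of n "Suc m"] by auto
      moreover have "set (A (Suc m)) \<subseteq> set (A (n + Suc m))"
        unfolding add.commute[of n "Suc m"] using mono[of "Suc m" n] by auto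
      ultimately show ?case using n by (intro exI[of _ "n + Suc m"]) auto
    qed simp
    then obtain n where n: "\<forall>z\<in>set zs. z \<in> set (A n)" by blast
    then have "\<forall>z\<in>set zs. \<exists>i<length (A n). A n ! i = z" by (metis in_set_conv_nth)
    then obtain idx where idx: "\<And>z. z \<in> set zs \<Longrightarrow> idx z < length (A n) \<and> A n ! idx z = z" by metis
    have "zs = map ((!) (A n)) (map idx zs)" using idx by (simp add: map_idI)
    moreover have "map g zs = map ((!) (B n)) (map idx zs)"
    proof -
      have "g z = B n ! idx z" if "z \<in> set zs" for z
        using arg_cong[OF gA[of n], of "\<lambda>l. l ! idx z"] idx[OF that] by simp
      then show ?thesis by simp
    qed
    ultimately show ?thesis using idx by (intro tp_select_eq[OF tpAB[of n, symmetric], of "map idx zs"]) (auto simp: len)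
  qed
  have "g \<in> perms \<Omega>" using \<open>bij g\<close> img g_out tpg by (simp add: perms_def)
  moreover have "map g xs = ys" using gA[of 0] S(2) by (simp add: A_def B_def)
  ultimately show ?thesis by blast
qed

lemma conj_iff_tp:
  assumes "extensible \<Omega>" "set xs \<subseteq> \<Omega>" "set ys \<subseteq> \<Omega>"
  shows "(\<exists>g\<in>perms \<Omega>. map g xs = ys) \<longleftrightarrow> tp xs = tp ys"
proof
  assume "\<exists>g\<in>perms \<Omega>. map g xs = ys"
  then show "tp xs = tp ys" using assms(2) by (auto simp: perms_def)
qed (rule back_and_forth[OF assms])

lemma stable_action_perms:
  assumes \<Omega>: "extensible \<Omega>"
  shows "stable_action \<Omega> (perms \<Omega>) k"
proof
  have sub: "\<Omega> \<subseteq> M" using \<Omega> by (simp add: extensible_def)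
  show "bij g" "g ` \<Omega> = \<Omega>" if "g \<in> perms \<Omega>" for g using that by (auto simp: perms_def)
  show "id \<in> perms \<Omega>" by (simp add: perms_def)
  show "g \<circ> h \<in> perms \<Omega>" if "g \<in> perms \<Omega>" "h \<in> perms \<Omega>" for g h
  proof -
    have "tp (map (g \<circ> h) zs) = tp zs" if "set zs \<subseteq> \<Omega>" for zs
    proof -
      have "set (map h zs) \<subseteq> \<Omega>" using that \<open>h \<in> perms \<Omega>\<close> by (auto simp: perms_def)
      then have "tp (map g (map h zs)) = tp (map h zs)" using \<open>g \<in> perms \<Omega>\<close> unfolding perms_def by blast
      then show ?thesis using that \<open>h \<in> perms \<Omega>\<close> by (simp add: perms_def)
    qed
    moreover have "(g \<circ> h) ` \<Omega> = \<Omega>" using that unfolding perms_def by (simp only: image_comp[symmetric] mem_Collect_eq)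
    moreover have "bij (g \<circ> h)" "\<forall>x. x \<notin> \<Omega> \<longrightarrow> (g \<circ> h) x = x" using that by (auto simp: perms_def bij_comp)
    ultimately show ?thesis unfolding perms_def by blast
  qed
  show "inv g \<in> perms \<Omega>" if g: "g \<in> perms \<Omega>" for g
  proof -
    have b: "bij g" "g ` \<Omega> = \<Omega>" using g by (auto simp: perms_def)
    have i: "inv g ` \<Omega> = \<Omega>" using b by (metis bij_is_inj image_inv_f_f)
    have "tp (map (inv g) zs) = tp zs" if "set zs \<subseteq> \<Omega>" for zs
    proof -
      have "set (map (inv g) zs) \<subseteq> \<Omega>" using that i by auto
      then have "tp (map g (map (inv g) zs)) = tp (map (inv g) zs)" using g unfolding perms_def by blast
      moreover have "map g (map (inv g) zs) = zs" using b(1) by (simp add: map_idI bij_is_surj surj_f_inv_f)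
      ultimately show ?thesis by simp
    qed
    moreover have "inv g x = x" if "x \<notin> \<Omega>" for x
    proof -
      have "g x = x" using g that by (simp add: perms_def)
      then show ?thesis using inv_f_f[OF bij_is_inj[OF b(1)], of x] by simp
    qed
    ultimately show ?thesis using b i by (simp add: perms_def bij_imp_bij_inv)
  qed
  show "\<exists>S. finite S \<and> (\<forall>xs\<in>tups \<Omega> n. \<exists>ys\<in>S. \<exists>g\<in>perms \<Omega>. map g xs = ys)" for n
  proof -
    have "tups \<Omega> n \<subseteq> tups M n" using sub by (auto simp: tups_def)
    then have fin: "finite (tp ` tups \<Omega> n)" using finite_types[of n] by (meson finite_subset image_mono)
    let ?s = "\<lambda>t. SOME ys. ys \<in> tups \<Omega> n \<and> tp ys = t"
    have "\<exists>ys\<in>?s ` tp ` tups \<Omega> n. \<exists>g\<in>perms \<Omega>. map g xs = ys" if "xs \<in> tups \<Omega> n" for xs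
    proof -
      have "?s (tp xs) \<in> tups \<Omega> n \<and> tp (?s (tp xs)) = tp xs" by (rule someI[of _ xs]) (simp add: that)
      then have "\<exists>g\<in>perms \<Omega>. map g xs = ?s (tp xs)" using that by (intro back_and_forth[OF \<Omega>]) (auto simp: tups_def)
      then show ?thesis using that by blast
    qed
    then show ?thesis using fin by (intro exI[of _ "?s ` tp ` tups \<Omega> n"]) blast
  qed
  show "\<exists>g\<in>perms \<Omega>. (\<forall>a\<in>A. g a = a) \<and> g x = y"
    if A: "finite A" "A \<noteq> {}" "A \<subseteq> \<Omega>" "x \<in> \<Omega>" "y \<in> \<Omega>"
      and t: "\<And>es. es \<in> tups A k \<Longrightarrow> \<exists>g\<in>perms \<Omega>. map g (es @ [x]) = es @ [y]" for A x y
  proof -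
    obtain xs where xs: "set xs = A" using A finite_list by blast
    have tpk: "tp (es @ [x]) = tp (es @ [y])" if es: "es \<in> tups (set xs) k" for es
    proof -
      obtain g where "g \<in> perms \<Omega>" "map g (es @ [x]) = es @ [y]" using t[of es] es xs by auto
      moreover have "set (es @ [x]) \<subseteq> \<Omega>" using es xs A by (auto simp: tups_def)
      ultimately show ?thesis using perms_tp[of g \<Omega> "es @ [x]"] by metis
    qed
    have "xs \<noteq> []" using xs A(2) by auto
    then have "tp (xs @ [x]) = tp (xs @ [y])" using tpk by (rule tp_determined)
    then obtain g where g: "g \<in> perms \<Omega>" "map g (xs @ [x]) = xs @ [y]"
      using back_and_forth[OF \<Omega>, of "xs @ [x]" "xs @ [y]"] xs A by auto
    then have "map g xs = map id xs" "g x = y" by auto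
    then have "\<forall>a\<in>A. g a = a" unfolding map_eq_conv xs by simp
    then show ?thesis using g \<open>g x = y\<close> by blast
  qed
  show "\<exists>n. \<not> ladder R (tups \<Omega> p) (tups \<Omega> q) n" if R: "invariant_rel (perms \<Omega>) \<Omega> p q R" for p q R
  proof -
    let ?R = "\<lambda>xs ys. \<exists>us\<in>tups \<Omega> p. \<exists>vs\<in>tups \<Omega> q. tp (us @ vs) = tp (xs @ ys) \<and> R us vs"
    have "\<exists>n. \<not> ladder ?R (tups M p) (tups M q) n" by (rule no_ladder) auto
    then obtain n where n: "\<not> ladder ?R (tups M p) (tups M q) n" by blast
    have R_iff: "?R xs ys \<longleftrightarrow> R xs ys" if xs: "xs \<in> tups \<Omega> p" "ys \<in> tups \<Omega> q" for xs ys
    proof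
      assume "?R xs ys"
      then obtain us vs where us: "us \<in> tups \<Omega> p" "vs \<in> tups \<Omega> q" "tp (us @ vs) = tp (xs @ ys)" "R us vs" by blast
      then obtain g where g: "g \<in> perms \<Omega>" "map g (us @ vs) = xs @ ys"
        using back_and_forth[OF \<Omega>, of "us @ vs" "xs @ ys"] xs by (auto simp: tups_def)
      then have "map g us = xs" "map g vs = ys" using us xs by (auto simp: tups_def)
      then show "R xs ys" using R g(1) us unfolding invariant_rel_def by blast
    qed (use xs in blast)
    have "\<not> ladder R (tups \<Omega> p) (tups \<Omega> q) n"
    proof
      assume "ladder R (tups \<Omega> p) (tups \<Omega> q) n"
      then obtain a b where ab: "\<forall>i<n. a i \<in> tups \<Omega> p \<and> b i \<in> tups \<Omega> q" "\<forall>i<n. \<forall>j<n. R (a i) (b j) \<longleftrightarrow> i < j"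
        unfolding ladder_def by blast
      have "ladder ?R (tups \<Omega> p) (tups \<Omega> q) n"
        unfolding ladder_def using ab R_iff by (intro exI[of _ a] exI[of _ b]) simp
      then have "ladder ?R (tups M p) (tups M q) n" by (rule ladder_mono) (use sub in \<open>auto simp: tups_def\<close>)
      then show False using n by simp
    qed
    then show ?thesis by blast
  qed
qed

lemma tp_append:
  assumes "tp (xs @ ys) = tp (xs' @ ys')" "length xs = length xs'"
  shows "tp ys = tp ys'" "tp (butlast ys @ xs) = tp (butlast ys' @ xs')"
proof -
  have len: "length ys = length ys'" using tp_length[OF assms(1)] assms(2) by simp
  let ?p = "length xs" and ?q = "length ys"
  show "tp ys = tp ys'"
  proof (rule tp_select_eq[OF assms(1), of "[?p..<?p + ?q]"])
    show "ys = map ((!) (xs @ ys)) [?p..<?p + ?q]" by (rule nth_equalityI) auto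
    show "ys' = map ((!) (xs' @ ys')) [?p..<?p + ?q]" using len assms(2) by (intro nth_equalityI) auto
  qed auto
  show "tp (butlast ys @ xs) = tp (butlast ys' @ xs')"
  proof (rule tp_select_eq[OF assms(1), of "[?p..<?p + (?q - 1)] @ [0..<?p]"])
    show "butlast ys @ xs = map ((!) (xs @ ys)) ([?p..<?p + (?q - 1)] @ [0..<?p])"
      by (rule nth_equalityI) (auto simp: nth_append nth_butlast)
    show "butlast ys' @ xs' = map ((!) (xs' @ ys')) ([?p..<?p + (?q - 1)] @ [0..<?p])"
      using len assms(2) by (intro nth_equalityI) (auto simp: nth_append nth_butlast)
  qed auto
qed

text \<open>The relation \<open>same_type\<close> on an extensible set is given by types.  This bounds the trees for it, and thereby
  the lengths of the parameter tuples of minimal types, uniformly for all extensible sets.\<close>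

lemma exists_minimal_uniform:
  "\<exists>m. \<forall>\<Omega>. extensible \<Omega> \<longrightarrow> infinite \<Omega> \<longrightarrow> (\<exists>b d. stable_action.minimal_over \<Omega> (perms \<Omega>) b d \<and> length b \<le> m)"
proof -
  let ?R = "\<lambda>xs ys. tp (butlast ys @ xs) = tp ys"
  have "\<exists>n. \<not> ladder ?R (tups M 1) (tups M (Suc k)) n"
  proof (rule no_ladder)
    fix xs ys xs' ys' assume xs: "xs \<in> tups M 1" "xs' \<in> tups M 1" and eq: "tp (xs @ ys) = tp (xs' @ ys')" and R: "?R xs ys"
    have "length xs = length xs'" using xs by (simp add: tups_def)
    then have "tp ys = tp ys'" "tp (butlast ys @ xs) = tp (butlast ys' @ xs')" using tp_append[OF eq] by blast+
    then show "?R xs' ys'" using R by simp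
  qed
  then obtain n where n: "\<not> ladder ?R (tups M 1) (tups M (Suc k)) n" by blast
  let ?N = "tree_bound (2 * Suc n)"
  show ?thesis
  proof (intro exI[of _ "Suc (k * ?N)"] allI impI)
    fix \<Omega> assume \<Omega>: "extensible \<Omega>" "infinite \<Omega>"
    interpret stable_action \<Omega> "perms \<Omega>" k by (rule stable_action_perms[OF \<Omega>(1)])
    have "\<not> splitting_tree same_type (tups \<Omega> (Suc k)) ?N (tups \<Omega> 1)"
    proof
      assume "splitting_tree same_type (tups \<Omega> (Suc k)) ?N (tups \<Omega> 1)"
      then have "ladder same_type (tups \<Omega> 1) (tups \<Omega> (Suc k)) n" by (rule ladder_of_splitting_tree)
      then obtain a b where ab: "\<forall>i<n. a i \<in> tups \<Omega> 1 \<and> b i \<in> tups \<Omega> (Suc k)" "\<forall>i<n. \<forall>j<n. same_type (a i) (b j) \<longleftrightarrow> i < j"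
        unfolding ladder_def by blast
      have same: "same_type xs ys \<longleftrightarrow> ?R xs ys" if xs: "xs \<in> tups \<Omega> 1" "ys \<in> tups \<Omega> (Suc k)" for xs ys
      proof -
        have "set (butlast ys @ xs) \<subseteq> \<Omega>" "set ys \<subseteq> \<Omega>" using xs in_set_butlastD[of _ ys] by (auto simp: tups_def)
        then show ?thesis unfolding same_type_def by (rule conj_iff_tp[OF \<Omega>(1)])
      qed
      have "ladder ?R (tups \<Omega> 1) (tups \<Omega> (Suc k)) n"
        unfolding ladder_def
      proof (rule exI[of _ a], rule exI[of _ b], intro conjI allI impI)
        fix i j assume "i < n" "j < n"
        then show "?R (a i) (b j) \<longleftrightarrow> i < j" using ab same[of "a i" "b j"] by simp
      qed (use ab in auto)
      then have "ladder ?R (tups M 1) (tups M (Suc k)) n"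
        by (rule ladder_mono) (use \<Omega>(1) in \<open>auto simp: extensible_def tups_def\<close>)
      then show False using n by simp
    qed
    then show "\<exists>b d. minimal_over b d \<and> length b \<le> Suc (k * ?N)" by (rule exists_minimal[OF \<Omega>(2)])
  qed
qed

text \<open>Shrinking a minimal type makes it algebraic, and types that are algebraic remain so when the set shrinks further.  Since there are
  finitely many types of tuples of bounded length, the process ends with a finite set.\<close>

theorem finite_extensible_superset:
  assumes "extensible \<Omega>" "finite B" "B \<subseteq> \<Omega>"
  shows "\<exists>A. finite A \<and> B \<subseteq> A \<and> A \<subseteq> \<Omega> \<and> extensible A"
proof -
  obtain m where m: "\<And>\<Omega>. extensible \<Omega> \<Longrightarrow> infinite \<Omega> \<Longrightarrow>
      \<exists>b d. stable_action.minimal_over \<Omega> (perms \<Omega>) b d \<and> length b \<le> m"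
    using exists_minimal_uniform by blast
  define T where "T \<Omega> = {tp (b @ [d]) | b d. set b \<subseteq> \<Omega> \<and> d \<in> \<Omega> \<and> length b \<le> m \<and>
      infinite {d' \<in> \<Omega>. tp (b @ [d']) = tp (b @ [d])}}" for \<Omega>
  have finT: "finite (T \<Omega>)" if \<Omega>: "extensible \<Omega>" for \<Omega>
  proof (rule finite_subset)
    show "T \<Omega> \<subseteq> (\<Union>n\<le>Suc m. tp ` tups M n)"
    proof
      fix t assume "t \<in> T \<Omega>"
      then obtain b d where b: "t = tp (b @ [d])" "set b \<subseteq> \<Omega>" "d \<in> \<Omega>" "length b \<le> m" by (auto simp: T_def)
      moreover have "\<Omega> \<subseteq> M" using \<Omega> by (simp add: extensible_def)
      ultimately have "b @ [d] \<in> tups M (Suc (length b))" by (auto simp: tups_def)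
      then show "t \<in> (\<Union>n\<le>Suc m. tp ` tups M n)" using b(1,4) by blast
    qed
  qed (simp add: finite_types)
  show ?thesis
    using assms(1,3)
  proof (induction "card (T \<Omega>)" arbitrary: \<Omega> rule: less_induct)
    case less
    have \<Omega>: "extensible \<Omega>" "B \<subseteq> \<Omega>" using less.prems by auto
    show ?case
    proof (cases "finite \<Omega>")
      case True
      then show ?thesis using \<Omega> by blast
    next
      case False
      then obtain b0 d0 where b0: "stable_action.minimal_over \<Omega> (perms \<Omega>) b0 d0" "length b0 \<le> m"
        using m[OF \<Omega>(1)] by blast
      interpret stable_action \<Omega> "perms \<Omega>" k by (rule stable_action_perms[OF \<Omega>(1)])
      interpret minimal_type \<Omega> "perms \<Omega>" k b0 d0 by unfold_locales (rule b0(1))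
      have "\<exists>\<Omega>'\<subseteq>\<Omega>. B \<subseteq> \<Omega>' \<and> (\<forall>b. finite (X b \<inter> \<Omega>')) \<and>
        (\<forall>g\<in>perms \<Omega>. \<forall>xs c. set xs \<subseteq> \<Omega>' \<longrightarrow> g ` set xs \<subseteq> \<Omega>' \<longrightarrow> c \<in> \<Omega>' \<longrightarrow>
          (\<exists>h\<in>perms \<Omega>. map h xs = map g xs \<and> h c \<in> \<Omega>'))"
        by (rule shrink[OF assms(2) \<Omega>(2)])
      then obtain \<Omega>' where \<Omega>': "\<Omega>' \<subseteq> \<Omega>" "B \<subseteq> \<Omega>'" "\<forall>b. finite (X b \<inter> \<Omega>')"
        "\<forall>g\<in>perms \<Omega>. \<forall>xs c. set xs \<subseteq> \<Omega>' \<longrightarrow> g ` set xs \<subseteq> \<Omega>' \<longrightarrow> c \<in> \<Omega>' \<longrightarrow>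
          (\<exists>h\<in>perms \<Omega>. map h xs = map g xs \<and> h c \<in> \<Omega>')"
        by (elim exE conjE) (rule that; assumption)
      have ext: "extensible \<Omega>'"
        unfolding extensible_def
      proof (intro conjI allI impI)
        show "\<Omega>' \<subseteq> M" using \<Omega>'(1) \<Omega>(1) by (auto simp: extensible_def)
        fix xs ys c assume xs: "set xs \<subseteq> \<Omega>'" "set ys \<subseteq> \<Omega>'" "tp xs = tp ys" "c \<in> \<Omega>'"
        then obtain g where g: "g \<in> perms \<Omega>" "map g xs = ys" using back_and_forth[OF \<Omega>(1), of xs ys] \<Omega>'(1) by blast
        then have "g ` set xs \<subseteq> \<Omega>'" using xs(2) by (metis set_map)
        then have "\<exists>h\<in>perms \<Omega>. map h xs = map g xs \<and> h c \<in> \<Omega>'" using bspec[OF \<Omega>'(4) g(1)] xs(1,4) by blast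
        then obtain h where h: "h \<in> perms \<Omega>" "map h xs = ys" "h c \<in> \<Omega>'" unfolding g(2) by blast
        have "set (xs @ [c]) \<subseteq> \<Omega>" using xs \<Omega>'(1) by auto
        then have "tp (xs @ [c]) = tp (ys @ [h c])" using perms_tp[OF h(1), of "xs @ [c]"] h(2) by simp
        then show "\<exists>d\<in>\<Omega>'. tp (xs @ [c]) = tp (ys @ [d])" using h(3) by blast
      qed
      have X_tp: "d \<in> X b" if bd: "set b \<subseteq> \<Omega>" "d \<in> \<Omega>" and eq: "tp (b @ [d]) = tp (b0 @ [d0])" for b d
      proof -
        obtain g where "g \<in> perms \<Omega>" "map g (b0 @ [d0]) = b @ [d]"
          using back_and_forth[OF \<Omega>(1) _ _ eq[symmetric]] bd b0_simps by auto
        then show ?thesis by (auto simp: X_def Pts_def image_iff)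
      qed
      have tp_X: "tp (b0 @ [d]) = tp (b0 @ [d0])" if d: "d \<in> X b0" for d
      proof -
        obtain g where g: "g \<in> perms \<Omega>" "map g b0 = b0" "g d0 = d" using d by (auto simp: X_def Pts_def)
        have "set (b0 @ [d0]) \<subseteq> \<Omega>" using b0_simps by auto
        then show ?thesis using perms_tp[OF g(1), of "b0 @ [d0]"] g(2,3) by simp
      qed
      have "T \<Omega>' \<subseteq> T \<Omega>"
      proof
        fix t assume "t \<in> T \<Omega>'"
        then obtain b d where b: "t = tp (b @ [d])" "set b \<subseteq> \<Omega>'" "d \<in> \<Omega>'" "length b \<le> m"
          "infinite {d' \<in> \<Omega>'. tp (b @ [d']) = tp (b @ [d])}" by (auto simp: T_def)
        have "infinite {d' \<in> \<Omega>. tp (b @ [d']) = tp (b @ [d])}"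
          using b(5) by (rule infinite_super[rotated]) (use \<Omega>'(1) in auto)
        then show "t \<in> T \<Omega>" using b \<Omega>'(1) unfolding T_def by blast
      qed
      moreover have "tp (b0 @ [d0]) \<in> T \<Omega>"
      proof -
        have "infinite (X b0)" using X_infinite[of b0] G_id by (force simp: Par_def)
        then have "infinite {d' \<in> \<Omega>. tp (b0 @ [d']) = tp (b0 @ [d0])}"
          by (rule infinite_super[rotated]) (use tp_X X_in in auto)
        then show ?thesis using b0_simps b0(2) unfolding T_def by blast
      qed
      moreover have "tp (b0 @ [d0]) \<notin> T \<Omega>'"
      proof
        assume "tp (b0 @ [d0]) \<in> T \<Omega>'"
        then obtain b d where b: "tp (b0 @ [d0]) = tp (b @ [d])" "set b \<subseteq> \<Omega>'"
          "infinite {d' \<in> \<Omega>'. tp (b @ [d']) = tp (b @ [d])}" by (auto simp: T_def)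
        have "{d' \<in> \<Omega>'. tp (b @ [d']) = tp (b @ [d])} \<subseteq> X b \<inter> \<Omega>'"
          using X_tp[of b] b(1,2) \<Omega>'(1) by auto
        then show False using b(3) \<Omega>'(3) finite_subset by blast
      qed
      ultimately have "card (T \<Omega>') < card (T \<Omega>)" using finT[OF \<Omega>(1)] by (intro psubset_card_mono) auto
      then have "\<exists>A. finite A \<and> B \<subseteq> A \<and> A \<subseteq> \<Omega>' \<and> extensible A" using ext \<Omega>'(2) by (rule less.hyps)
      then show ?thesis using \<Omega>'(1) by blast
    qed
  qed
qed

end

section \<open>Isomorphisms and satisfaction\<close>

lemma sat_cong: "(\<And>x. x \<in> free_vars \<phi> \<Longrightarrow> v x = w x) \<Longrightarrow> sat M v \<phi> \<longleftrightarrow> sat M w \<phi>"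
proof (induction \<phi> arbitrary: v w)
  case (Rel R xs)
  then have "map v xs = map w xs" by (intro map_cong) auto
  then show ?case by (simp only: sat.simps)
next
  case (Conj \<phi> \<psi>)
  have "sat M v \<phi> \<longleftrightarrow> sat M w \<phi>" "sat M v \<psi> \<longleftrightarrow> sat M w \<psi>"
    using Conj.prems by (intro Conj.IH; simp)+
  then show ?case by simp
next
  case (Exists x \<phi>)
  have "sat M (v(x := a)) \<phi> \<longleftrightarrow> sat M (w(x := a)) \<phi>" for a using Exists.prems by (intro Exists.IH) simp
  then show ?case by simp
next
  case (Neg \<phi>)
  have "sat M v \<phi> \<longleftrightarrow> sat M w \<phi>" using Neg.prems by (intro Neg.IH) simp
  then show ?case by simp
qed simp

lemma isomorphismD:
  assumes "isomorphism L M N f"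
  shows "bij_betw f (carrier M) (carrier N)" "a \<in> carrier M \<Longrightarrow> f a \<in> carrier N"
    "R \<in> symbols L \<Longrightarrow> as \<in> tuples M (arity L R) \<Longrightarrow> map f as \<in> interp N R \<longleftrightarrow> as \<in> interp M R"
  using assms by (auto simp: isomorphism_def bij_betw_def)

lemma isomorphism_image_tuples:
  assumes "isomorphism L M N f" shows "map f ` tuples M n = tuples N n"
proof
  show "map f ` tuples M n \<subseteq> tuples N n" using isomorphismD(2)[OF assms] by (auto simp: tuples_def subset_iff)
  show "tuples N n \<subseteq> map f ` tuples M n"
  proof
    fix bs assume bs: "bs \<in> tuples N n"
    let ?g = "inv_into (carrier M) f"
    have "f (?g b) = b \<and> ?g b \<in> carrier M" if "b \<in> carrier N" for b
      using that isomorphismD(1)[OF assms] f_inv_into_f[of b f "carrier M"] inv_into_into[of b f "carrier M"]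
      by (simp add: bij_betw_def)
    then have "map f (map ?g bs) = bs" "set (map ?g bs) \<subseteq> carrier M"
      using bs by (auto simp: tuples_def subset_iff intro!: map_idI)
    moreover have "map ?g bs \<in> tuples M n" using calculation(2) bs by (simp add: tuples_def)
    ultimately show "bs \<in> map f ` tuples M n" by (metis image_eqI)
  qed
qed

lemma isomorphism_comp:
  assumes f: "isomorphism L M N f" and g: "isomorphism L N K g" shows "isomorphism L M K (g \<circ> f)"
  unfolding isomorphism_def
proof (intro conjI ballI)
  show "bij_betw (g \<circ> f) (carrier M) (carrier K)" by (rule bij_betw_trans[OF isomorphismD(1)[OF f] isomorphismD(1)[OF g]])
  fix R as assume R: "R \<in> symbols L" "as \<in> tuples M (arity L R)"
  then have "map f as \<in> tuples N (arity L R)" using isomorphism_image_tuples[OF f] by blast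
  then show "as \<in> interp M R \<longleftrightarrow> map (g \<circ> f) as \<in> interp K R"
    using isomorphismD(3)[OF f R] isomorphismD(3)[OF g R(1), of "map f as"] by simp
qed

lemma isomorphism_inv:
  assumes f: "isomorphism L M N f" shows "isomorphism L N M (inv_into (carrier M) f)"
  unfolding isomorphism_def
proof (intro conjI ballI)
  let ?g = "inv_into (carrier M) f"
  show "bij_betw ?g (carrier N) (carrier M)" by (rule bij_betw_inv_into[OF isomorphismD(1)[OF f]])
  fix R bs assume R: "R \<in> symbols L" "bs \<in> tuples N (arity L R)"
  then obtain as where as: "as \<in> tuples M (arity L R)" "bs = map f as" using isomorphism_image_tuples[OF f] by blast
  have "map ?g bs = as"
    using as isomorphismD(1)[OF f] unfolding as(2) map_map by (auto simp: tuples_def bij_betw_def intro!: map_idI)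
  then show "bs \<in> interp N R \<longleftrightarrow> map ?g bs \<in> interp M R" using isomorphismD(3)[OF f R(1) as(1)] as(2) by simp
qed

lemma sat_isomorphism:
  assumes f: "isomorphism L M N f"
  shows "wf_fm L \<phi> \<Longrightarrow> (\<And>x. x \<in> free_vars \<phi> \<Longrightarrow> v x \<in> carrier M) \<Longrightarrow> sat N (f \<circ> v) \<phi> \<longleftrightarrow> sat M v \<phi>"
proof (induction \<phi> arbitrary: v)
  case (Eq x y)
  then show ?case using isomorphismD(1)[OF f] by (auto simp: bij_betw_def dest: inj_onD)
next
  case (Rel R xs)
  then have "R \<in> symbols L" "map v xs \<in> tuples M (arity L R)" by (auto simp: tuples_def)
  then show ?case using isomorphismD(3)[OF f, of R "map v xs"] by (simp add: comp_def)
next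
  case (Conj \<phi> \<psi>)
  have "sat N (f \<circ> v) \<phi> \<longleftrightarrow> sat M v \<phi>" "sat N (f \<circ> v) \<psi> \<longleftrightarrow> sat M v \<psi>"
    using Conj.prems by (intro Conj.IH; simp)+
  then show ?case by (simp only: sat.simps)
next
  case (Exists x \<phi>)
  have *: "sat N ((f \<circ> v)(x := f a)) \<phi> \<longleftrightarrow> sat M (v(x := a)) \<phi>" if "a \<in> carrier M" for a
  proof -
    have "sat N (f \<circ> v(x := a)) \<phi> \<longleftrightarrow> sat M (v(x := a)) \<phi>" using Exists.prems that by (intro Exists.IH) auto
    then show ?thesis by (simp add: fun_upd_comp)
  qed
  have "carrier N = f ` carrier M" using isomorphismD(1)[OF f] by (auto simp: bij_betw_def)
  then show ?case using * by (simp add: comp_def)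
next
  case (Neg \<phi>)
  have "sat N (f \<circ> v) \<phi> \<longleftrightarrow> sat M v \<phi>" using Neg.prems by (intro Neg.IH) simp_all
  then show ?case by (simp only: sat.simps)
qed

text \<open>The valuation of a tuple of variables, as it occurs in \<^const>\<open>sat_at\<close>.\<close>

lemma valuation_nth:
  "distinct xs \<Longrightarrow> length as = length xs \<Longrightarrow> i < length xs \<Longrightarrow> the (map_of (zip xs as) (xs ! i)) = as ! i"
  by (simp add: map_of_zip_nth)

lemma valuation_map:
  "distinct xs \<Longrightarrow> length as = length xs \<Longrightarrow> map (\<lambda>x. the (map_of (zip xs as) x)) xs = as"
  by (rule nth_equalityI) (auto simp: valuation_nth)

lemma sat_at_cong:
  assumes "formula_in L xs \<phi>" "length as = length xs" "map v xs = as"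
  shows "sat_at M \<phi> xs as \<longleftrightarrow> sat M v \<phi>"
  unfolding sat_at_def
proof (rule sat_cong)
  fix x assume "x \<in> free_vars \<phi>"
  then obtain i where "i < length xs" "xs ! i = x" using assms(1) by (auto simp: formula_in_def in_set_conv_nth subset_iff)
  then show "the (map_of (zip xs as) x) = v x"
    using valuation_nth[of xs as i] assms by (auto simp: formula_in_def)
qed

lemma sat_at_isomorphism:
  assumes f: "isomorphism L M N f" and \<phi>: "formula_in L xs \<phi>" and as: "as \<in> tuples M (length xs)"
  shows "sat_at N \<phi> xs (map f as) \<longleftrightarrow> sat_at M \<phi> xs as"
proof -
  let ?v = "\<lambda>x. the (map_of (zip xs as) x)"
  have d: "distinct xs" "length as = length xs" using \<phi> as by (auto simp: formula_in_def tuples_def)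
  have v: "map ?v xs = as" using valuation_map[OF d] .
  have "?v x \<in> carrier M" if "x \<in> free_vars \<phi>" for x
  proof -
    have "x \<in> set xs" using that \<phi> by (auto simp: formula_in_def)
    then have "?v x \<in> set (map ?v xs)" by (simp del: map_eq_conv)
    then show ?thesis using v as by (auto simp: tuples_def)
  qed
  then have "sat N (f \<circ> ?v) \<phi> \<longleftrightarrow> sat M ?v \<phi>" using \<phi> by (intro sat_isomorphism[OF f]) (auto simp: formula_in_def)
  moreover have "map (f \<circ> ?v) xs = map f as" using v by (metis map_map)
  ultimately show ?thesis
    using sat_at_cong[OF \<phi>, of "map f as" "f \<circ> ?v" N] d(2) by (simp add: sat_at_def)
qed

lemma theory_of_isomorphism: "isomorphism L M N f \<Longrightarrow> theory_of L M = theory_of L N"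
  using sat_at_isomorphism[of L M N f "[]" _ "[]"] by (auto simp: theory_of_def tuples_def)

lemma card_solutions_isomorphism:
  assumes f: "isomorphism L M N f" and \<phi>: "formula_in L (xs @ ys) \<phi>" and bs: "bs \<in> tuples M (length ys)"
  shows "card (solutions N \<phi> xs ys (map f bs)) = card (solutions M \<phi> xs ys bs)"
proof -
  have "solutions N \<phi> xs ys (map f bs) = map f ` solutions M \<phi> xs ys bs"
  proof -
    have "sat_at N \<phi> (xs @ ys) (map f as @ map f bs) \<longleftrightarrow> sat_at M \<phi> (xs @ ys) (as @ bs)"
      if "as \<in> tuples M (length xs)" for as
      using sat_at_isomorphism[OF f \<phi>, of "as @ bs"] that bs by (auto simp: tuples_def)
    then show ?thesis unfolding solutions_def isomorphism_image_tuples[OF f, symmetric] by auto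
  qed
  moreover have "inj_on (map f) (solutions M \<phi> xs ys bs)"
  proof (rule inj_on_subset)
    show "inj_on (map f) (lists (carrier M))"
      using isomorphismD(1)[OF f] by (auto simp: bij_betw_def intro: inj_on_map_lists)
    show "solutions M \<phi> xs ys bs \<subseteq> lists (carrier M)" by (auto simp: solutions_def tuples_def)
  qed
  ultimately show ?thesis by (simp add: card_image)
qed

section \<open>Quantifier-free types\<close>

text \<open>Atomic relations are recorded by positions in the tuple, so that types of tuples in different structures can be
  compared.\<close>

definition qftype :: "'r language \<Rightarrow> ('r, 'a) rel_structure \<Rightarrow> 'a list \<Rightarrow> nat \<times> (nat \<times> nat) set \<times> ('r \<times> nat list) set" where
  "qftype L M xs = (length xs, {(i, j). i < length xs \<and> j < length xs \<and> xs ! i = xs ! j},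
     {(R, ns). R \<in> symbols L \<and> set ns \<subseteq> {..<length xs} \<and> length ns = arity L R \<and> map ((!) xs) ns \<in> interp M R})"

lemma qftype_eqI:
  assumes "length xs = length ys"
    and "\<And>i j. i < length xs \<Longrightarrow> j < length xs \<Longrightarrow> xs ! i = xs ! j \<longleftrightarrow> ys ! i = ys ! j"
    and "\<And>R ns. R \<in> symbols L \<Longrightarrow> set ns \<subseteq> {..<length xs} \<Longrightarrow> length ns = arity L R \<Longrightarrow>
       map ((!) xs) ns \<in> interp M R \<longleftrightarrow> map ((!) ys) ns \<in> interp N R"
  shows "qftype L M xs = qftype L N ys"
  using assms by (auto simp: qftype_def)

lemma qftype_eqD:
  assumes "qftype L M xs = qftype L N ys"
  shows "length xs = length ys"
    and "i < length xs \<Longrightarrow> j < length xs \<Longrightarrow> xs ! i = xs ! j \<longleftrightarrow> ys ! i = ys ! j"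
    and "R \<in> symbols L \<Longrightarrow> set ns \<subseteq> {..<length xs} \<Longrightarrow> length ns = arity L R \<Longrightarrow>
       map ((!) xs) ns \<in> interp M R \<longleftrightarrow> map ((!) ys) ns \<in> interp N R"
proof -
  have eq: "length xs = length ys" "{(i, j). i < length xs \<and> j < length xs \<and> xs ! i = xs ! j} = {(i, j). i < length ys \<and> j < length ys \<and> ys ! i = ys ! j}"
    "{(R, ns). R \<in> symbols L \<and> set ns \<subseteq> {..<length xs} \<and> length ns = arity L R \<and> map ((!) xs) ns \<in> interp M R} =
     {(R, ns). R \<in> symbols L \<and> set ns \<subseteq> {..<length ys} \<and> length ns = arity L R \<and> map ((!) ys) ns \<in> interp N R}"
    using assms unfolding qftype_def prod.inject by - (elim conjE, assumption)+
  show "length xs = length ys" by (rule eq(1))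
  show "xs ! i = xs ! j \<longleftrightarrow> ys ! i = ys ! j" if "i < length xs" "j < length xs"
    using eq(2)[unfolded set_eq_iff, rule_format, of "(i, j)"] that eq(1) by simp
  show "map ((!) xs) ns \<in> interp M R \<longleftrightarrow> map ((!) ys) ns \<in> interp N R"
    if "R \<in> symbols L" "set ns \<subseteq> {..<length xs}" "length ns = arity L R"
    using eq(3)[unfolded set_eq_iff, rule_format, of "(R, ns)"] that eq(1) by simp
qed

text \<open>Finitely many candidates for the types of \<open>n\<close>-tuples, for all structures at the same time.\<close>

definition qftype_bound :: "'r language \<Rightarrow> nat \<Rightarrow> (nat \<times> (nat \<times> nat) set \<times> ('r \<times> nat list) set) set" where
  "qftype_bound L n = {n} \<times> Pow ({..<n} \<times> {..<n}) \<times> Pow (SIGMA R:symbols L. {ns. set ns \<subseteq> {..<n} \<and> length ns = arity L R})"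

lemma qftype_in_bound: "qftype L M xs \<in> qftype_bound L (length xs)"
  by (auto simp: qftype_def qftype_bound_def)

lemma finite_qftype_bound: "finite (symbols L) \<Longrightarrow> finite (qftype_bound L n)"
  unfolding qftype_bound_def
  by (intro finite_cartesian_product finite_SigmaI iffD2[OF finite_Pow_iff] finite_lists_length_eq) auto

lemma qftype_isomorphism:
  assumes f: "isomorphism L M N f" and xs: "set xs \<subseteq> carrier M"
  shows "qftype L N (map f xs) = qftype L M xs"
proof (rule qftype_eqI)
  fix i j assume "i < length (map f xs)" "j < length (map f xs)"
  then have "xs ! i \<in> carrier M" "xs ! j \<in> carrier M" using xs by auto
  moreover have "inj_on f (carrier M)" using isomorphismD(1)[OF f] by (simp add: bij_betw_def)
  ultimately show "map f xs ! i = map f xs ! j \<longleftrightarrow> xs ! i = xs ! j"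
    using \<open>i < length (map f xs)\<close> \<open>j < length (map f xs)\<close> by (auto dest: inj_onD)
next
  fix R ns assume R: "R \<in> symbols L" "set ns \<subseteq> {..<length (map f xs)}" "length ns = arity L R"
  then have "map ((!) xs) ns \<in> tuples M (arity L R)" using xs by (auto simp: tuples_def subset_iff)
  moreover have eq: "map ((!) (map f xs)) ns = map f (map ((!) xs) ns)" using R(2) by auto
  ultimately show "map ((!) (map f xs)) ns \<in> interp N R \<longleftrightarrow> map ((!) xs) ns \<in> interp M R"
    unfolding eq using isomorphismD(3)[OF f R(1)] by blast
qed simp

lemma qftype_select:
  assumes eq: "qftype L M xs = qftype L N ys" and ns: "set ns \<subseteq> {..<length xs}"
  shows "qftype L M (map ((!) xs) ns) = qftype L N (map ((!) ys) ns)"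
proof (rule qftype_eqI)
  fix i j assume "i < length (map ((!) xs) ns)" "j < length (map ((!) xs) ns)"
  then show "map ((!) xs) ns ! i = map ((!) xs) ns ! j \<longleftrightarrow> map ((!) ys) ns ! i = map ((!) ys) ns ! j"
    using qftype_eqD(2)[OF eq, of "ns ! i" "ns ! j"] subsetD[OF ns nth_mem, of i] subsetD[OF ns nth_mem, of j] by simp
next
  fix R ms assume R: "R \<in> symbols L" "set ms \<subseteq> {..<length (map ((!) xs) ns)}" "length ms = arity L R"
  let ?ks = "map ((!) ns) ms"
  have ks: "map ((!) (map ((!) xs) ns)) ms = map ((!) xs) ?ks" "map ((!) (map ((!) ys) ns)) ms = map ((!) ys) ?ks"
    using R(2) by auto
  have "ns ! m < length xs" if "m \<in> set ms" for m
    using subsetD[OF R(2) that] subsetD[OF ns nth_mem, of m] by simp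
  then have "set ?ks \<subseteq> {..<length xs}" by auto
  then show "map ((!) (map ((!) xs) ns)) ms \<in> interp M R \<longleftrightarrow> map ((!) (map ((!) ys) ns)) ms \<in> interp N R"
    unfolding ks using R(3) by (intro qftype_eqD(3)[OF eq R(1)]) simp_all
qed simp

text \<open>An atomic formula about \<open>xs @ [x]\<close> is one about \<open>x\<close> and at most \<open>k\<close> entries of \<open>xs\<close>.  Positions left over in the
  \<open>k\<close>-tuple are filled by repeating an entry.\<close>

lemma qftype_determined:
  assumes k: "\<And>R. R \<in> symbols L \<Longrightarrow> arity L R \<le> k" "0 < k" and xs: "xs \<noteq> []"
    and eq: "\<And>es. es \<in> tups (set xs) k \<Longrightarrow> qftype L M (es @ [x]) = qftype L M (es @ [y])"
  shows "qftype L M (xs @ [x]) = qftype L M (xs @ [y])"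
proof (rule qftype_eqI)
  have x_eq: "x = a \<longleftrightarrow> y = a" if "a \<in> set xs" for a
  proof -
    let ?es = "replicate k a"
    have "?es \<in> tups (set xs) k" using that by (auto simp: tups_def)
    from qftype_eqD(2)[OF eq[OF this], of k 0] show ?thesis using k(2) by (simp add: nth_append)
  qed
  fix i j assume "i < length (xs @ [x])" "j < length (xs @ [x])"
  then show "(xs @ [x]) ! i = (xs @ [x]) ! j \<longleftrightarrow> (xs @ [y]) ! i = (xs @ [y]) ! j"
    using x_eq[of "xs ! i"] x_eq[of "xs ! j"] by (auto simp: nth_append less_Suc_eq)
next
  fix R ns assume R: "R \<in> symbols L" "set ns \<subseteq> {..<length (xs @ [x])}" "length ns = arity L R"
  let ?h = "\<lambda>i. if i < length xs then xs ! i else hd xs"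
  define es where "es = map ?h ns @ replicate (k - arity L R) (hd xs)"
  define ms where "ms = map (\<lambda>p. if ns ! p < length xs then p else k) [0..<arity L R]"
  have len: "length es = k" using R(3) k(1)[OF R(1)] by (simp add: es_def)
  have "es \<in> tups (set xs) k" using len xs by (auto simp: tups_def es_def)
  then have eq': "qftype L M (es @ [x]) = qftype L M (es @ [y])" by (rule eq)
  have sel: "map ((!) (es @ [z])) ms = map ((!) (xs @ [z])) ns" for z
  proof (rule nth_equalityI)
    fix p assume "p < length (map ((!) (es @ [z])) ms)"
    then have p: "p < arity L R" by (simp add: ms_def)
    then have "ns ! p < Suc (length xs)" using subsetD[OF R(2) nth_mem, of p] R(3) by simp
    then show "map ((!) (es @ [z])) ms ! p = map ((!) (xs @ [z])) ns ! p"
      using p R(3) len k(1)[OF R(1)] by (auto simp: ms_def nth_append es_def less_Suc_eq)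
  qed (simp add: ms_def R(3))
  have "set ms \<subseteq> {..<length (es @ [x])}" "length ms = arity L R" using k(1)[OF R(1)] len by (auto simp: ms_def)
  then have "map ((!) (es @ [x])) ms \<in> interp M R \<longleftrightarrow> map ((!) (es @ [y])) ms \<in> interp M R"
    by (intro qftype_eqD(3)[OF eq' R(1)])
  then show "map ((!) (xs @ [x])) ns \<in> interp M R \<longleftrightarrow> map ((!) (xs @ [y])) ns \<in> interp M R" unfolding sel .
qed simp

definition tuple_homogeneous :: "'r language \<Rightarrow> ('r, 'a) rel_structure \<Rightarrow> bool" where
  "tuple_homogeneous L M \<longleftrightarrow> (\<forall>xs ys. set xs \<subseteq> carrier M \<longrightarrow> set ys \<subseteq> carrier M \<longrightarrow> qftype L M xs = qftype L M ys \<longrightarrow>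
     (\<exists>g. isomorphism L M M g \<and> map g xs = ys))"

lemma tuple_homogeneousD:
  "tuple_homogeneous L M \<Longrightarrow> set xs \<subseteq> carrier M \<Longrightarrow> set ys \<subseteq> carrier M \<Longrightarrow> qftype L M xs = qftype L M ys \<Longrightarrow>
   \<exists>g. isomorphism L M M g \<and> map g xs = ys"
  unfolding tuple_homogeneous_def by blast

lemma tuple_homogeneous:
  assumes hom: "homogeneous L M" shows "tuple_homogeneous L M"
  unfolding tuple_homogeneous_def
proof (intro allI impI)
  fix xs ys assume xs: "set xs \<subseteq> carrier M" "set ys \<subseteq> carrier M" and eq: "qftype L M xs = qftype L M ys"
  have len: "length xs = length ys" using qftype_eqD(1)[OF eq] .
  define f where "f a = ys ! (SOME i. i < length xs \<and> xs ! i = a)" for a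
  have f: "f (xs ! i) = ys ! i" if i: "i < length xs" for i
  proof -
    let ?j = "SOME j. j < length xs \<and> xs ! j = xs ! i"
    have "?j < length xs \<and> xs ! ?j = xs ! i" by (rule someI[of _ i]) (simp add: i)
    then show ?thesis using qftype_eqD(2)[OF eq, of ?j i] i by (simp add: f_def)
  qed
  then have map_f: "map f xs = ys" using len by (intro nth_equalityI) auto
  have "inj_on f (set xs)"
  proof (rule inj_onI)
    fix a b assume "a \<in> set xs" "b \<in> set xs" "f a = f b"
    then obtain i j where "i < length xs" "a = xs ! i" "j < length xs" "b = xs ! j" by (metis in_set_conv_nth)
    then show "a = b" using \<open>f a = f b\<close> f qftype_eqD(2)[OF eq, of i j] by simp
  qed
  then have bij: "bij_betw f (set xs) (set ys)" using map_f by (auto simp: bij_betw_def)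
  have "isomorphism L (substructure_on M (set xs)) (substructure_on M (set ys)) f"
    unfolding isomorphism_def
  proof (intro conjI ballI)
    show "bij_betw f (carrier (substructure_on M (set xs))) (carrier (substructure_on M (set ys)))"
      using bij by (simp add: substructure_on_def)
    fix R as assume R: "R \<in> symbols L" "as \<in> tuples (substructure_on M (set xs)) (arity L R)"
    then have as: "set as \<subseteq> set xs" "length as = arity L R" by (auto simp: tuples_def substructure_on_def)
    then have "\<forall>a\<in>set as. \<exists>i<length xs. xs ! i = a" by (metis in_set_conv_nth subsetD)
    then obtain idx where idx: "\<And>a. a \<in> set as \<Longrightarrow> idx a < length xs \<and> xs ! idx a = a" by metis
    let ?ns = "map idx as"
    have as_eq: "as = map ((!) xs) ?ns" using idx by (simp add: map_idI)
    have "f a = ys ! idx a" if "a \<in> set as" for a using f[of "idx a"] idx[OF that] by simp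
    then have "map f as = map ((!) ys) ?ns" by simp
    moreover have "map ((!) xs) ?ns \<in> interp M R \<longleftrightarrow> map ((!) ys) ?ns \<in> interp M R"
      using idx as(2) by (intro qftype_eqD(3)[OF eq R(1)]) auto
    ultimately have "as \<in> interp M R \<longleftrightarrow> map f as \<in> interp M R" using as_eq by metis
    moreover have "set (map f as) \<subseteq> set ys" using as(1) map_f by auto
    ultimately show "as \<in> interp (substructure_on M (set xs)) R \<longleftrightarrow> map f as \<in> interp (substructure_on M (set ys)) R"
      using as(1) by (auto simp: substructure_on_def)
  qed
  then obtain g where g: "isomorphism L M M g" "\<forall>a\<in>set xs. g a = f a"
    using hom xs unfolding homogeneous_def by (metis List.finite_set)
  then have "map g xs = ys" using map_f by (metis map_cong)
  then show "\<exists>g. isomorphism L M M g \<and> map g xs = ys" using g(1) by blast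
qed

lemma tuple_homogeneous_isomorphism:
  assumes f: "isomorphism L M N f" and M: "tuple_homogeneous L M" shows "tuple_homogeneous L N"
  unfolding tuple_homogeneous_def
proof (intro allI impI)
  fix us vs assume us: "set us \<subseteq> carrier N" "set vs \<subseteq> carrier N" "qftype L N us = qftype L N vs"
  then have "us \<in> map f ` tuples M (length us)" "vs \<in> map f ` tuples M (length vs)"
    using isomorphism_image_tuples[OF f] by (auto simp: tuples_def)
  then obtain xs ys where xs: "us = map f xs" "set xs \<subseteq> carrier M" "vs = map f ys" "set ys \<subseteq> carrier M"
    by (auto simp: tuples_def)
  then have "qftype L M xs = qftype L M ys" using us(3) qftype_isomorphism[OF f] by metis
  then obtain g where g: "isomorphism L M M g" "map g xs = ys" using tuple_homogeneousD[OF M xs(2,4)] by blast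
  let ?f' = "inv_into (carrier M) f"
  have "isomorphism L N N (f \<circ> (g \<circ> ?f'))"
    using isomorphism_comp[OF isomorphism_comp[OF isomorphism_inv[OF f] g(1)] f] .
  moreover have "map ?f' (map f xs) = xs" unfolding map_map
    using xs(2) isomorphismD(1)[OF f] by (intro map_idI) (auto simp: bij_betw_def subset_iff)
  then have "map (f \<circ> (g \<circ> ?f')) us = vs" using g(2) xs(1,3) by (metis map_map)
  ultimately show "\<exists>g. isomorphism L N N g \<and> map g us = vs" by blast
qed

text \<open>There is no atomic formula for truth.  The formula \<open>Exists 0 (Eq 0 0)\<close> takes its place, as it has no free
  variables and holds in nonempty structures.\<close>

lemma conj_formula:
  assumes "finite S" "\<And>s. s \<in> S \<Longrightarrow> wf_fm L (f s) \<and> free_vars (f s) \<subseteq> V"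
  shows "\<exists>\<phi>. wf_fm L \<phi> \<and> free_vars \<phi> \<subseteq> V \<and>
    (\<forall>(M :: ('r, 'a) rel_structure) v. carrier M \<noteq> {} \<longrightarrow> (sat M v \<phi> \<longleftrightarrow> (\<forall>s\<in>S. sat M v (f s))))"
  using assms
proof (induction S rule: finite_induct)
  case empty
  show ?case by (rule exI[of _ "Exists 0 (Eq 0 0)"]) auto
next
  case (insert s S)
  have "\<exists>\<phi>. wf_fm L \<phi> \<and> free_vars \<phi> \<subseteq> V \<and>
    (\<forall>(M :: ('r, 'a) rel_structure) v. carrier M \<noteq> {} \<longrightarrow> (sat M v \<phi> \<longleftrightarrow> (\<forall>s\<in>S. sat M v (f s))))"
    using insert.prems by (intro insert.IH) simp
  then obtain \<phi> where "wf_fm L \<phi>" "free_vars \<phi> \<subseteq> V"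
    "\<forall>(M :: ('r, 'a) rel_structure) v. carrier M \<noteq> {} \<longrightarrow> (sat M v \<phi> \<longleftrightarrow> (\<forall>s\<in>S. sat M v (f s)))" by blast
  then show ?case using insert.prems[of s] by (intro exI[of _ "Conj (f s) \<phi>"]) simp
qed

lemma disj_formula:
  assumes "finite S" "\<And>s. s \<in> S \<Longrightarrow> wf_fm L (f s) \<and> free_vars (f s) \<subseteq> V"
  shows "\<exists>\<phi>. wf_fm L \<phi> \<and> free_vars \<phi> \<subseteq> V \<and>
    (\<forall>(M :: ('r, 'a) rel_structure) v. carrier M \<noteq> {} \<longrightarrow> (sat M v \<phi> \<longleftrightarrow> (\<exists>s\<in>S. sat M v (f s))))"
proof -
  have "\<exists>\<phi>. wf_fm L \<phi> \<and> free_vars \<phi> \<subseteq> V \<and>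
    (\<forall>(M :: ('r, 'a) rel_structure) v. carrier M \<noteq> {} \<longrightarrow> (sat M v \<phi> \<longleftrightarrow> (\<forall>s\<in>S. sat M v (Neg (f s)))))"
    using assms by (intro conj_formula) auto
  then obtain \<phi> where "wf_fm L \<phi>" "free_vars \<phi> \<subseteq> V"
    "\<forall>(M :: ('r, 'a) rel_structure) v. carrier M \<noteq> {} \<longrightarrow> (sat M v \<phi> \<longleftrightarrow> (\<forall>s\<in>S. sat M v (Neg (f s))))" by blast
  then show ?thesis by (intro exI[of _ "Neg \<phi>"]) simp
qed

lemma qftype_formula:
  assumes L: "finite (symbols L)" and xs: "distinct xs"
  shows "\<exists>\<phi>. formula_in L xs \<phi> \<and> (\<forall>M :: ('r, 'a) rel_structure. carrier M \<noteq> {} \<longrightarrow>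
    (\<forall>as\<in>tuples M (length xs). sat_at M \<phi> xs as \<longleftrightarrow> qftype L M as = t))"
proof (cases "t \<in> qftype_bound L (length xs)")
  case False
  let ?F = "Neg (Exists 0 (Eq 0 0))"
  have "\<not> sat_at M ?F xs as" if "carrier M \<noteq> {}" for M :: "('r, 'a) rel_structure" and as
    using that by (auto simp: sat_at_def)
  moreover have "qftype L M as \<noteq> t" if "as \<in> tuples M (length xs)" for M :: "('r, 'a) rel_structure" and as
    using False qftype_in_bound[of L M as] that by (auto simp: tuples_def)
  ultimately show ?thesis using xs by (intro exI[of _ ?F]) (auto simp: formula_in_def sat_at_def)
next
  case True
  let ?n = "length xs"
  obtain E I where t: "t = (?n, E, I)" "E \<subseteq> {..<?n} \<times> {..<?n}"
    "I \<subseteq> (SIGMA R:symbols L. {ns. set ns \<subseteq> {..<?n} \<and> length ns = arity L R})"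
    using True by (auto simp: qftype_bound_def)
  let ?S = "({..<?n} \<times> {..<?n}) <+> (SIGMA R:symbols L. {ns. set ns \<subseteq> {..<?n} \<and> length ns = arity L R})"
  define f where "f s = (case s of
      Inl (i, j) \<Rightarrow> if (i, j) \<in> E then Eq (xs ! i) (xs ! j) else Neg (Eq (xs ! i) (xs ! j))
    | Inr (R, ns) \<Rightarrow> if (R, ns) \<in> I then Rel R (map ((!) xs) ns) else Neg (Rel R (map ((!) xs) ns)))" for s
  have fin: "finite ?S" using L by (intro finite_Plus finite_SigmaI finite_lists_length_eq finite_cartesian_product) auto
  have f: "wf_fm L (f s) \<and> free_vars (f s) \<subseteq> set xs" if "s \<in> ?S" for s
    using that by (auto simp: f_def subset_iff split: if_splits)
  have "\<exists>\<phi>. wf_fm L \<phi> \<and> free_vars \<phi> \<subseteq> set xs \<and>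
    (\<forall>(M :: ('r, 'a) rel_structure) v. carrier M \<noteq> {} \<longrightarrow> (sat M v \<phi> \<longleftrightarrow> (\<forall>s\<in>?S. sat M v (f s))))"
    by (rule conj_formula[OF fin f])
  then obtain \<phi> where \<phi>: "wf_fm L \<phi>" "free_vars \<phi> \<subseteq> set xs"
    "\<forall>(M :: ('r, 'a) rel_structure) v. carrier M \<noteq> {} \<longrightarrow> (sat M v \<phi> \<longleftrightarrow> (\<forall>s\<in>?S. sat M v (f s)))"
    by (elim exE conjE) (rule that; assumption)
  have "sat_at M \<phi> xs as \<longleftrightarrow> qftype L M as = t"
    if M: "carrier M \<noteq> {}" and as: "as \<in> tuples M ?n" for M :: "('r, 'a) rel_structure" and as
  proof -
    have len: "length as = ?n" using as by (simp add: tuples_def)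
    let ?v = "\<lambda>x. the (map_of (zip xs as) x)"
    have v: "?v (xs ! i) = as ! i" if "i < ?n" for i using valuation_nth[OF xs len that] .
    have mv: "map ?v (map ((!) xs) ns) = map ((!) as) ns" if "set ns \<subseteq> {..<?n}" for ns using v that by auto
    have "sat_at M \<phi> xs as \<longleftrightarrow> (\<forall>s\<in>?S. sat M ?v (f s))" unfolding sat_at_def using \<phi>(3) M by blast
    also have "\<dots> \<longleftrightarrow> (\<forall>i<?n. \<forall>j<?n. sat M ?v (f (Inl (i, j)))) \<and>
       (\<forall>R\<in>symbols L. \<forall>ns. set ns \<subseteq> {..<?n} \<and> length ns = arity L R \<longrightarrow> sat M ?v (f (Inr (R, ns))))"
      by (auto simp: Plus_def)
    also have "\<dots> \<longleftrightarrow> (\<forall>i<?n. \<forall>j<?n. as ! i = as ! j \<longleftrightarrow> (i, j) \<in> E) \<and>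
       (\<forall>R\<in>symbols L. \<forall>ns. set ns \<subseteq> {..<?n} \<and> length ns = arity L R \<longrightarrow> (map ((!) as) ns \<in> interp M R \<longleftrightarrow> (R, ns) \<in> I))"
    proof -
      have "sat M ?v (f (Inl (i, j))) \<longleftrightarrow> (as ! i = as ! j \<longleftrightarrow> (i, j) \<in> E)" if "i < ?n" "j < ?n" for i j
        using v that by (simp add: f_def)
      moreover have "sat M ?v (f (Inr (R, ns))) \<longleftrightarrow> (map ((!) as) ns \<in> interp M R \<longleftrightarrow> (R, ns) \<in> I)" if "set ns \<subseteq> {..<?n}" for R ns
        using mv[OF that] by (simp add: f_def del: map_map map_eq_conv)
      ultimately show ?thesis by (simp cong: conj_cong)
    qed
    also have "\<dots> \<longleftrightarrow> qftype L M as = t"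
      using t(2,3) unfolding t(1) qftype_def len by (auto simp: set_eq_iff)
    finally show ?thesis .
  qed
  then show ?thesis using \<phi>(1,2) xs by (intro exI[of _ \<phi>]) (simp add: formula_in_def)
qed

section \<open>Stability bounds ladders\<close>

lemma tuples_tups: "tuples M n = tups (carrier M) n"
  by (auto simp: tuples_def tups_def)

text \<open>A relation invariant under types is defined by the disjunction of the formulas for finitely many types, so \<open>M\<close> itself would
  be a model in which a formula has the order property.\<close>

lemma no_infinite_ladder:
  fixes M :: "('r, nat) rel_structure"
  assumes L: "finite (symbols L)" and M: "is_structure L M" and stable: "stable_theory L (theory_of L M)"
    and R: "\<And>xs ys xs' ys'. \<lbrakk>xs \<in> tuples M p; ys \<in> tuples M q; xs' \<in> tuples M p; ys' \<in> tuples M q;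
       qftype L M (xs @ ys) = qftype L M (xs' @ ys'); R xs ys\<rbrakk> \<Longrightarrow> R xs' ys'"
    and ab: "\<And>i::nat. a i \<in> tuples M p" "\<And>i::nat. b i \<in> tuples M q" "\<And>i j. R (a i) (b j) \<longleftrightarrow> i < j"
  shows False
proof -
  let ?T = "{qftype L M (xs @ ys) | xs ys. xs \<in> tuples M p \<and> ys \<in> tuples M q \<and> R xs ys}"
  let ?vs = "[0..<p] @ [p..<p + q]"
  have "?T \<subseteq> qftype_bound L (p + q)"
  proof
    fix t assume "t \<in> ?T"
    then obtain xs ys where "t = qftype L M (xs @ ys)" "xs \<in> tuples M p" "ys \<in> tuples M q" by blast
    then show "t \<in> qftype_bound L (p + q)" using qftype_in_bound[of L M "xs @ ys"] by (simp add: tuples_def)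
  qed
  then have finT: "finite ?T" using finite_qftype_bound[OF L] finite_subset by blast
  have d: "distinct ?vs" by auto
  have "\<forall>t. \<exists>\<phi>. formula_in L ?vs \<phi> \<and> (\<forall>M :: ('r, nat) rel_structure. carrier M \<noteq> {} \<longrightarrow>
      (\<forall>as\<in>tuples M (length ?vs). sat_at M \<phi> ?vs as \<longleftrightarrow> qftype L M as = t))"
    using qftype_formula[OF L d] by blast
  then obtain f where f: "\<And>t. formula_in L ?vs (f t)" "\<And>t (M :: ('r, nat) rel_structure) as. carrier M \<noteq> {} \<Longrightarrow>
      as \<in> tuples M (length ?vs) \<Longrightarrow> sat_at M (f t) ?vs as \<longleftrightarrow> qftype L M as = t" by metis
  have "\<exists>\<phi>. wf_fm L \<phi> \<and> free_vars \<phi> \<subseteq> set ?vs \<and>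
    (\<forall>(M :: ('r, nat) rel_structure) v. carrier M \<noteq> {} \<longrightarrow> (sat M v \<phi> \<longleftrightarrow> (\<exists>t\<in>?T. sat M v (f t))))"
    using f(1) by (intro disj_formula[OF finT]) (simp add: formula_in_def)
  then obtain \<phi> where \<phi>: "wf_fm L \<phi>" "free_vars \<phi> \<subseteq> set ?vs"
    "\<forall>(M :: ('r, nat) rel_structure) v. carrier M \<noteq> {} \<longrightarrow> (sat M v \<phi> \<longleftrightarrow> (\<exists>t\<in>?T. sat M v (f t)))"
    by (elim exE conjE) (rule that; assumption)
  have ne: "carrier M \<noteq> {}" using M by (simp add: is_structure_def)
  have sat_R: "sat_at M \<phi> ?vs (as @ bs) \<longleftrightarrow> R as bs" if ab: "as \<in> tuples M p" "bs \<in> tuples M q" for as bs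
  proof -
    have "as @ bs \<in> tuples M (length ?vs)" using ab by (auto simp: tuples_def)
    then have "sat_at M (f t) ?vs (as @ bs) \<longleftrightarrow> qftype L M (as @ bs) = t" for t using f(2)[OF ne] by blast
    moreover have "sat_at M \<phi> ?vs (as @ bs) \<longleftrightarrow> (\<exists>t\<in>?T. sat_at M (f t) ?vs (as @ bs))"
      unfolding sat_at_def using \<phi>(3) ne by blast
    ultimately have "sat_at M \<phi> ?vs (as @ bs) \<longleftrightarrow> qftype L M (as @ bs) \<in> ?T" by blast
    also have "\<dots> \<longleftrightarrow> R as bs"
    proof
      assume "qftype L M (as @ bs) \<in> ?T"
      then obtain xs ys where "qftype L M (xs @ ys) = qftype L M (as @ bs)" "xs \<in> tuples M p" "ys \<in> tuples M q" "R xs ys"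
        by auto
      then show "R as bs" using R ab by blast
    qed (use ab in blast)
    finally show ?thesis .
  qed
  have "formula_in L ?vs \<phi>" using \<phi> d by (simp add: formula_in_def)
  moreover have "is_model L M (theory_of L M)" using M by (simp add: is_model_def)
  moreover have "\<forall>i. a i \<in> tuples M (length [0..<p])" "\<forall>j. b j \<in> tuples M (length [p..<p + q])" using ab by auto
  moreover have "\<forall>i j. sat_at M \<phi> ?vs (a i @ b j) \<longleftrightarrow> i < j" using sat_R ab by blast
  ultimately have "\<exists>\<phi> xs ys (N :: ('r, nat) rel_structure) (a :: nat \<Rightarrow> nat list) (b :: nat \<Rightarrow> nat list).
      formula_in L (xs @ ys) \<phi> \<and> is_model L N (theory_of L M) \<and>
      (\<forall>i. a i \<in> tuples N (length xs)) \<and> (\<forall>j. b j \<in> tuples N (length ys)) \<and>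
      (\<forall>i j. sat_at N \<phi> (xs @ ys) (a i @ b j) \<longleftrightarrow> i < j)"
    by - (rule exI[of _ \<phi>], rule exI[of _ "[0..<p]"], rule exI[of _ "[p..<p + q]"], rule exI[of _ M],
      rule exI[of _ a], rule exI[of _ b], intro conjI)
  then show False by (rule notE[OF stable[unfolded stable_theory_def]])
qed

text \<open>A ladder is turned into a single tuple, which has a type.\<close>

definition flat :: "('a list \<times> 'a list) list \<Rightarrow> 'a list" where
  "flat ps = concat (map (\<lambda>(x, y). x @ y) ps)"

lemma flat_simps [simp]: "flat [] = []" "flat ((x, y) # ps) = x @ y @ flat ps"
  by (simp_all add: flat_def)

lemma flat_inj:
  assumes "set ps \<subseteq> tups A p \<times> tups A q" "set qs \<subseteq> tups A p \<times> tups A q" "length ps = length qs" "flat ps = flat qs"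
  shows "ps = qs"
  using assms
proof (induction ps arbitrary: qs)
  case (Cons c ps)
  then obtain d qs' where qs: "qs = d # qs'" by (cases qs) auto
  obtain x y u v where c: "c = (x, y)" and d: "d = (u, v)" by (cases c, cases d)
  have "length x = length u" "length y = length v" using Cons.prems qs c d by (auto simp: tups_def)
  then have "x = u" "y = v" "flat ps = flat qs'" using Cons.prems(4) qs c d by auto
  then show ?case using Cons.IH[of qs'] Cons.prems qs c d by simp
qed simp

lemma length_flat: "set ps \<subseteq> tups A p \<times> tups A q \<Longrightarrow> length (flat ps) = length ps * (p + q)"
  by (induction ps) (auto simp: tups_def)

lemma set_flat: "set ps \<subseteq> tups A p \<times> tups A q \<Longrightarrow> set (flat ps) \<subseteq> A"
  by (induction ps) (auto simp: tups_def)

lemma flat_map: "flat (map (map_prod (map g) (map g)) ps) = map g (flat ps)"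
  by (induction ps) auto

text \<open>By homogeneity, a ladder of length \<open>m\<close> that is the beginning of arbitrarily long ladders up to isomorphism is so
  on the nose.  As there are finitely many types of ladders of length \<open>m + 1\<close>, such a ladder can be prolonged.\<close>

lemma infinite_ladder:
  assumes L: "finite (symbols L)" and hom: "tuple_homogeneous L M"
    and R: "\<And>xs ys xs' ys'. \<lbrakk>xs \<in> tuples M p; ys \<in> tuples M q; xs' \<in> tuples M p; ys' \<in> tuples M q;
       qftype L M (xs @ ys) = qftype L M (xs' @ ys'); R xs ys\<rbrakk> \<Longrightarrow> R xs' ys'"
    and long: "\<And>n. ladder R (tuples M p) (tuples M q) n"
  shows "\<exists>a b. (\<forall>i::nat. a i \<in> tuples M p \<and> b i \<in> tuples M q) \<and> (\<forall>i j. R (a i) (b j) \<longleftrightarrow> i < j)"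
proof -
  let ?A = "carrier M"
  define chain where "chain ps \<longleftrightarrow> set ps \<subseteq> tups ?A p \<times> tups ?A q \<and>
    (\<forall>i<length ps. \<forall>j<length ps. R (fst (ps ! i)) (snd (ps ! j)) \<longleftrightarrow> i < j)" for ps
  define long_chain where "long_chain C \<longleftrightarrow> (\<forall>n. \<exists>D. chain (C @ D) \<and> n \<le> length D)" for C
  have chain_image: "chain (map (map_prod (map g) (map g)) ps)" if g: "isomorphism L M M g" and ps: "chain ps" for g ps
  proof -
    have map_g: "map g xs \<in> tups ?A n" if "xs \<in> tups ?A n" for xs n
      using isomorphism_image_tuples[OF g, of n] that tuples_tups by blast
    have R_g: "R (map g xs) (map g ys) \<longleftrightarrow> R xs ys" if xs: "xs \<in> tups ?A p" "ys \<in> tups ?A q" for xs ys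
    proof -
      have "set (xs @ ys) \<subseteq> ?A" using xs by (auto simp: tups_def)
      then have eq: "qftype L M (map g xs @ map g ys) = qftype L M (xs @ ys)"
        using qftype_isomorphism[OF g, of "xs @ ys"] by simp
      show ?thesis
        using R[of xs ys "map g xs" "map g ys"] R[of "map g xs" "map g ys" xs ys] eq xs map_g unfolding tuples_tups by metis
    qed
    have mem: "fst (ps ! i) \<in> tups ?A p" "snd (ps ! i) \<in> tups ?A q" if "i < length ps" for i
    proof -
      have "ps ! i \<in> tups ?A p \<times> tups ?A q" using ps nth_mem[OF that] unfolding chain_def by blast
      then show "fst (ps ! i) \<in> tups ?A p" "snd (ps ! i) \<in> tups ?A q" by (auto simp: mem_Times_iff)
    qed
    show ?thesis
      unfolding chain_def
    proof (intro conjI allI impI)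
      show "set (map (map_prod (map g) (map g)) ps) \<subseteq> tups ?A p \<times> tups ?A q"
        using ps map_g unfolding chain_def by auto
      fix i j assume "i < length (map (map_prod (map g) (map g)) ps)" "j < length (map (map_prod (map g) (map g)) ps)"
      then have ij: "i < length ps" "j < length ps" by auto
      then show "R (fst (map (map_prod (map g) (map g)) ps ! i)) (snd (map (map_prod (map g) (map g)) ps ! j)) \<longleftrightarrow> i < j"
        using R_g[OF mem(1)[OF ij(1)] mem(2)[OF ij(2)]] ps unfolding chain_def by (simp add: fst_map_prod snd_map_prod)
    qed
  qed
  have "long_chain []"
    unfolding long_chain_def
  proof
    fix n :: nat
    obtain a b where ab: "\<forall>i<n. a i \<in> tuples M p \<and> b i \<in> tuples M q" "\<forall>i<n. \<forall>j<n. R (a i) (b j) \<longleftrightarrow> i < j"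
      using long[of n] unfolding ladder_def by blast
    then have "chain (map (\<lambda>i. (a i, b i)) [0..<n])" by (auto simp: chain_def tuples_tups)
    then show "\<exists>D. chain ([] @ D) \<and> n \<le> length D" by (intro exI[of _ "map (\<lambda>i. (a i, b i)) [0..<n]"]) simp
  qed
  have prolong: "\<exists>c. long_chain (C @ [c])" if C: "long_chain C" for C
  proof -
    have "\<forall>n. \<exists>D. chain (C @ D) \<and> Suc n \<le> length D" using C unfolding long_chain_def by blast
    then obtain D where D: "\<And>n. chain (C @ D n)" "\<And>n. Suc n \<le> length (D n)" by metis
    have D_eq: "D n = hd (D n) # tl (D n)" for n using D(2)[of n] by (cases "D n") auto
    have D_chain: "chain ((C @ [hd (D n)]) @ tl (D n))" for n using D(1)[of n] D_eq[of n] by simp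
    then have tup: "set (C @ [hd (D n)]) \<subseteq> tups ?A p \<times> tups ?A q" for n unfolding chain_def by auto
    let ?t = "\<lambda>n. qftype L M (flat (C @ [hd (D n)]))"
    have "range ?t \<subseteq> qftype_bound L (length (C @ [undefined]) * (p + q))"
      using qftype_in_bound[of L M "flat (C @ [hd (D n)])" for n] length_flat[OF tup] by auto
    then have "finite (range ?t)" using finite_qftype_bound[OF L] finite_subset by blast
    then obtain n0 where n0: "infinite {n \<in> UNIV. ?t n = ?t n0}" using pigeonhole_infinite[OF infinite_UNIV_nat] by blast
    let ?c = "hd (D n0)"
    have "long_chain (C @ [?c])"
      unfolding long_chain_def
    proof
      fix n :: nat
      obtain n' where n': "n \<le> n'" "?t n' = ?t n0" using n0 unfolding infinite_nat_iff_unbounded_le by blast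
      obtain g where g: "isomorphism L M M g" "map g (flat (C @ [hd (D n')])) = flat (C @ [?c])"
        using tuple_homogeneousD[OF hom set_flat[OF tup] set_flat[OF tup] n'(2)] by blast
      let ?G = "map (map_prod (map g) (map g))"
      have ch: "chain (?G (C @ [hd (D n')]) @ ?G (tl (D n')))"
        using chain_image[OF g(1) D_chain[of n']] by (simp only: map_append)
      have "?G (C @ [hd (D n')]) = C @ [?c]"
      proof (rule flat_inj[OF _ tup])
        show "set (?G (C @ [hd (D n')])) \<subseteq> tups ?A p \<times> tups ?A q" using ch unfolding chain_def set_append by blast
        show "flat (?G (C @ [hd (D n')])) = flat (C @ [?c])" unfolding flat_map by (rule g(2))
      qed simp
      then have "chain ((C @ [?c]) @ ?G (tl (D n')))" using ch by simp
      moreover have "n \<le> length (?G (tl (D n')))" using D(2)[of n'] n'(1) by simp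
      ultimately show "\<exists>D. chain ((C @ [?c]) @ D) \<and> n \<le> length D" by blast
    qed
    then show ?thesis by blast
  qed
  have "\<exists>S. \<forall>n::nat. (long_chain (S n) \<and> length (S n) = n) \<and> (\<exists>c. S (Suc n) = S n @ [c])"
  proof (rule dependent_nat_choice)
    show "\<exists>C. long_chain C \<and> length C = 0" using \<open>long_chain []\<close> by blast
    fix C and n :: nat assume C: "long_chain C \<and> length C = n"
    then obtain c where "long_chain (C @ [c])" using prolong by blast
    then show "\<exists>C'. (long_chain C' \<and> length C' = Suc n) \<and> (\<exists>c. C' = C @ [c])"
      using C by (intro exI[of _ "C @ [c]"]) simp
  qed
  then obtain S where S: "\<And>n. long_chain (S n)" "\<And>n. length (S n) = n" "\<And>n. \<exists>c. S (Suc n) = S n @ [c]" by blast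
  have chain_S: "chain (S n)" for n
  proof -
    obtain D where D: "chain (S n @ D)" using S(1)[of n] unfolding long_chain_def by blast
    have "R (fst (S n ! i)) (snd (S n ! j)) \<longleftrightarrow> i < j" if "i < length (S n)" "j < length (S n)" for i j
    proof -
      have "i < length (S n @ D)" "j < length (S n @ D)" using that by auto
      then have "R (fst ((S n @ D) ! i)) (snd ((S n @ D) ! j)) \<longleftrightarrow> i < j" using D unfolding chain_def by blast
      then show ?thesis using that by (simp add: nth_append)
    qed
    then show ?thesis using D unfolding chain_def by simp
  qed
  have nth_S: "S (Suc i + n) ! i = S (Suc i) ! i" for i n
  proof (induction n)
    case (Suc n)
    obtain c where "S (Suc (Suc i + n)) = S (Suc i + n) @ [c]" using S(3) by blast
    then show ?case using Suc S(2)[of "Suc i + n"] by (simp add: nth_append)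
  qed simp
  let ?s = "\<lambda>i. S (Suc i) ! i"
  have s: "S m ! i = ?s i" if "i < m" for i m using nth_S[of i "m - Suc i"] that by simp
  have "fst (?s i) \<in> tups ?A p \<and> snd (?s i) \<in> tups ?A q" for i
  proof -
    have "?s i \<in> set (S (Suc i))" using S(2)[of "Suc i"] by simp
    then have "?s i \<in> tups ?A p \<times> tups ?A q" using chain_S[of "Suc i"] unfolding chain_def by blast
    then show ?thesis by (simp add: mem_Times_iff)
  qed
  moreover have "R (fst (?s i)) (snd (?s j)) \<longleftrightarrow> i < j" for i j
  proof -
    let ?m = "Suc (max i j)"
    have "i < ?m" "j < ?m" by auto
    then show ?thesis using chain_S[of ?m] S(2)[of ?m] s[of i ?m] s[of j ?m] unfolding chain_def by metis
  qed
  ultimately show ?thesis unfolding tuples_tups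
    by - (rule exI[of _ "\<lambda>i. fst (?s i)"], rule exI[of _ "\<lambda>i. snd (?s i)"], intro conjI allI; simp)
qed

theorem type_space_qftype:
  fixes M :: "('r, nat) rel_structure"
  assumes L: "finite (symbols L)" and M: "is_structure L M" and hom: "tuple_homogeneous L M"
    and stable: "stable_theory L (theory_of L M)"
  shows "\<exists>k. type_space (carrier M) (qftype L M) k"
proof -
  obtain k where k: "\<And>R. R \<in> symbols L \<Longrightarrow> arity L R \<le> k" "0 < k"
  proof -
    obtain k where "\<forall>R\<in>symbols L. arity L R \<le> k" using finite_nat_set_iff_bounded_le[of "arity L ` symbols L"] L by auto
    then show thesis using that[of "Suc k"] by fastforce
  qed
  have "type_space (carrier M) (qftype L M) k"
  proof
    show "finite (qftype L M ` tups (carrier M) n)" for n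
    proof (rule finite_subset)
      show "qftype L M ` tups (carrier M) n \<subseteq> qftype_bound L n" using qftype_in_bound by (fastforce simp: tups_def)
    qed (rule finite_qftype_bound[OF L])
    show "qftype L M (xs @ [x]) = qftype L M (xs @ [y])"
      if "xs \<noteq> []" "\<And>es. es \<in> tups (set xs) k \<Longrightarrow> qftype L M (es @ [x]) = qftype L M (es @ [y])" for xs x y
      using k that by (rule qftype_determined)
    show "\<exists>n. \<not> ladder R (tups (carrier M) p) (tups (carrier M) q) n"
      if R: "\<And>xs ys xs' ys'. \<lbrakk>xs \<in> tups (carrier M) p; ys \<in> tups (carrier M) q; xs' \<in> tups (carrier M) p; ys' \<in> tups (carrier M) q;
         qftype L M (xs @ ys) = qftype L M (xs' @ ys'); R xs ys\<rbrakk> \<Longrightarrow> R xs' ys'" for p q R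
    proof (rule ccontr)
      assume "\<not> ?thesis"
      then have long: "\<And>n. ladder R (tuples M p) (tuples M q) n" by (simp add: tuples_tups)
      have "\<exists>a b. (\<forall>i::nat. a i \<in> tuples M p \<and> b i \<in> tuples M q) \<and> (\<forall>i j. R (a i) (b j) \<longleftrightarrow> i < j)"
        using R long unfolding tuples_tups[symmetric] by (rule infinite_ladder[OF L hom])
      then obtain a b :: "nat \<Rightarrow> nat list" where ab: "\<And>i. a i \<in> tuples M p" "\<And>i. b i \<in> tuples M q" "\<And>i j. R (a i) (b j) \<longleftrightarrow> i < j"
        by blast
      show False using R ab unfolding tuples_tups[symmetric] by (rule no_infinite_ladder[OF L M stable])
    qed
    show "xs ! i = xs ! j \<longleftrightarrow> ys ! i = ys ! j"
      if "qftype L M xs = qftype L M ys" "i < length xs" "j < length xs" for xs ys i j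
      using qftype_eqD(2) that by blast
  qed (auto intro: qftype_eqD(1) qftype_select)
  then show ?thesis by blast
qed

section \<open>Ultraproducts\<close>

text \<open>By Zorn's lemma there is a minimal proper filter below \<^const>\<open>sequentially\<close>.\<close>

lemma free_ultrafilter: "\<exists>U :: nat filter. is_ultrafilter U \<and> U \<le> sequentially"
proof -
  define E where "E F = {P :: nat \<Rightarrow> bool. eventually P F}" for F
  define \<A> where "\<A> = E ` {F. F \<noteq> bot \<and> F \<le> sequentially}"
  have E_sub: "E F \<subseteq> E F' \<longleftrightarrow> F' \<le> F" for F F' by (auto simp: E_def le_filter_def)
  have "\<exists>S\<in>\<A>. \<forall>T\<in>\<C>. T \<subseteq> S" if C: "\<C> \<in> chains \<A>" for \<C>
  proof (cases "\<C> = {}")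
    case True
    have "E sequentially \<in> \<A>" by (auto simp: \<A>_def)
    then show ?thesis using True by blast
  next
    case False
    define \<F> where "\<F> = {F. F \<noteq> bot \<and> F \<le> sequentially \<and> E F \<in> \<C>}"
    have C_eq: "\<C> = E ` \<F>" using C by (auto simp: chains_def \<A>_def \<F>_def)
    then have ne: "\<F> \<noteq> {}" using False by blast
    have "\<exists>x\<in>\<F>. x \<le> inf F G" if FG: "F \<in> \<F>" "G \<in> \<F>" for F G
    proof -
      have "E F \<subseteq> E G \<or> E G \<subseteq> E F" using C FG unfolding C_eq chains_def chain_subset_def by blast
      then have "F \<le> G \<or> G \<le> F" using E_sub by blast
      then show ?thesis using FG by (metis inf.absorb1 inf.absorb2 order_refl)
    qed
    then have ev: "eventually P (Inf \<F>) \<longleftrightarrow> (\<exists>F\<in>\<F>. eventually P F)" for P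
      using eventually_Inf_base[OF ne] by blast
    have "Inf \<F> \<noteq> bot"
    proof
      assume "Inf \<F> = bot"
      then have "eventually (\<lambda>_. False) (Inf \<F>)" by simp
      then obtain F where "F \<in> \<F>" "eventually (\<lambda>_. False) F" unfolding ev by blast
      then show False by (simp add: \<F>_def eventually_False)
    qed
    moreover have "Inf \<F> \<le> sequentially"
    proof -
      obtain F where "F \<in> \<F>" using ne by blast
      then have "Inf \<F> \<le> F" "F \<le> sequentially" by (auto simp: Inf_lower \<F>_def)
      then show ?thesis by (rule order_trans)
    qed
    ultimately have "E (Inf \<F>) \<in> \<A>" by (auto simp: \<A>_def)
    moreover have "T \<subseteq> E (Inf \<F>)" if T: "T \<in> \<C>" for T
    proof -
      obtain F where "F \<in> \<F>" "T = E F" using T unfolding C_eq by blast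
      then show ?thesis by (simp add: E_sub Inf_lower)
    qed
    ultimately show ?thesis by blast
  qed
  then have "\<exists>S\<in>\<A>. \<forall>T\<in>\<A>. S \<subseteq> T \<longrightarrow> T = S" by (intro Zorn_Lemma2 ballI)
  then obtain S where S: "S \<in> \<A>" "\<forall>T\<in>\<A>. S \<subseteq> T \<longrightarrow> T = S" by (elim bexE) (rule that; assumption)
  then obtain U where U: "U \<noteq> bot" "U \<le> sequentially" "S = E U" by (auto simp: \<A>_def)
  have "eventually P U \<or> eventually (\<lambda>i. \<not> P i) U" for P
  proof (rule disjCI)
    assume nP: "\<not> eventually (\<lambda>i. \<not> P i) U"
    let ?F = "inf U (principal {i. P i})"
    have "?F \<noteq> bot" using nP by (auto simp: trivial_limit_def eventually_inf_principal)
    moreover have "?F \<le> sequentially" using U(2) by (meson inf.coboundedI1)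
    ultimately have "E ?F \<in> \<A>" by (auto simp: \<A>_def)
    moreover have "S \<subseteq> E ?F" unfolding U(3) E_sub by simp
    ultimately have "E ?F = E U" using S(2) U(3) by blast
    moreover have "eventually P ?F" by (simp add: eventually_inf_principal)
    ultimately show "eventually P U" unfolding E_def by blast
  qed
  then show ?thesis using U by (auto simp: is_ultrafilter_def)
qed

lemma eventually_not_ultrafilter:
  assumes "is_ultrafilter U" shows "eventually (\<lambda>i. \<not> P i) U \<longleftrightarrow> \<not> eventually P U"
proof
  assume "eventually (\<lambda>i. \<not> P i) U"
  show "\<not> eventually P U"
  proof
    assume "eventually P U"
    with \<open>eventually (\<lambda>i. \<not> P i) U\<close> have "eventually (\<lambda>i. False) U" by eventually_elim simp
    then show False using assms by (simp add: is_ultrafilter_def eventually_False)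
  qed
qed (use assms in \<open>auto simp: is_ultrafilter_def\<close>)

lemma equiv_ultraproduct_rel: "equiv {f. \<forall>i. f i \<in> carrier (N i)} (ultraproduct_rel U N)"
proof (rule equivI)
  show "ultraproduct_rel U N \<subseteq> {f. \<forall>i. f i \<in> carrier (N i)} \<times> {f. \<forall>i. f i \<in> carrier (N i)}"
    by (auto simp: ultraproduct_rel_def)
  show "refl_on {f. \<forall>i. f i \<in> carrier (N i)} (ultraproduct_rel U N)" by (auto simp: refl_on_def ultraproduct_rel_def)
  show "sym (ultraproduct_rel U N)" by (auto simp: sym_def ultraproduct_rel_def eq_commute)
  show "trans (ultraproduct_rel U N)"
    unfolding trans_def ultraproduct_rel_def by (auto elim: eventually_elim2)
qed

lemma class_eq_iff:
  assumes "\<And>i. f i \<in> carrier (N i)" "\<And>i. g i \<in> carrier (N i)"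
  shows "ultraproduct_rel U N `` {f} = ultraproduct_rel U N `` {g} \<longleftrightarrow> eventually (\<lambda>i. f i = g i) U"
  using eq_equiv_class_iff[OF equiv_ultraproduct_rel, of f N g U] assms by (simp add: ultraproduct_rel_def)

theorem los:
  assumes U: "is_ultrafilter U" and f: "\<And>x i. f x i \<in> carrier (N i)"
  shows "sat (ultraproduct U N) (\<lambda>x. ultraproduct_rel U N `` {f x}) \<phi> \<longleftrightarrow> eventually (\<lambda>i. sat (N i) (\<lambda>x. f x i) \<phi>) U"
  using f
proof (induction \<phi> arbitrary: f)
  case (Eq x y)
  then show ?case using class_eq_iff[of "f x" N "f y" U] by simp
next
  case (Rel R xs)
  let ?c = "\<lambda>f. ultraproduct_rel U N `` {f}"
  have "map (\<lambda>x. ?c (f x)) xs \<in> interp (ultraproduct U N) R \<longleftrightarrow> eventually (\<lambda>i. map (\<lambda>x. f x i) xs \<in> interp (N i) R) U"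
  proof
    assume "map (\<lambda>x. ?c (f x)) xs \<in> interp (ultraproduct U N) R"
    then obtain fs where fs: "map (\<lambda>x. ?c (f x)) xs = map ?c fs" "fs \<in> lists {f. \<forall>i. f i \<in> carrier (N i)}"
      "eventually (\<lambda>i. map (\<lambda>f. f i) fs \<in> interp (N i) R) U" by (auto simp: ultraproduct_def)
    have len: "length xs = length fs" using fs(1) by (metis length_map)
    have "eventually (\<lambda>i. f (xs ! n) i = (fs ! n) i) U" if n: "n < length xs" for n
    proof -
      have "fs ! n \<in> set fs" using n len by simp
      then have "\<And>i. (fs ! n) i \<in> carrier (N i)" using fs(2) by auto
      moreover have "?c (f (xs ! n)) = ?c (fs ! n)" using arg_cong[OF fs(1), of "\<lambda>l. l ! n"] n len by simp
      ultimately show ?thesis using class_eq_iff[of "f (xs ! n)" N "fs ! n" U] Rel.prems by blast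
    qed
    then have "eventually (\<lambda>i. \<forall>n\<in>{..<length xs}. f (xs ! n) i = (fs ! n) i) U" by (intro eventually_ball_finite) auto
    with fs(3) show "eventually (\<lambda>i. map (\<lambda>x. f x i) xs \<in> interp (N i) R) U"
    proof eventually_elim
      case (elim i)
      have "map (\<lambda>x. f x i) xs = map (\<lambda>f. f i) fs" using elim(2) len by (intro nth_equalityI) auto
      then show ?case using elim(1) by simp
    qed
  next
    assume ev: "eventually (\<lambda>i. map (\<lambda>x. f x i) xs \<in> interp (N i) R) U"
    have "map (\<lambda>x. ?c (f x)) xs = map ?c (map f xs)" by simp
    moreover have "map f xs \<in> lists {f. \<forall>i. f i \<in> carrier (N i)}" using Rel.prems by auto
    moreover have "eventually (\<lambda>i. map (\<lambda>f. f i) (map f xs) \<in> interp (N i) R) U" using ev by (simp add: comp_def)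
    moreover have "interp (ultraproduct U N) R = {map ?c fs | fs. fs \<in> lists {f. \<forall>i. f i \<in> carrier (N i)} \<and>
        eventually (\<lambda>i. map (\<lambda>f. f i) fs \<in> interp (N i) R) U}" by (simp add: ultraproduct_def)
    ultimately show "map (\<lambda>x. ?c (f x)) xs \<in> interp (ultraproduct U N) R" by blast
  qed
  then show ?case by (simp only: sat.simps)
next
  case (Neg \<phi>)
  then show ?case using eventually_not_ultrafilter[OF U] by simp
next
  case (Conj \<phi> \<psi>)
  then show ?case by (simp add: eventually_conj_iff)
next
  case (Exists x \<phi>)
  let ?c = "\<lambda>f. ultraproduct_rel U N `` {f}"
  have upd: "sat (ultraproduct U N) ((\<lambda>x. ?c (f x))(x := ?c g)) \<phi> \<longleftrightarrow>
      eventually (\<lambda>i. sat (N i) ((\<lambda>x. f x i)(x := g i)) \<phi>) U" if g: "\<And>i. g i \<in> carrier (N i)" for g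
  proof -
    have "sat (ultraproduct U N) (\<lambda>y. ?c ((f(x := g)) y)) \<phi> \<longleftrightarrow> eventually (\<lambda>i. sat (N i) (\<lambda>y. (f(x := g)) y i) \<phi>) U"
      using Exists.prems g by (intro Exists.IH) simp
    moreover have "(\<lambda>y. ?c ((f(x := g)) y)) = (\<lambda>x. ?c (f x))(x := ?c g)" by (simp add: fun_eq_iff)
    moreover have "(\<lambda>y. (f(x := g)) y i) = (\<lambda>x. f x i)(x := g i)" for i by (simp add: fun_eq_iff)
    ultimately show ?thesis by simp
  qed
  have carrier_eq: "carrier (ultraproduct U N) = ?c ` {g. \<forall>i. g i \<in> carrier (N i)}"
    by (auto simp: ultraproduct_def quotient_def)
  show ?case
  proof
    assume "sat (ultraproduct U N) (\<lambda>x. ?c (f x)) (Exists x \<phi>)"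
    then obtain g where g: "\<And>i. g i \<in> carrier (N i)" "sat (ultraproduct U N) ((\<lambda>x. ?c (f x))(x := ?c g)) \<phi>"
      by (auto simp: carrier_eq)
    then have "eventually (\<lambda>i. sat (N i) ((\<lambda>x. f x i)(x := g i)) \<phi>) U" using upd by blast
    then show "eventually (\<lambda>i. sat (N i) (\<lambda>x. f x i) (Exists x \<phi>)) U"
      by (rule eventually_mono) (use g(1) in auto)
  next
    assume ev: "eventually (\<lambda>i. sat (N i) (\<lambda>x. f x i) (Exists x \<phi>)) U"
    define g where "g i = (if \<exists>a\<in>carrier (N i). sat (N i) ((\<lambda>x. f x i)(x := a)) \<phi>
      then SOME a. a \<in> carrier (N i) \<and> sat (N i) ((\<lambda>x. f x i)(x := a)) \<phi> else f x i)" for i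
    have ex: "g i \<in> carrier (N i) \<and> sat (N i) ((\<lambda>x. f x i)(x := g i)) \<phi>"
      if "\<exists>a\<in>carrier (N i). sat (N i) ((\<lambda>x. f x i)(x := a)) \<phi>" for i
      using someI_ex[of "\<lambda>a. a \<in> carrier (N i) \<and> sat (N i) ((\<lambda>x. f x i)(x := a)) \<phi>"] that by (auto simp: g_def)
    have g: "g i \<in> carrier (N i)" for i using ex[of i] Exists.prems by (cases "\<exists>a\<in>carrier (N i). sat (N i) ((\<lambda>x. f x i)(x := a)) \<phi>") (auto simp: g_def)
    have "eventually (\<lambda>i. sat (N i) ((\<lambda>x. f x i)(x := g i)) \<phi>) U"
      using ev by (rule eventually_mono) (use ex in auto)
    then have "sat (ultraproduct U N) ((\<lambda>x. ?c (f x))(x := ?c g)) \<phi>" using upd g by blast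
    then show "sat (ultraproduct U N) (\<lambda>x. ?c (f x)) (Exists x \<phi>)" using g by (auto simp: carrier_eq)
  qed
qed

text \<open>Distinct natural numbers give rise to eventually constant, eventually different functions.\<close>

lemma infinite_ultraproduct:
  assumes U: "U \<le> sequentially" "U \<noteq> bot" and N: "\<And>i. {..i} \<subseteq> carrier (N i)"
  shows "infinite (carrier (ultraproduct U N))"
proof -
  let ?f = "\<lambda>j i. if j \<le> i then j else 0 :: nat"
  have f: "?f j i \<in> carrier (N i)" for j i using N[of i] by auto
  have "inj (\<lambda>j. ultraproduct_rel U N `` {?f j})"
  proof (rule injI)
    fix j k assume "ultraproduct_rel U N `` {?f j} = ultraproduct_rel U N `` {?f k}"
    then have "eventually (\<lambda>i. ?f j i = ?f k i) U" using class_eq_iff[of "?f j" N "?f k" U] f by simp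
    moreover have "eventually (\<lambda>i. max j k \<le> i) U" using U(1) eventually_ge_at_top filter_leD by blast
    ultimately have "eventually (\<lambda>i. j = k) U" by eventually_elim auto
    then show "j = k" using U(2) by simp
  qed
  moreover have "range (\<lambda>j. ultraproduct_rel U N `` {?f j}) \<subseteq> carrier (ultraproduct U N)"
  proof
    fix c assume "c \<in> range (\<lambda>j. ultraproduct_rel U N `` {?f j})"
    then show "c \<in> carrier (ultraproduct U N)" using f by (auto simp: ultraproduct_def intro!: quotientI)
  qed
  ultimately show ?thesis using infinite_iff_countable_subset by blast
qed

section \<open>Classes of finite homogeneous structures\<close>

text \<open>In a finite homogeneous structure the size of a definable set depends only on the type of its parameters, and
  there are finitely many types.\<close>

theorem mec_tuple_homogeneous:
  fixes C :: "('r, 'a) rel_structure set"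
  assumes L: "finite (symbols L)"
    and C: "\<And>M. M \<in> C \<Longrightarrow> is_structure L M \<and> finite (carrier M) \<and> tuple_homogeneous L M"
  shows "mec L C"
  unfolding mec_def
proof (intro conjI allI impI)
  show "\<forall>M\<in>C. is_structure L M \<and> finite (carrier M)" using C by blast
  fix \<phi> xs ys assume \<phi>: "formula_in L (xs @ ys) \<phi>"
  define \<pi> where "\<pi> t = {(M, bs) \<in> pointed C ys. qftype L M bs = t}" for t
  define P where "P = \<pi> ` qftype_bound L (length ys) - {{}}"
  define h where "h p M = real (card (solutions M \<phi> xs ys (SOME bs. (M, bs) \<in> p)))" for p and M :: "('r, 'a) rel_structure"
  have "finite P" unfolding P_def using finite_qftype_bound[OF L] by blast
  moreover have "definable_partition L C ys P"
    unfolding definable_partition_def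
  proof (intro conjI ballI)
    show "partition_on (pointed C ys) P"
    proof (rule partition_onI)
      have in_bound: "qftype L M bs \<in> qftype_bound L (length ys)" if "(M, bs) \<in> pointed C ys" for M bs
        using that qftype_in_bound[of L M bs] by (auto simp: pointed_def tuples_def)
      show "\<Union> P = pointed C ys"
      proof
        show "\<Union> P \<subseteq> pointed C ys" by (auto simp: P_def \<pi>_def)
        show "pointed C ys \<subseteq> \<Union> P"
        proof
          fix p assume p: "p \<in> pointed C ys"
          obtain M bs where Mb: "p = (M, bs)" by (cases p)
          have "p \<in> \<pi> (qftype L M bs)" using p Mb by (simp add: \<pi>_def)
          moreover have "\<pi> (qftype L M bs) \<in> P" using in_bound p Mb calculation unfolding P_def by blast
          ultimately show "p \<in> \<Union> P" by blast
        qed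
      qed
      show "disjnt p q" if "p \<in> P" "q \<in> P" "p \<noteq> q" for p q
        using that by (auto simp: P_def \<pi>_def disjnt_def)
    qed (simp add: P_def)
    fix p assume "p \<in> P"
    then obtain t where t: "p = \<pi> t" by (auto simp: P_def)
    have "distinct ys" using \<phi> by (simp add: formula_in_def)
    then have "\<exists>\<psi>. formula_in L ys \<psi> \<and> (\<forall>M :: ('r, 'a) rel_structure. carrier M \<noteq> {} \<longrightarrow>
        (\<forall>as\<in>tuples M (length ys). sat_at M \<psi> ys as \<longleftrightarrow> qftype L M as = t))"
      by (rule qftype_formula[OF L])
    then obtain \<psi> where \<psi>: "formula_in L ys \<psi>" "\<forall>M :: ('r, 'a) rel_structure. carrier M \<noteq> {} \<longrightarrow>
        (\<forall>as\<in>tuples M (length ys). sat_at M \<psi> ys as \<longleftrightarrow> qftype L M as = t)"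
      by (elim exE conjE) (rule that; assumption)
    have "{bs \<in> tuples M (length ys). sat_at M \<psi> ys bs} = {bs \<in> tuples M (length ys). (M, bs) \<in> p}" if M: "M \<in> C" for M
    proof -
      have "carrier M \<noteq> {}" using C[OF M] by (simp add: is_structure_def)
      then show ?thesis using \<psi>(2) M by (auto simp: t \<pi>_def pointed_def)
    qed
    then show "\<exists>\<psi>. formula_in L ys \<psi> \<and> (\<forall>M\<in>C. {bs \<in> tuples M (length ys). sat_at M \<psi> ys bs} =
        {bs \<in> tuples M (length ys). (M, bs) \<in> p})" using \<psi>(1) by blast
  qed
  moreover have "\<forall>p\<in>P. \<forall>M\<in>C. h p M \<ge> 0" by (simp add: h_def)
  moreover have "\<forall>p\<in>P. \<forall>(M, bs)\<in>p. real (card (solutions M \<phi> xs ys bs)) = h p M"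
  proof (intro ballI, clarify)
    fix p M bs assume p: "p \<in> P" and Mbs: "(M, bs) \<in> p"
    then obtain t where t: "p = \<pi> t" by (auto simp: P_def)
    let ?cs = "SOME bs. (M, bs) \<in> p"
    have "(M, ?cs) \<in> p" using Mbs by (rule someI)
    then have cs: "?cs \<in> tuples M (length ys)" "qftype L M ?cs = t" and bs: "bs \<in> tuples M (length ys)" "qftype L M bs = t"
      and M: "M \<in> C" using Mbs by (auto simp: t \<pi>_def pointed_def)
    obtain g where g: "isomorphism L M M g" "map g bs = ?cs"
      using tuple_homogeneousD[of L M bs ?cs] C[OF M] cs bs by (auto simp: tuples_def)
    show "real (card (solutions M \<phi> xs ys bs)) = h p M"
      using card_solutions_isomorphism[OF g(1) \<phi> bs(1)] g(2) by (simp add: h_def)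
  qed
  ultimately show "\<exists>P (h :: (('r, 'a) rel_structure \<times> 'a list) set \<Rightarrow> ('r, 'a) rel_structure \<Rightarrow> real).
      finite P \<and> definable_partition L C ys P \<and> (\<forall>\<pi>\<in>P. \<forall>M\<in>C. h \<pi> M \<ge> 0) \<and>
      (\<forall>\<pi>\<in>P. \<forall>(M, bs)\<in>\<pi>. real (card (solutions M \<phi> xs ys bs)) = h \<pi> M)" by blast
qed

section \<open>Approximation by finite substructures\<close>

lemma carrier_substructure_on [simp]: "carrier (substructure_on M A) = A"
  by (simp add: substructure_on_def)

lemma qftype_substructure_on:
  assumes "set xs \<subseteq> A" shows "qftype L (substructure_on M A) xs = qftype L M xs"
proof (rule qftype_eqI)
  fix R and ns :: "nat list" assume "set ns \<subseteq> {..<length xs}"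
  then have "set (map ((!) xs) ns) \<subseteq> A" using assms by (auto simp: subset_iff)
  then show "map ((!) xs) ns \<in> interp (substructure_on M A) R \<longleftrightarrow> map ((!) xs) ns \<in> interp M R"
    by (simp add: substructure_on_def lists_eq_set)
qed auto

lemma is_structure_substructure_on:
  assumes "is_structure L M" "A \<noteq> {}" shows "is_structure L (substructure_on M A)"
  using assms unfolding is_structure_def by (fastforce simp: substructure_on_def tuples_def)

lemma isomorphism_substructure_onI:
  assumes bij: "bij_betw g A A" and g: "\<And>xs. set xs \<subseteq> A \<Longrightarrow> qftype L M (map g xs) = qftype L M xs"
  shows "isomorphism L (substructure_on M A) (substructure_on M A) g"
  unfolding isomorphism_def
proof (intro conjI ballI)
  show "bij_betw g (carrier (substructure_on M A)) (carrier (substructure_on M A))" using bij by simp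
  fix R as assume R: "R \<in> symbols L" and "as \<in> tuples (substructure_on M A) (arity L R)"
  then have as: "set as \<subseteq> A" "length as = arity L R" by (auto simp: tuples_def)
  have "map ((!) as) [0..<length as] = as" "map ((!) (map g as)) [0..<length as] = map g as"
    using map_nth[of as] map_nth[of "map g as"] by simp_all
  then have "map g as \<in> interp M R \<longleftrightarrow> as \<in> interp M R"
    using qftype_eqD(3)[OF g[OF as(1)] R, of "[0..<length as]"] as(2) by (auto simp: atLeast0LessThan)
  moreover have "set (map g as) \<subseteq> A" using as(1) bij by (auto simp: bij_betw_def)
  ultimately show "as \<in> interp (substructure_on M A) R \<longleftrightarrow> map g as \<in> interp (substructure_on M A) R"
    using as(1) by (auto simp: substructure_on_def)
qed

lemma tuple_homogeneous_extensible:
  assumes "type_space (carrier M) (qftype L M) k" and A: "type_space.extensible (carrier M) (qftype L M) A"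
  shows "tuple_homogeneous L (substructure_on M A)"
proof -
  interpret type_space "carrier M" "qftype L M" k by fact
  show ?thesis
    unfolding tuple_homogeneous_def
  proof (intro allI impI)
    fix xs ys assume xs: "set xs \<subseteq> carrier (substructure_on M A)" "set ys \<subseteq> carrier (substructure_on M A)"
      "qftype L (substructure_on M A) xs = qftype L (substructure_on M A) ys"
    then have "qftype L M xs = qftype L M ys" by (simp add: qftype_substructure_on)
    then obtain g where g: "g \<in> perms A" "map g xs = ys" using back_and_forth[OF A, of xs ys] xs by auto
    have "bij_betw g A A" using g(1) by (auto simp: perms_def bij_betw_def bij_def intro: inj_on_subset)
    then have "isomorphism L (substructure_on M A) (substructure_on M A) g"
      using perms_tp[OF g(1)] by (rule isomorphism_substructure_onI)
    then show "\<exists>g. isomorphism L (substructure_on M A) (substructure_on M A) g \<and> map g xs = ys" using g(2) by blast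
  qed
qed

text \<open>Tuples of the same type are conjugate under an automorphism.\<close>

lemma sat_qftype:
  assumes M: "tuple_homogeneous L M" and \<phi>: "wf_fm L \<phi>" "free_vars \<phi> \<subseteq> set ks"
    and v: "v ` set ks \<subseteq> carrier M" "w ` set ks \<subseteq> carrier M" "qftype L M (map v ks) = qftype L M (map w ks)"
  shows "sat M v \<phi> \<longleftrightarrow> sat M w \<phi>"
proof -
  obtain g where g: "isomorphism L M M g" "map g (map v ks) = map w ks"
    using tuple_homogeneousD[OF M, of "map v ks" "map w ks"] v by auto
  have "sat M (g \<circ> v) \<phi> \<longleftrightarrow> sat M v \<phi>" using \<phi> v(1) by (intro sat_isomorphism[OF g(1)]) auto
  moreover have "sat M (g \<circ> v) \<phi> \<longleftrightarrow> sat M w \<phi>" using g(2) \<phi>(2) by (intro sat_cong) auto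
  ultimately show ?thesis by simp
qed

text \<open>Bound variables are counted as well.\<close>

primrec var_bound :: "'r fm \<Rightarrow> nat" where
  "var_bound (Eq x y) = Suc (max x y)"
| "var_bound (Rel R xs) = Suc (Max (insert 0 (set xs)))"
| "var_bound (Neg \<phi>) = var_bound \<phi>"
| "var_bound (Conj \<phi> \<psi>) = max (var_bound \<phi>) (var_bound \<psi>)"
| "var_bound (Exists x \<phi>) = max (Suc x) (var_bound \<phi>)"

lemma free_vars_bound: "free_vars \<phi> \<subseteq> {..<var_bound \<phi>}"
proof (induction \<phi>)
  case (Rel R xs)
  then show ?case by (auto simp: less_Suc_eq_le intro: Max_ge)
qed auto

text \<open>A finite homogeneous substructure which realizes all types of \<open>m\<close>-tuples satisfies the same
  formulas in the first \<open>m\<close> variables: a witness of an existential quantifier can be moved into it.\<close>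

lemma sat_substructure_on:
  assumes ts: "type_space (carrier M) (qftype L M) k" and A: "type_space.extensible (carrier M) (qftype L M) A"
    and hom: "tuple_homogeneous L M"
    and types: "\<And>xs. xs \<in> tuples M m \<Longrightarrow> \<exists>ys\<in>tups A m. qftype L M xs = qftype L M ys"
  shows "wf_fm L \<phi> \<Longrightarrow> var_bound \<phi> \<le> m \<Longrightarrow> v ` {..<m} \<subseteq> A \<Longrightarrow> sat (substructure_on M A) v \<phi> \<longleftrightarrow> sat M v \<phi>"
proof (induction \<phi> arbitrary: v)
  case (Rel R xs)
  have "set xs \<subseteq> {..<m}" using free_vars_bound[of "Rel R xs"] Rel.prems(2) by auto
  then have "map v xs \<in> lists A" using Rel.prems(3) by (auto simp: lists_eq_set)
  then show ?case by (simp add: substructure_on_def)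
next
  case (Exists x \<phi>)
  interpret type_space "carrier M" "qftype L M" k by (rule ts)
  have AM: "A \<subseteq> carrier M" using A by (simp add: extensible_def)
  have x: "x < m" and \<phi>: "wf_fm L \<phi>" "var_bound \<phi> \<le> m" using Exists.prems by auto
  have fv: "free_vars \<phi> \<subseteq> {..<m}" using free_vars_bound[of \<phi>] \<phi>(2) by auto
  have IH: "sat (substructure_on M A) (v(x := d)) \<phi> \<longleftrightarrow> sat M (v(x := d)) \<phi>" if "d \<in> A" for d
    using \<phi> Exists.prems(3) that by (intro Exists.IH) auto
  have "\<exists>d\<in>A. sat M (v(x := d)) \<phi>" if c: "c \<in> carrier M" "sat M (v(x := c)) \<phi>" for c
  proof -
    let ?w = "v(x := c)" and ?ks = "[0..<m]" and ?ns = "filter (\<lambda>i. i \<noteq> x) [0..<m]"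
    have wM: "?w ` {..<m} \<subseteq> carrier M" using Exists.prems(3) AM c(1) by auto
    then have "map ?w ?ks \<in> tuples M m" by (auto simp: tuples_def)
    then obtain ys where ys: "ys \<in> tups A m" "qftype L M (map ?w ?ks) = qftype L M ys" using types by blast
    have len: "length ys = m" and ysA: "set ys \<subseteq> A" using ys(1) by (auto simp: tups_def)
    have ys_nth: "ys ! i \<in> A" if "i < m" for i using ysA nth_mem[of i ys] len that by blast
    let ?u = "(!) ys"
    have "map ?u ?ks = ys" using map_nth[of ys] len by simp
    then have "sat M ?w \<phi> \<longleftrightarrow> sat M ?u \<phi>"
      using fv wM ys(2) ys_nth AM by (intro sat_qftype[OF hom \<phi>(1), of ?ks]) (auto simp: atLeast0LessThan)
    then have sat_u: "sat M ?u \<phi>" using c(2) by simp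
    have ns: "set ?ns \<subseteq> {..<length (map ?w ?ks)}" by auto
    have "map ((!) (map ?w ?ks)) ?ns = map v ?ns" by auto
    then have eq: "qftype L M (map ?u ?ns) = qftype L M (map v ?ns)" using qftype_select[OF ys(2) ns] by metis
    have "\<exists>d\<in>A. qftype L M (map ?u ?ns @ [ys ! x]) = qftype L M (map v ?ns @ [d])"
      using ys_nth x Exists.prems(3) eq by (intro extensibleD[OF A]) auto
    then obtain d where d: "d \<in> A" "qftype L M (map ?u ?ns @ [ys ! x]) = qftype L M (map v ?ns @ [d])" by blast
    have "map (v(x := d)) (?ns @ [x]) = map v ?ns @ [d]" by auto
    moreover have "map ?u (?ns @ [x]) = map ?u ?ns @ [ys ! x]" by simp
    ultimately have "qftype L M (map ?u (?ns @ [x])) = qftype L M (map (v(x := d)) (?ns @ [x]))" using d(2) by simp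
    moreover have "set (?ns @ [x]) = {..<m}" using x by auto
    ultimately have "sat M ?u \<phi> \<longleftrightarrow> sat M (v(x := d)) \<phi>"
      using fv ys_nth Exists.prems(3) d(1) AM by (intro sat_qftype[OF hom \<phi>(1), of "?ns @ [x]"]) auto
    then show ?thesis using sat_u d(1) by blast
  qed
  then have "(\<exists>c\<in>carrier M. sat M (v(x := c)) \<phi>) \<longleftrightarrow> (\<exists>d\<in>A. sat M (v(x := d)) \<phi>)" using AM by blast
  then show ?case using IH by simp
qed auto

text \<open>Reduction to structures whose elements are natural numbers.\<close>

lemma exists_copy_on_nat:
  fixes M :: "('r, 'a) rel_structure"
  assumes M: "is_structure L M" "countable (carrier M)" "infinite (carrier M)"
  shows "\<exists>(N :: ('r, nat) rel_structure) f. is_structure L N \<and> carrier N = UNIV \<and> isomorphism L M N f"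
proof -
  let ?f = "to_nat_on (carrier M)"
  have bij: "bij_betw ?f (carrier M) UNIV" using M by (intro to_nat_on_infinite)
  define N where "N = \<lparr>carrier = UNIV, interp = (\<lambda>R. map ?f ` (interp M R \<inter> lists (carrier M)))\<rparr>"
  have inj: "inj_on (map ?f) (lists (carrier M))" using bij by (auto simp: bij_betw_def intro: inj_on_map_lists)
  have "isomorphism L M N ?f"
    unfolding isomorphism_def
  proof (intro conjI ballI)
    show "bij_betw ?f (carrier M) (carrier N)" using bij by (simp add: N_def)
    fix R as assume "as \<in> tuples M (arity L R)"
    then have "as \<in> lists (carrier M)" by (auto simp: tuples_def)
    then show "as \<in> interp M R \<longleftrightarrow> map ?f as \<in> interp N R" using inj by (auto simp: N_def dest: inj_onD)
  qed
  moreover have "is_structure L N" using M(1) by (fastforce simp: is_structure_def N_def tuples_def)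
  ultimately show ?thesis by (intro exI[of _ N] exI[of _ ?f]) (simp add: N_def)
qed

theorem proposition4p1p5:
  fixes L :: "'r language" and M :: "('r, 'a) rel_structure"
  assumes "finite (symbols L)"
    and "is_structure L M"
    and "countable (carrier M)" and "infinite (carrier M)"
    and "homogeneous L M"
    and "stable_structure L M"
  shows "\<exists>(C :: ('r, nat) rel_structure set) (N :: nat \<Rightarrow> ('r, nat) rel_structure) (U :: nat filter).
           mec L C \<and> range N \<subseteq> C \<and> is_ultrafilter U \<and>
           infinite (carrier (ultraproduct U N)) \<and>
           elementarily_equivalent L (ultraproduct U N) M"
proof -
  obtain M' :: "('r, nat) rel_structure" and f where M': "is_structure L M'" "carrier M' = UNIV" "isomorphism L M M' f"
    using exists_copy_on_nat[OF assms(2-4)] by blast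
  have hom: "tuple_homogeneous L M'" using tuple_homogeneous_isomorphism[OF M'(3) tuple_homogeneous[OF assms(5)]] .
  have th_eq: "theory_of L M' = theory_of L M" using theory_of_isomorphism[OF M'(3)] by simp
  then have "stable_theory L (theory_of L M')" using assms(6) by (simp add: stable_structure_def)
  then obtain k where ts: "type_space (carrier M') (qftype L M') k"
    using type_space_qftype[OF assms(1) M'(1) hom] by blast
  then interpret type_space "carrier M'" "qftype L M'" k .
  have "extensible (carrier M')"
    unfolding extensible_def
  proof (intro conjI allI impI)
    fix xs ys c assume xs: "set xs \<subseteq> carrier M'" "set ys \<subseteq> carrier M'" "qftype L M' xs = qftype L M' ys"
    then obtain g where g: "isomorphism L M' M' g" "map g xs = ys" using tuple_homogeneousD[OF hom] by blast
    have "qftype L M' (map g (xs @ [c])) = qftype L M' (xs @ [c])" using M'(2) by (intro qftype_isomorphism[OF g(1)]) simp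
    then show "\<exists>d\<in>carrier M'. qftype L M' (xs @ [c]) = qftype L M' (ys @ [d])"
      using g(2) M'(2) by (intro bexI[of _ "g c"]) auto
  qed simp
  then have "\<forall>i::nat. \<exists>A. finite A \<and> {..i} \<subseteq> A \<and> extensible A"
    using finite_extensible_superset M'(2) by (metis finite_atMost subset_UNIV)
  then obtain A where A: "\<And>i. finite (A i)" "\<And>i::nat. {..i} \<subseteq> A i" "\<And>i. extensible (A i)" by metis
  define N where "N i = substructure_on M' (A i)" for i
  obtain U :: "nat filter" where U: "is_ultrafilter U" "U \<le> sequentially" using free_ultrafilter by blast
  have zero: "0 \<in> carrier (N i)" for i using A(2)[of i] by (auto simp: N_def)
  have "mec L (range N)"
  proof (rule mec_tuple_homogeneous[OF assms(1)])
    fix K assume "K \<in> range N"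
    then obtain i where i: "K = N i" by blast
    have "A i \<noteq> {}" using A(2)[of i] by auto
    then show "is_structure L K \<and> finite (carrier K) \<and> tuple_homogeneous L K"
      using is_structure_substructure_on[OF M'(1)] tuple_homogeneous_extensible[OF ts A(3)] A(1) by (simp add: i N_def)
  qed
  moreover have "infinite (carrier (ultraproduct U N))"
    using U A(2) by (intro infinite_ultraproduct) (auto simp: is_ultrafilter_def N_def)
  moreover have "theory_of L (ultraproduct U N) = theory_of L M'"
  proof -
    have "sat_at (ultraproduct U N) \<phi> [] [] \<longleftrightarrow> sat_at M' \<phi> [] []" if \<phi>: "formula_in L [] \<phi>" for \<phi>
    proof -
      have wf: "wf_fm L \<phi>" using \<phi> by (simp add: formula_in_def)
      let ?m = "var_bound \<phi>"
      have "\<exists>B. \<forall>i\<ge>B. \<forall>xs\<in>tuples M' ?m. \<exists>ys\<in>tups (A i) ?m. qftype L M' xs = qftype L M' ys"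
      proof -
        let ?r = "\<lambda>t. SOME ys. ys \<in> tuples M' ?m \<and> qftype L M' ys = t"
        let ?T = "qftype L M' ` tuples M' ?m"
        have r: "?r (qftype L M' xs) \<in> tuples M' ?m \<and> qftype L M' (?r (qftype L M' xs)) = qftype L M' xs"
          if "xs \<in> tuples M' ?m" for xs
          by (rule someI[of _ xs]) (simp add: that)
        have "finite (\<Union>t\<in>?T. set (?r t))" 
          using finite_types[of ?m] unfolding tuples_tups[symmetric] by (rule finite_UN_I) simp
        then obtain B where B: "(\<Union>t\<in>?T. set (?r t)) \<subseteq> {..B}" using finite_nat_iff_bounded_le by blast
        have "\<exists>ys\<in>tups (A i) ?m. qftype L M' xs = qftype L M' ys" if i: "B \<le> i" and xs: "xs \<in> tuples M' ?m" for i xs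
        proof -
          let ?ys = "?r (qftype L M' xs)"
          have "set ?ys \<subseteq> {..B}" using B xs by blast
          also have "\<dots> \<subseteq> A i" using A(2)[of i] i by fastforce
          finally show ?thesis using r[OF xs] by (intro bexI[of _ ?ys]) (auto simp: tups_def tuples_def)
        qed
        then show ?thesis by blast
      qed
      then obtain B where B: "\<And>i xs. B \<le> i \<Longrightarrow> xs \<in> tuples M' ?m \<Longrightarrow> \<exists>ys\<in>tups (A i) ?m. qftype L M' xs = qftype L M' ys" by blast
      have "sat (N i) (\<lambda>x. 0) \<phi> \<longleftrightarrow> sat M' (\<lambda>x. 0) \<phi>" if i: "B \<le> i" for i
        unfolding N_def using wf B[OF i] zero[of i]
        by (intro sat_substructure_on[OF ts A(3) hom, of ?m]) (auto simp: N_def)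
      then have "eventually (\<lambda>i. sat (N i) (\<lambda>x. 0) \<phi> \<longleftrightarrow> sat M' (\<lambda>x. 0) \<phi>) sequentially"
        unfolding eventually_sequentially by blast
      then have ev: "eventually (\<lambda>i. sat (N i) (\<lambda>x. 0) \<phi> \<longleftrightarrow> sat M' (\<lambda>x. 0) \<phi>) U" using U(2) by (rule filter_leD[rotated])
      have "sat_at (ultraproduct U N) \<phi> [] [] \<longleftrightarrow> sat (ultraproduct U N) (\<lambda>x. ultraproduct_rel U N `` {\<lambda>i. 0}) \<phi>"
        by (rule sat_at_cong[OF \<phi>]) auto
      also have "\<dots> \<longleftrightarrow> eventually (\<lambda>i. sat (N i) (\<lambda>x. 0) \<phi>) U" using los[OF U(1), of "\<lambda>x i. 0" N \<phi>] zero by blast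
      also have "\<dots> \<longleftrightarrow> eventually (\<lambda>i. sat M' (\<lambda>x. 0) \<phi>) U" by (rule eventually_subst[OF ev])
      also have "\<dots> \<longleftrightarrow> sat M' (\<lambda>x. 0) \<phi>" using U(1) by (simp add: is_ultrafilter_def)
      also have "\<dots> \<longleftrightarrow> sat_at M' \<phi> [] []" using sat_at_cong[OF \<phi>, of "[]" "\<lambda>x. 0" M'] by simp
      finally show ?thesis .
    qed
    then show ?thesis by (auto simp: theory_of_def)
  qed
  ultimately show ?thesis using U(1) th_eq
    by (intro exI[of _ "range N"] exI[of _ N] exI[of _ U]) (simp add: elementarily_equivalent_def)
qed

end
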